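(* Let $G$ be a finite abelian group and $n\ge2$. For every prime $\ell$ not dividing $\#G$ and every integer $1\le r\le n-1$, the formula $$T_{\ell,r}(\psi(\mathbf L,\chi,\Lambda)):=\sum_{\mathbf L\subset\mathbf L'\subset\mathbf L\otimes\mathbb R,\ \mathbf L'/\mathbf L\simeq(\mathbb Z/\ell\mathbb Z)^r}\psi(\mathbf L',\chi,\Lambda)$$ (the sum being over lattices $\mathbf L'$ containing $\mathbf L$ with the indicated quotient) gives a well-defined linear operator $T_{\ell,r}:\mathcal M_n(G)\to\mathcal M_n(G)$, and all these operators commute with each other.
   Context: Let $A=\mathrm{Hom}(G,\mathbb C^\times)$ be the character group of $G$, written additively. $\mathcal M_n(G)$ is the $\mathbb Z$-module generated by symbols $\langle a_1,\dots,a_n\rangle$ with $a_i\in A$ and $\sum_i\mathbb Z a_i=A$, subject to the relations: (S) $\langle a_{\sigma(1)},\dots,a_{\sigma(n)}\rangle=\langle a_1,\dots,a_n\rangle$ for all $\sigma\in\mathfrak S_n$; (M) for all $2\le k\le n$, all $a_1,\dots,a_k\in A$ and all $b_1,\dots,b_{n-k}\in A$ with $\sum_i\mathbb Z a_i+\sum_j\mathbb Z b_j=A$: $$\langle a_1,\dots,a_k,b_1,\dots,b_{n-k}\rangle=\sum_{1\le i\le k}\langle a_1-a_i,\dots,a_i,\dots,a_k-a_i,b_1,\dots,b_{n-k}\rangle,$$ where in the $i$-th summand the $i$-th entry is $a_i$ and for $j\le k$, $j\ne i$, the $j$-th entry is $a_j-a_i$. Symbols $\psi$: let $\mathbf L\simeq\mathbb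 Z^n$ be a lattice, $\chi\in\mathbf L\otimes A$ an element such that the induced homomorphism $\mathbf L^\vee\to A$ is surjective, and $\Lambda\subset\mathbf L\otimes\mathbb R$ a basic simplicial cone, i.e. a cone spanned by a basis $e_1,\dots,e_n$ of $\mathbf L$. Writing $\chi=\sum_i e_i\otimes a_i$, put $\psi(\mathbf L,\chi,\Lambda)=\langle a_1,\dots,a_n\rangle\in\mathcal M_n(G)$. More generally, for $\Lambda\subset\mathbf L\otimes\mathbb R$ any full-dimensional finitely generated convex rational polyhedral cone, $\psi(\mathbf L,\chi,\Lambda)=\sum_i\psi(\mathbf L,\chi,\Lambda_i)$ for any decomposition $\Lambda=\bigcup_i\Lambda_i$ into finitely many cones, basic simplicial with respect to $\mathbf L$, with disjoint interiors; this is independent of the decomposition, so $\psi(\mathbf L,\chi,\cdot)$ is additive under decompositions into cones with disjoint interiors. $\psi(\mathbf L,\chi,\Lambda)$ depends only on the isomorphism class of the triple, and the $\psi(\mathbf L,\chi,\Lambda)$ with $\Lambda$ basic simplicial are the generators of $\mathcal M_n(G)$. In the formula for $T_{\ell,r}$, $\chi$ is viewed as an element of $\mathbf L'\otimes A$ via $\mathbf L\otimes A\to\mathbf L'\otimes A$; the induced map $(\mathbf L')^\vee\to A$ is surjective since $\ell$ is coprime to $\#G$. *)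

theory Defs
  imports
    "HOL-Analysis.Analysis"
    "HOL-Algebra.Free_Abelian_Groups"
    "HOL-Combinatorics.Permutations"
    "HOL-Computational_Algebra.Primes"
begin

section \<open>The character group\<close>

text \<open>Abelian groups are written multiplicatively, as in HOL-Algebra. Thus \<open>a - b\<close> in the
  character group appears below as \<open>a \<otimes> inv b\<close> and \<open>k a\<close> (for an integer \<open>k\<close>) as \<open>a [^] k\<close>.\<close>

definition complex_units :: "complex monoid" where
  "complex_units = \<lparr>carrier = UNIV - {0}, monoid.mult = (*), one = 1\<rparr>"

definition character_group :: "('g, 'm) monoid_scheme \<Rightarrow> ('g \<Rightarrow> complex) monoid" where
  "character_group G =
     \<lparr>carrier = hom G complex_units \<inter> extensional (carrier G),
      monoid.mult = (\<lambda>\<alpha> \<beta>. \<lambda>x\<in>carrier G. \<alpha> x * \<beta> x),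
      one = (\<lambda>x\<in>carrier G. 1)\<rparr>"


section \<open>The groups \<open>\<M>\<^sub>n\<close>\<close>

definition symbols :: "('a, 'm) monoid_scheme \<Rightarrow> nat \<Rightarrow> 'a list set" where
  "symbols A n = {as. length as = n \<and> set as \<subseteq> carrier A \<and> generate A (set as) = carrier A}"

definition rels_S :: "('a, 'm) monoid_scheme \<Rightarrow> nat \<Rightarrow> ('a list \<Rightarrow>\<^sub>0 int) set" where
  "rels_S A n = {frag_of (permute_list \<sigma> as) - frag_of as |\<sigma> as.
     as \<in> symbols A n \<and> \<sigma> permutes {..<n}}"

definition blowup_entries :: "('a, 'm) monoid_scheme \<Rightarrow> 'a list \<Rightarrow> nat \<Rightarrow> 'a list" where
  "blowup_entries A as i =
     map (\<lambda>j. if j = i then as ! i else as ! j \<otimes>\<^bsub>A\<^esub> inv\<^bsub>A\<^esub> (as ! i)) [0..<length as]"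

definition rels_M :: "('a, 'm) monoid_scheme \<Rightarrow> nat \<Rightarrow> ('a list \<Rightarrow>\<^sub>0 int) set" where
  "rels_M A n = {frag_of (as @ bs) - (\<Sum>i<length as. frag_of (blowup_entries A as i @ bs)) |as bs.
     2 \<le> length as \<and> length as \<le> n \<and> length bs = n - length as \<and> as @ bs \<in> symbols A n}"

definition M_relations :: "('a, 'm) monoid_scheme \<Rightarrow> nat \<Rightarrow> ('a list \<Rightarrow>\<^sub>0 int) set" where
  "M_relations A n = generate (free_Abelian_group (symbols A n)) (rels_S A n \<union> rels_M A n)"

definition M_group :: "('a, 'm) monoid_scheme \<Rightarrow> nat \<Rightarrow> ('a list \<Rightarrow>\<^sub>0 int) set monoid" where
  "M_group A n = free_Abelian_group (symbols A n) Mod M_relations A n"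

definition symbol_class ::
    "('a, 'm) monoid_scheme \<Rightarrow> nat \<Rightarrow> 'a list \<Rightarrow> ('a list \<Rightarrow>\<^sub>0 int) set" where
  "symbol_class A n as = M_relations A n #>\<^bsub>free_Abelian_group (symbols A n)\<^esub> frag_of as"


section \<open>Tensor products of abelian groups\<close>

definition tensor_relations ::
    "('b, 'l) monoid_scheme \<Rightarrow> ('a, 'm) monoid_scheme \<Rightarrow> ('b \<times> 'a \<Rightarrow>\<^sub>0 int) set" where
  "tensor_relations B A = generate (free_Abelian_group (carrier B \<times> carrier A))
     ({frag_of (x \<otimes>\<^bsub>B\<^esub> y, a) - frag_of (x, a) - frag_of (y, a) |x y a.
         x \<in> carrier B \<and> y \<in> carrier B \<and> a \<in> carrier A} \<union>
      {frag_of (x, a \<otimes>\<^bsub>A\<^esub> b) - frag_of (x, a) - frag_of (x, b) |x a b.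
         x \<in> carrier B \<and> a \<in> carrier A \<and> b \<in> carrier A})"

definition tensor ::
    "('b, 'l) monoid_scheme \<Rightarrow> ('a, 'm) monoid_scheme \<Rightarrow> ('b \<times> 'a \<Rightarrow>\<^sub>0 int) set monoid" where
  "tensor B A = free_Abelian_group (carrier B \<times> carrier A) Mod tensor_relations B A"

definition pure_tensor ::
    "('b, 'l) monoid_scheme \<Rightarrow> ('a, 'm) monoid_scheme \<Rightarrow> 'b \<Rightarrow> 'a \<Rightarrow> ('b \<times> 'a \<Rightarrow>\<^sub>0 int) set" where
  "pure_tensor B A x a =
     tensor_relations B A #>\<^bsub>free_Abelian_group (carrier B \<times> carrier A)\<^esub> frag_of (x, a)"

text \<open>The map \<open>h \<otimes> id\<close> into \<open>C \<otimes> A\<close> induced by a homomorphism \<open>h\<close> into \<open>C\<close>: representatives are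
  pushed forward along \<open>(x, a) \<mapsto> (h x, a)\<close>, and adding the relations of \<open>C \<otimes> A\<close> turns the
  result into a full coset.\<close>

definition tensor_map ::
    "('c, 'l) monoid_scheme \<Rightarrow> ('a, 'm) monoid_scheme \<Rightarrow> ('b \<Rightarrow> 'c) \<Rightarrow>
     ('b \<times> 'a \<Rightarrow>\<^sub>0 int) set \<Rightarrow> ('c \<times> 'a \<Rightarrow>\<^sub>0 int) set" where
  "tensor_map C A h X =
     tensor_relations C A <#>\<^bsub>free_Abelian_group (carrier C \<times> carrier A)\<^esub>
       (frag_extend (\<lambda>(x, a). frag_of (h x, a)) ` X)"

text \<open>For a homomorphism \<open>\<phi>\<close> to the integers, the image of \<open>X\<close> under
  \<open>\<phi> \<otimes> id\<close> followed by \<open>\<int> \<otimes> A \<simeq> A\<close>, i.e. the homomorphism with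
  \<open>x \<otimes> a \<mapsto> \<phi>(x) a\<close>, computed on any representative of \<open>X\<close>.\<close>

definition contract ::
    "('a, 'm) monoid_scheme \<Rightarrow> ('b \<times> 'a \<Rightarrow>\<^sub>0 int) set \<Rightarrow> ('b \<Rightarrow> int) \<Rightarrow> 'a" where
  "contract A X \<phi> = (THE y. \<exists>c\<in>X.
     y = finprod A (\<lambda>p. snd p [^]\<^bsub>A\<^esub> (Poly_Mapping.lookup c p * \<phi> (fst p))) (Poly_Mapping.keys c))"


section \<open>Lattices and cones\<close>

definition additive_group :: "'v::ab_group_add set \<Rightarrow> 'v monoid" where
  "additive_group L = \<lparr>carrier = L, monoid.mult = (+), one = 0\<rparr>"

definition lattice_basis :: "(real ^ 'n) set \<Rightarrow> (real ^ 'n) list \<Rightarrow> bool" where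
  "lattice_basis L es \<longleftrightarrow> length es = CARD('n) \<and> distinct es \<and> independent (set es) \<and>
     L = range (\<lambda>c :: nat \<Rightarrow> int. \<Sum>i<CARD('n). of_int (c i) *\<^sub>R es ! i)"

text \<open>A lattice \<open>L\<close> of rank \<open>n\<close> is realised inside its ambient real vector space
  \<open>L \<otimes> \<real>\<close>, which is identified with \<open>\<real>\<^sup>n\<close>.\<close>

definition is_lattice :: "(real ^ 'n) set \<Rightarrow> bool" where
  "is_lattice L \<longleftrightarrow> (\<exists>es. lattice_basis L es)"

definition basic_simplicial :: "(real ^ 'n) set \<Rightarrow> (real ^ 'n) set \<Rightarrow> bool" where
  "basic_simplicial L \<Lambda> \<longleftrightarrow> (\<exists>es. lattice_basis L es \<and> \<Lambda> = convex_cone hull set es)"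

definition full_rational_cone :: "(real ^ 'n) set \<Rightarrow> (real ^ 'n) set \<Rightarrow> bool" where
  "full_rational_cone L \<Lambda> \<longleftrightarrow>
     (\<exists>S. finite S \<and> S \<subseteq> L \<and> \<Lambda> = convex_cone hull S) \<and> dim \<Lambda> = CARD('n)"

definition basic_decomposition ::
    "(real ^ 'n) set \<Rightarrow> (real ^ 'n) set \<Rightarrow> (real ^ 'n) set set \<Rightarrow> bool" where
  "basic_decomposition L \<Lambda> D \<longleftrightarrow> finite D \<and> \<Union>D = \<Lambda> \<and> (\<forall>C\<in>D. basic_simplicial L C) \<and>
     pairwise (\<lambda>C C'. interior C \<inter> interior C' = {}) D"


section \<open>The symbols \<open>\<psi>\<close>\<close>

text \<open>The element of \<open>L \<otimes> A\<close> usually called \<open>\<chi>\<close> is written \<open>\<xi>\<close>, since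
  \<open>\<chi>\<close> is binder syntax for vectors.\<close>

definition admissible_triple ::
    "('a, 'm) monoid_scheme \<Rightarrow> (real ^ 'n) set \<Rightarrow> ((real ^ 'n) \<times> 'a \<Rightarrow>\<^sub>0 int) set \<Rightarrow>
     (real ^ 'n) set \<Rightarrow> bool" where
  "admissible_triple A L \<xi> \<Lambda> \<longleftrightarrow> is_lattice L \<and> \<xi> \<in> carrier (tensor (additive_group L) A) \<and>
     contract A \<xi> ` hom (additive_group L) integer_group = carrier A \<and> full_rational_cone L \<Lambda>"

definition psi_basic ::
    "('a, 'm) monoid_scheme \<Rightarrow> (real ^ 'n) set \<Rightarrow> ((real ^ 'n) \<times> 'a \<Rightarrow>\<^sub>0 int) set \<Rightarrow>
     (real ^ 'n) set \<Rightarrow> ('a list \<Rightarrow>\<^sub>0 int) set" where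
  "psi_basic A L \<xi> \<Lambda> = (THE m. \<exists>es as.
     lattice_basis L es \<and> \<Lambda> = convex_cone hull set es \<and>
     length as = CARD('n) \<and> set as \<subseteq> carrier A \<and>
     \<xi> = finprod (tensor (additive_group L) A)
           (\<lambda>i. pure_tensor (additive_group L) A (es ! i) (as ! i)) {..<CARD('n)} \<and>
     m = symbol_class A CARD('n) as)"

text \<open>A definite description: the value is determined only because it does not depend on the
  decomposition.\<close>

definition psi ::
    "('a, 'm) monoid_scheme \<Rightarrow> (real ^ 'n) set \<Rightarrow> ((real ^ 'n) \<times> 'a \<Rightarrow>\<^sub>0 int) set \<Rightarrow>
     (real ^ 'n) set \<Rightarrow> ('a list \<Rightarrow>\<^sub>0 int) set" where
  "psi A L \<xi> \<Lambda> = (THE m. \<exists>D. basic_decomposition L \<Lambda> D \<and>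
     m = finprod (M_group A CARD('n)) (psi_basic A L \<xi>) D)"


section \<open>Hecke operators\<close>

definition superlattices :: "nat \<Rightarrow> nat \<Rightarrow> (real ^ 'n) set \<Rightarrow> (real ^ 'n) set set" where
  "superlattices l r L = {L'. is_lattice L' \<and> L \<subseteq> L' \<and>
     additive_group L' Mod L \<cong> product_group {..<r} (\<lambda>_. integer_mod_group l)}"

definition hecke_sum ::
    "('a, 'm) monoid_scheme \<Rightarrow> nat \<Rightarrow> nat \<Rightarrow> (real ^ 'n) set \<Rightarrow>
     ((real ^ 'n) \<times> 'a \<Rightarrow>\<^sub>0 int) set \<Rightarrow> (real ^ 'n) set \<Rightarrow> ('a list \<Rightarrow>\<^sub>0 int) set" where
  "hecke_sum A l r L \<xi> \<Lambda> = finprod (M_group A CARD('n))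
     (\<lambda>L'. psi A L' (tensor_map (additive_group L') A (\<lambda>v. v) \<xi>) \<Lambda>) (superlattices l r L)"

text \<open>The argument of type \<open>'n itself\<close> only carries the rank \<open>n = CARD('n)\<close>. Values of
  \<open>T\<close> outside the carrier are fixed by \<open>extensional\<close>, so that uniqueness of \<open>T\<close> is
  meaningful.\<close>

definition is_hecke_operator ::
    "'n::finite itself \<Rightarrow> ('a, 'm) monoid_scheme \<Rightarrow> nat \<Rightarrow> nat \<Rightarrow>
     (('a list \<Rightarrow>\<^sub>0 int) set \<Rightarrow> ('a list \<Rightarrow>\<^sub>0 int) set) \<Rightarrow> bool" where
  "is_hecke_operator _ A l r T \<longleftrightarrow>
     T \<in> hom (M_group A CARD('n)) (M_group A CARD('n)) \<inter> extensional (carrier (M_group A CARD('n))) \<and>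
     (\<forall>(L :: (real ^ 'n) set) \<xi> \<Lambda>. admissible_triple A L \<xi> \<Lambda> \<longrightarrow>
        T (psi A L \<xi> \<Lambda>) = hecke_sum A l r L \<xi> \<Lambda>)"

end

theory Submission imports Defs begin

text \<open>
  A symbol is a function of a lattice basis, and relation (M) says how it behaves when a basic cone is
  starred at the sum of some of its generators. Starring at lattice points of small coordinates, by
  induction on the index, extends this function to all simplicial cones with generators in the lattice.
  Modulo (M) the extension is a cocycle: for \<open>n + 1\<close> lattice vectors in an open half space with a linear
  relation \<open>\<rho>\<close>, the sum of the values on the cones omitting one vector, weighted by the signs of \<open>\<rho>\<close>,
  vanishes. Every linear relation between indicator functions of cones is a consequence of cocycle
  relations, hence \<open>\<psi>\<close> does not depend on the decomposition.

  The Hecke sum is therefore additive in the cone. It is also invariant under isomorphisms of triples, so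
  on a basic cone it depends on the symbol only; additivity on a starred cone is then exactly (M), which
  defines \<open>T\<close> on generators. Finally \<open>T T'\<close> is a sum over chains of superlattices of \<open>L\<close> with top \<open>L''\<close>.
  In coordinates in which \<open>L''\<close> is the dual of \<open>L\<close>, duality matches the chains for \<open>T T'\<close> with those for
  \<open>T' T\<close> having the same top, and only the top enters the summand.
\<close>

section \<open>Signed relations between simplicial cones\<close>

text \<open>The cocycle relation cannot hold for arbitrary vectors: if they surround the origin, the
  cones cover the whole space and their sum has no reason to vanish. This is why centres of
  subdivision are chosen up to sign so that a common half space survives, and why two dissections of
  a cone, which may contain lines, are compared orthant by orthant. A box point of one cone of a
  cocycle can have coordinates above 1 in the other cones, so starring all of them at it need not
  lower the index. The remedy is to round coordinates to nearest integers. Such a centre may lie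
  outside the cones, and subdivisions therefore carry signs; the extension, defined by one choice of
  box points, must first be shown not to depend on that choice. A basis of L is in general no basis
  of a superlattice. Hence dissections allow cones of any index, so that one dissection serves all
  terms of a Hecke sum. Coprimality of l and the order of G is used as divisibility of the character
  group by l, which keeps the tensor surjective over each superlattice.\<close>

definition sg :: "real \<Rightarrow> 'b::ab_group_add \<Rightarrow> 'b" where
  "sg c x = (if c > 0 then x else if c < 0 then - x else 0)"

lemma sg_simps [simp]: "sg 0 x = 0" "sg (- c) x = - sg c x" "sg 1 x = x" "sg c 0 = 0" "sg c (- x) = - sg c x"
  by (auto simp: sg_def)

lemma sg_add: "sg c (x + y) = sg c x + sg c y"
  and sg_diff: "sg c (x - y) = sg c x - sg c y"
  by (auto simp: sg_def)

lemma sg_sum: "sg c (sum f A) = (\<Sum>a\<in>A. sg c (f a))"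
  by (induction A rule: infinite_finite_induct) (auto simp: sg_add)

lemma sg_sg: "sg a (sg b x) = sg (a * b) x"
  by (auto simp: sg_def zero_less_mult_iff mult_less_0_iff)

text \<open>Base case of the induction on the dimension, where all cones coincide: the positive and
  the negative indices are equally many and cancel in pairs. The value group has no real scalars, so
  signs act through \<open>sg\<close>.\<close>

lemma sum_sg_const:
  assumes "finite I" "(\<Sum>i\<in>I. sgn (s i)) = (0::real)"
  shows "(\<Sum>i\<in>I. sg (s i) x) = 0"
proof -
  have "(\<Sum>i\<in>I. sgn (s i)) = (\<Sum>i\<in>I. of_bool (s i > 0) - of_bool (s i < 0))"
    by (rule sum.cong) (auto simp: sgn_if)
  also have "\<dots> = real (card {i\<in>I. s i > 0}) - real (card {i\<in>I. s i < 0})"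
    using assms(1) by (simp add: sum_subtractf sum_of_bool_eq Int_def)
  finally have "card {i\<in>I. s i > 0} = card {i\<in>I. s i < 0}"
    using assms by simp
  then obtain h where h: "bij_betw h {i\<in>I. s i > 0} {i\<in>I. s i < 0}"
    using finite_same_card_bij[of "{i\<in>I. s i > 0}" "{i\<in>I. s i < 0}"] assms(1) by auto
  have "(\<Sum>i\<in>I. sg (s i) x) = (\<Sum>i\<in>I. (if s i > 0 then x else 0) - (if s i < 0 then x else 0))"
    by (rule sum.cong) (auto simp: sg_def)
  also have "\<dots> = (\<Sum>i\<in>{i\<in>I. s i > 0}. x) - (\<Sum>i\<in>{i\<in>I. s i < 0}. x)"
    using assms(1) by (simp add: sum_subtractf sum.inter_filter)
  also have "(\<Sum>i\<in>{i\<in>I. s i < 0}. x) = (\<Sum>i\<in>{i\<in>I. s i > 0}. x)"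
    using sum.reindex_bij_betw[OF h, of "\<lambda>_. x"] by simp
  finally show ?thesis by simp
qed

text \<open>\<open>R\<close> stands for the relations. Identities are stated as membership of a
  difference in \<open>R\<close>, so sums remain in the ambient group and cosets appear only when
  \<open>psi\<close> is evaluated.\<close>

locale add_subgroup =
  fixes R :: "'b::ab_group_add set"
  assumes zero_mem: "0 \<in> R"
    and diff_mem: "x \<in> R \<Longrightarrow> y \<in> R \<Longrightarrow> x - y \<in> R"
begin

lemma minus_mem: "x \<in> R \<Longrightarrow> - x \<in> R"
  using diff_mem[of 0 x] zero_mem by simp

lemma add_mem: "x \<in> R \<Longrightarrow> y \<in> R \<Longrightarrow> x + y \<in> R"
  using diff_mem[of x "- y"] minus_mem by simp

lemma sum_mem: "(\<And>i. i \<in> I \<Longrightarrow> f i \<in> R) \<Longrightarrow> sum f I \<in> R"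
  by (induction I rule: infinite_finite_induct) (auto simp: zero_mem add_mem)

lemma sg_mem: "x \<in> R \<Longrightarrow> sg c x \<in> R"
  by (auto simp: sg_def zero_mem minus_mem)

lemma diff_trans_mem: "x - y \<in> R \<Longrightarrow> y - z \<in> R \<Longrightarrow> x - z \<in> R"
  using add_mem[of "x - y" "y - z"] by simp

lemma diff_sym_mem: "x - y \<in> R \<Longrightarrow> y - x \<in> R"
  using minus_mem[of "x - y"] by simp

lemma sum_diff_mem: "(\<And>i. i \<in> I \<Longrightarrow> f i - g i \<in> R) \<Longrightarrow> sum f I - sum g I \<in> R"
  using sum_mem[of I "\<lambda>i. f i - g i"] by (simp add: sum_subtractf)

end

section \<open>Coordinates with respect to a basis, and general position\<close>

lemma representation_unique:
  assumes "independent S" "finite S" "x = (\<Sum>v\<in>S. c v *\<^sub>R v)" "u \<in> S"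
  shows "representation S x u = c u"
proof -
  let ?f = "\<lambda>v. if v \<in> S then c v else 0"
  have "representation S x = ?f"
  proof (rule representation_eqI[OF assms(1)])
    show "x \<in> span S" unfolding assms(3) by (intro span_sum span_scale span_base)
    show "finite {b. ?f b \<noteq> 0}" by (rule finite_subset[OF _ assms(2)]) auto
    have "(\<Sum>b | ?f b \<noteq> 0. ?f b *\<^sub>R b) = (\<Sum>v\<in>S. c v *\<^sub>R v)"
      using assms(2) by (intro sum.mono_neutral_cong_left) auto
    then show "(\<Sum>b | ?f b \<noteq> 0. ?f b *\<^sub>R b) = x" using assms(3) by simp
  qed (auto split: if_splits)
  then show ?thesis using assms(4) by simp
qed

lemma representation_sum_eq:
  fixes S :: "'v::euclidean_space set"
  assumes "independent S" "x \<in> span S"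
  shows "(\<Sum>v\<in>S. representation S x v *\<^sub>R v) = x"
  using assms finiteI_independent by (intro sum_representation_eq) auto

lemma representation_affine:
  assumes "independent S" "x \<in> span S" "y \<in> span S"
  shows "representation S (x + c *\<^sub>R y) v = representation S x v + c * representation S y v"
  using assms by (simp add: representation_add representation_scale span_scale)

lemma representation_eq_0_iff:
  fixes S :: "'v::euclidean_space set"
  assumes "independent S" "x \<in> span S" "v \<in> S"
  shows "representation S x v = 0 \<longleftrightarrow> x \<in> span (S - {v})"
proof
  assume *: "representation S x v = 0"
  have "x = (\<Sum>u\<in>S. representation S x u *\<^sub>R u)"
    using assms representation_sum_eq by metis
  also have "\<dots> = (\<Sum>u\<in>S - {v}. representation S x u *\<^sub>R u)"
    using * assms finiteI_independent by (intro sum.mono_neutral_right) auto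
  also have "\<dots> \<in> span (S - {v})" by (intro span_sum span_scale span_base)
  finally show "x \<in> span (S - {v})" .
next
  assume "x \<in> span (S - {v})"
  then have "representation S x = representation (S - {v}) x"
    using assms by (intro representation_extend) auto
  then show "representation S x v = 0"
    using representation_ne_zero[of "S - {v}" x v] by auto
qed

text \<open>For independent \<open>S\<close> and \<open>x\<close> in its span, this is the relative
  interior of the cone on \<open>S\<close>.\<close>

definition pos_at :: "'v::real_vector set \<Rightarrow> 'v \<Rightarrow> bool" where
  "pos_at S x \<longleftrightarrow> (\<forall>v\<in>S. representation S x v > 0)"

text \<open>\<open>x\<close> avoids the hyperplanes spanned by the facets. Indicator functions are
  compared at such points only, so open and closed cones need not be told apart.\<close>

definition generic_at :: "'v::real_vector set \<Rightarrow> 'v \<Rightarrow> bool" where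
  "generic_at S x \<longleftrightarrow> (\<forall>v\<in>S. representation S x v \<noteq> 0)"

text \<open>Just to the right of 0 the constant term of an affine function decides its sign, unless
  it is zero and the slope decides. Finitely many such conditions hold for a common
  \<open>t\<close>.\<close>

lemma small_perturbation:
  fixes P :: "'p set" and a b :: "'p \<Rightarrow> real"
  assumes "finite P"
  shows "\<exists>t>0. \<forall>q\<in>P. sgn (a q + t * b q) = (if a q \<noteq> 0 then sgn (a q) else sgn (b q))"
proof -
  have "eventually (\<lambda>t. sgn (a q + t * b q) = (if a q \<noteq> 0 then sgn (a q) else sgn (b q))) (at_right 0)" for q
  proof (cases "a q = 0")
    case True
    then show ?thesis
      by (auto simp: eventually_at_right_field sgn_mult intro!: exI[of _ 1])
  next
    case False
    have lim: "((\<lambda>t. a q + t * b q) \<longlongrightarrow> a q + 0 * b q) (at_right 0)"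
      by (intro tendsto_intros)
    show ?thesis
    proof (cases "a q > 0")
      case True
      with lim have "eventually (\<lambda>t. a q + t * b q > 0) (at_right 0)"
        by (intro order_tendstoD(1)[where y = "a q"]) auto
      then show ?thesis using True by (auto elim: eventually_mono)
    next
      case *: False
      with lim \<open>a q \<noteq> 0\<close> have "eventually (\<lambda>t. a q + t * b q < 0) (at_right 0)"
        by (intro order_tendstoD(2)[where y = "a q"]) auto
      then show ?thesis using \<open>a q \<noteq> 0\<close> * by (auto elim!: eventually_mono)
    qed
  qed
  then have "eventually (\<lambda>t. \<forall>q\<in>P. sgn (a q + t * b q) = (if a q \<noteq> 0 then sgn (a q) else sgn (b q))) (at_right 0)"
    using assms by (intro eventually_ball_finite) auto
  moreover have "eventually (\<lambda>t::real. t > 0) (at_right 0)"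
    by (simp add: eventually_at_right_less)
  ultimately have "eventually (\<lambda>t. t > 0 \<and> (\<forall>q\<in>P. sgn (a q + t * b q) = (if a q \<noteq> 0 then sgn (a q) else sgn (b q)))) (at_right 0)"
    by eventually_elim auto
  then show ?thesis
    using eventually_happens trivial_limit_at_right_real by blast
qed

text \<open>Finitely many proper hyperplanes do not fill a real vector space: for each further
  functional, a small multiple of a vector on which it does not vanish is added. Linearity is
  required on \<open>H\<close> only, because coordinates are linear on a span but not outside
  it.\<close>

lemma avoid_hyperplanes:
  fixes l :: "'p \<Rightarrow> 'v::real_vector \<Rightarrow> real"
  assumes "finite P" "subspace H"
    and "\<And>q x y c. q \<in> P \<Longrightarrow> x \<in> H \<Longrightarrow> y \<in> H \<Longrightarrow> l q (x + c *\<^sub>R y) = l q x + c * l q y"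
    and "\<And>q. q \<in> P \<Longrightarrow> \<exists>x\<in>H. l q x \<noteq> 0"
  shows "\<exists>z\<in>H. \<forall>q\<in>P. l q z \<noteq> 0"
  using assms
proof (induction P rule: finite_induct)
  case empty
  then show ?case using subspace_0 by blast
next
  case (insert q P)
  then obtain z where z: "z \<in> H" "\<forall>q\<in>P. l q z \<noteq> 0" by auto
  obtain x where x: "x \<in> H" "l q x \<noteq> 0" using insert.prems(3)[of q] by blast
  obtain t where "t > 0" and t: "\<forall>p\<in>insert q P. sgn (l p z + t * l p x) = (if l p z \<noteq> 0 then sgn (l p z) else sgn (l p x))"
    using small_perturbation[of "insert q P" "\<lambda>p. l p z" "\<lambda>p. l p x"] insert.hyps by auto
  have "z + t *\<^sub>R x \<in> H" using z x insert.prems by (simp add: subspace_add subspace_scale)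
  moreover have "\<forall>p\<in>insert q P. l p (z + t *\<^sub>R x) \<noteq> 0"
  proof
    fix p assume p: "p \<in> insert q P"
    have "l p z \<noteq> 0 \<or> l p x \<noteq> 0" using p x z by auto
    then have "sgn (l p z + t * l p x) \<noteq> 0"
      using bspec[OF t p] by (auto simp: sgn_zero_iff split: if_splits)
    then show "l p (z + t *\<^sub>R x) \<noteq> 0" using insert.prems(2)[OF p z(1) x(1)] by (simp add: sgn_zero_iff)
  qed
  ultimately show ?case by blast
qed

text \<open>The signed indicator of the facets in \<open>H'\<close> is the jump, across \<open>H'\<close> in direction \<open>p\<close>, of the vanishing
  signed indicator of the cones.\<close>

lemma facet_indicator:
  fixes S :: "'i \<Rightarrow> 'v::euclidean_space set"
  assumes H: "subspace H" and dimH: "dim H = Suc k" and I: "finite I"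
    and S: "\<And>i. i \<in> I \<Longrightarrow> independent (S i) \<and> span (S i) = H"
    and zero: "\<And>x. x \<in> H \<Longrightarrow> (\<forall>i\<in>I. generic_at (S i) x) \<Longrightarrow>
      (\<Sum>i\<in>I. sgn (s i) * of_bool (pos_at (S i) x)) = 0"
    and H': "subspace H'" "H' \<subseteq> H" "dim H' = k" and p: "p \<in> H" "p \<notin> H'"
    and J: "J = {(i, v). i \<in> I \<and> v \<in> S i \<and> span (S i - {v}) = H'}"
    and y: "y \<in> H'" "\<And>i v. (i, v) \<in> J \<Longrightarrow> generic_at (S i - {v}) y"
  shows "(\<Sum>(i, v)\<in>J. sgn (s i * representation (S i) p v) * of_bool (pos_at (S i - {v}) y)) = 0"
proof -
  define l where "l = (\<lambda>(i, v) x. representation (S i) x v)"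
  define P where "P = Sigma I S"
  have finS: "finite (S i)" if "i \<in> I" for i using S[OF that] finiteI_independent by auto
  have finP: "finite P" unfolding P_def using I finS by auto
  have JP: "J \<subseteq> P" unfolding J P_def by auto
  have lin: "l q (x + c *\<^sub>R x') = l q x + c * l q x'" if "q \<in> P" "x \<in> H" "x' \<in> H" for q x c x'
    using that S unfolding P_def l_def by (auto simp: representation_affine)
  \<comment> \<open>A coordinate functional that vanishes on \<open>H'\<close> belongs to a facet in
    \<open>H'\<close>, because the facet and \<open>H'\<close> have the same dimension. So the
    functionals outside \<open>J\<close> can be made nonzero at a point of
    \<open>H'\<close>.\<close>
  have inJ: "q \<in> J" if "q \<in> P" and van: "\<And>x. x \<in> H' \<Longrightarrow> l q x = 0" for q
  proof -
    obtain i v where q: "q = (i, v)" "i \<in> I" "v \<in> S i" using \<open>q \<in> P\<close> P_def by auto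
    have ind: "independent (S i)" "span (S i) = H" using S q by auto
    have "H' \<subseteq> span (S i - {v})"
    proof
      fix x assume "x \<in> H'"
      then have "representation (S i) x v = 0" "x \<in> span (S i)"
        using van[of x] H' ind unfolding l_def by (auto simp: q)
      then show "x \<in> span (S i - {v})" using representation_eq_0_iff ind q by blast
    qed
    moreover have "dim (span (S i - {v})) = k"
    proof -
      have "card (S i) = Suc k" using ind dimH by (metis dim_span_eq_card_independent)
      moreover have "independent (S i - {v})" using ind by (meson Diff_subset independent_mono)
      ultimately show ?thesis using q finS
        by (simp add: dim_span_eq_card_independent del: dim_span)
    qed
    ultimately have "H' = span (S i - {v})"
      using H' by (intro subspace_dim_equal) auto
    then show ?thesis using q J by auto
  qed
  have lJ: "l q x = 0" if "q \<in> J" "x \<in> H'" for q x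
    using that H' S representation_eq_0_iff[of "S (fst q)"] unfolding J l_def by (auto simp: subset_iff)
  have lJp: "l q p \<noteq> 0" if "q \<in> J" for q
    using that p S representation_eq_0_iff[of "S (fst q)" p "snd q"] unfolding J l_def by force
  obtain z where z: "z \<in> H'" "\<forall>q\<in>P - J. l q z \<noteq> 0"
  proof -
    have "\<exists>z\<in>H'. \<forall>q\<in>P - J. l q z \<noteq> 0"
    proof (rule avoid_hyperplanes)
      show "l q (x + c *\<^sub>R y) = l q x + c * l q y" if "q \<in> P - J" "x \<in> H'" "y \<in> H'" for q x y c
        using lin[of q x y c] that H' by blast
      show "\<exists>x\<in>H'. l q x \<noteq> 0" if "q \<in> P - J" for q using inJ[of q] that by blast
    qed (use finP H' in auto)
    then show ?thesis using that by blast
  qed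
  obtain t where t: "t > 0" "\<forall>q\<in>P. sgn (l q y + t * l q z) = (if l q y \<noteq> 0 then sgn (l q y) else sgn (l q z))"
    using small_perturbation[OF finP, of "\<lambda>q. l q y" "\<lambda>q. l q z"] by blast
  \<comment> \<open>\<open>y\<close> moves inside \<open>H'\<close> off every other facet
    hyperplane. The step is too small to change a sign that is nonzero at \<open>y\<close>, so each
    facet in \<open>H'\<close> still contains \<open>y'\<close> exactly if it contains
    \<open>y\<close>.\<close>
  define y' where "y' = y + t *\<^sub>R z"
  have y'H: "y' \<in> H'" unfolding y'_def using y z H' by (simp add: subspace_add subspace_scale)
  have ly': "l q y' = l q y + t * l q z" if "q \<in> P" for q
    unfolding y'_def using lin[OF that, of y z t] y z H' by blast
  have y'nz: "l q y' \<noteq> 0" if "q \<in> P - J" for q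
  proof -
    have "sgn (l q y') \<noteq> 0" using ly' t z that by (auto simp: sgn_zero_iff)
    then show ?thesis by (simp add: sgn_zero_iff)
  qed
  obtain \<epsilon> where \<epsilon>: "\<epsilon> > 0" "\<forall>(q, b)\<in>P \<times> {1, -1 :: real}. sgn (l q y' + \<epsilon> * (b * l q p)) =
      (if l q y' \<noteq> 0 then sgn (l q y') else sgn (b * l q p))"
    using small_perturbation[of "P \<times> {1, -1 :: real}" "\<lambda>(q, b). l q y'" "\<lambda>(q, b). b * l q p"] finP
    by (auto simp: case_prod_unfold)
  \<comment> \<open>\<open>x 1\<close> and \<open>x (-1)\<close> lie on either side of
    \<open>H'\<close>; only the coordinates indexed by \<open>J\<close> distinguish them.\<close>
  define x where "x b = y' + (\<epsilon> * b) *\<^sub>R p" for b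
  have xH: "x b \<in> H" for b unfolding x_def using y'H H' H p by (simp add: subspace_add subspace_scale subset_iff)
  have lx: "sgn (l q (x b)) = (if l q y' \<noteq> 0 then sgn (l q y') else b * sgn (l q p))"
    if "q \<in> P" "b \<in> {1, -1}" for q b
  proof -
    have "l q (x b) = l q y' + \<epsilon> * (b * l q p)"
      unfolding x_def using lin[OF that(1), of y' p "\<epsilon> * b"] y'H H' p by (auto simp: algebra_simps)
    moreover have "sgn (b * l q p) = b * sgn (l q p)" using that by auto
    ultimately show ?thesis using \<epsilon>(2) that by auto
  qed
  have gen: "generic_at (S i) (x b)" if "i \<in> I" "b \<in> {1, -1}" for i b
    unfolding generic_at_def
  proof
    fix v assume v: "v \<in> S i"
    then have q: "(i, v) \<in> P" using that P_def by auto
    have "sgn (l (i, v) (x b)) \<noteq> 0"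
      using lx[OF q that(2)] y'nz[of "(i, v)"] lJp[of "(i, v)"] q that(2)
      by (cases "(i, v) \<in> J") (auto simp: sgn_zero_iff lJ y'H)
    then show "representation (S i) (x b) v \<noteq> 0" by (simp add: l_def sgn_zero_iff)
  qed
  have sums: "(\<Sum>i\<in>I. sgn (s i) * of_bool (pos_at (S i) (x b))) = 0" if "b \<in> {1, -1}" for b
    using zero[OF xH] gen that by auto
  have pos_iff: "pos_at (S i) (x b) \<longleftrightarrow> (\<forall>v\<in>S i. sgn (l (i, v) (x b)) > 0)" for i b
    by (simp add: pos_at_def l_def)
  \<comment> \<open>At most one facet of a simplicial cone lies in \<open>H'\<close>. Without one,
    both points are on the same side of every facet. With one, at most one of the points is inside
    the cone, and one is exactly when \<open>y\<close> is interior to that facet.\<close>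
  have diff: "of_bool (pos_at (S i) (x 1)) - of_bool (pos_at (S i) (x (-1))) =
      (\<Sum>v | v \<in> S i \<and> (i, v) \<in> J. sgn (representation (S i) p v) * of_bool (pos_at (S i - {v}) y))"
    (is "?L = ?Rs") if i: "i \<in> I" for i
  proof (cases "\<exists>v\<in>S i. (i, v) \<in> J")
    case False
    then have "sgn (l (i, v) (x b)) = sgn (l (i, v) y')" if "v \<in> S i" "b \<in> {1, -1}" for v b
      using lx[of "(i, v)" b] y'nz[of "(i, v)"] that i unfolding P_def by auto
    then have "pos_at (S i) (x 1) = pos_at (S i) (x (-1))" unfolding pos_iff by auto
    moreover have "?Rs = 0" using False by (intro sum.neutral) auto
    ultimately show ?thesis by simp
  next
    case True
    then obtain v where v: "v \<in> S i" "(i, v) \<in> J" by auto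
    have ind: "independent (S i)" "span (S i) = H" using S i by auto
    have spv: "span (S i - {v}) = H'" using v J by auto
    have uniq: "u = v" if u: "u \<in> S i" "(i, u) \<in> J" for u
    proof (rule ccontr)
      assume "u \<noteq> v"
      then have "u \<in> span (S i - {v})" using u by (intro span_base) auto
      also have "\<dots> = span (S i - {u})" using spv u J by auto
      finally show False using ind(1) u(1) unfolding dependent_def by auto
    qed
    have set_eq: "{v. v \<in> S i \<and> (i, v) \<in> J} = {v}" using v uniq by blast
    have sgnu: "sgn (l (i, u) (x b)) = sgn (representation (S i - {v}) y u)"
      if u: "u \<in> S i - {v}" and b: "b \<in> {1, -1}" for u b
    proof -
      have q: "(i, u) \<in> P" "(i, u) \<notin> J" using u i uniq P_def by auto
      have "representation (S i) y = representation (S i - {v}) y"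
        using ind y spv by (intro representation_extend) auto
      then have e: "l (i, u) y = representation (S i - {v}) y u" by (simp add: l_def)
      have "representation (S i - {v}) y u \<noteq> 0" using y(2)[OF v(2)] u by (auto simp: generic_at_def)
      then have "sgn (l (i, u) y') = sgn (l (i, u) y)" using t(2) q ly' e by auto
      then show ?thesis using lx[OF q(1) b] y'nz[of "(i, u)"] q e by auto
    qed
    have sgnv: "sgn (l (i, v) (x b)) = b * sgn (representation (S i) p v)" if "b \<in> {1, -1}" for b
      using lx[of "(i, v)" b] that v JP lJ[OF v(2) y'H] by (auto simp: l_def)
    have "pos_at (S i) (x b) \<longleftrightarrow> b * sgn (representation (S i) p v) > 0 \<and> pos_at (S i - {v}) y"
      if "b \<in> {1, -1}" for b
    proof -
      have "pos_at (S i) (x b) \<longleftrightarrow> sgn (l (i, v) (x b)) > 0 \<and> (\<forall>u\<in>S i - {v}. sgn (l (i, u) (x b)) > 0)"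
        unfolding pos_iff using v by auto
      also have "\<dots> \<longleftrightarrow> b * sgn (representation (S i) p v) > 0 \<and> pos_at (S i - {v}) y"
        using sgnu[OF _ that] sgnv[OF that] by (auto simp: pos_at_def)
      finally show ?thesis .
    qed
    note pa = this[of 1] this[of "-1"]
    show ?thesis unfolding set_eq using pa lJp[OF v(2)] by (simp add: l_def sgn_if)
  qed
  have J_eq: "J = Sigma I (\<lambda>i. {v. v \<in> S i \<and> (i, v) \<in> J})" using J by auto
  have "(\<Sum>(i, v)\<in>J. sgn (s i * representation (S i) p v) * of_bool (pos_at (S i - {v}) y)) =
    (\<Sum>i\<in>I. \<Sum>v | v \<in> S i \<and> (i, v) \<in> J. sgn (s i * representation (S i) p v) * of_bool (pos_at (S i - {v}) y))"
    using I finS by (subst (1) J_eq, subst sum.Sigma) auto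
  also have "\<dots> = (\<Sum>i\<in>I. sgn (s i) * (of_bool (pos_at (S i) (x 1)) - of_bool (pos_at (S i) (x (-1)))))"
    using diff by (intro sum.cong) (auto simp: sum_distrib_left sgn_mult mult.assoc)
  also have "\<dots> = 0" using sums[of 1] sums[of "-1"] by (simp add: algebra_simps sum_subtractf)
  finally show ?thesis .
qed

text \<open>\<open>V\<close> has one element more than a basis of \<open>H\<close>, so \<rho> is
  unique up to a factor and the cones with \<rho> v \<noteq> 0 are simplicial; the others are erased
  by \<open>sg\<close>, whatever \<open>G\<close> assigns to them. \<open>X\<close> leaves room for
  a half space condition, and \<open>H\<close> for the induction on the dimension.\<close>

definition cocycles :: "'v::euclidean_space set \<Rightarrow> 'v set \<Rightarrow> ('v set \<Rightarrow> 'b::ab_group_add) \<Rightarrow> 'b set \<Rightarrow> bool" where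
  "cocycles X H G R \<longleftrightarrow> (\<forall>V \<rho>. V \<subseteq> X \<inter> H \<and> finite V \<and> card V = Suc (dim H) \<and> span V = H \<and>
     (\<Sum>v\<in>V. \<rho> v *\<^sub>R v) = 0 \<longrightarrow> (\<Sum>v\<in>V. sg (\<rho> v) (G (V - {v}))) \<in> R)"

lemma cocyclesI:
  assumes "\<And>V \<rho>. V \<subseteq> X \<inter> H \<Longrightarrow> finite V \<Longrightarrow> card V = Suc (dim H) \<Longrightarrow> span V = H \<Longrightarrow>
    (\<Sum>v\<in>V. \<rho> v *\<^sub>R v) = 0 \<Longrightarrow> (\<Sum>v\<in>V. sg (\<rho> v) (G (V - {v}))) \<in> R"
  shows "cocycles X H G R"
  using assms unfolding cocycles_def by simp

lemma cocyclesD: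
  assumes "cocycles X H G R" "V \<subseteq> X \<inter> H" "finite V" "card V = Suc (dim H)" "span V = H"
    "(\<Sum>v\<in>V. \<rho> v *\<^sub>R v) = 0"
  shows "(\<Sum>v\<in>V. sg (\<rho> v) (G (V - {v}))) \<in> R"
  using assms unfolding cocycles_def by simp


section \<open>Relations between simplicial cones, by induction on the dimension\<close>

context add_subgroup
begin

text \<open>Induction on the dimension: with a common apex \<open>p\<close>, the cocycle relation replaces each cone by the
  cones from \<open>p\<close> over its facets, and the facets in one hyperplane satisfy the hypotheses there.\<close>

lemma cone_relation_nat:
  fixes S :: "nat \<Rightarrow> 'v::euclidean_space set"
  assumes "subspace H" "dim H = k" "cocycles X H G R" "finite I"
    and "\<And>i. i \<in> I \<Longrightarrow> independent (S i) \<and> S i \<subseteq> X \<and> span (S i) = H"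
    and "\<And>x. x \<in> H \<Longrightarrow> (\<forall>i\<in>I. generic_at (S i) x) \<Longrightarrow>
      (\<Sum>i\<in>I. sgn (s i) * of_bool (pos_at (S i) x)) = 0"
  shows "(\<Sum>i\<in>I. sg (s i) (G (S i))) \<in> R"
  using assms
proof (induction k arbitrary: H G I S s)
  case 0
  have "S i = {}" if "i \<in> I" for i
    using 0(5)[OF that] 0(2) by (metis card_eq_0_iff dim_span_eq_card_independent finiteI_independent)
  then have "(\<Sum>i\<in>I. sg (s i) (G (S i))) = (\<Sum>i\<in>I. sg (s i) (G {}))" by auto
  moreover have "(\<Sum>i\<in>I. sgn (s i)) = 0"
    using 0(6)[of 0] subspace_0[OF 0(1)] \<open>\<And>i. i \<in> I \<Longrightarrow> S i = {}\<close>
    by (simp add: generic_at_def pos_at_def)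
  ultimately show ?case using 0(4) by (simp add: sum_sg_const zero_mem)
next
  case (Suc k)
  note H = Suc.prems(1) and dimH = Suc.prems(2) and I = Suc.prems(4)
  show ?case
  proof (cases "I = {}")
    case True
    then show ?thesis by (simp add: zero_mem)
  next
    case False
    have S: "independent (S i)" "S i \<subseteq> X" "span (S i) = H" "finite (S i)" "card (S i) = Suc k" if "i \<in> I" for i
      using Suc.prems(5)[OF that] dimH finiteI_independent dim_span_eq_card_independent[of "S i"] by auto
    obtain i0 p where "i0 \<in> I" "p \<in> S i0"
      using False S(5) by (metis card.empty equals0I nat.distinct(1))
    then have p: "p \<in> X" "p \<in> H" using S span_superset[of "S i0"] by auto
    define c where "c i v = representation (S i) p v" for i v
    have sp: "p \<in> span (S i)" if "i \<in> I" for i using S p that by auto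
    \<comment> \<open>The cocycle on \<open>insert p (S i)\<close>, with coefficient -1 at
      \<open>p\<close>. If \<open>p\<close> is itself a generator, the sum on the right reduces to
      \<open>G (S i)\<close>.\<close>
    have expand: "G (S i) - (\<Sum>v\<in>S i. sg (c i v) (G (insert p (S i - {v})))) \<in> R" if i: "i \<in> I" for i
    proof (cases "p \<in> S i")
      case True
      then have "c i = (\<lambda>v. if v = p then 1 else 0)"
        unfolding c_def using S[OF i] representation_basis by auto
      then have "(\<Sum>v\<in>S i. sg (c i v) (G (insert p (S i - {v})))) =
          (\<Sum>v\<in>S i. if v = p then G (S i) else 0)"
        using True by (intro sum.cong) (auto simp: insert_absorb)
      then show ?thesis using S[OF i] True by (simp add: zero_mem)
    next
      case False
      let ?V = "insert p (S i)" and ?\<rho> = "\<lambda>v. if v = p then - 1 else c i v"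
      have "?V \<subseteq> X \<inter> H" "finite ?V" "card ?V = Suc (dim H)" "span ?V = H"
        using S[OF i] p False dimH span_superset[of "S i"] by (auto simp: span_redundant)
      moreover have "(\<Sum>v\<in>?V. ?\<rho> v *\<^sub>R v) = 0"
      proof -
        have "(\<Sum>v\<in>?V. ?\<rho> v *\<^sub>R v) = - p + (\<Sum>v\<in>S i. ?\<rho> v *\<^sub>R v)"
          using False S[OF i] by simp
        also have "(\<Sum>v\<in>S i. ?\<rho> v *\<^sub>R v) = (\<Sum>v\<in>S i. c i v *\<^sub>R v)"
          using False by (intro sum.cong) auto
        also have "\<dots> = p" unfolding c_def by (rule representation_sum_eq[OF S(1)[OF i] sp[OF i]])
        finally show ?thesis by simp
      qed
      ultimately have "(\<Sum>v\<in>?V. sg (?\<rho> v) (G (?V - {v}))) \<in> R"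
        by (intro cocyclesD[OF Suc.prems(3)]) auto
      also have "(\<Sum>v\<in>?V. sg (?\<rho> v) (G (?V - {v}))) =
          - G (S i) + (\<Sum>v\<in>S i. sg (?\<rho> v) (G (?V - {v})))"
        using False S[OF i] by simp
      also have "(\<Sum>v\<in>S i. sg (?\<rho> v) (G (?V - {v}))) = (\<Sum>v\<in>S i. sg (c i v) (G (insert p (S i - {v}))))"
        using False by (intro sum.cong) (auto simp: insert_Diff_if)
      finally show ?thesis using minus_mem by force
    qed
    \<comment> \<open>A facet whose hyperplane contains \<open>p\<close> spans no full-dimensional
      cone with \<open>p\<close>; its coefficient is zero and it drops out.\<close>
    define P where "P = {(i, v). i \<in> I \<and> v \<in> S i \<and> c i v \<noteq> 0}"
    define hyp where "hyp = (\<lambda>(i, v). span (S i - {v}))"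
    define g where "g = (\<lambda>(i, v). sg (s i * c i v) (G (insert p (S i - {v}))))"
    have P_sub: "P \<subseteq> Sigma I S" unfolding P_def by auto
    have finP: "finite P" using P_sub I S by (meson finite_SigmaI finite_subset)
    have "(\<Sum>q\<in>P. g q) \<in> R"
    proof -
      have "(\<Sum>q\<in>P. g q) = (\<Sum>H'\<in>hyp ` P. \<Sum>q | q \<in> P \<and> hyp q = H'. g q)"
        by (rule sum.image_gen[OF finP])
      moreover have "(\<Sum>q | q \<in> P \<and> hyp q = H'. g q) \<in> R" if H'in: "H' \<in> hyp ` P" for H'
      proof -
        obtain i1 v1 where iv1: "i1 \<in> I" "v1 \<in> S i1" "c i1 v1 \<noteq> 0" "H' = span (S i1 - {v1})"
          using H'in unfolding P_def hyp_def by auto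
        have H': "subspace H'" "H' \<subseteq> H" "dim H' = k"
        proof -
          show "subspace H'" "H' \<subseteq> H"
            using iv1 S(3)[OF iv1(1)] span_mono[of "S i1 - {v1}" "S i1"] by auto
          have "independent (S i1 - {v1})" using S(1)[OF iv1(1)] by (meson Diff_subset independent_mono)
          then show "dim H' = k" unfolding iv1(4)
            using S[OF iv1(1)] iv1 by (simp add: dim_span_eq_card_independent del: dim_span)
        qed
        have pH': "p \<notin> H'"
          using iv1 S[OF iv1(1)] sp[OF iv1(1)] representation_eq_0_iff[of "S i1" p v1] unfolding c_def by auto
        define J where "J = {(i, v). i \<in> I \<and> v \<in> S i \<and> span (S i - {v}) = H'}"
        have J_eq: "{q. q \<in> P \<and> hyp q = H'} = J"
        proof -
          have "c i v \<noteq> 0" if "i \<in> I" "v \<in> S i" "span (S i - {v}) = H'" for i v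
            using that pH' sp[OF that(1)] S[OF that(1)] representation_eq_0_iff[of "S i" p v] unfolding c_def by auto
          then show ?thesis unfolding J_def P_def hyp_def by auto
        qed
        have finJ: "finite J" unfolding J_eq[symmetric] using finP by simp
        obtain h where h: "bij_betw h {..<card J} J"
          using finJ ex_bij_betw_nat_finite[OF finJ] by (auto simp: atLeast0LessThan)
        define T where "T = (\<lambda>(i, v). S i - {v})"
        have hJ: "h j \<in> J" if "j < card J" for j using h that by (auto simp: bij_betw_def)
        have "(\<Sum>j<card J. sg (case h j of (i, v) \<Rightarrow> s i * c i v) (G (insert p (T (h j))))) \<in> R"
        proof (rule Suc.IH[where H = H' and G = "\<lambda>T. G (insert p T)" and S = "\<lambda>j. T (h j)"])
          show "subspace H'" "dim H' = k" by fact+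
          show "cocycles X H' (\<lambda>T. G (insert p T)) R"
            proof (rule cocyclesI)
            fix V and \<rho> :: "'v \<Rightarrow> real" assume V: "V \<subseteq> X \<inter> H'" "finite V" "card V = Suc (dim H')" "span V = H'" "(\<Sum>v\<in>V. \<rho> v *\<^sub>R v) = 0"
            \<comment> \<open>A relation inside \<open>H'\<close> extends to
              \<open>insert p V\<close> by the coefficient 0 at \<open>p\<close>, so joining with
              the apex preserves the cocycle property.\<close>
            let ?V = "insert p V" and ?\<rho> = "\<lambda>v. if v = p then 0 else \<rho> v"
            have pV: "p \<notin> V" using pH' V by auto
            have "span ?V = H"
            proof (rule subspace_dim_equal)
              show "span ?V \<subseteq> H" using V H' p H by (intro span_minimal) auto
              have "dim ?V = Suc k" using dim_insert[of p V] V H' pH' by (simp flip: dim_span[of V])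
              then show "dim H \<le> dim (span ?V)" using dimH by simp
            qed (use H in auto)
            moreover have "?V \<subseteq> X \<inter> H" "finite ?V" "card ?V = Suc (dim H)"
              using V p H' pV dimH by auto
            moreover have "(\<Sum>v\<in>?V. ?\<rho> v *\<^sub>R v) = 0"
            proof -
              have "(\<Sum>v\<in>?V. ?\<rho> v *\<^sub>R v) = (\<Sum>v\<in>V. ?\<rho> v *\<^sub>R v)" using V pV by simp
              also have "\<dots> = (\<Sum>v\<in>V. \<rho> v *\<^sub>R v)" using pV by (intro sum.cong) auto
              finally show ?thesis using V by simp
            qed
            ultimately have "(\<Sum>v\<in>?V. sg (?\<rho> v) (G (?V - {v}))) \<in> R"
              by (intro cocyclesD[OF Suc.prems(3)]) auto
            also have "(\<Sum>v\<in>?V. sg (?\<rho> v) (G (?V - {v}))) = (\<Sum>v\<in>V. sg (?\<rho> v) (G (?V - {v})))"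
              using V pV by simp
            also have "\<dots> = (\<Sum>v\<in>V. sg (\<rho> v) (G (insert p (V - {v}))))"
              using pV by (intro sum.cong) (auto simp: insert_Diff_if)
            finally show "(\<Sum>v\<in>V. sg (\<rho> v) (G (insert p (V - {v})))) \<in> R" .
          qed
          show "finite {..<card J}" by simp
          fix j assume "j \<in> {..<card J}"
          then obtain i v where iv: "h j = (i, v)" "i \<in> I" "v \<in> S i" "span (S i - {v}) = H'"
            using hJ[of j] unfolding J_def by auto
          then show "independent (T (h j)) \<and> T (h j) \<subseteq> X \<and> span (T (h j)) = H'"
            unfolding T_def using S[of i] independent_mono[of "S i" "S i - {v}"] by auto
        next
          fix y assume y: "y \<in> H'" "\<forall>j\<in>{..<card J}. generic_at (T (h j)) y"
          have gen: "generic_at (S i - {v}) y" if "(i, v) \<in> J" for i v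
          proof -
            obtain j where "j < card J" "h j = (i, v)" using h \<open>(i, v) \<in> J\<close> unfolding bij_betw_def by (metis imageE lessThan_iff)
            then show ?thesis using bspec[OF y(2), of j] by (simp add: T_def)
          qed
          have "(\<Sum>j<card J. sgn (case h j of (i, v) \<Rightarrow> s i * c i v) * of_bool (pos_at (T (h j)) y)) =
            (\<Sum>q\<in>J. sgn (case q of (i, v) \<Rightarrow> s i * c i v) * of_bool (pos_at (T q) y))"
            by (rule sum.reindex_bij_betw[OF h])
          also have "\<dots> = (\<Sum>(i, v)\<in>J. sgn (s i * representation (S i) p v) * of_bool (pos_at (S i - {v}) y))"
            by (intro sum.cong) (auto simp: T_def c_def)
          also have "\<dots> = 0"
            by (rule facet_indicator[OF H dimH I _ Suc.prems(6) H' p(2) pH' J_def y(1) gen]) (use S in auto)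
          finally show "(\<Sum>j\<in>{..<card J}. sgn (case h j of (i, v) \<Rightarrow> s i * c i v) * of_bool (pos_at (T (h j)) y)) = 0" .
        qed
        also have "(\<Sum>j<card J. sg (case h j of (i, v) \<Rightarrow> s i * c i v) (G (insert p (T (h j))))) =
          (\<Sum>q\<in>J. sg (case q of (i, v) \<Rightarrow> s i * c i v) (G (insert p (T q))))"
          by (rule sum.reindex_bij_betw[OF h])
        also have "\<dots> = (\<Sum>q\<in>J. g q)" by (intro sum.cong) (auto simp: g_def T_def)
        finally show ?thesis unfolding J_eq .
      qed
      ultimately show ?thesis by (simp add: sum_mem)
    qed
    moreover have "(\<Sum>q\<in>P. g q) = (\<Sum>i\<in>I. \<Sum>v\<in>S i. sg (s i) (sg (c i v) (G (insert p (S i - {v})))))"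
    proof -
      have "(\<Sum>q\<in>P. g q) = (\<Sum>q\<in>Sigma I S. g q)"
        using P_sub I S by (intro sum.mono_neutral_left) (auto simp: P_def g_def)
      also have "\<dots> = (\<Sum>i\<in>I. \<Sum>v\<in>S i. g (i, v))"
        using I S by (subst sum.Sigma) auto
      finally show ?thesis by (simp add: g_def sg_sg)
    qed
    moreover have "(\<Sum>i\<in>I. sg (s i) (G (S i) - (\<Sum>v\<in>S i. sg (c i v) (G (insert p (S i - {v})))))) \<in> R"
      using expand by (intro sum_mem sg_mem) auto
    ultimately have "(\<Sum>q\<in>P. g q) + (\<Sum>i\<in>I. sg (s i) (G (S i) - (\<Sum>v\<in>S i. sg (c i v) (G (insert p (S i - {v})))))) \<in> R"
      using add_mem by blast
    then show ?thesis
      using \<open>(\<Sum>q\<in>P. g q) = _\<close> by (simp add: sg_diff sg_sum sum_subtractf)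
  qed
qed

text \<open>The induction needs one fixed index type, since its hypothesis is applied to pairs of a
  cone and a facet. Natural numbers serve there and are traded for an arbitrary index type
  here.\<close>

lemma cone_relation:
  fixes S :: "'i \<Rightarrow> 'v::euclidean_space set"
  assumes "subspace H" "cocycles X H G R" "finite I"
    and "\<And>i. i \<in> I \<Longrightarrow> independent (S i) \<and> S i \<subseteq> X \<and> span (S i) = H"
    and zero: "\<And>x. x \<in> H \<Longrightarrow> (\<forall>i\<in>I. generic_at (S i) x) \<Longrightarrow>
      (\<Sum>i\<in>I. sgn (s i) * of_bool (pos_at (S i) x)) = 0"
  shows "(\<Sum>i\<in>I. sg (s i) (G (S i))) \<in> R"
proof -
  obtain h where h: "bij_betw h {..<card I} I"
    using ex_bij_betw_nat_finite[OF assms(3)] by (auto simp: atLeast0LessThan)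
  then have hI: "h j \<in> I" if "j < card I" for j using that by (auto simp: bij_betw_def)
  have "(\<Sum>j<card I. sg (s (h j)) (G (S (h j)))) \<in> R"
  proof (rule cone_relation_nat[OF assms(1) refl assms(2)])
    fix x assume x: "x \<in> H" "\<forall>i\<in>{..<card I}. generic_at (S (h i)) x"
    then have "\<forall>i\<in>I. generic_at (S i) x" using h unfolding bij_betw_def by (metis imageE)
    then show "(\<Sum>i<card I. sgn (s (h i)) * of_bool (pos_at (S (h i)) x)) = 0"
      using zero[OF x(1)] sum.reindex_bij_betw[OF h, of "\<lambda>i. sgn (s i) * of_bool (pos_at (S i) x)"] by simp
  qed (use assms hI in auto)
  then show ?thesis using sum.reindex_bij_betw[OF h, of "\<lambda>i. sg (s i) (G (S i))"] by simp
qed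

end

section \<open>Bases and indices in a lattice\<close>

text \<open>The unordered form of \<open>lattice_basis\<close>. A cone, and the functions on cones
  below, depend on the set of generators alone; orderings return with the symbols.\<close>

definition Zbasis :: "(real^'n) set \<Rightarrow> (real^'n) set \<Rightarrow> bool" where
  "Zbasis L S \<longleftrightarrow> independent S \<and> span S = UNIV \<and> L = {x. \<forall>v\<in>S. representation S x v \<in> \<int>}"

text \<open>The covolume of the lattice spanned by \<open>S\<close>. Another enumeration permutes
  the columns and can change only the sign, so the choice of \<open>e\<close> does not
  matter.\<close>

definition adet :: "(real^'n) set \<Rightarrow> real" where
  "adet S = \<bar>det (\<chi> i j. (SOME e. bij_betw e UNIV S) j $ i :: real^'n^'n)\<bar>"

lemma adet_enum:
  fixes e :: "'n::finite \<Rightarrow> real^'n"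
  assumes "bij_betw e UNIV S"
  shows "adet S = \<bar>det (\<chi> i j. e j $ i)\<bar>"
proof -
  define e' where "e' = (SOME e :: 'n \<Rightarrow> real^'n. bij_betw e UNIV S)"
  have e': "bij_betw e' UNIV S" unfolding e'_def by (rule someI[where P = "\<lambda>e. bij_betw e UNIV S", OF assms])
  define p where "p = inv_into UNIV e \<circ> e'"
  have inj: "inj e" "range e = S" using assms by (auto simp: bij_betw_def)
  have "bij_betw (inv_into UNIV e) S UNIV"
    using assms bij_betw_inv_into by blast
  then have "bij p" unfolding p_def using e' bij_betw_trans by blast
  then have p: "p permutes UNIV" by (intro bij_imp_permutes) auto
  have ep: "e (p j) = e' j" for j
    unfolding p_def using inj e' by (simp add: f_inv_into_f bij_betw_apply)
  have "(\<chi> i j. e' j $ i) = (\<chi> i j. (\<chi> i j. e j $ i) $ i $ p j :: real^'n^'n)"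
    by (simp add: vec_eq_iff ep)
  then have "det (\<chi> i j. e' j $ i) = of_int (sign p) * det (\<chi> i j. e j $ i)"
    using det_permute_columns[OF p, of "\<chi> i j. e j $ i"] by simp
  then show ?thesis unfolding adet_def e'_def[symmetric] by (simp add: abs_mult sign_def)
qed

lemma card_basis:
  fixes S :: "(real^'n) set"
  assumes "independent S" "span S = UNIV"
  shows "finite S" "card S = CARD('n)"
  using assms finiteI_independent dim_span_eq_card_independent[of S] by (auto simp: dim_UNIV)

lemma basis_enum:
  fixes S :: "(real^'n) set"
  assumes "independent S" "span S = UNIV"
  obtains e :: "'n \<Rightarrow> real^'n" where "bij_betw e UNIV S"
  using card_basis[OF assms] finite_same_card_bij[of "UNIV :: 'n set" S] by auto

text \<open>Cramer's rule: the new column is the old matrix applied to the coordinates of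
  \<open>w\<close>.\<close>

lemma adet_replace:
  fixes S :: "(real^'n) set"
  assumes S: "independent S" "span S = UNIV" and v: "v \<in> S" and w: "representation S w v \<noteq> 0"
  shows "adet (insert w (S - {v})) = \<bar>representation S w v\<bar> * adet S"
proof -
  obtain e :: "'n \<Rightarrow> real^'n" where e: "bij_betw e UNIV S" using basis_enum[OF S] .
  then have inj: "inj e" "range e = S" by (auto simp: bij_betw_def)
  obtain k where k: "e k = v" using inj v by auto
  have wS: "w \<notin> S - {v}" using w representation_basis[OF S(1), of w] by (auto split: if_splits)
  have e': "bij_betw (e(k := w)) UNIV (insert w (S - {v}))"
  proof -
    have "inj (e(k := w))" using inj(1) wS k inj(2)
      by (auto simp: inj_def)
    moreover have "range (e(k := w)) = insert w (S - {v})"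
      using inj k by (auto simp: inj_def image_iff)
    ultimately show ?thesis by (simp add: bij_betw_def)
  qed
  let ?A = "\<chi> i j. e j $ i :: real^'n^'n" and ?x = "\<chi> j. representation S w (e j) :: real^'n"
  have "?A *v ?x = (\<Sum>j\<in>UNIV. representation S w (e j) *\<^sub>R e j)"
    by (simp add: vec_eq_iff matrix_vector_mult_def mult.commute)
  also have "\<dots> = (\<Sum>u\<in>S. representation S w u *\<^sub>R u)"
    by (rule sum.reindex_bij_betw[OF e])
  also have "\<dots> = w" using S by (intro representation_sum_eq) auto
  finally have Ax: "?A *v ?x = w" .
  have "(\<chi> i j. (e(k := w)) j $ i) = (\<chi> i j. if j = k then (?A *v ?x) $ i else ?A $ i $ j :: real^'n^'n)"
    unfolding Ax by (simp add: vec_eq_iff)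
  then have "det (\<chi> i j. (e(k := w)) j $ i) = ?x $ k * det ?A"
    by (simp only: cramer_lemma)
  then show ?thesis using adet_enum[OF e'] adet_enum[OF e] k by (simp add: abs_mult)
qed

lemma adet_nonzero:
  fixes S :: "(real^'n) set"
  assumes "independent S" "span S = UNIV"
  shows "adet S > 0"
proof -
  obtain e :: "'n \<Rightarrow> real^'n" where e: "bij_betw e UNIV S" using basis_enum[OF assms] .
  let ?A = "\<chi> i j. e j $ i :: real^'n^'n"
  have cols: "column j ?A = e j" for j by (simp add: column_def vec_eq_iff)
  have "columns ?A = S" using e by (auto simp: columns_def cols bij_betw_def)
  then have "\<exists>B. ?A ** B = mat 1"
    using assms matrix_right_invertible_span_columns[of ?A] by (simp add: span_vec_eq)
  then have "det ?A \<noteq> 0" by (metis invertible_det_nz invertible_right_inverse)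
  then show ?thesis using adet_enum[OF e] by simp
qed

lemma det_Ints:
  fixes A :: "real^'n^'n"
  assumes "\<And>i j. A $ i $ j \<in> \<int>"
  shows "det A \<in> \<int>"
  unfolding det_def using assms by (intro Ints_sum Ints_mult Ints_prod) auto

text \<open>The matrix expressing \<open>S\<close> in \<open>B\<close> is integral, so its
  determinant is an integer, and it is not zero because \<open>S\<close> is a basis.\<close>

lemma adet_multiple:
  fixes S B :: "(real^'n) set"
  assumes B: "independent B" "span B = UNIV" and S: "independent S" "span S = UNIV"
    and int: "\<And>v b. v \<in> S \<Longrightarrow> b \<in> B \<Longrightarrow> representation B v b \<in> \<int>"
  shows "\<exists>k::nat. k \<ge> 1 \<and> adet S = real k * adet B"
proof -
  obtain e :: "'n \<Rightarrow> real^'n" where e: "bij_betw e UNIV S" using basis_enum[OF S] .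
  obtain b :: "'n \<Rightarrow> real^'n" where b: "bij_betw b UNIV B" using basis_enum[OF B] .
  let ?C = "\<chi> i j. representation B (e j) (b i) :: real^'n^'n"
  have "(\<chi> i j. e j $ i) = (\<chi> i j. b j $ i) ** ?C"
  proof -
    have "e j = (\<Sum>k\<in>UNIV. representation B (e j) (b k) *\<^sub>R b k)" for j
    proof -
      have "e j = (\<Sum>u\<in>B. representation B (e j) u *\<^sub>R u)"
        using B by (intro representation_sum_eq[symmetric]) auto
      then show ?thesis using sum.reindex_bij_betw[OF b, of "\<lambda>u. representation B (e j) u *\<^sub>R u"] by simp
    qed
    then have "e j $ i = (\<Sum>k\<in>UNIV. representation B (e j) (b k) *\<^sub>R b k) $ i" for i j by metis
    then show ?thesis by (simp add: vec_eq_iff matrix_matrix_mult_def mult.commute)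
  qed
  then have "adet S = \<bar>det ?C\<bar> * adet B"
    using adet_enum[OF e] adet_enum[OF b] by (simp add: det_mul abs_mult mult.commute)
  moreover have "det ?C \<in> \<int>"
    using int e b by (intro det_Ints) (auto simp: bij_betw_def)
  then obtain k :: int where k: "det ?C = of_int k" by (auto elim: Ints_cases)
  ultimately have "adet S = real (nat \<bar>k\<bar>) * adet B" by simp
  moreover have "nat \<bar>k\<bar> \<ge> 1"
    using calculation adet_nonzero[OF S] by (cases "nat \<bar>k\<bar>") auto
  ultimately show ?thesis by blast
qed

text \<open>\<open>B\<close> serves as the unit of volume: the index of a family of generators is
  measured against it.\<close>

locale lattice_context =
  fixes L B :: "(real^'n) set"
  assumes ZbasisB: "Zbasis L B"
begin

lemma B: "independent B" "span B = UNIV"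
  using ZbasisB by (auto simp: Zbasis_def)

lemma mem_L: "x \<in> L \<longleftrightarrow> (\<forall>v\<in>B. representation B x v \<in> \<int>)"
  using ZbasisB by (auto simp: Zbasis_def)

lemma zero_L: "0 \<in> L"
  by (simp add: mem_L representation_zero)

lemma diff_L: "x \<in> L \<Longrightarrow> y \<in> L \<Longrightarrow> x - y \<in> L"
  using B by (auto simp: mem_L representation_diff)

lemma minus_L: "x \<in> L \<Longrightarrow> - x \<in> L"
  using diff_L[OF zero_L] by force

lemma add_L: "x \<in> L \<Longrightarrow> y \<in> L \<Longrightarrow> x + y \<in> L"
  using diff_L[OF _ minus_L] by force

lemma scale_L: "x \<in> L \<Longrightarrow> c \<in> \<int> \<Longrightarrow> c *\<^sub>R x \<in> L"
  using B by (auto simp: mem_L representation_scale)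

lemma sum_L: "(\<And>i. i \<in> I \<Longrightarrow> f i \<in> L) \<Longrightarrow> sum f I \<in> L"
  by (induction I rule: infinite_finite_induct) (auto simp: zero_L add_L)

definition good :: "(real^'n) set \<Rightarrow> bool" where
  "good S \<longleftrightarrow> S \<subseteq> L \<and> independent S \<and> span S = UNIV"

lemma goodD:
  assumes "good S"
  shows "S \<subseteq> L" "independent S" "span S = UNIV" "finite S" "card S = CARD('n)" "x \<in> span S"
  using assms card_basis by (auto simp: good_def)

lemma Zbasis_good: "Zbasis L S \<Longrightarrow> good S"
  unfolding good_def by (auto simp: Zbasis_def representation_basis)

text \<open>The index in \<open>L\<close> of the sublattice spanned by \<open>S\<close>; a junk value unless \<open>good S\<close>.\<close>

definition idx :: "(real^'n) set \<Rightarrow> nat" where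
  "idx S = (THE k. adet S = real k * adet B)"

lemma idx: assumes "good S" shows "adet S = real (idx S) * adet B" "idx S \<ge> 1"
proof -
  obtain k :: nat where k: "k \<ge> 1" "adet S = real k * adet B"
    using adet_multiple[OF B goodD(2,3)[OF assms]] goodD(1)[OF assms] mem_L by blast
  then have "idx S = k" unfolding idx_def using adet_nonzero[OF B] by (intro the_equality) auto
  then show "adet S = real (idx S) * adet B" "idx S \<ge> 1" using k by auto
qed

text \<open>The engine of every descent on the index: a coordinate of \<open>w\<close> below 1 in
  absolute value makes it drop.\<close>

lemma good_replace:
  assumes S: "good S" and "v \<in> S" "w \<in> L" "representation S w v \<noteq> 0"
  shows "good (insert w (S - {v}))" "real (idx (insert w (S - {v}))) = \<bar>representation S w v\<bar> * real (idx S)"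
proof -
  note S' = goodD[OF S]
  let ?T = "insert w (S - {v})"
  have "w \<notin> span (S - {v})" using representation_eq_0_iff[of S w v] S' assms by auto
  moreover have "independent (S - {v})" using S' by (meson Diff_subset independent_mono)
  ultimately have ind: "independent ?T" by (rule independent_insertI)
  moreover have "card ?T = CARD('n)"
    using S' assms \<open>w \<notin> span (S - {v})\<close> span_base[of w "S - {v}"] card_Suc_Diff1[of S v] by (auto simp: card_insert_if)
  then have "span ?T = UNIV"
    using ind card_ge_dim_independent[of ?T UNIV] by (auto simp: dim_UNIV)
  ultimately show g: "good ?T" unfolding good_def using S' assms by auto
  have "real (idx ?T) * adet B = \<bar>representation S w v\<bar> * (real (idx S) * adet B)"
    using adet_replace[OF S'(2,3) assms(2,4)] idx[OF S] idx[OF g] by simp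
  then show "real (idx ?T) = \<bar>representation S w v\<bar> * real (idx S)"
    using adet_nonzero[OF B] by simp
qed

lemma nonintegral_point:
  assumes S: "good S" and "\<not> Zbasis L S"
  obtains x v where "x \<in> L" "v \<in> S" "representation S x v \<notin> \<int>"
proof -
  note S' = goodD[OF S]
  have "{x. \<forall>v\<in>S. representation S x v \<in> \<int>} \<subseteq> L"
  proof
    fix x assume x: "x \<in> {x. \<forall>v\<in>S. representation S x v \<in> \<int>}"
    have "x = (\<Sum>v\<in>S. representation S x v *\<^sub>R v)" using S' by (simp add: representation_sum_eq)
    also have "\<dots> \<in> L" using x S' by (intro sum_L scale_L) auto
    finally show "x \<in> L" .
  qed
  then show ?thesis using that assms S' unfolding Zbasis_def by blast
qed

text \<open>Integral combinations of \<open>S\<close> move the coordinates of a lattice point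
  independently by integers. \<open>P\<close> prescribes a set of residues: the interval from 0 to 1
  for \<open>box_point\<close>, a symmetric one whose endpoint depends on \<open>v\<close> for
  \<open>half_point\<close>. Starting from a nonintegral coordinate guarantees that the result is
  not zero.\<close>

lemma shifted_point:
  assumes S: "good S" and "\<not> Zbasis L S"
    and k: "\<And>c v. \<exists>k::int. P (c - of_int k) v"
  obtains w where "w \<in> L" "w \<noteq> 0" "\<And>v. v \<in> S \<Longrightarrow> P (representation S w v) v"
proof -
  note S' = goodD[OF S]
  obtain x v0 where x: "x \<in> L" "v0 \<in> S" "representation S x v0 \<notin> \<int>"
    using nonintegral_point[OF assms(1,2)] .
  obtain k where k: "P (representation S x v - of_int (k v)) v" for v
    using k[of "representation S x v" v for v] by metis
  define w where "w = x - (\<Sum>v\<in>S. of_int (k v) *\<^sub>R v)"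
  have rep: "representation S w v = representation S x v - of_int (k v)" if "v \<in> S" for v
  proof -
    have "representation S (\<Sum>v\<in>S. of_int (k v) *\<^sub>R v) v = of_int (k v)"
      using S' that by (intro representation_unique) auto
    then show ?thesis unfolding w_def using S' by (simp add: representation_diff)
  qed
  show ?thesis
  proof
    show "w \<in> L" unfolding w_def using S' x by (intro diff_L sum_L scale_L) auto
    show "w \<noteq> 0"
      using rep[OF x(2)] x(3) by (auto simp: representation_zero)
    show "P (representation S w v) v" if "v \<in> S" for v using rep[OF that] k by simp
  qed
qed

definition box_point :: "(real^'n) set \<Rightarrow> real^'n \<Rightarrow> bool" where
  "box_point S w \<longleftrightarrow> w \<in> L \<and> w \<noteq> 0 \<and> (\<forall>v\<in>S. 0 \<le> representation S w v \<and> representation S w v < 1)"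

lemma box_point_exists:
  assumes "good S" "\<not> Zbasis L S"
  obtains w where "box_point S w"
proof -
  have "\<exists>k::int. 0 \<le> c - of_int k \<and> c - of_int k < 1" for c :: real
    by (intro exI[of _ "\<lfloor>c\<rfloor>"]) linarith
  then obtain w where "w \<in> L" "w \<noteq> 0" "\<And>v. v \<in> S \<Longrightarrow> 0 \<le> representation S w v \<and> representation S w v < 1"
    using shifted_point[OF assms, of "\<lambda>c _. 0 \<le> c \<and> c < 1"] by metis
  then show ?thesis using that[of w] by (simp add: box_point_def)
qed

text \<open>If \<open>S\<close> is not a basis there is a box point, and exchanging a generator for
  it would give an index below 1. Conversely, the covolumes of two bases divide each other.\<close>

lemma idx_eq_1_iff:
  assumes "good S" shows "idx S = 1 \<longleftrightarrow> Zbasis L S"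
proof
  assume *: "idx S = 1"
  show "Zbasis L S"
  proof (rule ccontr)
    assume "\<not> Zbasis L S"
    then obtain w where w: "box_point S w" using box_point_exists[OF assms] by blast
    have "\<exists>v\<in>S. representation S w v \<noteq> 0"
      using w representation_sum_eq[of S w] goodD[OF assms] unfolding box_point_def
      by (metis (no_types, lifting) scale_zero_left sum.neutral)
    then obtain v where v: "v \<in> S" "representation S w v \<noteq> 0" by auto
    have "real (idx (insert w (S - {v}))) < 1"
      using good_replace(2)[OF assms v(1) _ v(2)] w * v by (auto simp: box_point_def)
    moreover have "idx (insert w (S - {v})) \<ge> 1"
      using idx(2)[OF good_replace(1)[OF assms v(1) _ v(2)]] w by (auto simp: box_point_def)
    ultimately show False by simp
  qed
next
  assume *: "Zbasis L S"
  then obtain k :: nat where k: "k \<ge> 1" "adet B = real k * adet S"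
    using adet_multiple[of S B] B Zbasis_good[OF ZbasisB] unfolding Zbasis_def good_def by blast
  then have "adet B = real k * real (idx S) * adet B" using idx[OF assms] by simp
  then have "real k * real (idx S) = 1" using adet_nonzero[OF B] by simp
  then have "real (k * idx S) = real 1" by simp
  then have "k * idx S = 1" by (simp only: of_nat_eq_iff)
  then show "idx S = 1" by simp
qed

end

section \<open>Extending a function from basic to simplicial cones\<close>

text \<open>The diagonal needs its own hypothesis: antisymmetry alone only says that twice
  \<open>g x x\<close> is zero, which does not suffice in a group with 2-torsion.\<close>

lemma sum_antisym:
  fixes g :: "'i \<Rightarrow> 'i \<Rightarrow> 'b::ab_group_add"
  assumes "finite V" "\<And>x y. g x y = - g y x" "\<And>x. g x x = 0"
  shows "(\<Sum>x\<in>V. \<Sum>y\<in>V. g x y) = 0"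
  using assms(1)
proof (induction V rule: finite_induct)
  case (insert z V)
  have "(\<Sum>x\<in>insert z V. \<Sum>y\<in>insert z V. g x y) =
      (\<Sum>y\<in>V. g z y) + ((\<Sum>x\<in>V. g x z) + (\<Sum>x\<in>V. \<Sum>y\<in>V. g x y))"
    using insert.hyps assms(3) by (simp add: sum.distrib)
  also have "(\<Sum>x\<in>V. g x z) = - (\<Sum>y\<in>V. g z y)"
    using assms(2)[of _ z] by (simp add: sum_negf[symmetric])
  finally show ?case using insert.IH by simp
qed simp

text \<open>The boundary of a boundary: a cone through \<open>w\<close> that omits \<open>x\<close>
  and \<open>y\<close> appears once for \<open>x\<close> and once for \<open>y\<close>, with
  opposite minors.\<close>

lemma sum_cocycle_terms:
  fixes F :: "'v set \<Rightarrow> 'b::ab_group_add" and a \<rho> :: "'v \<Rightarrow> real"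
  assumes "finite V"
  shows "(\<Sum>x\<in>V. sg (\<rho> x) (F (V - {x})) +
      (\<Sum>y\<in>V - {x}. sg (a x * \<rho> y - \<rho> x * a y) (F (insert w (V - {x, y}))))) =
    (\<Sum>x\<in>V. sg (\<rho> x) (F (V - {x})))"
proof -
  define g where "g x y = sg (a x * \<rho> y - \<rho> x * a y) (F (insert w (V - {x, y})))" for x y
  have anti: "g x y = - g y x" for x y
  proof -
    have 1: "a y * \<rho> x - \<rho> y * a x = - (a x * \<rho> y - \<rho> x * a y)" by (simp add: mult.commute)
    have 2: "{y, x} = {x, y}" by auto
    show ?thesis unfolding g_def 1 2 sg_simps(2) by simp
  qed
  have g0: "g x x = 0" for x unfolding g_def by simp
  have "(\<Sum>x\<in>V. \<Sum>y\<in>V. g x y) = 0" by (rule sum_antisym[OF assms anti g0])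
  moreover have "(\<Sum>y\<in>V. g x y) = (\<Sum>y\<in>V - {x}. g x y)" if "x \<in> V" for x
    using assms that g0 by (simp add: sum.remove[of V x])
  ultimately show ?thesis unfolding g_def[symmetric] by (simp add: sum.distrib)
qed

text \<open>Elimination of \<open>x\<close> by means of the relation \<rho>. Multiplied by \<rho> x,
  the new coefficients are, up to sign, the 2x2 minors in the cocycles below.\<close>

lemma relation_solve:
  fixes V :: "'v::real_vector set"
  assumes "finite V" "x \<in> V" "\<rho> x \<noteq> 0" "(\<Sum>v\<in>V. \<rho> v *\<^sub>R v) = 0"
  shows "(\<Sum>y\<in>V. a y *\<^sub>R y) = (\<Sum>y\<in>V - {x}. (a y - a x * \<rho> y / \<rho> x) *\<^sub>R y)"
proof -
  have "(\<Sum>y\<in>V. a y *\<^sub>R y) = (\<Sum>y\<in>V. a y *\<^sub>R y) - (a x / \<rho> x) *\<^sub>R (\<Sum>v\<in>V. \<rho> v *\<^sub>R v)"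
    using assms by simp
  also have "\<dots> = (\<Sum>y\<in>V. (a y - a x * \<rho> y / \<rho> x) *\<^sub>R y)"
    by (simp add: scaleR_sum_right sum_subtractf[symmetric] algebra_simps)
  also have "\<dots> = (\<Sum>y\<in>V - {x}. (a y - a x * \<rho> y / \<rho> x) *\<^sub>R y)"
    using assms by (simp add: sum.remove[of V x])
  finally show ?thesis .
qed

lemma sum_of_bool_scaleR:
  assumes "finite V" "x \<in> V"
  shows "(\<Sum>y\<in>V. of_bool (y = x) *\<^sub>R y) = (x :: 'v::real_vector)"
proof -
  have "(\<Sum>y\<in>V. of_bool (y = x) *\<^sub>R y) = (\<Sum>y\<in>V. if y = x then y else 0)"
    by (intro sum.cong) auto
  then show ?thesis using assms by simp
qed

text \<open>A functional that is positive on the finite set \<open>V\<close> stays so when it is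
  tilted slightly towards \<open>w\<close>, and the tilt makes its value at \<open>w\<close>
  nonzero. The sign of that value cannot be prescribed, hence the two cases.\<close>

lemma positive_extension:
  fixes V :: "'v::euclidean_space set"
  assumes "finite V" "\<And>v. v \<in> V \<Longrightarrow> \<phi> \<bullet> v > 0" "w \<noteq> 0"
  obtains \<psi> where "(\<forall>v\<in>V. \<psi> \<bullet> v > 0) \<and> \<psi> \<bullet> w > 0" | \<psi> where "(\<forall>v\<in>V. \<psi> \<bullet> v > 0) \<and> \<psi> \<bullet> (- w) > 0"
proof -
  obtain t where t: "\<forall>q\<in>insert w V. sgn (\<phi> \<bullet> q + t * (w \<bullet> q)) = (if \<phi> \<bullet> q \<noteq> 0 then sgn (\<phi> \<bullet> q) else sgn (w \<bullet> q))"
    using small_perturbation[of "insert w V" "\<lambda>v. \<phi> \<bullet> v" "\<lambda>v. w \<bullet> v"] assms(1) by auto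
  define \<psi> where "\<psi> = \<phi> + t *\<^sub>R w"
  have \<psi>: "\<psi> \<bullet> q = \<phi> \<bullet> q + t * (w \<bullet> q)" for q by (simp add: \<psi>_def inner_add_left)
  have pos: "\<psi> \<bullet> v > 0" if "v \<in> V" for v
  proof -
    have "sgn (\<psi> \<bullet> v) = 1" using t that assms(2)[OF that] unfolding \<psi> by auto
    then show ?thesis by (simp add: sgn_1_pos)
  qed
  have "sgn (\<psi> \<bullet> w) \<noteq> 0" using t assms(3) unfolding \<psi> by (auto simp: sgn_zero_iff split: if_splits)
  then have "\<psi> \<bullet> w > 0 \<or> \<psi> \<bullet> (- w) > 0" by (auto simp: sgn_zero_iff)
  then show ?thesis using that pos by blast
qed

text \<open>The assumption \<open>star\<close> is relation (M) in geometric form: the star subdivision of a basic cone at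
  the sum of some of its generators.\<close>

locale cone_symbol = lattice_context L B + add_subgroup R
  for L B :: "(real^'n) set" and R :: "'b::ab_group_add set" +
  fixes f :: "(real^'n) set \<Rightarrow> 'b"
  assumes star: "Zbasis L S \<Longrightarrow> K \<subseteq> S \<Longrightarrow> 2 \<le> card K \<Longrightarrow>
    f S - (\<Sum>v\<in>K. f (insert (\<Sum>K) (S - {v}))) \<in> R"
begin

text \<open>Fixing one box point makes \<open>F\<close> a function. That every other small point in
  a common half space gives the same value modulo \<open>R\<close> is
  \<open>F_expansion_small\<close>.\<close>

definition box_choice :: "(real^'n) set \<Rightarrow> real^'n" where
  "box_choice S = (SOME w. box_point S w)"

lemma box_choice: "good S \<Longrightarrow> \<not> Zbasis L S \<Longrightarrow> box_point S (box_choice S)"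
  unfolding box_choice_def using box_point_exists by (metis someI)

text \<open>Each cone on the right has smaller index than \<open>S\<close>, because box points have coordinates below 1.\<close>

function F :: "(real^'n) set \<Rightarrow> 'b" where
  "F S = (if good S \<and> \<not> Zbasis L S
     then \<Sum>v\<in>{v\<in>S. representation S (box_choice S) v > 0}. F (insert (box_choice S) (S - {v}))
     else f S)"
  by auto
termination
proof (relation "Wellfounded.measure idx")
  fix S v assume *: "good S \<and> \<not> Zbasis L S" and v: "v \<in> {v\<in>S. representation S (box_choice S) v > 0}"
  have w: "box_point S (box_choice S)" using box_choice * by auto
  have "real (idx (insert (box_choice S) (S - {v}))) = \<bar>representation S (box_choice S) v\<bar> * real (idx S)"
    using good_replace(2)[of S v "box_choice S"] * v w by (auto simp: box_point_def)
  also have "\<dots> < 1 * real (idx S)"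
    using w v idx(2)[of S] * by (intro mult_strict_right_mono) (auto simp: box_point_def)
  finally show "(insert (box_choice S) (S - {v}), S) \<in> Wellfounded.measure idx" by simp
qed simp

declare F.simps [simp del]

lemma F_Zbasis: "Zbasis L S \<Longrightarrow> F S = f S"
  by (simp add: F.simps)

text \<open>The signed star of \<open>S\<close> at \<open>w\<close>; negative coordinates occur
  because \<open>w\<close> may lie outside the cone.\<close>

definition expansion :: "(real^'n) set \<Rightarrow> real^'n \<Rightarrow> 'b" where
  "expansion S w = (\<Sum>v\<in>S. sg (representation S w v) (F (insert w (S - {v}))))"

lemma F_expansion:
  assumes "good S" "\<not> Zbasis L S"
  shows "F S = expansion S (box_choice S)"
proof -
  have "expansion S (box_choice S) =
      (\<Sum>v\<in>S. if representation S (box_choice S) v > 0 then F (insert (box_choice S) (S - {v})) else 0)"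
    unfolding expansion_def using box_choice[OF assms]
    by (intro sum.cong) (auto simp: sg_def box_point_def not_less[symmetric])
  also have "\<dots> = F S" using assms goodD(4)[OF assms(1)] by (simp add: F.simps[of S] sum.inter_filter)
  finally show ?thesis by simp
qed

text \<open>The functional \<open>\<phi>\<close> confines \<open>V\<close> to an open half space.\<close>

definition cocycle_below :: "nat \<Rightarrow> bool" where
  "cocycle_below m \<longleftrightarrow> (\<forall>V \<rho> \<phi>. V \<subseteq> L \<and> finite V \<and> card V = Suc CARD('n) \<and> span V = UNIV \<and>
     (\<forall>v\<in>V. \<phi> \<bullet> v > 0) \<and> (\<Sum>v\<in>V. \<rho> v *\<^sub>R v) = 0 \<and> (\<forall>v\<in>V. \<rho> v \<noteq> 0 \<longrightarrow> idx (V - {v}) < m) \<longrightarrow>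
     (\<Sum>v\<in>V. sg (\<rho> v) (F (V - {v}))) \<in> R)"

lemma cocycle_belowD:
  assumes "cocycle_below m" "V \<subseteq> L" "finite V" "card V = Suc CARD('n)" "span V = UNIV"
    "\<And>v. v \<in> V \<Longrightarrow> \<phi> \<bullet> v > 0" "(\<Sum>v\<in>V. \<rho> v *\<^sub>R v) = 0" "\<And>v. v \<in> V \<Longrightarrow> \<rho> v \<noteq> 0 \<Longrightarrow> idx (V - {v}) < m"
  shows "(\<Sum>v\<in>V. sg (\<rho> v) (F (V - {v}))) \<in> R"
  using assms unfolding cocycle_below_def by blast

section \<open>Indices of the cones in a cocycle\<close>

lemma omit_good:
  assumes V: "V \<subseteq> L" "finite V" "card V = Suc CARD('n)" "span V = UNIV" "(\<Sum>v\<in>V. \<rho> v *\<^sub>R v) = 0"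
    and x: "x \<in> V" "\<rho> x \<noteq> 0"
  shows "good (V - {x})"
proof -
  have "x = (\<Sum>y\<in>V. of_bool (y = x) *\<^sub>R y)" using sum_of_bool_scaleR[OF V(2) x(1)] by simp
  also have "\<dots> = (\<Sum>y\<in>V - {x}. (of_bool (y = x) - of_bool (x = x) * \<rho> y / \<rho> x) *\<^sub>R y)"
    using relation_solve[where a = "\<lambda>y. of_bool (y = x)", OF V(2) x V(5)] .
  also have "\<dots> \<in> span (V - {x})" by (intro span_sum span_scale span_base)
  finally have "span (V - {x}) = span V" using x by (metis insert_Diff span_redundant)
  then have sp: "span (V - {x}) = UNIV" using V by simp
  have "independent (V - {x})"
    using V x sp by (intro card_le_dim_spanning[where V = UNIV]) (auto simp: dim_UNIV)
  then show ?thesis unfolding good_def using V sp by auto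
qed

lemma omit_representation:
  assumes V: "V \<subseteq> L" "finite V" "card V = Suc CARD('n)" "span V = UNIV" "(\<Sum>v\<in>V. \<rho> v *\<^sub>R v) = 0"
    and x: "x \<in> V" "\<rho> x \<noteq> 0" and w: "w = (\<Sum>y\<in>V. a y *\<^sub>R y)" and y: "y \<in> V - {x}"
  shows "representation (V - {x}) w y = a y - a x * \<rho> y / \<rho> x"
  using omit_good[OF V x] relation_solve[where a = a, OF V(2) x V(5)] w y V(2)
  by (intro representation_unique) (auto simp: good_def)

text \<open>In \<open>V - {x}\<close> the coordinate of \<open>x\<close> at \<open>y\<close> is
  minus the quotient of the coefficients, so the indices of the cones of a cocycle are proportional
  to the absolute values of \<rho>.\<close>

lemma omit_idx:
  assumes V: "V \<subseteq> L" "finite V" "card V = Suc CARD('n)" "span V = UNIV" "(\<Sum>v\<in>V. \<rho> v *\<^sub>R v) = 0"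
    and x: "x \<in> V" "\<rho> x \<noteq> 0" and y: "y \<in> V" "\<rho> y \<noteq> 0"
  shows "real (idx (V - {y})) * \<bar>\<rho> x\<bar> = \<bar>\<rho> y\<bar> * real (idx (V - {x}))"
proof (cases "x = y")
  case False
  have "x = (\<Sum>y\<in>V. of_bool (y = x) *\<^sub>R y)" using sum_of_bool_scaleR[OF V(2) x(1)] by simp
  then have "representation (V - {x}) x y = of_bool (y = x) - of_bool (x = x) * \<rho> y / \<rho> x"
    using y False by (intro omit_representation[OF V x]) auto
  then have r: "representation (V - {x}) x y = - (\<rho> y / \<rho> x)" using False by simp
  have "insert x (V - {x} - {y}) = V - {y}" using x False by auto
  then have "real (idx (V - {y})) = \<bar>- (\<rho> y / \<rho> x)\<bar> * real (idx (V - {x}))"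
    using good_replace(2)[OF omit_good[OF V x], of y x] r x y False V by auto
  then show ?thesis using x by (simp add: field_simps)
qed simp

text \<open>The same exchange with \<open>w\<close> in place of \<open>x\<close>: now the index is
  governed by a 2x2 minor of \<open>a\<close> and \<rho>, which is also the coefficient of this cone
  in the subdivided cocycle.\<close>

lemma omit_two_idx:
  assumes V: "V \<subseteq> L" "finite V" "card V = Suc CARD('n)" "span V = UNIV" "(\<Sum>v\<in>V. \<rho> v *\<^sub>R v) = 0"
    and x0: "x0 \<in> V" "\<rho> x0 \<noteq> 0" and w: "w = (\<Sum>y\<in>V. a y *\<^sub>R y)" "w \<in> L"
    and xy: "x \<in> V" "y \<in> V" "x \<noteq> y" and d: "a x * \<rho> y - \<rho> x * a y \<noteq> 0"
  shows "real (idx (insert w (V - {x, y}))) * \<bar>\<rho> x0\<bar> = \<bar>a x * \<rho> y - \<rho> x * a y\<bar> * real (idx (V - {x0}))"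
proof -
  have main: "real (idx (insert w (V - {x, y}))) * \<bar>\<rho> x0\<bar> = \<bar>a x * \<rho> y - \<rho> x * a y\<bar> * real (idx (V - {x0}))"
    if xy: "x \<in> V" "y \<in> V" "x \<noteq> y" and d: "a x * \<rho> y - \<rho> x * a y \<noteq> 0" and x: "\<rho> x \<noteq> 0" for x y
  proof -
    have r: "representation (V - {x}) w y = a y - a x * \<rho> y / \<rho> x"
      using xy by (intro omit_representation[OF V xy(1) x w(1)]) auto
    have rx: "\<rho> x * (a y - a x * \<rho> y / \<rho> x) = - (a x * \<rho> y - \<rho> x * a y)"
      using x by (simp add: field_simps)
    then have "representation (V - {x}) w y \<noteq> 0" using d r by auto
    then have "real (idx (insert w (V - {x} - {y}))) = \<bar>a y - a x * \<rho> y / \<rho> x\<bar> * real (idx (V - {x}))"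
      using good_replace(2)[OF omit_good[OF V xy(1) x], of y w] r xy w by auto
    moreover have "V - {x} - {y} = V - {x, y}" by auto
    ultimately have "real (idx (insert w (V - {x, y}))) * \<bar>\<rho> x0\<bar> =
        \<bar>a y - a x * \<rho> y / \<rho> x\<bar> * (real (idx (V - {x})) * \<bar>\<rho> x0\<bar>)" by simp
    also have "\<dots> = \<bar>a y - a x * \<rho> y / \<rho> x\<bar> * (\<bar>\<rho> x\<bar> * real (idx (V - {x0})))"
      using omit_idx[OF V x0 xy(1) x] by simp
    also have "\<dots> = \<bar>\<rho> x * (a y - a x * \<rho> y / \<rho> x)\<bar> * real (idx (V - {x0}))"
      by (simp add: abs_mult)
    finally show ?thesis unfolding rx abs_minus_cancel .
  qed
  show ?thesis
  proof (cases "\<rho> x = 0")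
    case False
    then show ?thesis using main[of x y] xy d by auto
  next
    case True
    \<comment> \<open>For \<rho> x = 0 there is no cone omitting \<open>x\<close> to start from. The
      nonzero minor supplies one omitting \<open>y\<close>, and the two vectors exchange
      roles.\<close>
    then have "\<rho> y \<noteq> 0" using d by auto
    moreover have "a y * \<rho> x - \<rho> y * a x \<noteq> 0" using d by (auto simp: algebra_simps)
    ultimately have "real (idx (insert w (V - {y, x}))) * \<bar>\<rho> x0\<bar> = \<bar>a y * \<rho> x - \<rho> y * a x\<bar> * real (idx (V - {x0}))"
      using xy by (intro main) auto
    moreover have "\<bar>a y * \<rho> x - \<rho> y * a x\<bar> = \<bar>a x * \<rho> y - \<rho> x * a y\<bar>"
    proof -
      have "a y * \<rho> x - \<rho> y * a x = - (a x * \<rho> y - \<rho> x * a y)" by (simp add: mult.commute)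
      then show ?thesis by (simp only: abs_minus_cancel)
    qed
    moreover have "{y, x} = {x, y}" by auto
    ultimately show ?thesis by (simp only:)
  qed
qed

text \<open>The cocycle relation on \<open>insert w (V - {x})\<close>: eliminating \<open>x\<close>
  between \<rho> and the expression for \<open>w\<close> gives a relation with coefficient \<rho> x
  at \<open>w\<close> and the minors elsewhere. If \<rho> x and \<open>a x\<close> both vanish,
  every term is zero.\<close>

lemma cocycle_term:
  assumes coc: "cocycle_below m"
    and V: "V \<subseteq> L" "finite V" "card V = Suc CARD('n)" "span V = UNIV" "(\<Sum>v\<in>V. \<rho> v *\<^sub>R v) = 0"
    and w: "w = (\<Sum>y\<in>V. a y *\<^sub>R y)" "w \<in> L" "w \<notin> V" and \<phi>: "\<And>v. v \<in> insert w V \<Longrightarrow> \<phi> \<bullet> v > 0"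
    and x: "x \<in> V" and i1: "\<rho> x \<noteq> 0 \<Longrightarrow> idx (V - {x}) < m"
    and i2: "\<And>y. y \<in> V - {x} \<Longrightarrow> a x * \<rho> y - \<rho> x * a y \<noteq> 0 \<Longrightarrow> idx (insert w (V - {x, y})) < m"
  shows "sg (\<rho> x) (F (V - {x})) + (\<Sum>y\<in>V - {x}. sg (a x * \<rho> y - \<rho> x * a y) (F (insert w (V - {x, y})))) \<in> R"
proof (cases "\<rho> x = 0 \<and> a x = 0")
  case True
  then show ?thesis by (simp add: zero_mem)
next
  case False
  let ?V = "insert w (V - {x})" and ?r = "\<lambda>u. if u = w then \<rho> x else a x * \<rho> u - \<rho> x * a u"
  have wVx: "w \<notin> V - {x}" using w by auto
  have wa: "w - (\<Sum>y\<in>V - {x}. a y *\<^sub>R y) = a x *\<^sub>R x"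
    using w(1) V(2) x by (simp add: sum.remove[of V x])
  have rx: "(\<Sum>y\<in>V - {x}. \<rho> y *\<^sub>R y) = - (\<rho> x *\<^sub>R x)"
    using V(5) V(2) x by (simp add: sum.remove[of V x] eq_neg_iff_add_eq_0 add.commute)
  have "x \<in> span ?V"
  proof (cases "\<rho> x = 0")
    case True
    then have ax: "a x \<noteq> 0" using False by auto
    have "w - (\<Sum>y\<in>V - {x}. a y *\<^sub>R y) \<in> span ?V"
      by (intro span_diff span_sum span_scale span_base) auto
    then have "(1 / a x) *\<^sub>R (a x *\<^sub>R x) \<in> span ?V" unfolding wa by (rule span_scale)
    then show ?thesis using ax by simp
  next
    case False
    then have "x \<in> span (V - {x})" using omit_good[OF V x] by (simp add: good_def)
    then show ?thesis using span_mono[of "V - {x}" ?V] by auto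
  qed
  then have "V \<subseteq> span ?V" by (auto intro: span_base)
  then have "span ?V = UNIV" using V(4) by (metis UNIV_eq_I span_minimal subspace_span top.extremum_uniqueI)
  moreover have "?V \<subseteq> L" "finite ?V" "card ?V = Suc CARD('n)" using V w wVx x by auto
  moreover have "\<And>v. v \<in> ?V \<Longrightarrow> \<phi> \<bullet> v > 0" using \<phi> by auto
  moreover have "(\<Sum>v\<in>?V. ?r v *\<^sub>R v) = 0"
  proof -
    have "(\<Sum>v\<in>?V. ?r v *\<^sub>R v) = \<rho> x *\<^sub>R w + (\<Sum>v\<in>V - {x}. ?r v *\<^sub>R v)"
      using V(2) wVx by simp
    also have "(\<Sum>v\<in>V - {x}. ?r v *\<^sub>R v) = (\<Sum>v\<in>V - {x}. (a x * \<rho> v - \<rho> x * a v) *\<^sub>R v)"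
      using wVx by (intro sum.cong) auto
    also have "\<dots> = a x *\<^sub>R (\<Sum>v\<in>V - {x}. \<rho> v *\<^sub>R v) - \<rho> x *\<^sub>R (\<Sum>v\<in>V - {x}. a v *\<^sub>R v)"
      by (simp add: scaleR_sum_right sum_subtractf algebra_simps)
    finally have "(\<Sum>v\<in>?V. ?r v *\<^sub>R v) = \<rho> x *\<^sub>R (w - (\<Sum>v\<in>V - {x}. a v *\<^sub>R v)) + a x *\<^sub>R (\<Sum>v\<in>V - {x}. \<rho> v *\<^sub>R v)"
      by (simp add: algebra_simps)
    then show ?thesis unfolding wa rx by simp
  qed
  moreover have "idx (?V - {v}) < m" if "v \<in> ?V" "?r v \<noteq> 0" for v
  proof (cases "v = w")
    case True
    then have "?V - {v} = V - {x}" using wVx by auto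
    then show ?thesis using i1 that True by auto
  next
    case False
    then have "?V - {v} = insert w (V - {x, v})" by auto
    then show ?thesis using i2[of v] that False by auto
  qed
  ultimately have "(\<Sum>v\<in>?V. sg (?r v) (F (?V - {v}))) \<in> R"
    by (intro cocycle_belowD[OF coc, where \<phi> = \<phi>]) auto
  also have "(\<Sum>v\<in>?V. sg (?r v) (F (?V - {v}))) =
      sg (\<rho> x) (F (?V - {w})) + (\<Sum>v\<in>V - {x}. sg (?r v) (F (?V - {v})))"
    using V(2) wVx by simp
  also have "?V - {w} = V - {x}" using wVx by auto
  also have "(\<Sum>v\<in>V - {x}. sg (?r v) (F (?V - {v}))) =
      (\<Sum>y\<in>V - {x}. sg (a x * \<rho> y - \<rho> x * a y) (F (insert w (V - {x, y}))))"
  proof (rule sum.cong[OF refl])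
    fix y assume "y \<in> V - {x}"
    then have "y \<noteq> w" "?V - {y} = insert w (V - {x, y})" using wVx by auto
    then show "sg (?r y) (F (?V - {y})) = sg (a x * \<rho> y - \<rho> x * a y) (F (insert w (V - {x, y})))" by simp
  qed
  finally show ?thesis .
qed

text \<open>The terms of \<open>cocycle_term\<close> for \<open>V = insert w' S\<close> are summed.
  Those at elements of \<open>S\<close> involve only indices below \<open>m\<close>. The term at
  \<open>w'\<close> contains \<open>F S\<close>, which has index \<open>m\<close> and is out of
  reach of the hypothesis, but the same \<open>F S\<close> stands in the total and cancels.\<close>

lemma expansion_compare:
  assumes coc: "cocycle_below m" and S: "good S" "idx S = m"
    and w: "w \<in> L" "w \<notin> S" "\<And>v. v \<in> S \<Longrightarrow> \<bar>representation S w v\<bar> < 1"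
    and w': "w' \<in> L" "w' \<notin> S" "\<And>v. v \<in> S \<Longrightarrow> \<bar>representation S w' v\<bar> < 1" and ww': "w \<noteq> w'"
    and \<phi>: "\<And>v. v \<in> insert w (insert w' S) \<Longrightarrow> \<phi> \<bullet> v > 0"
    and minors: "\<And>u v. u \<in> S \<Longrightarrow> v \<in> S \<Longrightarrow> u \<noteq> v \<Longrightarrow>
      \<bar>representation S w u * representation S w' v - representation S w' u * representation S w v\<bar> < 1"
  shows "expansion S w - expansion S w' \<in> R"
proof -
  note S' = goodD[OF S(1)]
  define V where "V = insert w' S"
  define \<rho> where "\<rho> u = (if u = w' then - 1 else representation S w' u)" for u
  define a where "a u = (if u = w' then 0 else representation S w u)" for u
  have onS: "\<rho> u = representation S w' u" "a u = representation S w u" if "u \<in> S" for u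
    using that w' by (auto simp: \<rho>_def a_def)
  have "span V = UNIV" unfolding V_def using S'(3) span_mono[of S "insert w' S"] by auto
  then have V: "V \<subseteq> L" "finite V" "card V = Suc CARD('n)" "span V = UNIV"
    unfolding V_def using S' w' by auto
  have "(\<Sum>v\<in>S. \<rho> v *\<^sub>R v) = w'"
    using representation_sum_eq[of S w'] S' onS by (simp cong: sum.cong)
  then have rel: "(\<Sum>v\<in>V. \<rho> v *\<^sub>R v) = 0" unfolding V_def using S' w' by (simp add: \<rho>_def)
  have "(\<Sum>v\<in>S. a v *\<^sub>R v) = w"
    using representation_sum_eq[of S w] S' onS by (simp cong: sum.cong)
  then have wa: "w = (\<Sum>v\<in>V. a v *\<^sub>R v)" unfolding V_def using S' w' by (simp add: a_def)
  have w'V: "w' \<in> V" "\<rho> w' = -1" "a w' = 0" "V - {w'} = S" by (auto simp: V_def \<rho>_def a_def w')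
  have wV: "w \<notin> V" using w ww' by (auto simp: V_def)
  define t where "t x = sg (\<rho> x) (F (V - {x})) +
      (\<Sum>y\<in>V - {x}. sg (a x * \<rho> y - \<rho> x * a y) (F (insert w (V - {x, y}))))" for x
  have tS: "t x \<in> R" if x: "x \<in> S" for x
    unfolding t_def
  proof (rule cocycle_term[OF coc V rel wa w(1) wV])
    show "0 < \<phi> \<bullet> v" if "v \<in> insert w V" for v using \<phi> that by (auto simp: V_def)
    show xV: "x \<in> V" using x by (simp add: V_def)
    show "idx (V - {x}) < m" if nz: "\<rho> x \<noteq> 0"
    proof -
      have "real (idx (V - {x})) = \<bar>\<rho> x\<bar> * real m"
        using omit_idx[OF V rel w'V(1) _ xV nz] w'V S by simp
      also have "\<dots> < 1 * real m"
        using w'(3)[OF x] onS[OF x] idx(2)[OF S(1)] S(2) by (intro mult_strict_right_mono) auto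
      finally show ?thesis by simp
    qed
    show "idx (insert w (V - {x, y})) < m" if y: "y \<in> V - {x}" and nz: "a x * \<rho> y - \<rho> x * a y \<noteq> 0" for y
    proof -
      have "real (idx (insert w (V - {x, y}))) = \<bar>a x * \<rho> y - \<rho> x * a y\<bar> * real m"
        using omit_two_idx[OF V rel w'V(1) _ wa w(1) xV _ _ nz] y w'V S by auto
      also have "\<bar>a x * \<rho> y - \<rho> x * a y\<bar> < 1"
      proof (cases "y = w'")
        case True
        then show ?thesis using w(3)[OF x] onS[OF x] w'V by simp
      next
        case False
        then have "y \<in> S" "x \<noteq> y" using y by (auto simp: V_def)
        then show ?thesis using minors[OF x, of y] onS[OF x] onS[of y] by simp
      qed
      then have "\<bar>a x * \<rho> y - \<rho> x * a y\<bar> * real m < 1 * real m"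
        using idx(2)[OF S(1)] S(2) by (intro mult_strict_right_mono) auto
      finally show ?thesis by simp
    qed
  qed
  have "(\<Sum>x\<in>V. t x) = (\<Sum>x\<in>V. sg (\<rho> x) (F (V - {x})))"
    unfolding t_def by (rule sum_cocycle_terms[OF V(2)])
  moreover have "(\<Sum>x\<in>V. t x) = t w' + (\<Sum>x\<in>S. t x)" unfolding V_def using S' w' by simp
  moreover have "t w' = - F S + expansion S w"
  proof -
    have "(\<Sum>y\<in>S. sg (a w' * \<rho> y - \<rho> w' * a y) (F (insert w (V - {w', y})))) = expansion S w"
      unfolding expansion_def
    proof (rule sum.cong[OF refl])
      fix y assume "y \<in> S"
      moreover from this have "V - {w', y} = S - {y}" using w' by (auto simp: V_def)
      ultimately show "sg (a w' * \<rho> y - \<rho> w' * a y) (F (insert w (V - {w', y}))) =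
          sg (representation S w y) (F (insert w (S - {y})))" using w'V onS by simp
    qed
    then show ?thesis unfolding t_def using w'V by simp
  qed
  moreover have "(\<Sum>x\<in>V. sg (\<rho> x) (F (V - {x}))) = - F S + expansion S w'"
  proof -
    have "(\<Sum>x\<in>V. sg (\<rho> x) (F (V - {x}))) = sg (\<rho> w') (F (V - {w'})) + (\<Sum>x\<in>S. sg (\<rho> x) (F (V - {x})))"
      using V(2) w'V(1) w'V(4) by (simp add: sum.remove)
    also have "(\<Sum>x\<in>S. sg (\<rho> x) (F (V - {x}))) = expansion S w'"
      unfolding expansion_def
    proof (rule sum.cong[OF refl])
      fix y assume "y \<in> S"
      moreover from this have "V - {y} = insert w' (S - {y})" using w' by (auto simp: V_def)
      ultimately show "sg (\<rho> y) (F (V - {y})) = sg (representation S w' y) (F (insert w' (S - {y})))"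
        using onS by simp
    qed
    finally show ?thesis using w'V by simp
  qed
  ultimately have "(\<Sum>x\<in>S. t x) = expansion S w' - expansion S w" by (simp add: algebra_simps)
  then have "expansion S w' - expansion S w \<in> R" using tS sum_mem[of S t] by simp
  then show ?thesis by (rule diff_sym_mem)
qed

lemma small_not_mem:
  assumes "good S" "\<And>v. v \<in> S \<Longrightarrow> \<bar>representation S w v\<bar> < 1"
  shows "w \<notin> S"
proof
  assume w: "w \<in> S"
  then have "representation S w w = 1" using goodD(2)[OF assms(1)] by (simp add: representation_basis)
  then show False using assms(2)[OF w] by simp
qed

lemma positive_combination:
  assumes S: "good S" and \<phi>: "\<And>v. v \<in> S \<Longrightarrow> \<phi> \<bullet> v > 0"
    and w: "w \<noteq> 0" "\<And>v. v \<in> S \<Longrightarrow> representation S w v \<ge> 0"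
  shows "\<phi> \<bullet> w > 0"
proof -
  note S' = goodD[OF S]
  have e: "(\<Sum>v\<in>S. representation S w v *\<^sub>R v) = w" using S' by (simp add: representation_sum_eq)
  then obtain v where v: "v \<in> S" "representation S w v \<noteq> 0"
    using w(1) by (metis (no_types, lifting) scale_zero_left sum.neutral)
  have v_pos: "representation S w v > 0" using v w(2)[OF v(1)] by simp
  have "\<phi> \<bullet> w = (\<Sum>v\<in>S. representation S w v * (\<phi> \<bullet> v))"
    using arg_cong[OF e, of "\<lambda>x. \<phi> \<bullet> x"] by (simp add: inner_sum_right)
  also have "\<dots> > 0"
    using S' v v_pos w(2) \<phi> by (intro sum_pos2[OF _ v(1)]) (auto simp: less_imp_le)
  finally show ?thesis .
qed

text \<open>Without negative coordinates, \<open>w\<close> is compared with the chosen box point; a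
  minor is then a difference of two numbers in [0,1). Otherwise a generator \<open>v0\<close> with
  negative coordinate is added to \<open>w\<close>. This removes one negative coordinate, keeps all
  coordinates below 1 in absolute value, and makes each minor of the old and the new point zero or,
  up to sign, a coordinate of \<open>w\<close>.\<close>

lemma F_expansion_small:
  assumes coc: "cocycle_below m" and S: "good S" "idx S = m" "\<not> Zbasis L S"
    and \<phi>S: "\<And>v. v \<in> S \<Longrightarrow> \<phi> \<bullet> v > 0"
  shows "w \<in> L \<Longrightarrow> \<phi> \<bullet> w > 0 \<Longrightarrow> (\<And>v. v \<in> S \<Longrightarrow> \<bar>representation S w v\<bar> < 1) \<Longrightarrow> F S - expansion S w \<in> R"
proof (induction "card {v\<in>S. representation S w v < 0}" arbitrary: w rule: less_induct)
  case less
  note S' = goodD[OF S(1)] and w = less.prems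
  have w0: "w \<noteq> 0" using w by auto
  have wS: "w \<notin> S" using small_not_mem[OF S(1) w(3)] .
  show ?case
  proof (cases "\<exists>v\<in>S. representation S w v < 0")
    case False
    then have pos: "representation S w v \<ge> 0" if "v \<in> S" for v using that by force
    let ?b = "box_choice S"
    have b: "?b \<in> L" "?b \<noteq> 0" "\<And>v. v \<in> S \<Longrightarrow> 0 \<le> representation S ?b v" "\<And>v. v \<in> S \<Longrightarrow> representation S ?b v < 1"
      using box_choice[OF S(1,3)] by (auto simp: box_point_def)
    have bS: "?b \<notin> S" using b by (intro small_not_mem[OF S(1)]) auto
    show ?thesis
    proof (cases "w = ?b")
      case True
      then show ?thesis using F_expansion[OF S(1,3)] by (simp add: zero_mem)
    next
      case False
      have "expansion S ?b - expansion S w \<in> R"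
      proof (rule expansion_compare[OF coc S(1,2) b(1) bS _ w(1) wS w(3)])
        show "\<bar>representation S ?b v\<bar> < 1" if "v \<in> S" for v using b(3,4)[OF that] by simp
        show "0 < \<phi> \<bullet> v" if "v \<in> insert ?b (insert w S)" for v
          using that w(2) \<phi>S positive_combination[OF S(1) \<phi>S b(2,3)] by auto
        show "\<bar>representation S ?b u * representation S w v - representation S w u * representation S ?b v\<bar> < 1"
          if uv: "u \<in> S" "v \<in> S" for u v
        proof -
          have *: "0 \<le> x * y \<and> x * y < 1" if "0 \<le> x" "x < 1" "0 \<le> y" "y < 1" for x y :: real
            using that mult_strict_mono[of x 1 y 1] by simp
          have "0 \<le> representation S ?b u * representation S w v \<and> representation S ?b u * representation S w v < 1"
               "0 \<le> representation S w u * representation S ?b v \<and> representation S w u * representation S ?b v < 1"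
            using b(3,4)[OF uv(1)] b(3,4)[OF uv(2)] pos[OF uv(1)] pos[OF uv(2)] w(3)[OF uv(1)] w(3)[OF uv(2)]
            by (intro *; simp)+
          then show ?thesis by linarith
        qed
      qed (use False in auto)
      then show ?thesis using F_expansion[OF S(1,3)] by simp
    qed
  next
    case True
    then obtain v0 where v0: "v0 \<in> S" "representation S w v0 < 0" by auto
    define w' where "w' = w + v0"
    have rep: "representation S w' v = representation S w v + (if v = v0 then 1 else 0)" if "v \<in> S" for v
      unfolding w'_def using S' v0 by (simp add: representation_add representation_basis)
    have small: "\<bar>representation S w' v\<bar> < 1" if "v \<in> S" for v
      using rep[OF that] w(3)[OF that] v0 by auto
    have w'L: "w' \<in> L" unfolding w'_def using w S' v0 by (auto intro: add_L)
    have \<phi>w': "\<phi> \<bullet> w' > 0" unfolding w'_def using w(2) \<phi>S[OF v0(1)] by (simp add: inner_add_right)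
    have w'S: "w' \<notin> S" using small_not_mem[OF S(1) small] .
    have "{v\<in>S. representation S w' v < 0} \<subset> {v\<in>S. representation S w v < 0}"
    proof -
      have "v0 \<notin> {v\<in>S. representation S w' v < 0}" using rep[OF v0(1)] w(3)[OF v0(1)] by auto
      moreover have "{v\<in>S. representation S w' v < 0} \<subseteq> {v\<in>S. representation S w v < 0}"
        using rep by (auto split: if_splits)
      ultimately show ?thesis using v0 by blast
    qed
    then have "card {v\<in>S. representation S w' v < 0} < card {v\<in>S. representation S w v < 0}"
      using S' by (intro psubset_card_mono) auto
    then have "F S - expansion S w' \<in> R" using less.hyps[of w'] w'L \<phi>w' small by blast
    moreover have "expansion S w' - expansion S w \<in> R"
    proof (rule expansion_compare[OF coc S(1,2) w'L w'S small w(1) wS w(3)])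
      show "w' \<noteq> w" unfolding w'_def using \<phi>S[OF v0(1)] by auto
      show "0 < \<phi> \<bullet> v" if "v \<in> insert w' (insert w S)" for v using that \<phi>w' w(2) \<phi>S by auto
      show "\<bar>representation S w' u * representation S w v - representation S w u * representation S w' v\<bar> < 1"
        if "u \<in> S" "v \<in> S" "u \<noteq> v" for u v
        using that w(3)[of u] w(3)[of v] by (auto simp: rep algebra_simps)
    qed
    ultimately show ?thesis by (rule diff_trans_mem)
  qed
qed

text \<open>All nonzero coefficients are 1 or -1, so the positive part \<open>P\<close> and the
  negative part \<open>N\<close> have the same sum \<open>z\<close>. A cone omitting a vector of
  \<open>P\<close> is starred at the sum of \<open>N\<close>, a cone omitting one of
  \<open>N\<close> at the sum of \<open>P\<close>; both sides become the same sum over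
  \<open>P \<times> N\<close> of cones through \<open>z\<close>. This is where (M) enters.\<close>

lemma cocycle_index_1:
  assumes V: "V \<subseteq> L" "finite V" "card V = Suc CARD('n)" "span V = UNIV" "(\<Sum>v\<in>V. \<rho> v *\<^sub>R v) = 0"
    and \<phi>: "\<And>v. v \<in> V \<Longrightarrow> \<phi> \<bullet> v > 0" and x0: "x0 \<in> V" "\<rho> x0 = 1"
    and one: "\<And>v. v \<in> V \<Longrightarrow> \<rho> v \<noteq> 0 \<Longrightarrow> idx (V - {v}) = 1"
  shows "(\<Sum>v\<in>V. sg (\<rho> v) (F (V - {v}))) \<in> R"
proof -
  have Z: "Zbasis L (V - {v})" if "v \<in> V" "\<rho> v \<noteq> 0" for v
    using idx_eq_1_iff[OF omit_good[OF V that]] one[OF that] by simp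
  have pm: "\<rho> v = 1 \<or> \<rho> v = -1 \<or> \<rho> v = 0" if "v \<in> V" for v
    using omit_idx[OF V x0(1) _ that] x0 one[OF x0(1)] one[OF that] by (cases "\<rho> v = 0") auto
  define P where "P = {v\<in>V. \<rho> v = 1}"
  define N where "N = {v\<in>V. \<rho> v = - 1}"
  have fin: "finite P" "finite N" using V(2) by (auto simp: P_def N_def)
  define z where "z = \<Sum>P"
  have "(\<Sum>v\<in>V. \<rho> v *\<^sub>R v) = (\<Sum>v\<in>V. (if \<rho> v = 1 then v else 0) - (if \<rho> v = - 1 then v else 0))"
    using pm by (intro sum.cong) auto
  also have "\<dots> = \<Sum>P - \<Sum>N" using V(2) by (simp add: sum_subtractf P_def N_def sum.inter_filter)
  finally have PN: "\<Sum>P = \<Sum>N" using V(5) by simp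
  have Pne: "P \<noteq> {}" using x0 by (auto simp: P_def)
  \<comment> \<open>The half space excludes a relation with positive coefficients only, so
    \<open>N\<close> is not empty.\<close>
  have "(\<Sum>v\<in>P. \<phi> \<bullet> v) > 0" using fin Pne \<phi> by (intro sum_pos) (auto simp: P_def)
  moreover have "\<phi> \<bullet> \<Sum>N = (\<Sum>v\<in>P. \<phi> \<bullet> v)" unfolding PN[symmetric] by (simp add: inner_sum_right)
  ultimately have "\<phi> \<bullet> \<Sum>N > 0" by simp
  then have Nne: "N \<noteq> {}" by auto
  have refine: "F (V - {x}) - (\<Sum>y\<in>K. f (insert (\<Sum>K) (V - {x} - {y}))) \<in> R"
    if x: "x \<in> V" "\<rho> x \<noteq> 0" and K: "K \<subseteq> V - {x}" "K \<noteq> {}" for x K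
  proof (cases "card K \<ge> 2")
    case True
    then show ?thesis using star[OF Z[OF x] K(1)] F_Zbasis[OF Z[OF x]] by simp
  next
    \<comment> \<open>A single vector is its own sum, and starring at it leaves the cone as it
      is.\<close>
    case False
    moreover have "finite K" using K V(2) by (meson finite_Diff finite_subset)
    ultimately have "card K = 1" using K by (metis One_nat_def Suc_1 Suc_leI card_gt_0_iff le_neq_implies_less not_le)
    then obtain y where "K = {y}" using card_1_singletonE by blast
    then show ?thesis using F_Zbasis[OF Z[OF x]] K by (simp add: insert_absorb zero_mem)
  qed
  define g where "g x y = f (insert z (V - {x, y}))" for x y
  have 1: "F (V - {x}) - (\<Sum>y\<in>N. g x y) \<in> R" if "x \<in> P" for x
  proof -
    have "V - {x} - {y} = V - {x, y}" for y by auto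
    moreover have "N \<subseteq> V - {x}" "x \<in> V" "\<rho> x \<noteq> 0" using that by (auto simp: P_def N_def)
    ultimately show ?thesis using refine[of x N] Nne unfolding g_def z_def PN by simp
  qed
  have 2: "F (V - {y}) - (\<Sum>x\<in>P. g x y) \<in> R" if "y \<in> N" for y
  proof -
    have "V - {y} - {x} = V - {x, y}" for x by auto
    moreover have "P \<subseteq> V - {y}" "y \<in> V" "\<rho> y \<noteq> 0" using that by (auto simp: P_def N_def)
    ultimately show ?thesis using refine[of y P] Pne unfolding g_def z_def by simp
  qed
  have swap: "(\<Sum>y\<in>N. \<Sum>x\<in>P. g x y) = (\<Sum>x\<in>P. \<Sum>y\<in>N. g x y)" by (rule sum.swap)
  have "(\<Sum>x\<in>P. F (V - {x})) - (\<Sum>x\<in>P. \<Sum>y\<in>N. g x y) \<in> R" using 1 by (rule sum_diff_mem)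
  moreover have "(\<Sum>y\<in>N. F (V - {y})) - (\<Sum>x\<in>P. \<Sum>y\<in>N. g x y) \<in> R"
    using sum_diff_mem[of N "\<lambda>y. F (V - {y})" "\<lambda>y. \<Sum>x\<in>P. g x y", OF 2] unfolding swap .
  ultimately have "(\<Sum>x\<in>P. F (V - {x})) - (\<Sum>y\<in>N. F (V - {y})) \<in> R"
    using diff_mem by fastforce
  moreover have "(\<Sum>v\<in>V. sg (\<rho> v) (F (V - {v}))) =
      (\<Sum>v\<in>V. (if \<rho> v = 1 then F (V - {v}) else 0) - (if \<rho> v = - 1 then F (V - {v}) else 0))"
  proof (rule sum.cong[OF refl])
    fix v assume "v \<in> V"
    then show "sg (\<rho> v) (F (V - {v})) = (if \<rho> v = 1 then F (V - {v}) else 0) - (if \<rho> v = - 1 then F (V - {v}) else 0)"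
      using pm[of v] by (auto simp: sg_def)
  qed
  then have "(\<Sum>v\<in>V. sg (\<rho> v) (F (V - {v}))) = (\<Sum>x\<in>P. F (V - {x})) - (\<Sum>y\<in>N. F (V - {y}))"
    using V(2) by (simp add: sum_subtractf P_def N_def sum.inter_filter)
  ultimately show ?thesis by simp
qed

text \<open>Each product is at most 1/2 in absolute value, so the bound is in danger only if
  \<open>a\<close> and \<open>b\<close> both have absolute value 1/2. The sign rule then gives the
  two products the same sign, that of \<open>e * p * q\<close>, and their difference is at most
  1/2.\<close>

lemma half_minor_bound:
  fixes a b p q :: real
  assumes p: "\<bar>p\<bar> \<le> 1" and q: "\<bar>q\<bar> \<le> 1" and e: "e = 1 \<or> e = -1"
    and a: "\<bar>a\<bar> < 1/2 \<or> a = e * (if p \<ge> 0 then 1/2 else -1/2)"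
    and b: "\<bar>b\<bar> < 1/2 \<or> b = e * (if q \<ge> 0 then 1/2 else -1/2)"
  shows "\<bar>a * q - p * b\<bar> < 1"
proof -
  have aq: "\<bar>a * q\<bar> \<le> \<bar>a\<bar>" using q by (simp add: abs_mult mult_left_le)
  have pb: "\<bar>p * b\<bar> \<le> \<bar>b\<bar>" using p by (simp add: abs_mult mult_left_le_one_le)
  have le: "\<bar>a\<bar> \<le> 1/2" "\<bar>b\<bar> \<le> 1/2" using a b e by (auto split: if_splits)
  show ?thesis
  proof (cases "\<bar>a\<bar> < 1/2 \<or> \<bar>b\<bar> < 1/2")
    case True
    then show ?thesis using aq pb le by linarith
  next
    case False
    then show ?thesis using a b e p q by (auto split: if_splits)
  qed
qed

text \<open>Both rounding to nearest integers and the choice of the sign at 1/2 matter: together they keep the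
  2x2 minors against \<open>\<rho>\<close> below 1, so that subdividing a cocycle at \<open>w\<close> lowers every index involved.\<close>

lemma half_point:
  assumes S: "good S" "\<not> Zbasis L S"
  obtains w where "w \<in> L" "w \<noteq> 0"
    "\<And>v. v \<in> S \<Longrightarrow> \<bar>representation S w v\<bar> < 1/2 \<or> representation S w v = (if \<rho> v \<ge> (0::real) then 1/2 else -1/2)"
proof -
  have "\<exists>k::int. \<bar>c - of_int k\<bar> < 1/2 \<or> c - of_int k = (if \<rho> v \<ge> (0::real) then 1/2 else -1/2)" for c :: real and v
  proof (cases "c - of_int \<lfloor>c\<rfloor> < 1/2")
    case True
    then have "\<bar>c - of_int \<lfloor>c\<rfloor>\<bar> < 1/2" by linarith
    then show ?thesis by blast
  next
    case False
    show ?thesis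
    proof (cases "c - of_int \<lfloor>c\<rfloor> = 1/2")
      case half: True
      show ?thesis
      proof (cases "\<rho> v \<ge> 0")
        case True
        then show ?thesis using half by auto
      next
        case False
        then show ?thesis using half by (intro exI[of _ "\<lfloor>c\<rfloor> + 1"]) auto
      qed
    next
      case neq: False
      have "\<bar>c - of_int (\<lfloor>c\<rfloor> + 1)\<bar> < 1/2" using False neq by linarith
      then show ?thesis by blast
    qed
  qed
  then show ?thesis
    using shifted_point[OF S, of "\<lambda>c v. \<bar>c\<bar> < 1/2 \<or> c = (if \<rho> v \<ge> 0 then 1/2 else -1/2)"] that by metis
qed

text \<open>A cone of the new index \<open>m\<close> is \<open>V - {x0}\<close>, and \<rho> is
  scaled to 1 at \<open>x0\<close>, which bounds it by 1 everywhere. If this cone is basic, all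
  indices are 1. Otherwise the cocycle is subdivided at a half point \<open>w\<close> of it. The
  terms with index below \<open>m\<close> are settled by \<open>cocycle_term\<close>. Those with
  index \<open>m\<close> have coefficient 1 or -1, and in their cones \<open>w\<close> has small
  coordinates, so \<open>F_expansion_small\<close> applies.\<close>

lemma cocycle_below_Suc:
  assumes coc: "cocycle_below m"
  shows "cocycle_below (Suc m)"
  unfolding cocycle_below_def
proof (intro allI impI, elim conjE)
  fix V :: "(real^'n) set" and \<rho>' :: "real^'n \<Rightarrow> real" and \<phi> :: "real^'n"
  assume V: "V \<subseteq> L" "finite V" "card V = Suc CARD('n)" "span V = UNIV"
    and \<phi>: "\<forall>v\<in>V. 0 < \<phi> \<bullet> v" and rel': "(\<Sum>v\<in>V. \<rho>' v *\<^sub>R v) = 0"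
    and le: "\<forall>v\<in>V. \<rho>' v \<noteq> 0 \<longrightarrow> idx (V - {v}) < Suc m"
  show "(\<Sum>v\<in>V. sg (\<rho>' v) (F (V - {v}))) \<in> R"
  proof (cases "\<forall>v\<in>V. \<rho>' v \<noteq> 0 \<longrightarrow> idx (V - {v}) < m")
    case True
    then show ?thesis using V \<phi> rel' by (intro cocycle_belowD[OF coc, where \<phi> = \<phi>]) auto
  next
    case False
    then obtain x0 where x0: "x0 \<in> V" "\<rho>' x0 \<noteq> 0" "idx (V - {x0}) = m" using le by force
    define \<rho> where "\<rho> v = \<rho>' v / \<rho>' x0" for v
    have rel: "(\<Sum>v\<in>V. \<rho> v *\<^sub>R v) = 0"
    proof -
      have "(\<Sum>v\<in>V. \<rho> v *\<^sub>R v) = (1 / \<rho>' x0) *\<^sub>R (\<Sum>v\<in>V. \<rho>' v *\<^sub>R v)"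
        by (simp add: \<rho>_def scaleR_sum_right)
      then show ?thesis using rel' by simp
    qed
    have \<rho>0: "\<rho> x0 = 1" using x0 by (simp add: \<rho>_def)
    have nz: "\<rho> v \<noteq> 0 \<longleftrightarrow> \<rho>' v \<noteq> 0" for v using x0 by (simp add: \<rho>_def)
    define B0 where "B0 = V - {x0}"
    have B0: "good B0" "idx B0 = m" unfolding B0_def using omit_good[OF V rel' x0(1,2)] x0 by auto
    have m1: "m \<ge> 1" using idx(2)[OF B0(1)] B0 by simp
    have le1: "\<bar>\<rho> v\<bar> \<le> 1" and idx\<rho>: "\<rho> v \<noteq> 0 \<Longrightarrow> real (idx (V - {v})) = \<bar>\<rho> v\<bar> * real m" if v: "v \<in> V" for v
    proof -
      show *: "real (idx (V - {v})) = \<bar>\<rho> v\<bar> * real m" if "\<rho> v \<noteq> 0"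
        using omit_idx[OF V rel x0(1) _ v that] \<rho>0 x0 by simp
      show "\<bar>\<rho> v\<bar> \<le> 1"
      proof (cases "\<rho> v = 0")
        case False
        then have "\<bar>\<rho> v\<bar> * real m \<le> 1 * real m" using * le v nz by (auto simp: less_Suc_eq_le)
        then show ?thesis using m1 by (subst (asm) mult_le_cancel_right) auto
      qed simp
    qed
    have "(\<Sum>v\<in>V. sg (\<rho> v) (F (V - {v}))) \<in> R"
    proof (cases "Zbasis L B0")
      case True
      then have "m = 1" using idx_eq_1_iff[OF B0(1)] B0 by simp
      have "idx (V - {v}) = 1" if "v \<in> V" "\<rho> v \<noteq> 0" for v
        using idx(2)[OF omit_good[OF V rel that]] le that nz \<open>m = 1\<close> by (auto simp: less_Suc_eq_le)
      then show ?thesis using \<phi> by (intro cocycle_index_1[OF V rel _ x0(1) \<rho>0]) auto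
    next
      case notZ: False
      obtain w1 where w1: "w1 \<in> L" "w1 \<noteq> 0" "\<And>v. v \<in> B0 \<Longrightarrow> \<bar>representation B0 w1 v\<bar> < 1/2 \<or>
          representation B0 w1 v = (if \<rho> v \<ge> (0::real) then 1/2 else -1/2)"
        using half_point[OF B0(1) notZ, of \<rho>] by blast
      \<comment> \<open>The sign is not free: \<open>w1\<close> or its negative is taken according
        to which one shares an open half space with \<open>V\<close>.
        \<open>half_minor_bound\<close> admits both.\<close>
      obtain w \<psi> e where w: "w \<in> L" "w \<noteq> 0" and e: "e = 1 \<or> e = (-1::real)"
        and half: "\<And>v. v \<in> B0 \<Longrightarrow> \<bar>representation B0 w v\<bar> < 1/2 \<or>
          representation B0 w v = e * (if \<rho> v \<ge> 0 then 1/2 else -1/2)"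
        and \<psi>: "\<And>v. v \<in> V \<Longrightarrow> \<psi> \<bullet> v > 0" "\<psi> \<bullet> w > 0"
      proof (rule positive_extension[of V \<phi> w1])
        show "finite V" "\<And>v. v \<in> V \<Longrightarrow> 0 < \<phi> \<bullet> v" "w1 \<noteq> 0" using V \<phi> w1 by auto
        fix \<psi> assume "(\<forall>v\<in>V. 0 < \<psi> \<bullet> v) \<and> 0 < \<psi> \<bullet> w1"
        then show thesis using that[of w1 1 \<psi>] w1 by auto
      next
        fix \<psi> assume *: "(\<forall>v\<in>V. 0 < \<psi> \<bullet> v) \<and> 0 < \<psi> \<bullet> (- w1)"
        have "representation B0 (- w1) v = - representation B0 w1 v" for v
          using goodD[OF B0(1)] by (simp add: representation_neg)
        then show thesis using that[of "- w1" "-1" \<psi>] w1 minus_L * by auto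
      qed
      have small: "\<bar>representation B0 w v\<bar> < 1" if "v \<in> B0" for v
        using half[OF that] e by (auto split: if_splits)
      show ?thesis
      proof (cases "w \<in> V")
        case True
        \<comment> \<open>A member of \<open>V - {x0}\<close> would have a coordinate equal to 1
          there. Starring the cone at \<open>x0\<close> reproduces the cocycle itself.\<close>
        then have wx0: "w = x0" using small_not_mem[OF B0(1) small] by (auto simp: B0_def)
        have "F B0 - expansion B0 w \<in> R"
          using \<psi> small w by (intro F_expansion_small[OF coc B0 notZ, of \<psi>]) (auto simp: B0_def)
        moreover have "representation B0 w v = - \<rho> v" if "v \<in> B0" for v
        proof -
          have "w = (\<Sum>y\<in>V. of_bool (y = x0) *\<^sub>R y)"
            using wx0 sum_of_bool_scaleR[OF V(2) x0(1)] by simp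
          then have "representation B0 w v = of_bool (v = x0) - of_bool (x0 = x0) * \<rho> v / \<rho> x0"
            unfolding B0_def using that \<rho>0 by (intro omit_representation[OF V rel x0(1)]) (auto simp: B0_def)
          then show ?thesis using that \<rho>0 by (simp add: B0_def)
        qed
        then have "expansion B0 w = - (\<Sum>v\<in>B0. sg (\<rho> v) (F (V - {v})))"
          unfolding expansion_def sum_negf[symmetric]
        proof (intro sum.cong[OF refl])
          fix v assume v: "v \<in> B0" and *: "\<And>v. v \<in> B0 \<Longrightarrow> representation B0 w v = - \<rho> v"
          have "insert w (B0 - {v}) = V - {v}" using wx0 x0 v by (auto simp: B0_def)
          then show "sg (representation B0 w v) (F (insert w (B0 - {v}))) = - sg (\<rho> v) (F (V - {v}))"
            using *[OF v] by simp
        qed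
        moreover have "(\<Sum>v\<in>V. sg (\<rho> v) (F (V - {v}))) = F B0 + (\<Sum>v\<in>B0. sg (\<rho> v) (F (V - {v})))"
          using V x0 \<rho>0 by (simp add: sum.remove[of V x0] B0_def)
        ultimately show ?thesis by simp
      next
        case wV: False
        define a where "a v = (if v = x0 then 0 else representation B0 w v)" for v
        have "(\<Sum>v\<in>B0. a v *\<^sub>R v) = (\<Sum>v\<in>B0. representation B0 w v *\<^sub>R v)"
          by (intro sum.cong) (auto simp: a_def B0_def)
        also have "\<dots> = w" using goodD[OF B0(1)] by (simp add: representation_sum_eq)
        finally have wa: "w = (\<Sum>v\<in>V. a v *\<^sub>R v)"
          using V x0 by (simp add: sum.remove[of V x0] B0_def a_def)
        have ahalf: "\<bar>a v\<bar> < 1/2 \<or> a v = e * (if \<rho> v \<ge> 0 then 1/2 else -1/2)" if "v \<in> V" for v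
          using half[of v] that by (auto simp: a_def B0_def)
        have minor: "\<bar>a x * \<rho> y - \<rho> x * a y\<bar> < 1" if "x \<in> V" "y \<in> V" for x y
          using half_minor_bound[OF le1[OF that(1)] le1[OF that(2)] e ahalf[OF that(1)] ahalf[OF that(2)]] .
        have "sg (\<rho> x) (F (V - {x})) +
            (\<Sum>y\<in>V - {x}. sg (a x * \<rho> y - \<rho> x * a y) (F (insert w (V - {x, y})))) \<in> R" if x: "x \<in> V" for x
        proof (cases "\<rho> x \<noteq> 0 \<and> idx (V - {x}) = m")
          case True
          then have \<rho>x: "\<bar>\<rho> x\<bar> = 1" using idx\<rho>[OF x] m1 by auto
          let ?S = "V - {x}"
          have gS: "good ?S" using omit_good[OF V rel x] True by auto
          have "m \<noteq> 1" using idx_eq_1_iff[OF B0(1)] notZ B0 by auto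
          then have nZ: "\<not> Zbasis L ?S" using idx_eq_1_iff[OF gS] True by auto
          \<comment> \<open>Since \<rho> x is 1 or -1, the coordinates of \<open>w\<close> in this
            cone are minors up to sign, hence below 1 in absolute value.\<close>
          have rep: "\<rho> x * representation ?S w y = - (a x * \<rho> y - \<rho> x * a y)" if "y \<in> ?S" for y
            using omit_representation[OF V rel x _ wa that] True by (simp add: field_simps)
          have "\<bar>representation ?S w y\<bar> < 1" if "y \<in> ?S" for y
          proof -
            have "\<bar>\<rho> x * representation ?S w y\<bar> < 1" using rep[OF that] minor[OF x, of y] that by simp
            then show ?thesis using \<rho>x by (simp add: abs_mult)
          qed
          then have "F ?S - expansion ?S w \<in> R"
            using True \<psi> w by (intro F_expansion_small[OF coc gS _ nZ, of \<psi>]) auto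
          then have "sg (\<rho> x) (F ?S - expansion ?S w) \<in> R" by (rule sg_mem)
          moreover have "sg (\<rho> x) (expansion ?S w) =
              - (\<Sum>y\<in>?S. sg (a x * \<rho> y - \<rho> x * a y) (F (insert w (V - {x, y}))))"
            unfolding expansion_def sg_sum sum_negf[symmetric]
          proof (rule sum.cong[OF refl])
            fix y assume y: "y \<in> ?S"
            have "?S - {y} = V - {x, y}" by auto
            then show "sg (\<rho> x) (sg (representation ?S w y) (F (insert w (?S - {y})))) =
                - sg (a x * \<rho> y - \<rho> x * a y) (F (insert w (V - {x, y})))"
              unfolding sg_sg rep[OF y] by (simp del: minus_diff_eq)
          qed
          ultimately show ?thesis by (simp add: sg_diff)
        next
          case False
          show ?thesis
          proof (rule cocycle_term[OF coc V rel wa w(1) wV _ x])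
            show "0 < \<psi> \<bullet> v" if "v \<in> insert w V" for v using \<psi> that by auto
            show "idx (V - {x}) < m" if "\<rho> x \<noteq> 0"
              using False that le x nz by (auto simp: less_Suc_eq)
            show "idx (insert w (V - {x, y})) < m" if y: "y \<in> V - {x}" and d: "a x * \<rho> y - \<rho> x * a y \<noteq> 0" for y
            proof -
              have "real (idx (insert w (V - {x, y}))) = \<bar>a x * \<rho> y - \<rho> x * a y\<bar> * real m"
                using omit_two_idx[OF V rel x0(1) _ wa w(1) x _ _ d] y \<rho>0 x0 by auto
              also have "\<dots> < 1 * real m"
                using minor[OF x, of y] y m1 by (intro mult_strict_right_mono) auto
              finally show ?thesis by simp
            qed
          qed
        qed
        then have "(\<Sum>x\<in>V. sg (\<rho> x) (F (V - {x})) +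
            (\<Sum>y\<in>V - {x}. sg (a x * \<rho> y - \<rho> x * a y) (F (insert w (V - {x, y}))))) \<in> R"
          by (rule sum_mem)
        then show ?thesis unfolding sum_cocycle_terms[OF V(2)] .
      qed
    qed
    then have "sg (\<rho>' x0) (\<Sum>v\<in>V. sg (\<rho> v) (F (V - {v}))) \<in> R" by (rule sg_mem)
    moreover have "\<rho>' x0 * \<rho> v = \<rho>' v" for v using x0 by (simp add: \<rho>_def)
    ultimately show ?thesis by (simp add: sg_sum sg_sg)
  qed
qed

lemma cocycle_below_all: "cocycle_below m"
proof (induction m)
  case 0
  have "(\<Sum>v\<in>V. sg (\<rho> v) (F (V - {v}))) \<in> R"
    if idx0: "\<And>v. v \<in> V \<Longrightarrow> \<rho> v \<noteq> 0 \<Longrightarrow> idx (V - {v}) < 0" for V and \<rho> :: "_ \<Rightarrow> real"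
  proof -
    have "\<rho> v = 0" if "v \<in> V" for v using idx0[OF that] by auto
    then show ?thesis by (simp add: zero_mem)
  qed
  then show ?case unfolding cocycle_below_def by blast
qed (rule cocycle_below_Suc)

text \<open>Finitely many cones have bounded index, so the bound in \<open>cocycle_below\<close>
  disappears.\<close>

lemma F_cocycles: "cocycles {x\<in>L. \<phi> \<bullet> x > 0} UNIV F R"
proof (rule cocyclesI)
  fix V and \<rho> :: "real^'n \<Rightarrow> real"
  assume V: "V \<subseteq> {x\<in>L. \<phi> \<bullet> x > 0} \<inter> UNIV" "finite V" "card V = Suc (dim (UNIV :: (real^'n) set))"
    "span V = UNIV" "(\<Sum>v\<in>V. \<rho> v *\<^sub>R v) = 0"
  define m where "m = Suc (Max (insert 0 ((\<lambda>v. idx (V - {v})) ` V)))"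
  have "idx (V - {v}) < m" if "v \<in> V" for v
    unfolding m_def using V(2) that by (auto simp: less_Suc_eq_le intro!: Max_ge)
  then show "(\<Sum>v\<in>V. sg (\<rho> v) (F (V - {v}))) \<in> R"
    using V by (intro cocycle_belowD[OF cocycle_below_all[of m], where \<phi> = \<phi>]) (auto simp: dim_UNIV)
qed

end

section \<open>Dissections into simplicial cones\<close>

definition nonneg_at :: "'v::real_vector set \<Rightarrow> 'v \<Rightarrow> bool" where
  "nonneg_at S x \<longleftrightarrow> (\<forall>v\<in>S. representation S x v \<ge> 0)"

lemma linear_representation_basis:
  assumes "independent S" "span S = (UNIV :: 'v::real_vector set)"
  shows "linear (\<lambda>x. representation S x v)"
  using assms by (intro linearI) (auto simp: representation_add representation_scale)

lemma linear_as_inner: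
  fixes l :: "'v::euclidean_space \<Rightarrow> real"
  assumes "linear l"
  obtains \<phi> where "\<And>x. l x = \<phi> \<bullet> x"
proof
  fix x
  have "l x = l (\<Sum>i\<in>Basis. (x \<bullet> i) *\<^sub>R i)" by (simp add: euclidean_representation)
  also have "\<dots> = (\<Sum>i\<in>Basis. l i *\<^sub>R i) \<bullet> x"
    by (simp add: linear_sum[OF assms] linear_scale[OF assms] inner_sum_left inner_commute[of x] mult.commute)
  finally show "l x = (\<Sum>i\<in>Basis. l i *\<^sub>R i) \<bullet> x" by (simp only: inner_commute)
qed

lemma convex_cone_hull_finite:
  fixes S :: "'v::real_vector set"
  assumes "finite S"
  shows "convex_cone hull S = {\<Sum>v\<in>S. c v *\<^sub>R v |c. \<forall>v\<in>S. c v \<ge> (0::real)}" (is "_ = ?C")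
proof (rule hull_unique)
  show "S \<subseteq> ?C"
  proof
    fix x assume "x \<in> S"
    then show "x \<in> ?C" using sum_of_bool_scaleR[OF assms] by (auto intro!: exI[of _ "\<lambda>y. of_bool (y = x)"])
  qed
  show "convex_cone ?C"
    unfolding convex_cone_iff
  proof (intro conjI ballI allI impI)
    show "0 \<in> ?C" by (auto intro!: exI[of _ "\<lambda>_. 0"])
    fix x y assume "x \<in> ?C" "y \<in> ?C"
    then obtain c d where "x = (\<Sum>v\<in>S. c v *\<^sub>R v)" "y = (\<Sum>v\<in>S. d v *\<^sub>R v)" "\<forall>v\<in>S. c v \<ge> 0" "\<forall>v\<in>S. d v \<ge> 0"
      by auto
    then show "x + y \<in> ?C"
      by (auto intro!: exI[of _ "\<lambda>v. c v + d v"] simp: scaleR_add_left sum.distrib)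
  next
    fix x c assume "x \<in> ?C" "c \<ge> (0::real)"
    then obtain d where "x = (\<Sum>v\<in>S. d v *\<^sub>R v)" "\<forall>v\<in>S. d v \<ge> 0" by auto
    then show "c *\<^sub>R x \<in> ?C" using \<open>c \<ge> 0\<close>
      by (auto intro!: exI[of _ "\<lambda>v. c * d v"] simp: scaleR_sum_right)
  qed
  fix T assume T: "S \<subseteq> T" "convex_cone T"
  have "(\<Sum>v\<in>S'. c v *\<^sub>R v) \<in> T" if "finite S'" "S' \<subseteq> S" "\<forall>v\<in>S. c v \<ge> 0" for c :: "'v \<Rightarrow> real" and S'
    using that
  proof (induction S' rule: finite_induct)
    case empty
    then show ?case using T by (simp add: convex_cone_contains_0)
  next
    case (insert v S')
    then show ?case using T by (auto intro!: convex_cone_add convex_cone_scaleR)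
  qed
  then show "?C \<subseteq> T" using assms by auto
qed

lemma cone_iff_nonneg:
  fixes S :: "'v::euclidean_space set"
  assumes "independent S" "span S = UNIV"
  shows "x \<in> convex_cone hull S \<longleftrightarrow> nonneg_at S x"
proof -
  have fin: "finite S" using assms finiteI_independent by auto
  show ?thesis
  proof
    assume "x \<in> convex_cone hull S"
    then obtain c where c: "x = (\<Sum>v\<in>S. c v *\<^sub>R v)" "\<forall>v\<in>S. c v \<ge> 0"
      unfolding convex_cone_hull_finite[OF fin] by auto
    then show "nonneg_at S x" unfolding nonneg_at_def using representation_unique[OF assms(1) fin c(1)] by auto
  next
    assume "nonneg_at S x"
    moreover have "x = (\<Sum>v\<in>S. representation S x v *\<^sub>R v)" using assms by (simp add: representation_sum_eq)
    ultimately show "x \<in> convex_cone hull S"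
      unfolding convex_cone_hull_finite[OF fin] nonneg_at_def by blast
  qed
qed

text \<open>Links \<open>pos_at\<close> with the topological interior in
  \<open>basic_decomposition\<close>. From an interior point a small multiple of \<open>v\<close>
  can be subtracted without leaving the cone, so the coordinate at \<open>v\<close> is
  positive.\<close>

lemma interior_cone:
  fixes S :: "'v::euclidean_space set"
  assumes S: "independent S" "span S = UNIV"
  shows "interior (convex_cone hull S) = {x. pos_at S x}"
proof (intro equalityI subsetI)
  have fin: "finite S" using S finiteI_independent by auto
  have eq: "{x. pos_at S x} = (\<Inter>v\<in>S. {x. representation S x v > 0})" by (auto simp: pos_at_def)
  have "open {x. representation S x v > 0}" for v
    using linear_representation_basis[OF S, of v]
    by (intro open_Collect_less continuous_on_const linear_continuous_on) (simp add: linear_conv_bounded_linear)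
  then have "open {x. pos_at S x}" unfolding eq using fin by (intro open_INT) auto
  then have "{x. pos_at S x} \<subseteq> interior (convex_cone hull S)"
    by (intro interior_maximal) (auto simp: cone_iff_nonneg[OF S] pos_at_def nonneg_at_def less_imp_le)
  then show "x \<in> interior (convex_cone hull S)" if "x \<in> {x. pos_at S x}" for x using that by blast
  fix x assume x: "x \<in> interior (convex_cone hull S)"
  show "x \<in> {x. pos_at S x}"
    unfolding pos_at_def
  proof (intro CollectI ballI)
    fix v assume v: "v \<in> S"
    obtain e where e: "e > 0" "ball x e \<subseteq> convex_cone hull S" using x by (meson mem_interior)
    have v0: "v \<noteq> 0" using S v dependent_zero by blast
    define t where "t = e / (2 * norm v)"
    have t: "t > 0" using e v0 by (simp add: t_def)
    have "x - t *\<^sub>R v \<in> ball x e" using e v0 unfolding mem_ball by (simp add: dist_norm t_def)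
    then have "nonneg_at S (x - t *\<^sub>R v)" using e(2) cone_iff_nonneg[OF S] by blast
    moreover have "representation S (x - t *\<^sub>R v) v = representation S x v - t"
      using S v by (simp add: representation_diff representation_scale representation_basis)
    ultimately show "representation S x v > 0" using v t by (auto simp: nonneg_at_def)
  qed
qed

lemma cone_mono_pos:
  fixes S T :: "'v::euclidean_space set"
  assumes "independent S" "span S = UNIV" "independent T" "span T = UNIV"
    and "convex_cone hull T \<subseteq> convex_cone hull S" "pos_at T x"
  shows "pos_at S x"
  using interior_mono[OF assms(5)] assms by (auto simp: interior_cone)

text \<open>Supplies an interior point; it serves to show that two pieces with overlapping interiors
  are equal.\<close>

lemma pos_at_sum:
  assumes "independent S" "finite S" shows "pos_at S (\<Sum>S)"
proof -
  have "representation S (\<Sum>S) v = 1" if "v \<in> S" for v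
    using that by (intro representation_unique[OF assms, of _ "\<lambda>_. 1"]) auto
  then show ?thesis by (simp add: pos_at_def)
qed

text \<open>A generating set of least size for \<open>x\<close> is independent: along a linear
  dependence the coefficients could be moved until one of them reaches zero.\<close>

lemma conic_caratheodory:
  fixes S :: "'v::euclidean_space set"
  assumes "finite S" "x \<in> convex_cone hull S"
  obtains T where "T \<subseteq> S" "independent T" "x \<in> convex_cone hull T"
proof -
  define P where "P T \<longleftrightarrow> T \<subseteq> S \<and> x \<in> convex_cone hull T" for T
  have "P S" using assms by (simp add: P_def)
  then obtain T where T: "P T" and min: "\<And>U. P U \<Longrightarrow> card T \<le> card U"
    using ex_has_least_nat[of P S card] by auto
  have finT: "finite T" using T assms unfolding P_def by (meson finite_subset)
  obtain c where c: "x = (\<Sum>v\<in>T. c v *\<^sub>R v)" "\<forall>v\<in>T. c v \<ge> 0"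
    using T unfolding P_def convex_cone_hull_finite[OF finT] by auto
  have "independent T"
  proof
    assume "dependent T"
    then obtain u0 where u0: "\<exists>v\<in>T. u0 v \<noteq> 0" "(\<Sum>v\<in>T. u0 v *\<^sub>R v) = (0::'v)"
      using dependent_finite[OF finT] by auto
    obtain u where u: "\<exists>v\<in>T. u v > 0" "(\<Sum>v\<in>T. u v *\<^sub>R v) = 0"
    proof (cases "\<exists>v\<in>T. u0 v > 0")
      case True
      then show ?thesis using that u0 by blast
    next
      case False
      then have "\<exists>v\<in>T. - u0 v > 0" using u0(1) by (auto simp: not_less) (metis le_less)
      then show ?thesis using that[of "\<lambda>v. - u0 v"] u0(2) by (auto simp: sum_negf)
    qed
    define A where "A = {v\<in>T. u v > 0}"
    have A: "finite A" "A \<noteq> {}" using finT u by (auto simp: A_def)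
    define t where "t = Min ((\<lambda>v. c v / u v) ` A)"
    obtain v0 where v0: "v0 \<in> A" "t = c v0 / u v0"
      using Min_in[of "(\<lambda>v. c v / u v) ` A"] A unfolding t_def by blast
    have t0: "t \<ge> 0" using v0 c by (auto simp: A_def)
    have tle: "t \<le> c v / u v" if "v \<in> A" for v unfolding t_def using A that by auto
    define d where "d v = c v - t * u v" for v
    have d0: "d v \<ge> 0" if "v \<in> T" for v
    proof (cases "u v > 0")
      case True
      then show ?thesis using tle[of v] that by (simp add: A_def d_def field_simps)
    next
      case False
      then have "t * u v \<le> 0" using t0 by (simp add: mult_nonneg_nonpos)
      then show ?thesis using c that by (auto simp: d_def intro: order_trans)
    qed
    have "d v0 = 0" using v0 by (auto simp: d_def A_def)
    have "(\<Sum>v\<in>T. d v *\<^sub>R v) = x - t *\<^sub>R (\<Sum>v\<in>T. u v *\<^sub>R v)"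
      by (simp add: c(1) d_def scaleR_sum_right sum_subtractf algebra_simps)
    then have "x = (\<Sum>v\<in>T. d v *\<^sub>R v)" using u by simp
    also have "\<dots> = (\<Sum>v\<in>T - {v0}. d v *\<^sub>R v)"
      using finT \<open>d v0 = 0\<close> by (intro sum.mono_neutral_right) auto
    finally have "x \<in> convex_cone hull (T - {v0})"
      unfolding convex_cone_hull_finite[OF finite_Diff[OF finT]] using d0 by auto
    then have "P (T - {v0})" using T by (auto simp: P_def)
    then have "card T \<le> card (T - {v0})" by (rule min)
    moreover have "v0 \<in> T" using v0 by (auto simp: A_def)
    ultimately show False using finT by (metis card_Diff1_less not_le)
  qed
  then show ?thesis using that T P_def by auto
qed

section \<open>Dissections by cones with generators in a lattice\<close>

context lattice_context
begin

text \<open>The pieces are given by their generators, which lie in \<open>L\<close> but need not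
  form a basis of it, and they need not meet in common faces. With bases as generators this becomes
  \<open>basic_decomposition\<close>.\<close>

definition dissection :: "(real^'n) set \<Rightarrow> (real^'n) set set \<Rightarrow> bool" where
  "dissection \<Lambda> D \<longleftrightarrow> finite D \<and> (\<forall>T\<in>D. good T) \<and> \<Lambda> = (\<Union>T\<in>D. convex_cone hull T) \<and>
     (\<forall>T\<in>D. \<forall>T'\<in>D. \<forall>x. pos_at T x \<and> pos_at T' x \<longrightarrow> T = T')"

lemma dissectionD:
  assumes "dissection \<Lambda> D"
  shows "finite D" "T \<in> D \<Longrightarrow> good T" "\<Lambda> = (\<Union>T\<in>D. convex_cone hull T)"
    "T \<in> D \<Longrightarrow> T' \<in> D \<Longrightarrow> pos_at T x \<Longrightarrow> pos_at T' x \<Longrightarrow> T = T'"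
    "T \<in> D \<Longrightarrow> convex_cone hull T \<subseteq> \<Lambda>"
  using assms unfolding dissection_def by blast+

lemma good_cone: "good S \<Longrightarrow> x \<in> convex_cone hull S \<longleftrightarrow> nonneg_at S x"
  by (intro cone_iff_nonneg goodD)

lemma good_cone_mono_pos:
  "good S \<Longrightarrow> good T \<Longrightarrow> convex_cone hull T \<subseteq> convex_cone hull S \<Longrightarrow> pos_at T x \<Longrightarrow> pos_at S x"
  by (rule cone_mono_pos) (auto simp: good_def)

lemma good_pos_sum: "good S \<Longrightarrow> pos_at S (\<Sum>S)"
  using goodD[of S] by (intro pos_at_sum) auto

text \<open>One pivot step: \<open>w\<close> takes over the coordinate at \<open>v\<close>, and the
  other coordinates are corrected by multiples of it.\<close>

lemma representation_replace:
  assumes S: "good S" and v: "v \<in> S" and w: "w \<in> L" "representation S w v \<noteq> 0"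
  shows "representation (insert w (S - {v})) x w = representation S x v / representation S w v"
    and "u \<in> S - {v} \<Longrightarrow> representation (insert w (S - {v})) x u =
      representation S x u - representation S w u * (representation S x v / representation S w v)"
proof -
  note S' = goodD[OF S]
  let ?T = "insert w (S - {v})" and ?c = "representation S w" and ?x = "representation S x"
  note T = goodD[OF good_replace(1)[OF S v w]]
  have wS: "w \<notin> S - {v}" using w S'(2) representation_basis[of S w] by (auto split: if_splits)
  define d where "d u = (if u = w then ?x v / ?c v else ?x u - ?c u * (?x v / ?c v))" for u
  have ew: "w - ?c v *\<^sub>R v = (\<Sum>u\<in>S - {v}. ?c u *\<^sub>R u)"
    using representation_sum_eq[of S w] S' v by (simp add: sum.remove[of S v] algebra_simps)
  have ex: "x = ?x v *\<^sub>R v + (\<Sum>u\<in>S - {v}. ?x u *\<^sub>R u)"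
    using representation_sum_eq[of S x] S' v by (simp add: sum.remove[of S v])
  have "(\<Sum>u\<in>?T. d u *\<^sub>R u) = (?x v / ?c v) *\<^sub>R w + (\<Sum>u\<in>S - {v}. d u *\<^sub>R u)"
    using wS S' by (simp add: d_def)
  also have "(\<Sum>u\<in>S - {v}. d u *\<^sub>R u) = (\<Sum>u\<in>S - {v}. (?x u - ?c u * (?x v / ?c v)) *\<^sub>R u)"
    using wS by (intro sum.cong) (auto simp: d_def)
  also have "\<dots> = (\<Sum>u\<in>S - {v}. ?x u *\<^sub>R u) - (?x v / ?c v) *\<^sub>R (\<Sum>u\<in>S - {v}. ?c u *\<^sub>R u)"
    by (simp add: scaleR_sum_right sum_subtractf algebra_simps)
  also have "\<dots> = x - ?x v *\<^sub>R v - (?x v / ?c v) *\<^sub>R (w - ?c v *\<^sub>R v)"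
    unfolding ew by (subst ex) simp
  also have "(?x v / ?c v) *\<^sub>R w + \<dots> = x" using w by (simp add: algebra_simps)
  finally have x: "x = (\<Sum>u\<in>?T. d u *\<^sub>R u)" by simp
  show "representation ?T x w = ?x v / ?c v"
    using representation_unique[OF T(2,4) x, of w] by (simp add: d_def)
  show "representation ?T x u = ?x u - ?c u * (?x v / ?c v)" if "u \<in> S - {v}"
    using representation_unique[OF T(2,4) x, of u] that wS by (auto simp: d_def)
qed

text \<open>The piece containing \<open>x\<close> omits a generator \<open>v\<close> at which the
  quotient of the coordinates of \<open>x\<close> and \<open>w\<close> is least. For
  \<open>x\<close> to be interior to the piece this minimum must be strict, which separates the
  interiors.\<close>

lemma dissection_star:
  assumes S: "good S" and w: "w \<in> L" "w \<noteq> 0" "nonneg_at S w"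
  shows "dissection (convex_cone hull S) ((\<lambda>v. insert w (S - {v})) ` {v\<in>S. representation S w v > 0})"
proof -
  note S' = goodD[OF S]
  define A where "A = {v\<in>S. representation S w v > 0}"
  define T where "T v = insert w (S - {v})" for v
  have gT: "good (T v)" if "v \<in> A" for v
    unfolding T_def using that w by (intro good_replace[OF S]) (auto simp: A_def)
  have rw: "representation (T v) x w = representation S x v / representation S w v"
    and ru: "\<And>u. u \<in> S - {v} \<Longrightarrow> representation (T v) x u =
      representation S x u - representation S w u * (representation S x v / representation S w v)"
    if "v \<in> A" for v x
    using representation_replace[OF S, of v w] that w unfolding A_def T_def by auto
  have finA: "finite A" using S' by (simp add: A_def)
  have "A \<noteq> {}"
  proof
    assume "A = {}"
    then have "representation S w v = 0" if "v \<in> S" for v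
      using w(3) that by (force simp: A_def nonneg_at_def)
    then have "(\<Sum>v\<in>S. representation S w v *\<^sub>R v) = 0" by simp
    then show False using representation_sum_eq[of S w] S' w(2) by simp
  qed
  have "convex_cone hull S = (\<Union>v\<in>A. convex_cone hull (T v))"
  proof (intro equalityI subsetI)
    fix x assume "x \<in> convex_cone hull S"
    then have x: "representation S x v \<ge> 0" if "v \<in> S" for v
      using good_cone[OF S] that by (auto simp: nonneg_at_def)
    define t where "t = Min ((\<lambda>v. representation S x v / representation S w v) ` A)"
    obtain v where v: "v \<in> A" "t = representation S x v / representation S w v"
      using Min_in[of "(\<lambda>v. representation S x v / representation S w v) ` A"] finA \<open>A \<noteq> {}\<close> unfolding t_def by blast
    have tle: "t \<le> representation S x u / representation S w u" if "u \<in> A" for u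
      unfolding t_def using finA that by auto
    have t0: "t \<ge> 0" using v x by (auto simp: A_def)
    have "nonneg_at (T v) x"
      unfolding nonneg_at_def
    proof
      fix u assume "u \<in> T v"
      then consider "u = w" | "u \<in> S - {v}" by (auto simp: T_def)
      then show "representation (T v) x u \<ge> 0"
      proof cases
        case 1
        then show ?thesis using rw[OF v(1)] t0 v by simp
      next
        case 2
        have "representation S w u * t \<le> representation S x u"
        proof (cases "representation S w u > 0")
          case True
          then show ?thesis using tle[of u] 2 by (simp add: A_def field_simps)
        next
          case False
          then have "representation S w u = 0" using w(3) 2 by (force simp: nonneg_at_def)
          then show ?thesis using x 2 by simp
        qed
        then show ?thesis using ru[OF v(1) 2] v by simp
      qed
    qed
    then show "x \<in> (\<Union>v\<in>A. convex_cone hull (T v))" using v good_cone[OF gT] by blast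
  next
    fix x assume "x \<in> (\<Union>v\<in>A. convex_cone hull (T v))"
    then obtain v where v: "v \<in> A" "x \<in> convex_cone hull (T v)" by blast
    have "T v \<subseteq> convex_cone hull S"
      unfolding T_def using w(3) good_cone[OF S] hull_subset[of S convex_cone] by auto
    then have "convex_cone hull (T v) \<subseteq> convex_cone hull S"
      by (intro hull_minimal) (auto simp: convex_cone_convex_cone_hull)
    then show "x \<in> convex_cone hull S" using v by blast
  qed
  moreover have disj: "T v = T v'" if "v \<in> A" "v' \<in> A" and pos: "pos_at (T v) x" "pos_at (T v') x" for v v' x
  proof (rule ccontr)
    assume "T v \<noteq> T v'"
    then have ne: "v' \<in> S - {v}" "v \<in> S - {v'}" using that by (auto simp: A_def)
    have "representation (T v) x v' > 0" "representation (T v') x v > 0"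
      using pos ne by (auto simp: pos_at_def T_def)
    then have "representation S x v' / representation S w v' > representation S x v / representation S w v"
      "representation S x v / representation S w v > representation S x v' / representation S w v'"
      using ru[OF that(1) ne(1), of x] ru[OF that(2) ne(2), of x] that by (auto simp: A_def field_simps)
    then show False by simp
  qed
  ultimately have "dissection (convex_cone hull S) (T ` A)"
    unfolding dissection_def
  proof (intro conjI ballI allI impI; (elim conjE)?)
    show "finite (T ` A)" using finA by simp
    show "good U" if "U \<in> T ` A" for U using that gT by blast
    show "U = U'" if "U \<in> T ` A" "U' \<in> T ` A" "pos_at U x" "pos_at U' x" for U U' x
      using that disj by blast
  qed (auto simp only: image_image SUP_image o_def)
  moreover have "T = (\<lambda>v. insert w (S - {v}))" by (rule ext) (simp add: T_def)
  ultimately show ?thesis by (simp only: A_def)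
qed

lemma dissection_self: "good S \<Longrightarrow> dissection (convex_cone hull S) {S}"
  by (simp add: dissection_def)

lemma dissection_trans:
  assumes D: "dissection \<Lambda> D" and E: "\<And>T. T \<in> D \<Longrightarrow> dissection (convex_cone hull T) (E T)"
  shows "dissection \<Lambda> (\<Union>T\<in>D. E T)"
proof -
  have "U = U'" if "U \<in> E T" "T \<in> D" "U' \<in> E T'" "T' \<in> D" "pos_at U x" "pos_at U' x" for U T U' T' x
  proof -
    have "pos_at T x"
      using that by (intro good_cone_mono_pos[of T U x] dissectionD(2)[OF D] dissectionD(2)[OF E] dissectionD(5)[OF E])
    moreover have "pos_at T' x"
      using that by (intro good_cone_mono_pos[of T' U' x] dissectionD(2)[OF D] dissectionD(2)[OF E] dissectionD(5)[OF E])
    ultimately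
    have "T = T'" using dissectionD(4)[OF D] that by blast
    then show ?thesis using dissectionD(4)[OF E] that by blast
  qed
  moreover have "\<Lambda> = (\<Union>U\<in>(\<Union>T\<in>D. E T). convex_cone hull U)"
    using dissectionD(3)[OF D] dissectionD(3)[OF E] by auto
  moreover have "finite (\<Union>T\<in>D. E T)" using dissectionD(1)[OF D] dissectionD(1)[OF E] by auto
  moreover have "good U" if "U \<in> E T" "T \<in> D" for U T using dissectionD(2)[OF E] that by blast
  ultimately show ?thesis unfolding dissection_def by blast
qed

text \<open>Starring at a box point lowers the index of every piece, and the pieces are resolved in
  turn.\<close>

lemma resolution:
  assumes "good S"
  shows "\<exists>D. dissection (convex_cone hull S) D \<and> (\<forall>T\<in>D. Zbasis L T)"
  using assms
proof (induction "idx S" arbitrary: S rule: less_induct)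
  case less
  show ?case
  proof (cases "Zbasis L S")
    case True
    then show ?thesis using dissection_self[OF less.prems] by blast
  next
    case False
    then obtain w where w: "box_point S w" using box_point_exists[OF less.prems] by blast
    define D where "D = (\<lambda>v. insert w (S - {v})) ` {v\<in>S. representation S w v > 0}"
    have D: "dissection (convex_cone hull S) D"
      unfolding D_def
      using w by (intro dissection_star[OF less.prems]) (auto simp: box_point_def nonneg_at_def)
    have "\<exists>E. dissection (convex_cone hull T) E \<and> (\<forall>U\<in>E. Zbasis L U)" if TD: "T \<in> D" for T
    proof -
      obtain v where v: "v \<in> S" "representation S w v > 0" "T = insert w (S - {v})" using TD unfolding D_def by blast
      have "real (idx T) = \<bar>representation S w v\<bar> * real (idx S)"
        using good_replace(2)[OF less.prems, of v w] v w by (auto simp: box_point_def)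
      also have "\<dots> < 1 * real (idx S)"
        using w v idx(2)[OF less.prems] by (intro mult_strict_right_mono) (auto simp: box_point_def)
      finally show ?thesis using less.hyps[of T] dissectionD(2)[OF D TD] by simp
    qed
    then obtain E where "\<And>T. T \<in> D \<Longrightarrow> dissection (convex_cone hull T) (E T) \<and> (\<forall>U\<in>E T. Zbasis L U)"
      by metis
    then show ?thesis using dissection_trans[OF D, of E] by blast
  qed
qed

section \<open>Cutting cones by rational hyperplanes\<close>

lemma linear_sign_on_cone:
  fixes l :: "real^'n \<Rightarrow> real"
  assumes l: "linear l" and S: "good S" and x: "x \<in> convex_cone hull S" and pos: "\<And>v. v \<in> S \<Longrightarrow> l v \<ge> 0"
  shows "l x \<ge> 0"
proof -
  have "l x = l (\<Sum>v\<in>S. representation S x v *\<^sub>R v)" using goodD[OF S] by (simp add: representation_sum_eq)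
  also have "\<dots> = (\<Sum>v\<in>S. representation S x v * l v)"
    by (simp add: linear_sum[OF l] linear_scale[OF l])
  also have "\<dots> \<ge> 0" using x pos good_cone[OF S] by (intro sum_nonneg) (auto simp: nonneg_at_def)
  finally show ?thesis .
qed

definition one_sided :: "(real^'n \<Rightarrow> real) \<Rightarrow> (real^'n) set \<Rightarrow> bool" where
  "one_sided l S \<longleftrightarrow> (\<forall>v\<in>S. l v \<ge> 0) \<or> (\<forall>v\<in>S. l v \<le> 0)"

lemma one_sided_sub:
  assumes "linear l" "good S" "one_sided l S" "T \<subseteq> convex_cone hull S"
  shows "one_sided l T"
proof -
  have "linear (\<lambda>x. - l x)" using assms(1) by (rule linear_compose_neg)
  then show ?thesis
    using assms linear_sign_on_cone[of l S] linear_sign_on_cone[of "\<lambda>x. - l x" S]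
    unfolding one_sided_def by (metis neg_0_le_iff_le subsetD)
qed

text \<open>As long as \<open>l\<close> takes both signs on the generators, the cone is starred on
  the ray where the face from \<open>p\<close> to \<open>q\<close> meets the hyperplane; rationality
  provides a lattice point there. Each piece exchanges \<open>p\<close> or \<open>q\<close> for a
  zero of \<open>l\<close>.\<close>

lemma dissection_by_functional:
  assumes l: "linear l" and rat: "\<And>x. x \<in> L \<Longrightarrow> l x \<in> \<rat>" and "good S"
  shows "\<exists>D. dissection (convex_cone hull S) D \<and> (\<forall>T\<in>D. one_sided l T)"
  using assms(3)
proof (induction "card {v\<in>S. l v \<noteq> 0}" arbitrary: S rule: less_induct)
  case less
  note S' = goodD[OF less.prems]
  show ?case
  proof (cases "one_sided l S")
    case True
    then show ?thesis using dissection_self[OF less.prems] by blast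
  next
    case False
    then obtain p q where pq: "p \<in> S" "q \<in> S" "l p > 0" "l q < 0"
      unfolding one_sided_def by (meson not_le)
    obtain a b :: int where ab: "b > 0" "l p = of_int a / of_int b"
      using rat[of p] pq S' by (auto elim!: Rats_cases')
    obtain c d :: int where cd: "d > 0" "l q = of_int c / of_int d"
      using rat[of q] pq S' by (auto elim!: Rats_cases')
    have "a > 0" "c < 0" using ab cd pq by (auto simp: zero_less_divide_iff divide_less_0_iff)
    \<comment> \<open>Denominators are cleared: \<open>- c * b\<close> and \<open>a * d\<close> are
      positive integers that balance the values of \<open>l\<close> at \<open>p\<close> and
      \<open>q\<close>.\<close>
    define i where "i = real_of_int (- c * b)"
    define j where "j = real_of_int (a * d)"
    have ij: "i > 0" "j > 0" "i \<in> \<int>" "j \<in> \<int>" "i * l p + j * l q = 0"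
      using ab cd \<open>a > 0\<close> \<open>c < 0\<close> by (auto simp: i_def j_def mult_neg_pos)
    define w where "w = i *\<^sub>R p + j *\<^sub>R q"
    have lw: "l w = 0" using ij by (simp add: w_def linear_add[OF l] linear_scale[OF l])
    have pq_ne: "p \<noteq> q" using pq by auto
    have rep: "representation S w v = (if v = p then i else if v = q then j else 0)" if "v \<in> S" for v
      unfolding w_def using S' pq pq_ne by (simp add: representation_add representation_scale representation_basis)
    have w: "w \<in> L" unfolding w_def using ij S' pq by (auto intro: add_L scale_L)
    have w0: "w \<noteq> 0" using rep[OF pq(1)] ij by (auto simp: representation_zero)
    define D where "D = (\<lambda>v. insert w (S - {v})) ` {v\<in>S. representation S w v > 0}"
    have D: "dissection (convex_cone hull S) D"
      unfolding D_def
      using rep ij by (intro dissection_star[OF less.prems w w0]) (auto simp: nonneg_at_def)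
    have "\<exists>E. dissection (convex_cone hull T) E \<and> (\<forall>U\<in>E. one_sided l U)" if TD: "T \<in> D" for T
    proof (rule less.hyps)
      show "good T" using dissectionD(2)[OF D TD] .
      obtain v where v: "v \<in> S" "representation S w v > 0" "T = insert w (S - {v})" using TD unfolding D_def by blast
      have vpq: "v = p \<or> v = q" using rep[OF v(1)] v by (auto split: if_splits)
      have "{u\<in>T. l u \<noteq> 0} \<subset> {v\<in>S. l v \<noteq> 0}"
      proof -
        have "{u\<in>T. l u \<noteq> 0} \<subseteq> {v\<in>S. l v \<noteq> 0}" "v \<notin> {u\<in>T. l u \<noteq> 0}" using lw v by auto
        moreover have "v \<in> {v\<in>S. l v \<noteq> 0}" using vpq pq by auto
        ultimately show ?thesis by blast
      qed
      then show "card {u\<in>T. l u \<noteq> 0} < card {v\<in>S. l v \<noteq> 0}" using S' by (intro psubset_card_mono) auto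
    qed
    then obtain E where "\<And>T. T \<in> D \<Longrightarrow> dissection (convex_cone hull T) (E T) \<and> (\<forall>U\<in>E T. one_sided l U)"
      by metis
    then show ?thesis using dissection_trans[OF D, of E] by blast
  qed
qed

lemma dissection_by_functionals:
  assumes "finite Q" "\<And>l. l \<in> Q \<Longrightarrow> linear l" "\<And>l x. l \<in> Q \<Longrightarrow> x \<in> L \<Longrightarrow> l x \<in> \<rat>" and "good S"
  shows "\<exists>D. dissection (convex_cone hull S) D \<and> (\<forall>T\<in>D. \<forall>l\<in>Q. one_sided l T)"
  using assms(1-3)
proof (induction Q rule: finite_induct)
  case empty
  then show ?case using dissection_self[OF assms(4)] by blast
next
  case (insert l Q)
  then obtain D where D: "dissection (convex_cone hull S) D" "\<forall>T\<in>D. \<forall>l\<in>Q. one_sided l T" by auto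
  have "\<exists>E. dissection (convex_cone hull T) E \<and> (\<forall>U\<in>E. one_sided l U)" if "T \<in> D" for T
    using dissection_by_functional[of l T] insert.prems dissectionD(2)[OF D(1) that] by auto
  then obtain E where E: "\<And>T. T \<in> D \<Longrightarrow> dissection (convex_cone hull T) (E T) \<and> (\<forall>U\<in>E T. one_sided l U)"
    by metis
  have "one_sided l' U" if "U \<in> E T" "T \<in> D" "l' \<in> Q" for l' U T
  proof (rule one_sided_sub)
    show "linear l'" using insert.prems that by auto
    show "good T" using dissectionD(2)[OF D(1) that(2)] .
    show "one_sided l' T" using D that by auto
    show "U \<subseteq> convex_cone hull T"
      using dissectionD(5)[of "convex_cone hull T" "E T" U] E[OF that(2)] that hull_subset[of U convex_cone] by blast
  qed
  then show ?case using dissection_trans[OF D(1), of E] E by blast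
qed

text \<open>Up to sign, the coordinate is a quotient of two indices.\<close>

lemma representation_rational:
  assumes "good S" "x \<in> L" "v \<in> S"
  shows "representation S x v \<in> \<rat>"
proof (cases "representation S x v = 0")
  case False
  have "\<bar>representation S x v\<bar> = real (idx (insert x (S - {v}))) / real (idx S)"
    using good_replace(2)[OF assms(1,3,2) False] idx(2)[OF assms(1)] by (simp add: field_simps)
  then have "\<bar>representation S x v\<bar> \<in> \<rat>" by simp
  then show ?thesis by (simp add: abs_if split: if_splits)
qed simp

text \<open>The new cone is cut along all facet hyperplanes of the cones already obtained. A piece
  that is not contained in such a cone lies on the wrong side of one of its facets and misses its
  interior, so the pieces outside can simply be added.\<close>

lemma dissection_Union:
  assumes "finite \<B>" "\<And>S. S \<in> \<B> \<Longrightarrow> good S"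
  shows "\<exists>D. dissection (\<Union>S\<in>\<B>. convex_cone hull S) D"
  using assms
proof (induction \<B> rule: finite_induct)
  case empty
  then show ?case by (intro exI[of _ "{}"]) (simp add: dissection_def)
next
  case (insert S \<B>)
  then obtain D where D: "dissection (\<Union>S\<in>\<B>. convex_cone hull S) D" by auto
  have gS: "good S" using insert.prems by auto
  let ?Q = "\<Union>T\<in>D. (\<lambda>v x. representation T x v) ` T"
  have "\<exists>E. dissection (convex_cone hull S) E \<and> (\<forall>P\<in>E. \<forall>l\<in>?Q. one_sided l P)"
  proof (rule dissection_by_functionals[OF _ _ _ gS])
    show "finite ?Q" using dissectionD(1,2)[OF D] goodD(4) by auto
    show "linear l" if "l \<in> ?Q" for l
      using that dissectionD(2)[OF D] goodD(2,3) by (auto intro!: linear_representation_basis)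
    show "l x \<in> \<rat>" if "l \<in> ?Q" "x \<in> L" for l x
      using that dissectionD(2)[OF D] by (auto intro!: representation_rational)
  qed
  then obtain E where E0: "dissection (convex_cone hull S) E" "\<forall>P\<in>E. \<forall>l\<in>?Q. one_sided l P" by blast
  have E2: "one_sided (\<lambda>x. representation T x v) P"
    if "P \<in> E" "T \<in> D" "v \<in> T" for P T v
    using E0 that by auto
  \<comment> \<open>Pieces inside a cone of \<open>D\<close> are covered already and are
    discarded.\<close>
  define E' where "E' = {P\<in>E. \<not> (\<exists>T\<in>D. convex_cone hull P \<subseteq> convex_cone hull T)}"
  have disj: "\<not> (pos_at P x \<and> pos_at T x)" if P: "P \<in> E'" and T: "T \<in> D" for P T x
  proof
    assume x: "pos_at P x \<and> pos_at T x"
    have gP: "good P" and gT: "good T" using P T dissectionD(2)[OF E0(1)] dissectionD(2)[OF D] by (auto simp: E'_def)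
    obtain y where y: "y \<in> convex_cone hull P" "\<not> nonneg_at T y"
      using P T good_cone[OF gT] unfolding E'_def by blast
    then obtain v where v: "v \<in> T" "representation T y v < 0" by (auto simp: nonneg_at_def not_le)
    have lin: "linear (\<lambda>x. representation T x v)" "linear (\<lambda>x. - representation T x v)"
      using linear_representation_basis[of T v] goodD[OF gT] by (auto intro: linear_compose_neg)
    have "\<not> (\<forall>u\<in>P. representation T u v \<ge> 0)"
      using linear_sign_on_cone[OF lin(1) gP y(1)] v by force
    then have neg: "\<forall>u\<in>P. representation T u v \<le> 0"
      using E2[of P T v] P T v unfolding E'_def one_sided_def by auto
    have "x \<in> convex_cone hull P" using x good_cone[OF gP] by (auto simp: pos_at_def nonneg_at_def less_imp_le)
    then have "representation T x v \<le> 0" using linear_sign_on_cone[OF lin(2) gP] neg by force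
    then show False using x v by (auto simp: pos_at_def)
  qed
  have "dissection (\<Union>S\<in>insert S \<B>. convex_cone hull S) (D \<union> E')"
    unfolding dissection_def
  proof (intro conjI)
    show "finite (D \<union> E')" using dissectionD(1)[OF D] dissectionD(1)[OF E0(1)] by (simp add: E'_def)
    show "\<forall>T\<in>D \<union> E'. good T" using dissectionD(2)[OF D] dissectionD(2)[OF E0(1)] by (auto simp: E'_def)
    show "(\<Union>S\<in>insert S \<B>. convex_cone hull S) = (\<Union>T\<in>D \<union> E'. convex_cone hull T)"
    proof (intro equalityI subsetI)
      fix x assume "x \<in> (\<Union>S\<in>insert S \<B>. convex_cone hull S)"
      then have "x \<in> (\<Union>T\<in>D. convex_cone hull T) \<or> x \<in> (\<Union>T\<in>E. convex_cone hull T)"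
        unfolding dissectionD(3)[OF D, symmetric] dissectionD(3)[OF E0(1), symmetric] by auto
      then show "x \<in> (\<Union>T\<in>D \<union> E'. convex_cone hull T)" unfolding E'_def by blast
    next
      fix x assume "x \<in> (\<Union>T\<in>D \<union> E'. convex_cone hull T)"
      then have "x \<in> (\<Union>T\<in>D. convex_cone hull T) \<or> x \<in> (\<Union>T\<in>E. convex_cone hull T)"
        unfolding E'_def by blast
      then show "x \<in> (\<Union>S\<in>insert S \<B>. convex_cone hull S)"
        unfolding dissectionD(3)[OF D, symmetric] dissectionD(3)[OF E0(1), symmetric] by auto
    qed
    show "\<forall>T\<in>D \<union> E'. \<forall>T'\<in>D \<union> E'. \<forall>x. pos_at T x \<and> pos_at T' x \<longrightarrow> T = T'"
      using disj dissectionD(4)[OF D] dissectionD(4)[OF E0(1)] unfolding E'_def by blast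
  qed
  then show ?case by blast
qed

text \<open>By Caratheodory the cone is the union of the cones on bases chosen among its generators.
  These overlap; \<open>dissection_Union\<close> removes the overlaps and \<open>resolution\<close>
  makes the pieces basic.\<close>

lemma basic_dissection_exists:
  assumes "full_rational_cone L \<Lambda>"
  shows "\<exists>D. dissection \<Lambda> D \<and> (\<forall>T\<in>D. Zbasis L T)"
proof -
  obtain S where S: "finite S" "S \<subseteq> L" "\<Lambda> = convex_cone hull S" "dim \<Lambda> = CARD('n)"
    using assms by (auto simp: full_rational_cone_def)
  have "span \<Lambda> = UNIV" using S(4) dim_eq_full[of \<Lambda>] by simp
  moreover have "\<Lambda> \<subseteq> span S"
    unfolding S(3) convex_cone_hull_finite[OF S(1)] by (auto intro!: span_sum intro: span_scale span_base)
  ultimately have spS: "span S = UNIV" by (metis UNIV_eq_I span_minimal subspace_span top.extremum_uniqueI)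
  define \<B> where "\<B> = {T. T \<subseteq> S \<and> good T}"
  have "\<Lambda> = (\<Union>T\<in>\<B>. convex_cone hull T)"
  proof (intro equalityI subsetI)
    fix x assume "x \<in> \<Lambda>"
    then obtain T where T: "T \<subseteq> S" "independent T" "x \<in> convex_cone hull T"
      using conic_caratheodory S by metis
    obtain T' where T': "T \<subseteq> T'" "T' \<subseteq> S" "independent T'" "S \<subseteq> span T'"
      using maximal_independent_subset_extend[OF T(1,2)] by blast
    have "span T' = UNIV" using T'(4) spS by (metis UNIV_eq_I span_minimal subspace_span top.extremum_uniqueI)
    then have "T' \<in> \<B>" unfolding \<B>_def good_def using T' S by auto
    then show "x \<in> (\<Union>T\<in>\<B>. convex_cone hull T)" using T(3) hull_mono[OF T'(1)] by blast
  next
    fix x assume "x \<in> (\<Union>T\<in>\<B>. convex_cone hull T)"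
    then show "x \<in> \<Lambda>" unfolding \<B>_def S(3) using hull_mono by blast
  qed
  moreover have "finite \<B>" unfolding \<B>_def using S(1) by simp
  moreover have "good T" if "T \<in> \<B>" for T using that by (simp add: \<B>_def)
  ultimately obtain D where D: "dissection \<Lambda> D" using dissection_Union[of \<B>] by metis
  have "\<exists>E. dissection (convex_cone hull T) E \<and> (\<forall>U\<in>E. Zbasis L U)" if "T \<in> D" for T
    using resolution dissectionD(2)[OF D that] .
  then obtain E where "\<And>T. T \<in> D \<Longrightarrow> dissection (convex_cone hull T) (E T) \<and> (\<forall>U\<in>E T. Zbasis L U)"
    by metis
  then show ?thesis using dissection_trans[OF D, of E] by blast
qed

text \<open>Interiors of different pieces are disjoint, so no point is counted twice.\<close>

lemma dissection_pos_count:
  assumes D: "dissection \<Lambda> D" and D': "D' \<subseteq> D"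
  shows "(\<Sum>T\<in>D'. of_bool (pos_at T x)) = (of_bool (\<exists>T\<in>D'. pos_at T x) :: real)"
proof (cases "\<exists>T\<in>D'. pos_at T x")
  case True
  then obtain T where T: "T \<in> D'" "pos_at T x" by auto
  have "(\<Sum>T\<in>D'. of_bool (pos_at T x)) = (\<Sum>U\<in>D'. if U = T then 1 else (0::real))"
    using dissectionD(4)[OF D _ _ _ T(2)] D' T by (intro sum.cong) auto
  then show ?thesis using True T dissectionD(1)[OF D] D' by (simp add: finite_subset)
qed auto

text \<open>At a generic point, lying in a closed piece and lying in its interior are the
  same.\<close>

lemma dissection_pos_iff:
  assumes D: "dissection \<Lambda> D" and gen: "\<And>T. T \<in> D \<Longrightarrow> generic_at T x"
  shows "(\<exists>T\<in>D. pos_at T x) \<longleftrightarrow> x \<in> \<Lambda>"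
proof -
  have "pos_at T x \<longleftrightarrow> x \<in> convex_cone hull T" if "T \<in> D" for T
    using good_cone[OF dissectionD(2)[OF D that]] gen[OF that]
    by (force simp: nonneg_at_def generic_at_def pos_at_def less_le)
  then show ?thesis using dissectionD(3)[OF D] by auto
qed

text \<open>Names the orthant of \<open>B\<close> that contains the cone on \<open>T\<close>;
  meaningful when no coordinate hyperplane cuts through the cone.\<close>

definition coordinate_signs :: "(real^'n) set \<Rightarrow> (real^'n) set" where
  "coordinate_signs T = {b\<in>B. \<forall>v\<in>T. representation B v b \<ge> 0}"

text \<open>Since \<open>T\<close> spans the space, no coordinate functional of \<open>B\<close>
  vanishes on all of \<open>T\<close>. If it does not change sign on \<open>T\<close>, it is
  therefore strictly positive or strictly negative at an interior point.\<close>

lemma coordinate_signs_at: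
  assumes T: "good T" and os: "\<And>b. b \<in> B \<Longrightarrow> one_sided (\<lambda>x. representation B x b) T" and x: "pos_at T x"
  shows "coordinate_signs T = {b\<in>B. representation B x b > 0}" "b \<in> B \<Longrightarrow> representation B x b \<noteq> 0"
proof -
  note T' = goodD[OF T]
  have lin: "linear (\<lambda>x. representation B x b)" for b using B by (rule linear_representation_basis)
  have ex: "(\<Sum>v\<in>T. representation T x v * representation B v b) = representation B x b" for b
  proof -
    have "representation B (\<Sum>v\<in>T. representation T x v *\<^sub>R v) b = (\<Sum>v\<in>T. representation T x v * representation B v b)"
      by (simp add: linear_sum[OF lin] linear_scale[OF lin])
    then show ?thesis using T' by (simp add: representation_sum_eq)
  qed
  have nz: "\<exists>v\<in>T. representation B v b \<noteq> 0" if "b \<in> B" for b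
  proof (rule ccontr)
    assume "\<not> ?thesis"
    then have "T \<subseteq> span (B - {b})" using B that representation_eq_0_iff[of B] by auto
    then have "span T \<subseteq> span (B - {b})" by (intro span_minimal) auto
    then have "b \<in> span (B - {b})" using T' by auto
    then show False using B that by (auto simp: dependent_def)
  qed
  have iff: "(\<forall>v\<in>T. representation B v b \<ge> 0) \<longleftrightarrow> representation B x b > 0" if b: "b \<in> B" for b
  proof
    assume *: "\<forall>v\<in>T. representation B v b \<ge> 0"
    obtain v where v: "v \<in> T" "representation B v b \<noteq> 0" using nz[OF b] by auto
    then have "representation T x v * representation B v b > 0"
      using x * by (intro mult_pos_pos) (auto simp: pos_at_def less_le)
    then have "(\<Sum>v\<in>T. representation T x v * representation B v b) > 0"
      using T' x * by (intro sum_pos2[OF _ v(1)]) (auto simp: pos_at_def less_imp_le)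
    then show "representation B x b > 0" by (simp add: ex)
  next
    assume *: "representation B x b > 0"
    show "\<forall>v\<in>T. representation B v b \<ge> 0"
    proof (rule ccontr)
      assume "\<not> ?thesis"
      then have "\<forall>v\<in>T. representation B v b \<le> 0" using os[OF b] by (auto simp: one_sided_def)
      then have "(\<Sum>v\<in>T. representation T x v * representation B v b) \<le> 0"
        using x by (intro sum_nonpos mult_nonneg_nonpos) (auto simp: pos_at_def less_imp_le)
      then show False using * by (simp add: ex)
    qed
  qed
  then show "coordinate_signs T = {b\<in>B. representation B x b > 0}" unfolding coordinate_signs_def by auto
  show "representation B x b \<noteq> 0" if b: "b \<in> B"
  proof (cases "\<forall>v\<in>T. representation B v b \<ge> 0")
    case True
    then show ?thesis using iff[OF b] by auto
  next
    case False
    then have *: "\<forall>v\<in>T. representation B v b \<le> 0" using os[OF b] by (auto simp: one_sided_def)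
    obtain v where v: "v \<in> T" "representation B v b \<noteq> 0" using nz[OF b] by auto
    have "0 < (\<Sum>v\<in>T. representation T x v * (- representation B v b))"
    proof (rule sum_pos2[OF T'(4) v(1)])
      show "0 < representation T x v * (- representation B v b)"
        using v * x by (intro mult_pos_pos) (auto simp: pos_at_def less_le)
      show "0 \<le> representation T x u * (- representation B u b)" if "u \<in> T" for u
        using that * x by (intro mult_nonneg_nonneg) (auto simp: pos_at_def less_imp_le)
    qed
    then show ?thesis using ex[of b] by (simp add: sum_negf)
  qed
qed

text \<open>An interior point of \<open>T\<close> is off the coordinate hyperplanes, so its signs
  alone decide the orthant of every uncut cone through it.\<close>

lemma coordinate_signs_eq:
  assumes T: "good T" "\<And>b. b \<in> B \<Longrightarrow> one_sided (\<lambda>x. representation B x b) T" "pos_at T x"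
    and U: "good U" "\<And>b. b \<in> B \<Longrightarrow> one_sided (\<lambda>x. representation B x b) U" "x \<in> convex_cone hull U"
  shows "coordinate_signs U = coordinate_signs T"
proof -
  have lin: "linear (\<lambda>x. representation B x b)" "linear (\<lambda>x. - representation B x b)" for b
    using linear_representation_basis[OF B, of b] by (auto intro: linear_compose_neg)
  have "b \<in> coordinate_signs U \<longleftrightarrow> representation B x b > 0" if b: "b \<in> B" for b
  proof (cases "b \<in> coordinate_signs U")
    case True
    then have "representation B x b \<ge> 0"
      using linear_sign_on_cone[OF lin(1) U(1,3)] by (auto simp: coordinate_signs_def)
    then show ?thesis using True coordinate_signs_at(2)[OF T b] by simp
  next
    case False
    then have "\<forall>v\<in>U. representation B v b \<le> 0"
      using U(2)[OF b] b by (auto simp: coordinate_signs_def one_sided_def)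
    then have "- representation B x b \<ge> 0"
      using linear_sign_on_cone[OF lin(2) U(1,3), of b] by auto
    then show ?thesis using False by simp
  qed
  moreover have "coordinate_signs U \<subseteq> B" by (auto simp: coordinate_signs_def)
  ultimately show ?thesis using coordinate_signs_at(1)[OF T] by auto
qed

text \<open>The cocycle relations are only available inside an open half space. Cones cut along the coordinate
  hyperplanes of \<open>B\<close> that lie in the same orthant share one.\<close>

lemma orthant_functional:
  obtains \<phi> where "\<And>T v. good T \<Longrightarrow> (\<And>b. b \<in> B \<Longrightarrow> one_sided (\<lambda>x. representation B x b) T) \<Longrightarrow>
    coordinate_signs T = \<sigma> \<Longrightarrow> v \<in> T \<Longrightarrow> \<phi> \<bullet> v > 0"
proof -
  have finB: "finite B" using goodD[OF Zbasis_good[OF ZbasisB]] by auto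
  define l where "l x = (\<Sum>b\<in>B. (if b \<in> \<sigma> then 1 else -1) * representation B x b)" for x
  have "linear l"
    using B by (intro linearI)
      (simp_all add: l_def representation_add representation_scale sum.distrib sum_distrib_left algebra_simps)
  then obtain \<phi> where \<phi>: "\<And>x. l x = \<phi> \<bullet> x" using linear_as_inner by blast
  show ?thesis
  proof
    fix T v assume T: "good T" and os: "\<And>b. b \<in> B \<Longrightarrow> one_sided (\<lambda>x. representation B x b) T"
      and \<sigma>: "coordinate_signs T = \<sigma>" and v: "v \<in> T"
    have "v \<noteq> 0" using v goodD(2)[OF T] dependent_zero by blast
    moreover have "(\<Sum>b\<in>B. representation B v b *\<^sub>R b) = v" using B by (simp add: representation_sum_eq)
    ultimately obtain b where b: "b \<in> B" "representation B v b \<noteq> 0"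
      by (metis (no_types, lifting) scale_zero_left sum.neutral)
    have sgn: "(if b \<in> \<sigma> then 1 else -1) * representation B v b = \<bar>representation B v b\<bar>" if "b \<in> B" for b
      using os[OF that] v that unfolding \<sigma>[symmetric] coordinate_signs_def one_sided_def by auto
    have "l v = (\<Sum>b\<in>B. \<bar>representation B v b\<bar>)" unfolding l_def using sgn by simp
    also have "\<dots> > 0" using b finB by (intro sum_pos2[OF _ b(1)]) auto
    finally show "\<phi> \<bullet> v > 0" using \<phi> by simp
  qed
qed

end

section \<open>Independence of the dissection\<close>

context cone_symbol
begin

text \<open>\<open>cone_relation\<close> with weight 1 on the first family and -1 on the second. The
  boolean tags keep apart the two occurrences of a cone that belongs to both.\<close>

lemma pointed_relation:
  assumes fin: "finite D1" "finite D2" and g: "\<And>T. T \<in> D1 \<union> D2 \<Longrightarrow> good T"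
    and \<phi>: "\<And>T v. T \<in> D1 \<union> D2 \<Longrightarrow> v \<in> T \<Longrightarrow> \<phi> \<bullet> v > 0"
    and count: "\<And>x. (\<And>T. T \<in> D1 \<union> D2 \<Longrightarrow> generic_at T x) \<Longrightarrow>
      (\<Sum>T\<in>D1. of_bool (pos_at T x)) = (\<Sum>T\<in>D2. of_bool (pos_at T x) :: real)"
  shows "sum F D1 - sum F D2 \<in> R"
proof -
  define I where "I = (Pair True ` D1) \<union> (Pair False ` D2)"
  define s where "s i = (if fst i then 1 else - 1 :: real)" for i :: "bool \<times> (real^'n) set"
  have split: "(\<Sum>i\<in>I. h i) = (\<Sum>T\<in>D1. h (True, T)) + (\<Sum>T\<in>D2. h (False, T))" for h :: "_ \<Rightarrow> 'z::comm_monoid_add"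
    unfolding I_def using fin by (subst sum.union_disjoint) (auto simp: sum.reindex inj_on_def)
  have "(\<Sum>i\<in>I. sg (s i) (F (snd i))) \<in> R"
  proof (rule cone_relation[OF subspace_UNIV F_cocycles[of \<phi>]])
    show "finite I" using fin by (simp add: I_def)
    show "independent (snd i) \<and> snd i \<subseteq> {x \<in> L. 0 < \<phi> \<bullet> x} \<and> span (snd i) = UNIV" if "i \<in> I" for i
    proof -
      have "snd i \<in> D1 \<union> D2" using that by (auto simp: I_def)
      then show ?thesis using g[of "snd i"] \<phi>[of "snd i"] by (auto simp: good_def)
    qed
    show "(\<Sum>i\<in>I. sgn (s i) * of_bool (pos_at (snd i) x)) = 0" if "\<forall>i\<in>I. generic_at (snd i) x" for x
    proof -
      have "generic_at T x" if "T \<in> D1 \<union> D2" for T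
      proof -
        have "(True, T) \<in> I \<or> (False, T) \<in> I" using that by (auto simp: I_def)
        then show ?thesis using \<open>\<forall>i\<in>I. generic_at (snd i) x\<close> by (metis snd_conv)
      qed
      then show ?thesis using count[of x] unfolding split by (simp add: s_def sum_negf)
    qed
  qed
  then show ?thesis unfolding split by (simp add: s_def sum_negf)
qed

text \<open>A simplicial cone is pointed: the sum of the coordinates is positive on its nonzero
  points, hence on the generators of all pieces.\<close>

lemma dissection_cone_relation:
  assumes S: "good S" and E: "dissection (convex_cone hull S) E"
  shows "F S - sum F E \<in> R"
proof -
  note S' = goodD[OF S]
  have lin: "linear (\<lambda>x. \<Sum>v\<in>S. representation S x v)"
    using linear_representation_basis[OF S'(2,3)] by (intro linear_compose_sum) auto
  then obtain \<phi> where \<phi>: "\<And>x. (\<Sum>v\<in>S. representation S x v) = \<phi> \<bullet> x" using linear_as_inner by blast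
  have S\<phi>: "\<phi> \<bullet> v > 0" if "v \<in> S" for v
    unfolding \<phi>[symmetric] using that S' by (simp add: representation_basis)
  have "sum F {S} - sum F E \<in> R"
  proof (rule pointed_relation[where \<phi> = \<phi>])
    show "finite E" using dissectionD(1)[OF E] .
    show gd: "good T" if "T \<in> {S} \<union> E" for T using that S dissectionD(2)[OF E] by auto
    show "\<phi> \<bullet> v > 0" if T: "T \<in> {S} \<union> E" and v: "v \<in> T" for T v
    proof (cases "T = S")
      case False
      then have "v \<in> convex_cone hull S"
        using T v dissectionD(5)[OF E, of T] hull_subset[of T convex_cone] by auto
      moreover have "v \<noteq> 0" using v goodD(2)[OF gd[OF T]] dependent_zero by blast
      ultimately show ?thesis
        using positive_combination[OF S S\<phi>, of v] good_cone[OF S] by (auto simp: nonneg_at_def)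
    qed (use S\<phi> v in auto)
    show "(\<Sum>T\<in>{S}. of_bool (pos_at T x)) = (\<Sum>T\<in>E. of_bool (pos_at T x) :: real)"
      if "\<And>T. T \<in> {S} \<union> E \<Longrightarrow> generic_at T x" for x
      using dissection_pos_count[OF dissection_self[OF S] subset_refl, of x] dissection_pos_count[OF E subset_refl, of x]
        dissection_pos_iff[OF dissection_self[OF S], of x] dissection_pos_iff[OF E, of x] that by auto
  qed simp
  then show ?thesis by simp
qed

text \<open>No piece \<open>U\<close> occurs twice, since the sum of its generators would be
  interior to two different cones of \<open>D\<close>.\<close>

lemma sum_dissection_Union:
  assumes D: "dissection \<Lambda> D" and E: "\<And>T. T \<in> D \<Longrightarrow> dissection (convex_cone hull T) (E T)"
  shows "sum h (\<Union>T\<in>D. E T) = (\<Sum>T\<in>D. sum h (E T))"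
proof (rule sum.UNION_disjoint)
  show "finite D" using dissectionD(1)[OF D] .
  show "\<forall>T\<in>D. finite (E T)" using dissectionD(1)[OF E] by blast
  have "T = T'" if "T \<in> D" "T' \<in> D" "U \<in> E T" "U \<in> E T'" for T T' U
  proof -
    have g: "good U" "good T" "good T'" using that dissectionD(2)[OF E] dissectionD(2)[OF D] by blast+
    have "convex_cone hull U \<subseteq> convex_cone hull T" "convex_cone hull U \<subseteq> convex_cone hull T'"
      using that dissectionD(5)[OF E] by blast+
    then have "pos_at T (\<Sum>U)" "pos_at T' (\<Sum>U)"
      using good_cone_mono_pos g good_pos_sum[OF g(1)] by blast+
    then show ?thesis using dissectionD(4)[OF D] that by blast
  qed
  then show "\<forall>T\<in>D. \<forall>T'\<in>D. T \<noteq> T' \<longrightarrow> E T \<inter> E T' = {}" by blast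
qed

lemma orthant_dissection:
  assumes D: "dissection \<Lambda> D"
  obtains E where "dissection \<Lambda> E" "sum F D - sum F E \<in> R"
    "\<And>T b. T \<in> E \<Longrightarrow> b \<in> B \<Longrightarrow> one_sided (\<lambda>x. representation B x b) T"
proof -
  let ?Q = "(\<lambda>b x. representation B x b) ` B"
  have "\<exists>E. dissection (convex_cone hull T) E \<and> (\<forall>U\<in>E. \<forall>l\<in>?Q. one_sided l U)" if "T \<in> D" for T
  proof (rule dissection_by_functionals)
    show "finite ?Q" using goodD(4)[OF Zbasis_good[OF ZbasisB]] by simp
    show "linear l" if "l \<in> ?Q" for l using that linear_representation_basis[OF B] by auto
    show "l x \<in> \<rat>" if "l \<in> ?Q" "x \<in> L" for l x using that by (auto simp: mem_L Ints_subset_Rats[THEN subsetD])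
    show "good T" using dissectionD(2)[OF D that] .
  qed
  then obtain E where E: "\<And>T. T \<in> D \<Longrightarrow> dissection (convex_cone hull T) (E T) \<and> (\<forall>U\<in>E T. \<forall>l\<in>?Q. one_sided l U)"
    by metis
  show ?thesis
  proof
    show "dissection \<Lambda> (\<Union>T\<in>D. E T)" using dissection_trans[OF D] E by blast
    have "(\<Sum>T\<in>D. F T) - (\<Sum>T\<in>D. sum F (E T)) \<in> R"
      using E dissection_cone_relation dissectionD(2)[OF D] by (intro sum_diff_mem) blast
    moreover have "sum F (\<Union>T\<in>D. E T) = (\<Sum>T\<in>D. sum F (E T))"
      using E by (intro sum_dissection_Union[OF D]) blast
    ultimately show "sum F D - sum F (\<Union>T\<in>D. E T) \<in> R" by simp
    show "one_sided (\<lambda>x. representation B x b) U" if "U \<in> (\<Union>T\<in>D. E T)" "b \<in> B" for U b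
      using that E by blast
  qed
qed

text \<open>Cutting every piece along the coordinate hyperplanes of \<open>B\<close> does not change
  the values, by \<open>dissection_cone_relation\<close>. The pieces in one orthant share a half
  space, and those of the two dissections have the same indicator function at generic
  points.\<close>

theorem dissection_independent:
  assumes "dissection \<Lambda> D1" "dissection \<Lambda> D2"
  shows "sum F D1 - sum F D2 \<in> R"
proof -
  obtain E1 where E1: "dissection \<Lambda> E1" "sum F D1 - sum F E1 \<in> R"
    and os1: "\<And>T b. T \<in> E1 \<Longrightarrow> b \<in> B \<Longrightarrow> one_sided (\<lambda>x. representation B x b) T"
    using orthant_dissection[OF assms(1)] by blast
  obtain E2 where E2: "dissection \<Lambda> E2" "sum F D2 - sum F E2 \<in> R"
    and os2: "\<And>T b. T \<in> E2 \<Longrightarrow> b \<in> B \<Longrightarrow> one_sided (\<lambda>x. representation B x b) T"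
    using orthant_dissection[OF assms(2)] by blast
  have fin: "finite E1" "finite E2" using dissectionD(1) E1 E2 by auto
  have g: "good T" if "T \<in> E1 \<union> E2" for T using that dissectionD(2) E1(1) E2(1) by blast
  have os: "one_sided (\<lambda>x. representation B x b) T" if "T \<in> E1 \<union> E2" "b \<in> B" for T b using that os1 os2 by auto
  define \<Sigma> where "\<Sigma> = coordinate_signs ` (E1 \<union> E2)"
  have group: "sum h E = (\<Sum>\<sigma>\<in>\<Sigma>. sum h {T\<in>E. coordinate_signs T = \<sigma>})"
    if "E \<subseteq> E1 \<union> E2" for E and h :: "_ \<Rightarrow> 'b"
    using that fin by (intro sum.group[symmetric]) (auto simp: \<Sigma>_def intro: finite_subset)
  have "sum F {T\<in>E1. coordinate_signs T = \<sigma>} - sum F {T\<in>E2. coordinate_signs T = \<sigma>} \<in> R" for \<sigma>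
  proof -
    obtain \<phi> where \<phi>: "\<And>T v. good T \<Longrightarrow> (\<And>b. b \<in> B \<Longrightarrow> one_sided (\<lambda>x. representation B x b) T) \<Longrightarrow>
      coordinate_signs T = \<sigma> \<Longrightarrow> v \<in> T \<Longrightarrow> \<phi> \<bullet> v > 0"
      using orthant_functional[of \<sigma>] by blast
    \<comment> \<open>A point interior to a piece of one dissection lies in some piece of the other,
      and that piece belongs to the same orthant. Genericity moves the point into its
      interior.\<close>
    have transfer: "\<exists>U\<in>E'. coordinate_signs U = \<sigma> \<and> pos_at U x"
      if E: "dissection \<Lambda> E" "dissection \<Lambda> E'" and sub: "E \<subseteq> E1 \<union> E2" "E' \<subseteq> E1 \<union> E2"
        and T: "T \<in> E" "coordinate_signs T = \<sigma>" "pos_at T x"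
        and gen: "\<And>U. U \<in> E' \<Longrightarrow> coordinate_signs U = \<sigma> \<Longrightarrow> generic_at U x" for E E' T x
    proof -
      have gT: "good T" using T sub g by auto
      have "x \<in> convex_cone hull T"
        using good_cone[OF gT] T(3) by (auto simp: pos_at_def nonneg_at_def less_imp_le)
      then have "x \<in> \<Lambda>" using dissectionD(5)[OF E(1) T(1)] by blast
      then obtain U where U: "U \<in> E'" "x \<in> convex_cone hull U" using dissectionD(3)[OF E(2)] by auto
      have gU: "good U" using U sub g by auto
      have sU: "coordinate_signs U = \<sigma>"
        using coordinate_signs_eq[OF gT _ T(3) gU _ U(2)] os T(1,2) U(1) sub by blast
      have "nonneg_at U x" using good_cone[OF gU] U by simp
      then have "pos_at U x" using gen[OF U(1) sU] by (force simp: nonneg_at_def generic_at_def pos_at_def less_le)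
      then show ?thesis using U sU by blast
    qed
    show ?thesis
    proof (rule pointed_relation[where \<phi> = \<phi>])
      show "finite {T\<in>E1. coordinate_signs T = \<sigma>}" "finite {T\<in>E2. coordinate_signs T = \<sigma>}" using fin by auto
      show "good T" if "T \<in> {T\<in>E1. coordinate_signs T = \<sigma>} \<union> {T\<in>E2. coordinate_signs T = \<sigma>}" for T
        using that g by auto
      show "\<phi> \<bullet> v > 0" if "T \<in> {T\<in>E1. coordinate_signs T = \<sigma>} \<union> {T\<in>E2. coordinate_signs T = \<sigma>}" "v \<in> T" for T v
        using that g os by (intro \<phi>[of T]) auto
      fix x assume gen: "\<And>T. T \<in> {T\<in>E1. coordinate_signs T = \<sigma>} \<union> {T\<in>E2. coordinate_signs T = \<sigma>} \<Longrightarrow> generic_at T x"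
      have "(\<exists>T\<in>{T\<in>E1. coordinate_signs T = \<sigma>}. pos_at T x) \<longleftrightarrow> (\<exists>T\<in>{T\<in>E2. coordinate_signs T = \<sigma>}. pos_at T x)"
        using transfer[OF E1(1) E2(1)] transfer[OF E2(1) E1(1)] gen by blast
      then show "(\<Sum>T\<in>{T\<in>E1. coordinate_signs T = \<sigma>}. of_bool (pos_at T x)) =
          (\<Sum>T\<in>{T\<in>E2. coordinate_signs T = \<sigma>}. of_bool (pos_at T x) :: real)"
        using dissection_pos_count[OF E1(1), of "{T\<in>E1. coordinate_signs T = \<sigma>}" x]
          dissection_pos_count[OF E2(1), of "{T\<in>E2. coordinate_signs T = \<sigma>}" x] by simp
    qed
  qed
  then have "(\<Sum>\<sigma>\<in>\<Sigma>. sum F {T\<in>E1. coordinate_signs T = \<sigma>}) - (\<Sum>\<sigma>\<in>\<Sigma>. sum F {T\<in>E2. coordinate_signs T = \<sigma>}) \<in> R"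
    by (intro sum_diff_mem)
  then have "sum F E1 - sum F E2 \<in> R" using group[of E1 F] group[of E2 F] by simp
  then show ?thesis using E1(2) E2(2) by (metis diff_sym_mem diff_trans_mem)
qed

end

section \<open>Symbols of lattice bases\<close>

text \<open>Groups given by generators and relations, with equality of cosets reduced to membership
  of a difference in \<open>N\<close>. It serves both the group of symbols and the tensor
  product.\<close>

locale free_quotient =
  fixes S :: "'c set" and X :: "('c \<Rightarrow>\<^sub>0 int) set"
  assumes X_sub: "X \<subseteq> carrier (free_Abelian_group S)"
begin

abbreviation "FG \<equiv> free_Abelian_group S"

definition N :: "('c \<Rightarrow>\<^sub>0 int) set" where
  "N = generate FG X"

lemma subgroup_N: "subgroup N FG"
  unfolding N_def using group.generate_is_subgroup[OF group_free_Abelian_group X_sub] .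

lemma N_keys: "c \<in> N \<Longrightarrow> Poly_Mapping.keys c \<subseteq> S"
  using subgroup.mem_carrier[OF subgroup_N] by simp

lemma X_N: "c \<in> X \<Longrightarrow> c \<in> N"
  unfolding N_def by (rule generate.incl)

sublocale add_subgroup N
proof
  show "0 \<in> N" using subgroup.one_closed[OF subgroup_N] by simp
  fix x y assume "x \<in> N" "y \<in> N"
  then have "x \<otimes>\<^bsub>FG\<^esub> inv\<^bsub>FG\<^esub> y \<in> N"
    using subgroup.m_closed[OF subgroup_N] subgroup.m_inv_closed[OF subgroup_N] by blast
  then show "x - y \<in> N" using N_keys[OF \<open>y \<in> N\<close>] by simp
qed

lemma coset_def: "N #>\<^bsub>FG\<^esub> c = {r + c |r. r \<in> N}"
  by (auto simp: r_coset_def)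

lemma coset_eq_iff: "N #>\<^bsub>FG\<^esub> c = N #>\<^bsub>FG\<^esub> d \<longleftrightarrow> c - d \<in> N"
proof
  assume "N #>\<^bsub>FG\<^esub> c = N #>\<^bsub>FG\<^esub> d"
  moreover have "c \<in> N #>\<^bsub>FG\<^esub> c" unfolding coset_def using zero_mem by force
  ultimately obtain r where "r \<in> N" "c = r + d" unfolding coset_def by auto
  then show "c - d \<in> N" by simp
next
  have sub: "N #>\<^bsub>FG\<^esub> c \<subseteq> N #>\<^bsub>FG\<^esub> d" if "c - d \<in> N" for c d
  proof
    fix x assume "x \<in> N #>\<^bsub>FG\<^esub> c"
    then obtain r where r: "r \<in> N" "x = r + c" unfolding coset_def by auto
    then have "x = (r + (c - d)) + d" "r + (c - d) \<in> N" using that add_mem by auto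
    then show "x \<in> N #>\<^bsub>FG\<^esub> d" unfolding coset_def by blast
  qed
  assume "c - d \<in> N"
  then show "N #>\<^bsub>FG\<^esub> c = N #>\<^bsub>FG\<^esub> d" using sub[of c d] sub[of d c] diff_sym_mem by blast
qed

lemma normal_N: "N \<lhd> FG"
  using comm_group.normal_iff_subgroup[OF abelian_free_Abelian_group] subgroup_N by blast

lemma comm_group_quotient: "comm_group (FG Mod N)"
  using comm_group.abelian_FactGroup[OF abelian_free_Abelian_group subgroup_N] .

lemma quotient_carrier: "carrier (FG Mod N) = {N #>\<^bsub>FG\<^esub> c |c. Poly_Mapping.keys c \<subseteq> S}"
  by (auto simp: carrier_FactGroup)

lemma coset_mult:
  assumes "Poly_Mapping.keys c \<subseteq> S" "Poly_Mapping.keys d \<subseteq> S"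
  shows "(N #>\<^bsub>FG\<^esub> c) \<otimes>\<^bsub>FG Mod N\<^esub> (N #>\<^bsub>FG\<^esub> d) = N #>\<^bsub>FG\<^esub> (c + d)"
  using normal.rcos_sum[OF normal_N, of c d] assms by simp

lemma coset_zero: "N #>\<^bsub>FG\<^esub> 0 = N"
  by (simp add: coset_def)

lemma sum_keys:
  fixes c :: "'i \<Rightarrow> 'c \<Rightarrow>\<^sub>0 int"
  shows "(\<And>i. i \<in> I \<Longrightarrow> Poly_Mapping.keys (c i) \<subseteq> S) \<Longrightarrow> Poly_Mapping.keys (sum c I) \<subseteq> S"
  using sum_closed_free_Abelian_group[of I c S] by simp

lemma finprod_coset:
  assumes "\<And>i. i \<in> I \<Longrightarrow> Poly_Mapping.keys (c i) \<subseteq> S"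
  shows "finprod (FG Mod N) (\<lambda>i. N #>\<^bsub>FG\<^esub> c i) I = N #>\<^bsub>FG\<^esub> sum c I"
proof -
  interpret Q: comm_group "FG Mod N" by (rule comm_group_quotient)
  show ?thesis using assms
  proof (induction I rule: infinite_finite_induct)
    case (insert i I)
    then have "finprod (FG Mod N) (\<lambda>i. N #>\<^bsub>FG\<^esub> c i) (insert i I) =
        (N #>\<^bsub>FG\<^esub> c i) \<otimes>\<^bsub>FG Mod N\<^esub> (N #>\<^bsub>FG\<^esub> sum c I)"
      by (subst Q.finprod_insert) (auto simp: quotient_carrier)
    also have "\<dots> = N #>\<^bsub>FG\<^esub> (c i + sum c I)" using insert by (intro coset_mult sum_keys) auto
    finally show ?case using insert by simp
  qed (simp_all add: coset_zero)
qed

end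

text \<open>If a tensor is a sum of terms \<open>e \<otimes> a\<close> over a basis, evaluating
  \<kappa> at the dual basis vector of \<open>e\<close> recovers the entry \<open>a\<close>.\<close>

definition dual_coefficient :: "((real^'n \<Rightarrow> real) \<Rightarrow> 'a) \<Rightarrow> (real^'n) set \<Rightarrow> real^'n \<Rightarrow> 'a" where
  "dual_coefficient \<kappa> S e = \<kappa> (\<lambda>x. representation S x e)"

definition enum_set :: "'v set \<Rightarrow> 'v list" where
  "enum_set S = (SOME es. distinct es \<and> set es = S)"

lemma enum_set: "finite S \<Longrightarrow> distinct (enum_set S)" "finite S \<Longrightarrow> set (enum_set S) = S"
  using someI_ex[OF finite_distinct_list[of S, unfolded conj_commute[of "set _ = _"]]] unfolding enum_set_def by auto

text \<open>The elements of the dual lattice, realised by real linear functionals so that coordinate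
  functionals of different bases live in one space.\<close>

definition integral_on :: "'v::real_vector set \<Rightarrow> ('v \<Rightarrow> real) \<Rightarrow> bool" where
  "integral_on L \<phi> \<longleftrightarrow> linear \<phi> \<and> (\<forall>x\<in>L. \<phi> x \<in> \<int>)"

lemma integral_on_representation: "Zbasis L S \<Longrightarrow> e \<in> S \<Longrightarrow> integral_on L (\<lambda>x. representation S x e)"
  unfolding integral_on_def Zbasis_def using linear_representation_basis by auto

section \<open>Symbols under blow-up and permutation\<close>

context comm_group
begin

text \<open>Adding the \<open>i\<close>-th entry to the differences recovers the old entries, so the
  new entries still generate the group.\<close>

lemma symbols_blowup:
  assumes "as @ bs \<in> symbols G m" "i < length as"
  shows "blowup_entries G as i @ bs \<in> symbols G m"
proof -
  let ?Y = "set (blowup_entries G as i @ bs)" and ?X = "set (as @ bs)"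
  have X: "?X \<subseteq> carrier G" "generate G ?X = carrier G" "length as + length bs = m"
    using assms by (auto simp: symbols_def)
  have ai: "as ! j \<in> carrier G" if "j < length as" for j using X that by auto
  have Y: "?Y \<subseteq> carrier G"
  proof
    fix y assume "y \<in> ?Y"
    then show "y \<in> carrier G" using X ai assms(2) by (auto simp: blowup_entries_def)
  qed
  have sub: "subgroup (generate G ?Y) G" using Y by (rule generate_is_subgroup)
  have inY: "y \<in> generate G ?Y" if "y \<in> ?Y" for y using that by (rule generate.incl)
  have i: "as ! i \<in> generate G ?Y"
    using assms(2) by (intro inY) (auto simp: blowup_entries_def image_iff intro!: bexI[of _ i])
  have "as ! j \<in> generate G ?Y" if j: "j < length as" for j
  proof (cases "j = i")
    case False
    then have "as ! j \<otimes> inv (as ! i) \<in> generate G ?Y"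
      using j by (intro inY) (auto simp: blowup_entries_def image_iff intro!: bexI[of _ j])
    then have "(as ! j \<otimes> inv (as ! i)) \<otimes> as ! i \<in> generate G ?Y" using i subgroup.m_closed[OF sub] by blast
    then show ?thesis using ai j assms(2) by (simp add: m_assoc)
  qed (use i in simp)
  then have "?X \<subseteq> generate G ?Y" using inY by (auto simp: in_set_conv_nth)
  then have "carrier G \<subseteq> generate G ?Y" using generate_subgroup_incl[OF _ sub] X by metis
  then have "generate G ?Y = carrier G" using generate_incl[OF Y] by auto
  then show ?thesis using X Y by (simp add: symbols_def blowup_entries_def)
qed

lemma symbols_permute:
  assumes "as \<in> symbols G m" "\<sigma> permutes {..<m}"
  shows "permute_list \<sigma> as \<in> symbols G m"
proof -
  have "set (permute_list \<sigma> as) = set as" using assms by (intro set_permute_list) (simp add: symbols_def)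
  then show ?thesis using assms by (simp add: symbols_def)
qed

lemma relations_carrier:
  "rels_S G m \<union> rels_M G m \<subseteq> carrier (free_Abelian_group (symbols G m))"
proof -
  have "frag_of (permute_list \<sigma> as) - frag_of as \<in> carrier (free_Abelian_group (symbols G m))"
    if "as \<in> symbols G m" "\<sigma> permutes {..<m}" for \<sigma> as
    using symbols_permute[OF that] that keys_diff[of "frag_of (permute_list \<sigma> as)" "frag_of as"] by auto
  moreover have "frag_of (as @ bs) - (\<Sum>i<length as. frag_of (blowup_entries G as i @ bs)) \<in> carrier (free_Abelian_group (symbols G m))"
    if "as @ bs \<in> symbols G m" for as bs
  proof -
    have "(\<Sum>i<length as. frag_of (blowup_entries G as i @ bs)) \<in> carrier (free_Abelian_group (symbols G m))"
      using symbols_blowup[OF that] by (intro sum_closed_free_Abelian_group) auto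
    then show ?thesis using that keys_diff[of "frag_of (as @ bs)"] by fastforce
  qed
  ultimately show ?thesis unfolding rels_S_def rels_M_def by blast
qed

end

text \<open>\<open>\<kappa> \<phi>\<close> plays the role of the contraction of \<open>\<xi>\<close> along \<open>\<phi>\<close>, for functionals that are integral on \<open>L\<close>.\<close>

locale symbol_lattice = comm_group A + lattice_context L B
  for A :: "('a, 'm) monoid_scheme" (structure) and L B :: "(real^'n) set" +
  fixes \<kappa> :: "(real^'n \<Rightarrow> real) \<Rightarrow> 'a"
  assumes \<kappa>_closed: "integral_on L \<phi> \<Longrightarrow> \<kappa> \<phi> \<in> carrier A"
    and \<kappa>_diff: "integral_on L \<phi> \<Longrightarrow> integral_on L \<psi> \<Longrightarrow> \<kappa> (\<lambda>x. \<phi> x - \<psi> x) = \<kappa> \<phi> \<otimes> inv (\<kappa> \<psi>)"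
    and \<kappa>_generate: "Zbasis L S \<Longrightarrow> generate A (dual_coefficient \<kappa> S ` S) = carrier A"
begin

sublocale Q: free_quotient "symbols A CARD('n)" "rels_S A CARD('n) \<union> rels_M A CARD('n)"
  by unfold_locales (rule relations_carrier)

lemma N_relations: "Q.N = M_relations A CARD('n)"
  by (simp add: Q.N_def M_relations_def)

definition symbol_of :: "(real^'n) list \<Rightarrow> 'a list" where
  "symbol_of es = map (dual_coefficient \<kappa> (set es)) es"

text \<open>Depends on an arbitrary enumeration of \<open>S\<close>, which (S) makes irrelevant
  modulo \<open>Q.N\<close>.\<close>

definition basis_symbol :: "(real^'n) set \<Rightarrow> 'a list \<Rightarrow>\<^sub>0 int" where
  "basis_symbol S = frag_of (symbol_of (enum_set S))"

lemma symbol_of_mem: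
  assumes "Zbasis L (set es)" "distinct es"
  shows "symbol_of es \<in> symbols A CARD('n)"
proof -
  have "length es = CARD('n)"
    using goodD(5)[OF Zbasis_good[OF assms(1)]] assms(2) by (simp add: distinct_card)
  then show ?thesis
    using assms \<kappa>_generate[OF assms(1)] integral_on_representation[OF assms(1), THEN \<kappa>_closed]
    unfolding symbols_def symbol_of_def by (auto simp: dual_coefficient_def)
qed

lemma basis_symbol_relation:
  assumes "Zbasis L (set es)" "distinct es"
  shows "basis_symbol (set es) - frag_of (symbol_of es) \<in> Q.N"
proof -
  let ?es = "enum_set (set es)"
  have es': "distinct ?es" "set ?es = set es" using enum_set[of "set es"] by auto
  then have "mset ?es = mset es" using assms(2) by (metis set_eq_iff_mset_eq_distinct)
  then obtain \<sigma> where \<sigma>: "\<sigma> permutes {..<length es}" "permute_list \<sigma> es = ?es"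
    using mset_eq_permutation by metis
  have len: "length es = CARD('n)"
    using goodD(5)[OF Zbasis_good[OF assms(1)]] assms(2) by (simp add: distinct_card)
  have "symbol_of ?es = permute_list \<sigma> (symbol_of es)"
    unfolding symbol_of_def using \<sigma> es' by (simp add: permute_list_map)
  then have "basis_symbol (set es) - frag_of (symbol_of es) \<in> rels_S A CARD('n)"
    unfolding basis_symbol_def rels_S_def using symbol_of_mem[OF assms] \<sigma> len by auto
  then show ?thesis by (intro Q.X_N) auto
qed

text \<open>Bases and entries transform contragrediently: when the sum of \<open>K\<close> replaces
  \<open>v\<close>, it inherits the dual vector of \<open>v\<close>, and this vector is subtracted
  from the dual vectors of the rest of \<open>K\<close>. This is the origin of the differences in
  (M).\<close>

lemma star_dual_coefficient:
  assumes S: "Zbasis L S" and K: "K \<subseteq> S" and v: "v \<in> K"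
  defines "T \<equiv> insert (\<Sum>K) (S - {v})"
  shows "Zbasis L T" and "dual_coefficient \<kappa> T (\<Sum>K) = dual_coefficient \<kappa> S v"
    and "u \<in> S - K \<Longrightarrow> dual_coefficient \<kappa> T u = dual_coefficient \<kappa> S u"
    and "u \<in> K - {v} \<Longrightarrow> dual_coefficient \<kappa> T u = dual_coefficient \<kappa> S u \<otimes> inv (dual_coefficient \<kappa> S v)"
proof -
  have g: "good S" using Zbasis_good[OF S] .
  note S' = goodD[OF g]
  have vS: "v \<in> S" and finK: "finite K" using K v S' by (auto intro: finite_subset)
  have zL: "\<Sum>K \<in> L" using K S' by (intro sum_L) auto
  have rz: "representation S (\<Sum>K) u = of_bool (u \<in> K)" if "u \<in> S" for u
  proof (rule representation_unique[OF S'(2,4) _ that])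
    have "(\<Sum>v\<in>S. of_bool (v \<in> K) *\<^sub>R v) = (\<Sum>v\<in>K. of_bool (v \<in> K) *\<^sub>R v)"
      using K S' by (intro sum.mono_neutral_right) auto
    then show "\<Sum>K = (\<Sum>v\<in>S. of_bool (v \<in> K) *\<^sub>R v)" by simp
  qed
  have nz: "representation S (\<Sum>K) v \<noteq> 0" using rz[OF vS] v by simp
  note rep = representation_replace[OF g vS zL nz, folded T_def]
  have "real (idx T) = 1"
    unfolding T_def using good_replace(2)[OF g vS zL nz] rz[OF vS] v idx_eq_1_iff[OF g] S by simp
  then show "Zbasis L T" using idx_eq_1_iff[of T] good_replace(1)[OF g vS zL nz] unfolding T_def by simp
  show "dual_coefficient \<kappa> T (\<Sum>K) = dual_coefficient \<kappa> S v"
    unfolding dual_coefficient_def rep(1) using rz[OF vS] v by simp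
  have rep2: "(\<lambda>x. representation T x u) = (\<lambda>x. representation S x u - of_bool (u \<in> K) * representation S x v)"
    if "u \<in> S - {v}" for u
    using rep(2)[OF that] rz[OF vS] rz[of u] v that by auto
  show "dual_coefficient \<kappa> T u = dual_coefficient \<kappa> S u" if "u \<in> S - K"
  proof -
    have "u \<in> S - {v}" "u \<notin> K" using that v by auto
    then show ?thesis unfolding dual_coefficient_def using rep2[of u] by simp
  qed
  show "dual_coefficient \<kappa> T u = dual_coefficient \<kappa> S u \<otimes> inv (dual_coefficient \<kappa> S v)" if u: "u \<in> K - {v}"
  proof -
    have "(\<lambda>x. representation T x u) = (\<lambda>x. representation S x u - representation S x v)"
      using rep2[of u] u K by auto
    then show ?thesis
      unfolding dual_coefficient_def using u K vS by (simp only:) (intro \<kappa>_diff integral_on_representation[OF S]; auto)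
  qed
qed

text \<open>Keeps the starred bases free of repetitions: a point with two coordinates equal to 1 is
  not a generator.\<close>

lemma star_not_mem:
  assumes S: "Zbasis L S" and K: "K \<subseteq> S" and card: "2 \<le> card K"
  shows "\<Sum>K \<notin> S"
proof
  note S' = goodD[OF Zbasis_good[OF S]]
  let ?z = "\<Sum>K"
  assume z: "?z \<in> S"
  have "representation S ?z u = 1" if "u \<in> K" for u
  proof -
    have "(\<Sum>v\<in>S. of_bool (v \<in> K) *\<^sub>R v) = (\<Sum>v\<in>K. of_bool (v \<in> K) *\<^sub>R v)"
      using K S' by (intro sum.mono_neutral_right) auto
    then have "?z = (\<Sum>v\<in>S. of_bool (v \<in> K) *\<^sub>R v)" by simp
    then have "representation S ?z u = of_bool (u \<in> K)" using S' that K by (intro representation_unique) auto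
    then show ?thesis using that by simp
  qed
  moreover have "representation S ?z u = (if u = ?z then 1 else 0)" for u
    using z S' by (simp add: representation_basis)
  ultimately have "u = ?z" if "u \<in> K" for u using that by (metis zero_neq_one)
  then have "K \<subseteq> {?z}" by blast
  then have "card K \<le> card {?z}" by (intro card_mono) auto
  then show False using card by simp
qed

lemma symbol_of_star:
  assumes S: "Zbasis L (set (ks @ rs))" and dist: "distinct (ks @ rs)" and len: "2 \<le> length ks" and i: "i < length ks"
  defines "S \<equiv> set (ks @ rs)" and "z \<equiv> \<Sum>(set ks)"
  shows "set (ks[i := z] @ rs) = insert z (S - {ks ! i})" "distinct (ks[i := z] @ rs)"
    "Zbasis L (set (ks[i := z] @ rs))"
    "symbol_of (ks[i := z] @ rs) = blowup_entries A (map (dual_coefficient \<kappa> S) ks) i @ map (dual_coefficient \<kappa> S) rs"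
proof -
  let ?K = "set ks" and ?v = "ks ! i" and ?es = "ks[i := z] @ rs"
  have K: "?K \<subseteq> S" and vK: "?v \<in> ?K" using i by (auto simp: S_def)
  have ks: "distinct ks" and rs: "set rs = S - ?K" using dist by (auto simp: S_def)
  have SZ: "Zbasis L S" using S by (simp add: S_def)
  have zS: "z \<notin> S"
    unfolding z_def using star_not_mem[OF SZ K] len ks by (simp add: distinct_card)
  note star = star_dual_coefficient[OF SZ K vK, folded z_def]
  let ?T = "insert z (S - {?v})"
  show set_es: "set ?es = ?T"
  proof -
    have "set (ks[i := z]) = insert z (?K - {?v})" using ks i by (simp add: set_update_distinct)
    then show ?thesis using rs K vK by auto
  qed
  show "distinct ?es"
    using ks dist zS K i by (auto simp: distinct_list_update set_update_distinct S_def)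
  show "Zbasis L (set ?es)" using star(1) set_es by simp
  have "map (dual_coefficient \<kappa> ?T) rs = map (dual_coefficient \<kappa> S) rs"
    using star(3) rs by auto
  moreover have "map (dual_coefficient \<kappa> ?T) (ks[i := z]) = blowup_entries A (map (dual_coefficient \<kappa> S) ks) i"
  proof (rule nth_equalityI)
    show "length (map (dual_coefficient \<kappa> ?T) (ks[i := z])) = length (blowup_entries A (map (dual_coefficient \<kappa> S) ks) i)"
      by (simp add: blowup_entries_def)
    fix j assume "j < length (map (dual_coefficient \<kappa> ?T) (ks[i := z]))"
    then have j: "j < length ks" by simp
    have "ks ! j \<in> ?K - {?v}" if "j \<noteq> i" using that j i nth_eq_iff_index_eq[OF ks] by auto
    then show "map (dual_coefficient \<kappa> ?T) (ks[i := z]) ! j = blowup_entries A (map (dual_coefficient \<kappa> S) ks) i ! j"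
      using star(2,4) j i by (auto simp: blowup_entries_def)
  qed
  ultimately show "symbol_of ?es = blowup_entries A (map (dual_coefficient \<kappa> S) ks) i @ map (dual_coefficient \<kappa> S) rs"
    unfolding symbol_of_def set_es by simp
qed

text \<open>With the generators in \<open>K\<close> listed first, the terms of (M) are the symbols
  of the starred bases. This discharges the assumption \<open>star\<close>.\<close>

lemma basis_symbol_star:
  assumes S: "Zbasis L S" and K: "K \<subseteq> S" and card: "2 \<le> card K"
  shows "basis_symbol S - (\<Sum>v\<in>K. basis_symbol (insert (\<Sum>K) (S - {v}))) \<in> Q.N"
proof -
  note S' = goodD[OF Zbasis_good[OF S]]
  have finK: "finite K" using K S' by (auto intro: finite_subset)
  define ks where "ks = enum_set K"
  define rs where "rs = enum_set (S - K)"
  define z where "z = \<Sum>K"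
  have ks: "distinct ks" "set ks = K" and rs: "distinct rs" "set rs = S - K"
    using enum_set[OF finK] enum_set[of "S - K"] S' by (auto simp: ks_def rs_def)
  have lk: "length ks = card K" using ks distinct_card by metis
  have len: "length ks + length rs = CARD('n)"
    using lk rs distinct_card[of rs] card_Diff_subset[OF finK K] card_mono[OF S'(4) K] S'(5) by simp
  have es: "set (ks @ rs) = S" "distinct (ks @ rs)" using ks rs K by auto
  have Zes: "Zbasis L (set (ks @ rs))" using S es(1) by simp
  define as where "as = map (dual_coefficient \<kappa> S) ks"
  define bs where "bs = map (dual_coefficient \<kappa> S) rs"
  have sym: "symbol_of (ks @ rs) = as @ bs" unfolding symbol_of_def es by (simp add: as_def bs_def)
  have rel: "frag_of (as @ bs) - (\<Sum>i<length as. frag_of (blowup_entries A as i @ bs)) \<in> Q.N"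
  proof (rule Q.X_N)
    have "as @ bs \<in> symbols A CARD('n)" using symbol_of_mem[OF Zes es(2)] sym by simp
    then show "frag_of (as @ bs) - (\<Sum>i<length as. frag_of (blowup_entries A as i @ bs)) \<in> rels_S A CARD('n) \<union> rels_M A CARD('n)"
      unfolding rels_M_def using len lk card by (auto simp: as_def bs_def)
  qed
  have blowup: "basis_symbol (insert z (S - {ks ! i})) - frag_of (blowup_entries A as i @ bs) \<in> Q.N" if i: "i < length ks" for i
    using symbol_of_star[OF Zes es(2) _ i] basis_symbol_relation[of "ks[i := z] @ rs"] lk card ks(2)
    unfolding es(1) z_def as_def bs_def by simp
  have "(\<Sum>v\<in>K. basis_symbol (insert z (S - {v}))) = (\<Sum>i<length ks. basis_symbol (insert z (S - {ks ! i})))"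
    using bij_betw_nth[OF ks(1) refl ks(2)[symmetric]] by (intro sum.reindex_bij_betw[symmetric]) (simp add: lessThan_def)
  then have "(\<Sum>v\<in>K. basis_symbol (insert z (S - {v}))) - (\<Sum>i<length ks. frag_of (blowup_entries A as i @ bs)) \<in> Q.N"
    using blowup Q.sum_diff_mem[of "{..<length ks}"] by simp
  moreover have "basis_symbol S - frag_of (as @ bs) \<in> Q.N"
    using basis_symbol_relation[OF Zes es(2)] es(1) sym by simp
  ultimately show ?thesis
    using rel Q.diff_trans_mem Q.diff_sym_mem unfolding z_def as_def length_map by blast
qed

sublocale cone_symbol L B Q.N basis_symbol
  by unfold_locales (rule basis_symbol_star)

lemma F_basis: "Zbasis L (set es) \<Longrightarrow> distinct es \<Longrightarrow> F (set es) - frag_of (symbol_of es) \<in> Q.N"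
  using basis_symbol_relation F_Zbasis by simp

lemma F_keys: "Zbasis L S \<Longrightarrow> Poly_Mapping.keys (F S) \<subseteq> symbols A CARD('n)"
  using symbol_of_mem[of "enum_set S"] enum_set[OF goodD(4)[OF Zbasis_good]]
  by (simp add: F_Zbasis basis_symbol_def keys_frag_of)

end

section \<open>Tensor products with a lattice\<close>

lemma sum_set_nth:
  assumes "distinct es"
  shows "(\<Sum>v\<in>set es. h v) = (\<Sum>i<length es. h (es ! i))"
  using bij_betw_nth[OF assms refl refl]
  by (intro sum.reindex_bij_betw[symmetric]) (simp add: lessThan_def)

lemma lattice_basis_iff:
  fixes L :: "(real^'n) set"
  shows "lattice_basis L es \<longleftrightarrow> distinct es \<and> Zbasis L (set es)"
proof -
  have L_eq: "range (\<lambda>c :: nat \<Rightarrow> int. \<Sum>i<CARD('n). of_int (c i) *\<^sub>R es ! i) =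
      {x. \<forall>v\<in>set es. representation (set es) x v \<in> \<int>}"
    if es: "distinct es" "independent (set es)" "span (set es) = UNIV" "length es = CARD('n)"
  proof (intro equalityI subsetI)
    fix x assume "x \<in> range (\<lambda>c :: nat \<Rightarrow> int. \<Sum>i<CARD('n). of_int (c i) *\<^sub>R es ! i)"
    then obtain c :: "nat \<Rightarrow> int" where c: "x = (\<Sum>i<CARD('n). of_int (c i) *\<^sub>R es ! i)" by auto
    define d where "d v = c (the_inv_into {..<length es} ((!) es) v)" for v
    have d: "d (es ! i) = c i" if "i < length es" for i
      unfolding d_def using that inj_on_nth[OF es(1), of "{..<length es}"] by (simp add: the_inv_into_f_f)
    have "x = (\<Sum>v\<in>set es. of_int (d v) *\<^sub>R v)"
      unfolding sum_set_nth[OF es(1)] c using es(4) d by simp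
    then show "x \<in> {x. \<forall>v\<in>set es. representation (set es) x v \<in> \<int>}"
      using representation_unique[OF es(2), of x "\<lambda>v. of_int (d v)"] by auto
  next
    fix x assume "x \<in> {x. \<forall>v\<in>set es. representation (set es) x v \<in> \<int>}"
    then have int: "of_int \<lfloor>representation (set es) x v\<rfloor> = representation (set es) x v" if "v \<in> set es" for v
      using that by (auto elim!: Ints_cases)
    have "x = (\<Sum>v\<in>set es. representation (set es) x v *\<^sub>R v)" using es by (simp add: representation_sum_eq)
    also have "\<dots> = (\<Sum>i<CARD('n). of_int \<lfloor>representation (set es) x (es ! i)\<rfloor> *\<^sub>R es ! i)"
      unfolding sum_set_nth[OF es(1)] es(4) using es(4)
      by (intro sum.cong refl arg_cong2[where f = scaleR] int[symmetric]) auto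
    finally show "x \<in> range (\<lambda>c :: nat \<Rightarrow> int. \<Sum>i<CARD('n). of_int (c i) *\<^sub>R es ! i)"
      by (rule range_eqI[of _ _ "\<lambda>i. \<lfloor>representation (set es) x (es ! i)\<rfloor>"])
  qed
  show ?thesis
  proof
    assume *: "lattice_basis L es"
    then have es: "distinct es" "independent (set es)" "length es = CARD('n)" by (auto simp: lattice_basis_def)
    then have "span (set es) = UNIV"
      using card_ge_dim_independent[of "set es" UNIV] by (auto simp: dim_UNIV distinct_card)
    then show "distinct es \<and> Zbasis L (set es)"
      using * es L_eq[OF es(1,2) _ es(3)] by (simp add: lattice_basis_def Zbasis_def)
  next
    assume *: "distinct es \<and> Zbasis L (set es)"
    then have es: "distinct es" "independent (set es)" "span (set es) = UNIV" by (auto simp: Zbasis_def)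
    have "length es = CARD('n)" using card_basis[OF es(2,3)] distinct_card[OF es(1)] by simp
    then show "lattice_basis L es"
      using * es L_eq[OF es(1-3)] by (simp add: lattice_basis_def Zbasis_def)
  qed
qed

lemma is_lattice_iff: "is_lattice L \<longleftrightarrow> (\<exists>S. Zbasis L S)"
proof
  assume "\<exists>S. Zbasis L S"
  then obtain S where S: "Zbasis L S" by auto
  then have "finite S" using card_basis by (auto simp: Zbasis_def)
  then obtain es where "set es = S" "distinct es" using finite_distinct_list by blast
  then show "is_lattice L" using S by (auto simp: is_lattice_def lattice_basis_iff)
qed (auto simp: is_lattice_def lattice_basis_iff)

lemma basic_simplicial_iff: "basic_simplicial L \<Lambda> \<longleftrightarrow> (\<exists>S. Zbasis L S \<and> \<Lambda> = convex_cone hull S)"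
proof
  assume "\<exists>S. Zbasis L S \<and> \<Lambda> = convex_cone hull S"
  then obtain S where S: "Zbasis L S" "\<Lambda> = convex_cone hull S" by auto
  then have "finite S" using card_basis by (auto simp: Zbasis_def)
  then obtain es where "set es = S" "distinct es" using finite_distinct_list by blast
  then show "basic_simplicial L \<Lambda>" using S by (auto simp: basic_simplicial_def lattice_basis_iff)
qed (auto simp: basic_simplicial_def lattice_basis_iff)

lemma additive_group_simps [simp]:
  "carrier (additive_group L) = L" "x \<otimes>\<^bsub>additive_group L\<^esub> y = x + y" "\<one>\<^bsub>additive_group L\<^esub> = 0"
  by (auto simp: additive_group_def)

section \<open>Contraction and expansion of tensors\<close>

locale tensor_lattice = comm_group A + lattice_context L B
  for A :: "('a, 'm) monoid_scheme" (structure) and L B :: "(real^'n) set"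
begin

definition X :: "((real^'n) \<times> 'a \<Rightarrow>\<^sub>0 int) set" where
  "X = {frag_of (x + y, a) - frag_of (x, a) - frag_of (y, a) |x y a. x \<in> L \<and> y \<in> L \<and> a \<in> carrier A} \<union>
    {frag_of (x, a \<otimes> b) - frag_of (x, a) - frag_of (x, b) |x a b. x \<in> L \<and> a \<in> carrier A \<and> b \<in> carrier A}"

lemma keys_frag_of_diff_diff: "Poly_Mapping.keys (frag_of p - frag_of q - frag_of r) \<subseteq> {p, q, r}"
  using keys_diff[of "frag_of p - frag_of q" "frag_of r"] keys_diff[of "frag_of p" "frag_of q"]
  by (auto simp: keys_frag_of)

sublocale T: free_quotient "L \<times> carrier A" X
proof
  show "X \<subseteq> carrier (free_Abelian_group (L \<times> carrier A))"
    unfolding X_def using keys_frag_of_diff_diff by (fastforce intro: add_L)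
qed

lemma tensor_N: "tensor_relations (additive_group L) A = T.N"
proof -
  have "tensor_relations (additive_group L) A = generate T.FG X"
    unfolding X_def by (simp add: tensor_relations_def)
  then show ?thesis by (simp add: T.N_def)
qed

lemma tensor_FG: "tensor (additive_group L) A = T.FG Mod T.N"
  by (simp add: tensor_def tensor_N)

lemma pure_tensor_coset: "pure_tensor (additive_group L) A x a = T.N #>\<^bsub>T.FG\<^esub> frag_of (x, a)"
  by (simp add: pure_tensor_def tensor_N)

text \<open>The contraction computed on one representative, as in the body of
  \<open>contract\<close>.\<close>

definition eval :: "(real^'n \<Rightarrow> int) \<Rightarrow> ((real^'n) \<times> 'a \<Rightarrow>\<^sub>0 int) \<Rightarrow> 'a" where
  "eval \<phi> c = finprod A (\<lambda>p. snd p [^] (Poly_Mapping.lookup c p * \<phi> (fst p))) (Poly_Mapping.keys c)"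

lemma eval_superset:
  assumes "finite K" "Poly_Mapping.keys c \<subseteq> K" "K \<subseteq> L \<times> carrier A"
  shows "eval \<phi> c = finprod A (\<lambda>p. snd p [^] (Poly_Mapping.lookup c p * \<phi> (fst p))) K"
  unfolding eval_def using assms
  by (intro finprod_mono_neutral_cong_left) (auto simp: in_keys_iff)

lemma eval_closed: "Poly_Mapping.keys c \<subseteq> L \<times> carrier A \<Longrightarrow> eval \<phi> c \<in> carrier A"
  unfolding eval_def by (intro finprod_closed) auto

lemma eval_zero: "eval \<phi> 0 = \<one>"
  by (simp add: eval_def)

lemma eval_diff:
  assumes "Poly_Mapping.keys c \<subseteq> L \<times> carrier A" "Poly_Mapping.keys d \<subseteq> L \<times> carrier A"
  shows "eval \<phi> (c - d) = eval \<phi> c \<otimes> inv (eval \<phi> d)"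
proof -
  let ?K = "Poly_Mapping.keys c \<union> Poly_Mapping.keys d"
  let ?e = "\<lambda>c p. snd p [^] (Poly_Mapping.lookup c p * \<phi> (fst p))"
  have K: "finite ?K" "?K \<subseteq> L \<times> carrier A" using assms by auto
  have cl: "?e c p \<in> carrier A" if "p \<in> ?K" for c p using that K by auto
  have "eval \<phi> (c - d) \<otimes> eval \<phi> d = finprod A (?e (c - d)) ?K \<otimes> finprod A (?e d) ?K"
    using K keys_diff[of c d] by (subst (1 2) eval_superset[of ?K]) auto
  also have "\<dots> = finprod A (\<lambda>p. ?e (c - d) p \<otimes> ?e d p) ?K"
    using cl by (intro finprod_multf[symmetric]) auto
  also have "\<dots> = finprod A (?e c) ?K"
  proof (rule finprod_cong')
    fix p assume p: "p \<in> ?K"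
    then have "snd p \<in> carrier A" using K by auto
    then show "?e (c - d) p \<otimes> ?e d p = ?e c p"
      by (simp flip: int_pow_mult add: lookup_minus algebra_simps)
  qed (use cl in auto)
  also have "\<dots> = eval \<phi> c" using K by (intro eval_superset[symmetric]) auto
  finally show ?thesis
    using eval_closed[of "c - d"] eval_closed[OF assms(1)] eval_closed[OF assms(2)] keys_diff[of c d] assms
    by (metis (no_types, lifting) inv_solve_right le_sup_iff subset_trans)
qed

lemma eval_add:
  assumes "Poly_Mapping.keys c \<subseteq> L \<times> carrier A" "Poly_Mapping.keys d \<subseteq> L \<times> carrier A"
  shows "eval \<phi> (c + d) = eval \<phi> c \<otimes> eval \<phi> d"
proof -
  have "Poly_Mapping.keys (c + d) \<subseteq> L \<times> carrier A" using assms keys_add[of c d] by blast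
  then have "eval \<phi> c = eval \<phi> (c + d) \<otimes> inv (eval \<phi> d)" "eval \<phi> (c + d) \<in> carrier A"
    using eval_diff[of "c + d" d] assms(2) eval_closed by auto
  then show ?thesis using eval_closed[OF assms(2)] by (simp add: m_assoc)
qed

lemma eval_frag_of: "a \<in> carrier A \<Longrightarrow> x \<in> L \<Longrightarrow> eval \<phi> (frag_of (x, a)) = a [^] \<phi> x"
  unfolding eval_def by (simp add: keys_frag_of finprod_singleton)

lemma eval_sum:
  assumes "\<And>i. i \<in> I \<Longrightarrow> Poly_Mapping.keys (c i) \<subseteq> L \<times> carrier A"
  shows "eval \<phi> (sum c I) = finprod A (\<lambda>i. eval \<phi> (c i)) I"
  using assms
proof (induction I rule: infinite_finite_induct)
  case (insert i I)
  then have "eval \<phi> (sum c (insert i I)) = eval \<phi> (c i) \<otimes> eval \<phi> (sum c I)"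
    using T.sum_keys[of I c] by (simp add: eval_add)
  then show ?case using insert eval_closed by (simp add: finprod_insert)
qed (auto simp: eval_zero)

lemma mult_cancel_both: "u \<in> carrier A \<Longrightarrow> v \<in> carrier A \<Longrightarrow> u \<otimes> v \<otimes> inv u \<otimes> inv v = \<one>"
  by (metis inv_closed m_assoc m_comm m_closed r_inv r_one)

text \<open>The representatives with trivial contraction form a subgroup, and bilinearity puts the
  defining relations into it. So the contraction is constant on cosets.\<close>

lemma eval_relations:
  assumes \<phi>: "\<phi> \<in> hom (additive_group L) integer_group" and c: "c \<in> T.N"
  shows "eval \<phi> c = \<one>"
proof -
  let ?H = "{c. Poly_Mapping.keys c \<subseteq> L \<times> carrier A \<and> eval \<phi> c = \<one>}"
  have add\<phi>: "\<phi> (x + y) = \<phi> x + \<phi> y" if "x \<in> L" "y \<in> L" for x y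
    using hom_mult[OF \<phi>, of x y] that by simp
  have "subgroup ?H T.FG"
  proof
    show "?H \<subseteq> carrier T.FG" by auto
    show "x \<otimes>\<^bsub>T.FG\<^esub> y \<in> ?H" if "x \<in> ?H" "y \<in> ?H" for x y
      using that keys_add[of x y] by (auto simp: eval_add)
    show "\<one>\<^bsub>T.FG\<^esub> \<in> ?H" by (simp add: eval_zero)
    show "inv\<^bsub>T.FG\<^esub> x \<in> ?H" if "x \<in> ?H" for x
      using that eval_diff[of 0 x] by (simp add: eval_zero)
  qed
  moreover have "X \<subseteq> ?H"
  proof
    fix c assume c: "c \<in> X"
    then have k: "Poly_Mapping.keys c \<subseteq> L \<times> carrier A" using subsetD[OF T.X_sub c] by simp
    have "eval \<phi> c = \<one>"
      using c unfolding X_def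
    proof (elim UnE CollectE exE conjE)
      fix x y a assume *: "c = frag_of (x + y, a) - frag_of (x, a) - frag_of (y, a)" "x \<in> L" "y \<in> L" "a \<in> carrier A"
      have "eval \<phi> c = eval \<phi> (frag_of (x + y, a) - frag_of (x, a)) \<otimes> inv (eval \<phi> (frag_of (y, a)))"
        unfolding *(1) using * add_L keys_diff[of "frag_of (x + y, a)" "frag_of (x, a)"]
        by (intro eval_diff) (auto simp: keys_frag_of)
      also have "eval \<phi> (frag_of (x + y, a) - frag_of (x, a)) = eval \<phi> (frag_of (x + y, a)) \<otimes> inv (eval \<phi> (frag_of (x, a)))"
        using * add_L by (intro eval_diff) (auto simp: keys_frag_of)
      finally show ?thesis using * add_L mult_cancel_both by (simp add: eval_frag_of add\<phi> int_pow_mult)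
    next
      fix x a b assume *: "c = frag_of (x, a \<otimes> b) - frag_of (x, a) - frag_of (x, b)" "x \<in> L" "a \<in> carrier A" "b \<in> carrier A"
      have "eval \<phi> c = eval \<phi> (frag_of (x, a \<otimes> b) - frag_of (x, a)) \<otimes> inv (eval \<phi> (frag_of (x, b)))"
        unfolding *(1) using * keys_diff[of "frag_of (x, a \<otimes> b)" "frag_of (x, a)"]
        by (intro eval_diff) (auto simp: keys_frag_of)
      also have "eval \<phi> (frag_of (x, a \<otimes> b) - frag_of (x, a)) = eval \<phi> (frag_of (x, a \<otimes> b)) \<otimes> inv (eval \<phi> (frag_of (x, a)))"
        using * by (intro eval_diff) (auto simp: keys_frag_of)
      finally show ?thesis using * mult_cancel_both by (simp add: eval_frag_of int_pow_distrib)
    qed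
    then show "c \<in> ?H" using k by simp
  qed
  ultimately have "generate T.FG X \<subseteq> ?H" by (intro group.generate_subgroup_incl) auto
  then show ?thesis using c by (auto simp: T.N_def)
qed

lemma contract_coset:
  assumes \<phi>: "\<phi> \<in> hom (additive_group L) integer_group" and c: "Poly_Mapping.keys c \<subseteq> L \<times> carrier A"
  shows "contract A (T.N #>\<^bsub>T.FG\<^esub> c) \<phi> = eval \<phi> c"
proof -
  have const: "eval \<phi> d = eval \<phi> c" if dc: "d \<in> T.N #>\<^bsub>T.FG\<^esub> c" for d
  proof -
    obtain r where r: "r \<in> T.N" "d = r + c" using dc unfolding T.coset_def by auto
    then show ?thesis using eval_add[OF T.N_keys[OF r(1)] c] eval_relations[OF \<phi> r(1)] eval_closed[OF c] by simp
  qed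
  have "c \<in> T.N #>\<^bsub>T.FG\<^esub> c" unfolding T.coset_def using T.zero_mem by force
  then have "(THE y. \<exists>d\<in>T.N #>\<^bsub>T.FG\<^esub> c. y = eval \<phi> d) = eval \<phi> c"
    by (intro the_equality) (use const in blast)+
  then show ?thesis unfolding contract_def eval_def[symmetric] .
qed

lemma tensor_add_right:
  assumes "x \<in> L" "a \<in> carrier A" "b \<in> carrier A"
  shows "frag_of (x, a \<otimes> b) - (frag_of (x, a) + frag_of (x, b)) \<in> T.N"
proof -
  have "frag_of (x, a \<otimes> b) - frag_of (x, a) - frag_of (x, b) \<in> X" unfolding X_def using assms by blast
  from T.X_N[OF this] show ?thesis by (simp only: diff_diff_add)
qed

lemma tensor_add_left:
  assumes "x \<in> L" "y \<in> L" "a \<in> carrier A"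
  shows "frag_of (x + y, a) - (frag_of (x, a) + frag_of (y, a)) \<in> T.N"
proof -
  have "frag_of (x + y, a) - frag_of (x, a) - frag_of (y, a) \<in> X" unfolding X_def using assms by blast
  from T.X_N[OF this] show ?thesis by (simp only: diff_diff_add)
qed

lemma tensor_one: "x \<in> L \<Longrightarrow> frag_of (x, \<one>) \<in> T.N"
  using tensor_add_right[of x \<one> \<one>] T.minus_mem by fastforce

lemma tensor_zero: "a \<in> carrier A \<Longrightarrow> frag_of (0, a) \<in> T.N"
  using tensor_add_left[of 0 0 a] zero_L T.minus_mem by fastforce

lemma tensor_diff_right:
  assumes "x \<in> L" "a \<in> carrier A" "b \<in> carrier A"
  shows "frag_of (x, a \<otimes> inv b) - (frag_of (x, a) - frag_of (x, b)) \<in> T.N"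
proof -
  have "frag_of (x, a) - (frag_of (x, a \<otimes> inv b) + frag_of (x, b)) \<in> T.N"
    using tensor_add_right[of x "a \<otimes> inv b" b] assms by (simp add: m_assoc)
  from T.minus_mem[OF this] show ?thesis by (simp add: algebra_simps)
qed

lemma tensor_scale:
  assumes x: "x \<in> L" and a: "a \<in> carrier A"
  shows "frag_of (of_int m *\<^sub>R x, a) - frag_of (x, a [^] (m::int)) \<in> T.N"
proof (induction m rule: int_induct[where k = 0])
  case base
  then show ?case using T.diff_mem[OF tensor_zero[OF a] tensor_one[OF x]] by simp
next
  case (step1 i)
  have "frag_of (of_int i *\<^sub>R x + x, a) - (frag_of (of_int i *\<^sub>R x, a) + frag_of (x, a)) \<in> T.N"
    using x a by (intro tensor_add_left scale_L) auto
  moreover have "frag_of (x, a [^] i \<otimes> a) - (frag_of (x, a [^] i) + frag_of (x, a)) \<in> T.N"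
    using x a by (intro tensor_add_right) auto
  moreover have "a [^] (i + 1) = a [^] i \<otimes> a" using a by (simp add: int_pow_mult)
  moreover have "of_int (i + 1) *\<^sub>R x = of_int i *\<^sub>R x + x" by (simp add: scaleR_add_left)
  ultimately show ?case
    using T.add_mem[OF T.diff_mem step1(2)] by (fastforce simp: algebra_simps)
next
  case (step2 i)
  have "frag_of (of_int (i - 1) *\<^sub>R x + x, a) - (frag_of (of_int (i - 1) *\<^sub>R x, a) + frag_of (x, a)) \<in> T.N"
    using x a by (intro tensor_add_left scale_L) auto
  moreover have "frag_of (x, a [^] (i - 1) \<otimes> a) - (frag_of (x, a [^] (i - 1)) + frag_of (x, a)) \<in> T.N"
    using x a by (intro tensor_add_right) auto
  moreover have "a [^] (i - 1) \<otimes> a = a [^] i" using a int_pow_mult[of a "i - 1" 1] by simp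
  moreover have "of_int (i - 1) *\<^sub>R x + x = of_int i *\<^sub>R x" by (simp add: scaleR_left_diff_distrib)
  ultimately show ?case
    using T.add_mem[OF T.diff_mem step2(2), of "frag_of (x, a [^] i) - (frag_of (x, a [^] (i - 1)) + frag_of (x, a))"
      "frag_of (of_int i *\<^sub>R x, a) - (frag_of (of_int (i - 1) *\<^sub>R x, a) + frag_of (x, a))"] by (simp add: algebra_simps)
qed

lemma tensor_linear:
  assumes a: "a \<in> carrier A" and "finite I" "\<And>e. e \<in> I \<Longrightarrow> e \<in> L"
  shows "frag_of (\<Sum>e\<in>I. of_int (m e) *\<^sub>R e, a) - (\<Sum>e\<in>I. frag_of (e, a [^] (m e :: int))) \<in> T.N"
  using assms(2,3)
proof (induction I rule: finite_induct)
  case empty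
  then show ?case using tensor_zero[OF a] by simp
next
  case (insert e I)
  let ?y = "\<Sum>e\<in>I. of_int (m e) *\<^sub>R e"
  have "frag_of (of_int (m e) *\<^sub>R e + ?y, a) - (frag_of (of_int (m e) *\<^sub>R e, a) + frag_of (?y, a)) \<in> T.N"
    using insert a by (intro tensor_add_left scale_L sum_L) auto
  moreover have "frag_of (of_int (m e) *\<^sub>R e, a) - frag_of (e, a [^] m e) \<in> T.N"
    using insert a by (intro tensor_scale) auto
  moreover have "frag_of (?y, a) - (\<Sum>e\<in>I. frag_of (e, a [^] m e)) \<in> T.N" using insert by auto
  ultimately have "(frag_of (of_int (m e) *\<^sub>R e + ?y, a) - (frag_of (of_int (m e) *\<^sub>R e, a) + frag_of (?y, a))) +
    ((frag_of (of_int (m e) *\<^sub>R e, a) - frag_of (e, a [^] m e)) + (frag_of (?y, a) - (\<Sum>e\<in>I. frag_of (e, a [^] m e)))) \<in> T.N"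
    by (intro T.add_mem)
  then show ?case using insert by (simp add: algebra_simps)
qed

text \<open>Coordinates identify the tensor product with one copy of the group for each basis
  vector. For a pure tensor this is the expansion of its first factor, and modulo \<open>T.N\<close>
  both sides are additive in \<open>c\<close>. The floor only turns an integral real number into an
  integer.\<close>

lemma tensor_expand:
  assumes E: "Zbasis L E" and c: "Poly_Mapping.keys c \<subseteq> L \<times> carrier A"
  shows "c - (\<Sum>e\<in>E. frag_of (e, eval (\<lambda>x. \<lfloor>representation E x e\<rfloor>) c)) \<in> T.N"
proof (rule free_Abelian_group_induct[OF c])
  show "0 - (\<Sum>e\<in>E. frag_of (e, eval (\<lambda>x. \<lfloor>representation E x e\<rfloor>) 0)) \<in> T.N"
    unfolding eval_zero diff_0
    using goodD(1)[OF Zbasis_good[OF E]] by (intro T.minus_mem T.sum_mem tensor_one) auto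
next
  fix c d
  assume 3: "Poly_Mapping.keys c \<subseteq> L \<times> carrier A" "Poly_Mapping.keys d \<subseteq> L \<times> carrier A"
    "c - (\<Sum>e\<in>E. frag_of (e, eval (\<lambda>x. \<lfloor>representation E x e\<rfloor>) c)) \<in> T.N"
    "d - (\<Sum>e\<in>E. frag_of (e, eval (\<lambda>x. \<lfloor>representation E x e\<rfloor>) d)) \<in> T.N"
  let ?e = "\<lambda>e. eval (\<lambda>x. \<lfloor>representation E x e\<rfloor>)"
  have "(\<Sum>e\<in>E. frag_of (e, ?e e c \<otimes> inv (?e e d))) - (\<Sum>e\<in>E. frag_of (e, ?e e c) - frag_of (e, ?e e d)) \<in> T.N"
    using goodD(1)[OF Zbasis_good[OF E]] 3 by (intro T.sum_diff_mem tensor_diff_right eval_closed) auto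
  moreover have "(c - (\<Sum>e\<in>E. frag_of (e, ?e e c))) - (d - (\<Sum>e\<in>E. frag_of (e, ?e e d))) \<in> T.N"
    by (rule T.diff_mem[OF 3(3,4)])
  moreover have "?e e (c - d) = ?e e c \<otimes> inv (?e e d)" for e using 3 by (intro eval_diff)
  ultimately show "c - d - (\<Sum>e\<in>E. frag_of (e, ?e e (c - d))) \<in> T.N"
    using T.diff_mem by (fastforce simp: sum_subtractf algebra_simps)
next
  fix p assume 4: "p \<in> L \<times> carrier A"
  then obtain x a where p: "p = (x, a)" "x \<in> L" "a \<in> carrier A" by auto
  have E': "E \<subseteq> L" "finite E" "independent E" "span E = UNIV" using goodD[OF Zbasis_good[OF E]] by auto
  have int: "of_int \<lfloor>representation E x e\<rfloor> = representation E x e" if "e \<in> E" for e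
    using E p that by (auto simp: Zbasis_def elim!: Ints_cases)
  have "x = (\<Sum>e\<in>E. representation E x e *\<^sub>R e)" using E' by (simp add: representation_sum_eq)
  also have "\<dots> = (\<Sum>e\<in>E. of_int \<lfloor>representation E x e\<rfloor> *\<^sub>R e)"
    by (intro sum.cong refl arg_cong2[where f = scaleR] int[symmetric])
  finally have "frag_of (x, a) - (\<Sum>e\<in>E. frag_of (e, a [^] \<lfloor>representation E x e\<rfloor>)) \<in> T.N"
    using tensor_linear[OF p(3) E'(2), of "\<lambda>e. \<lfloor>representation E x e\<rfloor>"] E' by auto
  then show "frag_of p - (\<Sum>e\<in>E. frag_of (e, eval (\<lambda>x. \<lfloor>representation E x e\<rfloor>) (frag_of p))) \<in> T.N"
    using p by (simp add: eval_frag_of)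
qed

end

lemma integral_onE:
  assumes "integral_on L \<phi>" "x \<in> L"
  obtains i :: int where "\<phi> x = of_int i"
  using assms unfolding integral_on_def by (blast elim: Ints_cases)

context tensor_lattice
begin

definition tensor_sum :: "(nat \<Rightarrow> real^'n) \<Rightarrow> (nat \<Rightarrow> 'a) \<Rightarrow> ((real^'n) \<times> 'a \<Rightarrow>\<^sub>0 int) set" where
  "tensor_sum b a = finprod (tensor (additive_group L) A)
     (\<lambda>i. pure_tensor (additive_group L) A (b i) (a i)) {..<CARD('n)}"

lemma tensor_sum_coset:
  assumes "\<And>i. i < CARD('n) \<Longrightarrow> b i \<in> L" "\<And>i. i < CARD('n) \<Longrightarrow> a i \<in> carrier A"
  shows "tensor_sum b a = T.N #>\<^bsub>T.FG\<^esub> (\<Sum>i<CARD('n). frag_of (b i, a i))"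
  unfolding tensor_sum_def tensor_FG pure_tensor_coset
  using assms by (intro T.finprod_coset) (auto simp: keys_frag_of)

lemma tensor_sum_keys:
  fixes b :: "nat \<Rightarrow> real^'n"
  assumes "\<And>i. i < CARD('n) \<Longrightarrow> b i \<in> L" "\<And>i. i < CARD('n) \<Longrightarrow> a i \<in> carrier A"
  shows "Poly_Mapping.keys (\<Sum>i<CARD('n). frag_of (b i, a i)) \<subseteq> L \<times> carrier A"
  using assms by (intro T.sum_keys) (auto simp: keys_frag_of)

lemma tensor_sum_carrier:
  assumes "\<And>i. i < CARD('n) \<Longrightarrow> b i \<in> L" "\<And>i. i < CARD('n) \<Longrightarrow> a i \<in> carrier A"
  shows "tensor_sum b a \<in> carrier (tensor (additive_group L) A)"
  unfolding tensor_FG T.quotient_carrier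
  using assms
  by (intro CollectI exI[of _ "\<Sum>i<CARD('n). frag_of (b i, a i)"] conjI tensor_sum_coset tensor_sum_keys)

lemma carrier_tensorE:
  assumes "\<xi> \<in> carrier (tensor (additive_group L) A)"
  obtains c where "Poly_Mapping.keys c \<subseteq> L \<times> carrier A" "\<xi> = T.N #>\<^bsub>T.FG\<^esub> c"
  using assms unfolding tensor_FG T.quotient_carrier by blast

lemma contract_tensor_sum:
  assumes \<phi>: "\<phi> \<in> hom (additive_group L) integer_group"
    and "\<And>i. i < CARD('n) \<Longrightarrow> b i \<in> L" "\<And>i. i < CARD('n) \<Longrightarrow> a i \<in> carrier A"
  shows "contract A (tensor_sum b a) \<phi> = finprod A (\<lambda>i. a i [^] \<phi> (b i)) {..<CARD('n)}"
proof -
  have "contract A (tensor_sum b a) \<phi> = eval \<phi> (\<Sum>i<CARD('n). frag_of (b i, a i))"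
    using assms tensor_sum_keys[of b a] by (simp add: tensor_sum_coset contract_coset)
  also have "\<dots> = finprod A (\<lambda>i. eval \<phi> (frag_of (b i, a i))) {..<CARD('n)}"
    using assms by (intro eval_sum) (auto simp: keys_frag_of)
  also have "\<dots> = finprod A (\<lambda>i. a i [^] \<phi> (b i)) {..<CARD('n)}"
    using assms by (intro finprod_cong') (auto simp: eval_frag_of)
  finally show ?thesis .
qed

lemma floor_hom:
  assumes "integral_on L \<phi>"
  shows "(\<lambda>x. \<lfloor>\<phi> x\<rfloor>) \<in> hom (additive_group L) integer_group"
proof (rule homI)
  fix x y assume "x \<in> carrier (additive_group L)" "y \<in> carrier (additive_group L)"
  then obtain i j :: int where "\<phi> x = of_int i" "\<phi> y = of_int j"
    using integral_onE[OF assms] by (metis additive_group_simps(1))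
  moreover have "\<phi> (x + y) = \<phi> x + \<phi> y" using assms by (auto simp: integral_on_def linear_add)
  ultimately show "\<lfloor>\<phi> (x \<otimes>\<^bsub>additive_group L\<^esub> y)\<rfloor> = \<lfloor>\<phi> x\<rfloor> \<otimes>\<^bsub>integer_group\<^esub> \<lfloor>\<phi> y\<rfloor>"
    by (simp flip: of_int_add)
qed simp

lemma contract_diff:
  assumes \<xi>: "\<xi> \<in> carrier (tensor (additive_group L) A)" and \<phi>: "integral_on L \<phi>" and \<psi>: "integral_on L \<psi>"
  shows "contract A \<xi> (\<lambda>x. \<lfloor>\<phi> x - \<psi> x\<rfloor>) = contract A \<xi> (\<lambda>x. \<lfloor>\<phi> x\<rfloor>) \<otimes> inv (contract A \<xi> (\<lambda>x. \<lfloor>\<psi> x\<rfloor>))"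
proof -
  obtain c where c: "Poly_Mapping.keys c \<subseteq> L \<times> carrier A" "\<xi> = T.N #>\<^bsub>T.FG\<^esub> c"
    using carrier_tensorE[OF \<xi>] .
  have \<phi>\<psi>: "integral_on L (\<lambda>x. \<phi> x - \<psi> x)"
    using \<phi> \<psi> unfolding integral_on_def by (auto intro: linear_compose_sub)
  let ?e = "\<lambda>\<phi> p. snd p [^] (Poly_Mapping.lookup c p * \<lfloor>\<phi> (fst p)\<rfloor>)"
  have cl: "?e \<phi> p \<in> carrier A" if "p \<in> Poly_Mapping.keys c" for \<phi> :: "_ \<Rightarrow> real" and p using that c by auto
  have "eval (\<lambda>x. \<lfloor>\<phi> x - \<psi> x\<rfloor>) c \<otimes> eval (\<lambda>x. \<lfloor>\<psi> x\<rfloor>) c =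
      finprod A (\<lambda>p. ?e (\<lambda>x. \<phi> x - \<psi> x) p \<otimes> ?e \<psi> p) (Poly_Mapping.keys c)"
    unfolding eval_def using cl[of _ "\<lambda>x. \<phi> x - \<psi> x"] cl[of _ \<psi>] by (intro finprod_multf[symmetric]) auto
  also have "\<dots> = finprod A (?e \<phi>) (Poly_Mapping.keys c)"
  proof (rule finprod_cong')
    fix p assume p: "p \<in> Poly_Mapping.keys c"
    then have pL: "fst p \<in> L" "snd p \<in> carrier A" using c by auto
    then obtain i j :: int where "\<phi> (fst p) = of_int i" "\<psi> (fst p) = of_int j"
      using integral_onE[OF \<phi>] integral_onE[OF \<psi>] by metis
    then show "?e (\<lambda>x. \<phi> x - \<psi> x) p \<otimes> ?e \<psi> p = ?e \<phi> p"
      using pL by (simp flip: int_pow_mult of_int_diff add: algebra_simps)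
  qed (use cl[of _ \<phi>] in auto)
  finally have "eval (\<lambda>x. \<lfloor>\<phi> x - \<psi> x\<rfloor>) c \<otimes> eval (\<lambda>x. \<lfloor>\<psi> x\<rfloor>) c = eval (\<lambda>x. \<lfloor>\<phi> x\<rfloor>) c"
    unfolding eval_def .
  then have "eval (\<lambda>x. \<lfloor>\<phi> x - \<psi> x\<rfloor>) c = eval (\<lambda>x. \<lfloor>\<phi> x\<rfloor>) c \<otimes> inv (eval (\<lambda>x. \<lfloor>\<psi> x\<rfloor>) c)"
    using eval_closed[OF c(1)] by (metis inv_solve_right)
  then show ?thesis
    using contract_coset[OF floor_hom[OF \<phi>] c(1)] contract_coset[OF floor_hom[OF \<psi>] c(1)]
      contract_coset[OF floor_hom[OF \<phi>\<psi>] c(1)] c(2) by simp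
qed

lemma contract_closed:
  assumes \<xi>: "\<xi> \<in> carrier (tensor (additive_group L) A)" and \<phi>: "\<phi> \<in> hom (additive_group L) integer_group"
  shows "contract A \<xi> \<phi> \<in> carrier A"
  using carrier_tensorE[OF \<xi>] contract_coset[OF \<phi>] eval_closed by metis

lemma tensor_basis_expansion:
  assumes \<xi>: "\<xi> \<in> carrier (tensor (additive_group L) A)" and es: "distinct es" "Zbasis L (set es)"
  shows "\<xi> = tensor_sum ((!) es) (\<lambda>i. contract A \<xi> (\<lambda>x. \<lfloor>representation (set es) x (es ! i)\<rfloor>))"
proof -
  let ?f = "\<lambda>e. contract A \<xi> (\<lambda>x. \<lfloor>representation (set es) x e\<rfloor>)"
  obtain c where c: "Poly_Mapping.keys c \<subseteq> L \<times> carrier A" "\<xi> = T.N #>\<^bsub>T.FG\<^esub> c"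
    using carrier_tensorE[OF \<xi>] .
  have len: "length es = CARD('n)" using goodD(5)[OF Zbasis_good[OF es(2)]] es(1) by (simp add: distinct_card)
  have f: "?f e = eval (\<lambda>x. \<lfloor>representation (set es) x e\<rfloor>) c" "?f e \<in> carrier A" if "e \<in> set es" for e
    using contract_coset[OF floor_hom[OF integral_on_representation[OF es(2) that]] c(1)] c eval_closed[OF c(1)] by auto
  have "\<xi> = T.N #>\<^bsub>T.FG\<^esub> (\<Sum>e\<in>set es. frag_of (e, ?f e))"
    unfolding c(2) T.coset_eq_iff using tensor_expand[OF es(2) c(1)] f(1) c(2) by simp
  also have "(\<Sum>e\<in>set es. frag_of (e, ?f e)) = (\<Sum>i<CARD('n). frag_of (es ! i, ?f (es ! i)))"
    using sum_set_nth[OF es(1)] len by simp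
  also have "T.N #>\<^bsub>T.FG\<^esub> \<dots> = tensor_sum ((!) es) (\<lambda>i. ?f (es ! i))"
    using len f(2) goodD(1)[OF Zbasis_good[OF es(2)]] by (intro tensor_sum_coset[symmetric]) auto
  finally show ?thesis .
qed

text \<open>Complements \<open>tensor_basis_expansion\<close>: the entries of a tensor in a given
  basis are unique.\<close>

lemma contract_basis_coefficient:
  assumes es: "distinct es" "Zbasis L (set es)" and a: "\<And>i. i < CARD('n) \<Longrightarrow> a i \<in> carrier A" and i: "i < CARD('n)"
  shows "contract A (tensor_sum ((!) es) a) (\<lambda>x. \<lfloor>representation (set es) x (es ! i)\<rfloor>) = a i"
proof -
  have len: "length es = CARD('n)" using goodD(5)[OF Zbasis_good[OF es(2)]] es(1) by (simp add: distinct_card)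
  have esL: "es ! j \<in> L" if "j < CARD('n)" for j using that len goodD(1)[OF Zbasis_good[OF es(2)]] by auto
  have "contract A (tensor_sum ((!) es) a) (\<lambda>x. \<lfloor>representation (set es) x (es ! i)\<rfloor>) =
      finprod A (\<lambda>j. a j [^] \<lfloor>representation (set es) (es ! j) (es ! i)\<rfloor>) {..<CARD('n)}"
    using esL a i len by (intro contract_tensor_sum floor_hom integral_on_representation[OF es(2)]) auto
  also have "\<dots> = finprod A (\<lambda>j. if i = j then a j else \<one>) {..<CARD('n)}"
  proof (rule finprod_cong')
    fix j assume j: "j \<in> {..<CARD('n)}"
    have "representation (set es) (es ! j) (es ! i) = (if i = j then 1 else 0)"
      using es(2) j i len nth_eq_iff_index_eq[OF es(1), of i j] by (auto simp: Zbasis_def representation_basis)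
    then show "a j [^] \<lfloor>representation (set es) (es ! j) (es ! i)\<rfloor> = (if i = j then a j else \<one>)"
      using a j by (auto simp: int_pow_1)
  qed (use a in auto)
  also have "\<dots> = a i" using a i by (intro finprod_singleton) auto
  finally show ?thesis .
qed

lemma finprod_mem_subgroup:
  assumes H: "subgroup H A" and "\<And>i. i \<in> I \<Longrightarrow> f i \<in> H"
  shows "finprod A f I \<in> H"
  using assms(2)
proof (induction I rule: infinite_finite_induct)
  case (insert i I)
  then have "f i \<otimes> finprod A f I \<in> H" by (intro subgroup.m_closed[OF H]) auto
  then show ?case using insert subgroup.mem_carrier[OF H] by (subst finprod_insert) auto
qed (simp_all add: subgroup.one_closed[OF H])

text \<open>A functional is determined by its values on a basis, so each contraction of \<xi> is a
  product of powers of its entries. Surjectivity thus makes the entries generate the group.\<close>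

lemma generate_coefficients:
  assumes \<xi>: "\<xi> \<in> carrier (tensor (additive_group L) A)"
    and adm: "contract A \<xi> ` hom (additive_group L) integer_group = carrier A" and E: "Zbasis L E"
  shows "generate A ((\<lambda>e. contract A \<xi> (\<lambda>x. \<lfloor>representation E x e\<rfloor>)) ` E) = carrier A"
proof -
  let ?f = "\<lambda>e. contract A \<xi> (\<lambda>x. \<lfloor>representation E x e\<rfloor>)"
  have finE: "finite E" using goodD(4)[OF Zbasis_good[OF E]] .
  obtain es where es: "distinct es" "set es = E" using finite_distinct_list[OF finE] by blast
  then have len: "length es = CARD('n)" using goodD(5)[OF Zbasis_good[OF E]] by (metis distinct_card)
  have f: "?f e \<in> carrier A" if "e \<in> E" for e
    using contract_closed[OF \<xi> floor_hom[OF integral_on_representation[OF E that]]] .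
  have sub: "subgroup (generate A (?f ` E)) A" using f by (intro generate_is_subgroup) auto
  have "y \<in> generate A (?f ` E)" if y: "y \<in> carrier A" for y
  proof -
    obtain \<phi> where \<phi>: "\<phi> \<in> hom (additive_group L) integer_group" "y = contract A \<xi> \<phi>" using adm y by blast
    have esE: "es ! i \<in> E" if "i < CARD('n)" for i using that len es(2) by auto
    have exp: "\<xi> = tensor_sum ((!) es) (\<lambda>i. ?f (es ! i))"
      using tensor_basis_expansion[OF \<xi> es(1)] es(2) E by simp
    have "y = contract A (tensor_sum ((!) es) (\<lambda>i. ?f (es ! i))) \<phi>"
      unfolding \<phi>(2) by (rule arg_cong[OF exp])
    also have "\<dots> = finprod A (\<lambda>i. ?f (es ! i) [^] \<phi> (es ! i)) {..<CARD('n)}"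
      using esE f goodD(1)[OF Zbasis_good[OF E]] by (intro contract_tensor_sum[OF \<phi>(1)]) auto
    also have "\<dots> \<in> generate A (?f ` E)"
      using len es(2) by (intro finprod_mem_subgroup[OF sub] subgroup_int_pow_closed[OF sub] generate.incl) auto
    finally show ?thesis .
  qed
  then show ?thesis using subgroup.subset[OF sub] by blast
qed

lemma subset_relations:
  assumes "tensor_lattice A L' B'" "L \<subseteq> L'"
  shows "tensor_relations (additive_group L) A \<subseteq> tensor_relations (additive_group L') A"
proof -
  interpret L': tensor_lattice A L' B' by fact
  have "X \<subseteq> L'.X" unfolding X_def L'.X_def using assms(2) by blast
  have "generate T.FG X \<subseteq> L'.T.N"
  proof
    fix c assume c: "c \<in> generate T.FG X"
    then show "c \<in> L'.T.N"
    proof (induction c rule: generate.induct)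
      case one
      then show ?case using L'.T.zero_mem by simp
    next
      case (incl h)
      then show ?case using \<open>X \<subseteq> L'.X\<close> L'.T.X_N by blast
    next
      case (inv h)
      then show ?case using \<open>X \<subseteq> L'.X\<close> L'.T.X_N L'.T.minus_mem T.X_sub by fastforce
    next
      case (eng h1 h2)
      then show ?case using L'.T.add_mem by simp
    qed
  qed
  then show ?thesis using tensor_N L'.tensor_N T.N_def by simp
qed

text \<open>Passing to a larger lattice keeps representatives, because relations over the smaller
  lattice remain relations.\<close>

lemma tensor_map_coset:
  assumes "tensor_lattice A L' B'" "L \<subseteq> L'"
  shows "tensor_map (additive_group L') A (\<lambda>v. v) (T.N #>\<^bsub>T.FG\<^esub> c) =
    tensor_relations (additive_group L') A #>\<^bsub>free_Abelian_group (L' \<times> carrier A)\<^esub> c"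
proof -
  interpret L': tensor_lattice A L' B' by fact
  have id: "frag_extend (\<lambda>(x, a). frag_of (x, a)) d = d" for d :: "(real^'n) \<times> 'a \<Rightarrow>\<^sub>0 int"
  proof -
    have "(\<lambda>(x :: real^'n, a :: 'a). frag_of (x, a)) = frag_of" by auto
    then show ?thesis using frag_expansion[of d] by simp
  qed
  have NN: "T.N \<subseteq> L'.T.N" using subset_relations[OF assms] tensor_N L'.tensor_N by simp
  have "tensor_map (additive_group L') A (\<lambda>v. v) (T.N #>\<^bsub>T.FG\<^esub> c) =
      {r + d |r d. r \<in> L'.T.N \<and> d \<in> T.N #>\<^bsub>T.FG\<^esub> c}"
    unfolding tensor_map_def id L'.tensor_N by (auto simp: set_mult_def)
  also have "\<dots> = {r + c |r. r \<in> L'.T.N}"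
  proof (intro equalityI subsetI)
    fix x assume "x \<in> {r + d |r d. r \<in> L'.T.N \<and> d \<in> T.N #>\<^bsub>T.FG\<^esub> c}"
    then obtain r s where "r \<in> L'.T.N" "s \<in> T.N" "x = r + (s + c)" unfolding T.coset_def by blast
    then have "r + s \<in> L'.T.N" "x = (r + s) + c" using NN L'.T.add_mem by (auto simp: add.assoc)
    then show "x \<in> {r + c |r. r \<in> L'.T.N}" by blast
  next
    fix x assume "x \<in> {r + c |r. r \<in> L'.T.N}"
    moreover have "c \<in> T.N #>\<^bsub>T.FG\<^esub> c" unfolding T.coset_def using T.zero_mem by force
    ultimately show "x \<in> {r + d |r d. r \<in> L'.T.N \<and> d \<in> T.N #>\<^bsub>T.FG\<^esub> c}" by blast
  qed
  also have "\<dots> = tensor_relations (additive_group L') A #>\<^bsub>free_Abelian_group (L' \<times> carrier A)\<^esub> c"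
    unfolding L'.tensor_N L'.T.coset_def ..
  finally show ?thesis .
qed

lemma tensor_map_properties:
  assumes L': "tensor_lattice A L' B'" "L \<subseteq> L'" and \<xi>: "\<xi> \<in> carrier (tensor (additive_group L) A)"
  defines "\<xi>' \<equiv> tensor_map (additive_group L') A (\<lambda>v. v) \<xi>"
  shows "\<xi>' \<in> carrier (tensor (additive_group L') A)"
    and "\<phi> \<in> hom (additive_group L') integer_group \<Longrightarrow> contract A \<xi>' \<phi> = contract A \<xi> \<phi>"
    and "tensor_lattice A L'' B'' \<Longrightarrow> L' \<subseteq> L'' \<Longrightarrow>
      tensor_map (additive_group L'') A (\<lambda>v. v) \<xi>' = tensor_map (additive_group L'') A (\<lambda>v. v) \<xi>"
proof -
  interpret L': tensor_lattice A L' B' by fact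
  obtain c where c: "Poly_Mapping.keys c \<subseteq> L \<times> carrier A" "\<xi> = T.N #>\<^bsub>T.FG\<^esub> c"
    using carrier_tensorE[OF \<xi>] .
  have \<xi>': "\<xi>' = L'.T.N #>\<^bsub>L'.T.FG\<^esub> c"
    unfolding \<xi>'_def c(2) tensor_map_coset[OF L'] L'.tensor_N ..
  have c': "Poly_Mapping.keys c \<subseteq> L' \<times> carrier A" using c L'(2) by auto
  then show "\<xi>' \<in> carrier (tensor (additive_group L') A)"
    unfolding \<xi>' L'.tensor_FG L'.T.quotient_carrier by blast
  show "contract A \<xi>' \<phi> = contract A \<xi> \<phi>" if \<phi>: "\<phi> \<in> hom (additive_group L') integer_group"
  proof -
    have "\<phi> \<in> hom (additive_group L) integer_group" using \<phi> L'(2) by (auto simp: hom_def)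
    then show ?thesis using contract_coset[OF _ c(1)] L'.contract_coset[OF \<phi> c'] c(2) \<xi>'
      by (simp add: eval_def L'.eval_def)
  qed
  show "tensor_map (additive_group L'') A (\<lambda>v. v) \<xi>' = tensor_map (additive_group L'') A (\<lambda>v. v) \<xi>"
    if L'': "tensor_lattice A L'' B''" "L' \<subseteq> L''"
  proof -
    have "L \<subseteq> L''" using L'(2) L''(2) by blast
    then show ?thesis
      unfolding \<xi>' unfolding c(2) by (simp only: L'.tensor_map_coset[OF L''] tensor_map_coset[OF L''(1)])
  qed
qed

end

section \<open>Evaluation of psi\<close>

locale admissible_lattice = tensor_lattice A L B
  for A :: "('a, 'm) monoid_scheme" (structure) and L B :: "(real^'n) set" +
  fixes \<xi> :: "((real^'n) \<times> 'a \<Rightarrow>\<^sub>0 int) set"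
  assumes \<xi>: "\<xi> \<in> carrier (tensor (additive_group L) A)"
    and adm: "contract A \<xi> ` hom (additive_group L) integer_group = carrier A"
begin

sublocale symbol_lattice A L B "\<lambda>\<phi>. contract A \<xi> (\<lambda>x. \<lfloor>\<phi> x\<rfloor>)"
proof
  show "contract A \<xi> (\<lambda>x. \<lfloor>\<phi> x\<rfloor>) \<in> carrier A" if "integral_on L \<phi>" for \<phi>
    using contract_closed[OF \<xi> floor_hom[OF that]] .
  show "contract A \<xi> (\<lambda>x. \<lfloor>\<phi> x - \<psi> x\<rfloor>) = contract A \<xi> (\<lambda>x. \<lfloor>\<phi> x\<rfloor>) \<otimes> inv (contract A \<xi> (\<lambda>x. \<lfloor>\<psi> x\<rfloor>))"
    if "integral_on L \<phi>" "integral_on L \<psi>" for \<phi> \<psi>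
    using contract_diff[OF \<xi> that] .
  show "generate A (dual_coefficient (\<lambda>\<phi>. contract A \<xi> (\<lambda>x. \<lfloor>\<phi> x\<rfloor>)) S ` S) = carrier A" if "Zbasis L S" for S
    using generate_coefficients[OF \<xi> adm that] by (simp add: dual_coefficient_def)
qed

lemma M_group_eq: "M_group A CARD('n) = Q.FG Mod Q.N"
  by (simp add: M_group_def N_relations)

lemma symbol_class_eq: "symbol_class A CARD('n) as = Q.N #>\<^bsub>Q.FG\<^esub> frag_of as"
  by (simp add: symbol_class_def N_relations)

text \<open>A second basis spanning the same cone is another dissection with one piece, so
  \<open>dissection_independent\<close> covers the change of basis as well.\<close>

lemma psi_basic_eq:
  assumes S: "Zbasis L S"
  shows "psi_basic A L \<xi> (convex_cone hull S) = Q.N #>\<^bsub>Q.FG\<^esub> F S"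
  unfolding psi_basic_def
proof (rule the_equality)
  have finS: "finite S" using goodD(4)[OF Zbasis_good[OF S]] .
  obtain es where es: "distinct es" "set es = S" using finite_distinct_list[OF finS] by blast
  have Zes: "Zbasis L (set es)" using S es by simp
  have len: "length es = CARD('n)" using goodD(5)[OF Zbasis_good[OF S]] es by (metis distinct_card)
  have lb: "lattice_basis L es" using es Zes by (simp add: lattice_basis_iff)
  have sm: "symbol_of es \<in> symbols A CARD('n)" using symbol_of_mem[OF Zes es(1)] .
  have nth: "symbol_of es ! i = contract A \<xi> (\<lambda>x. \<lfloor>representation (set es) x (es ! i)\<rfloor>)" if "i < CARD('n)" for i
    using that len by (simp add: symbol_of_def dual_coefficient_def)
  have "\<xi> = tensor_sum ((!) es) ((!) (symbol_of es))"
  proof -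
    have esL: "es ! i \<in> L" if "i < CARD('n)" for i using that len goodD(1)[OF Zbasis_good[OF Zes]] by auto
    have smA: "symbol_of es ! i \<in> carrier A" if "i < CARD('n)" for i using that sm by (auto simp: symbols_def)
    have "tensor_sum ((!) es) (\<lambda>i. contract A \<xi> (\<lambda>x. \<lfloor>representation (set es) x (es ! i)\<rfloor>)) =
        T.N #>\<^bsub>T.FG\<^esub> (\<Sum>i<CARD('n). frag_of (es ! i, contract A \<xi> (\<lambda>x. \<lfloor>representation (set es) x (es ! i)\<rfloor>)))"
      using esL smA nth by (intro tensor_sum_coset) auto
    also have "\<dots> = T.N #>\<^bsub>T.FG\<^esub> (\<Sum>i<CARD('n). frag_of (es ! i, symbol_of es ! i))"
      using nth by simp
    also have "\<dots> = tensor_sum ((!) es) ((!) (symbol_of es))"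
      using esL smA by (intro tensor_sum_coset[symmetric])
    finally show ?thesis using tensor_basis_expansion[OF \<xi> es(1) Zes] by simp
  qed
  moreover have "Q.N #>\<^bsub>Q.FG\<^esub> F S = symbol_class A CARD('n) (symbol_of es)"
    unfolding symbol_class_eq Q.coset_eq_iff using F_basis[OF Zes es(1)] es by simp
  ultimately show "\<exists>es as. lattice_basis L es \<and> convex_cone hull S = convex_cone hull set es \<and>
     length as = CARD('n) \<and> set as \<subseteq> carrier A \<and>
     \<xi> = finprod (tensor (additive_group L) A)
           (\<lambda>i. pure_tensor (additive_group L) A (es ! i) (as ! i)) {..<CARD('n)} \<and>
     Q.N #>\<^bsub>Q.FG\<^esub> F S = symbol_class A CARD('n) as"
    using lb es sm unfolding tensor_sum_def
    by (intro exI[of _ es] exI[of _ "symbol_of es"]) (auto simp: symbols_def)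
next
  fix m assume "\<exists>es as. lattice_basis L es \<and> convex_cone hull S = convex_cone hull set es \<and>
     length as = CARD('n) \<and> set as \<subseteq> carrier A \<and>
     \<xi> = finprod (tensor (additive_group L) A)
           (\<lambda>i. pure_tensor (additive_group L) A (es ! i) (as ! i)) {..<CARD('n)} \<and>
     m = symbol_class A CARD('n) as"
  then obtain es as where es: "distinct es" "Zbasis L (set es)" "convex_cone hull S = convex_cone hull set es"
    and as: "length as = CARD('n)" "set as \<subseteq> carrier A" "\<xi> = tensor_sum ((!) es) ((!) as)"
    and m: "m = symbol_class A CARD('n) as"
    unfolding tensor_sum_def lattice_basis_iff by blast
  have len: "length es = CARD('n)" using goodD(5)[OF Zbasis_good[OF es(2)]] es(1) by (simp add: distinct_card)
  have "as = symbol_of es"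
  proof (rule nth_equalityI)
    show "length as = length (symbol_of es)" using len as(1) by (simp add: symbol_of_def)
    fix i assume i: "i < length as"
    have "contract A \<xi> (\<lambda>x. \<lfloor>representation (set es) x (es ! i)\<rfloor>) = as ! i"
      unfolding as(3) using as(1,2) i by (intro contract_basis_coefficient[OF es(1,2)]) auto
    then show "as ! i = symbol_of es ! i" using i as(1) len by (simp add: symbol_of_def dual_coefficient_def)
  qed
  then have "m = Q.N #>\<^bsub>Q.FG\<^esub> F (set es)"
    unfolding m symbol_class_eq Q.coset_eq_iff using F_basis[OF es(2,1)] Q.diff_sym_mem by simp
  also have "\<dots> = Q.N #>\<^bsub>Q.FG\<^esub> F S"
    unfolding Q.coset_eq_iff
    using dissection_independent[of "convex_cone hull S" "{set es}" "{S}"] dissection_self[OF Zbasis_good[OF S]]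
      dissection_self[OF Zbasis_good[OF es(2)]] es(3) by simp
  finally show "m = Q.N #>\<^bsub>Q.FG\<^esub> F S" .
qed

text \<open>Decompositions and dissections are translated into each other: interiors are read off by
  \<open>pos_at\<close>, and a choice of bases turns cones into sets of generators.
  \<open>dissection_independent\<close> then gives the definite description a value.\<close>

lemma psi_eq:
  assumes D: "dissection \<Lambda> D" "\<And>S. S \<in> D \<Longrightarrow> Zbasis L S"
  shows "psi A L \<xi> \<Lambda> = Q.N #>\<^bsub>Q.FG\<^esub> sum F D"
  unfolding psi_def
proof (rule the_equality)
  let ?c = "\<lambda>S. convex_cone hull S"
  have inj: "inj_on ?c D"
  proof (rule inj_onI)
    fix S S' assume *: "S \<in> D" "S' \<in> D" "?c S = ?c S'"
    have "pos_at S (\<Sum>S)" using good_pos_sum dissectionD(2)[OF D(1)] * by blast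
    moreover from this have "pos_at S' (\<Sum>S)"
      using good_cone_mono_pos[of S' S] dissectionD(2)[OF D(1)] * by blast
    ultimately show "S = S'" using dissectionD(4)[OF D(1)] * by blast
  qed
  have "basic_decomposition L \<Lambda> (?c ` D)"
    unfolding basic_decomposition_def
  proof (intro conjI)
    show "finite (?c ` D)" using dissectionD(1)[OF D(1)] by simp
    show "\<Union> (?c ` D) = \<Lambda>" using dissectionD(3)[OF D(1)] by simp
    show "\<forall>C\<in>?c ` D. basic_simplicial L C" using D(2) by (auto simp: basic_simplicial_iff)
    show "pairwise (\<lambda>C C'. interior C \<inter> interior C' = {}) (?c ` D)"
    proof (rule pairwiseI)
      fix C C' assume "C \<in> ?c ` D" "C' \<in> ?c ` D" "C \<noteq> C'"
      then obtain S S' where S: "S \<in> D" "S' \<in> D" "C = ?c S" "C' = ?c S'" "S \<noteq> S'" by auto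
      have "interior C = {x. pos_at S x}" "interior C' = {x. pos_at S' x}"
        using S dissectionD(2)[OF D(1)] goodD(2,3) by (auto intro!: interior_cone)
      then show "interior C \<inter> interior C' = {}" using dissectionD(4)[OF D(1) S(1,2)] S(5) by auto
    qed
  qed
  moreover have "finprod (M_group A CARD('n)) (psi_basic A L \<xi>) (?c ` D) = Q.N #>\<^bsub>Q.FG\<^esub> sum F D"
  proof -
    interpret M: comm_group "Q.FG Mod Q.N" by (rule Q.comm_group_quotient)
    have car: "Q.N #>\<^bsub>Q.FG\<^esub> F S \<in> carrier (Q.FG Mod Q.N)" if "S \<in> D" for S
      using F_keys[OF D(2)[OF that]] by (auto simp: Q.quotient_carrier)
    have "finprod (Q.FG Mod Q.N) (psi_basic A L \<xi>) (?c ` D) = finprod (Q.FG Mod Q.N) (\<lambda>S. psi_basic A L \<xi> (?c S)) D"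
      using car psi_basic_eq[OF D(2)] by (intro M.finprod_reindex inj) auto
    also have "\<dots> = finprod (Q.FG Mod Q.N) (\<lambda>S. Q.N #>\<^bsub>Q.FG\<^esub> F S) D"
      using car psi_basic_eq[OF D(2)] by (intro M.finprod_cong') auto
    also have "\<dots> = Q.N #>\<^bsub>Q.FG\<^esub> sum F D" using F_keys[OF D(2)] by (intro Q.finprod_coset)
    finally show ?thesis unfolding M_group_eq .
  qed
  ultimately show "\<exists>D'. basic_decomposition L \<Lambda> D' \<and> Q.N #>\<^bsub>Q.FG\<^esub> sum F D = finprod (M_group A CARD('n)) (psi_basic A L \<xi>) D'"
    by metis
next
  fix m assume "\<exists>D'. basic_decomposition L \<Lambda> D' \<and> m = finprod (M_group A CARD('n)) (psi_basic A L \<xi>) D'"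
  then obtain D' where D': "basic_decomposition L \<Lambda> D'" and m: "m = finprod (M_group A CARD('n)) (psi_basic A L \<xi>) D'" by blast
  have "\<exists>S. Zbasis L S \<and> C = convex_cone hull S" if "C \<in> D'" for C
    using D' that by (auto simp: basic_decomposition_def basic_simplicial_iff)
  then obtain s where s: "\<And>C. C \<in> D' \<Longrightarrow> Zbasis L (s C)" "\<And>C. C \<in> D' \<Longrightarrow> C = convex_cone hull (s C)" by metis
  have inj: "inj_on s D'" using s(2) by (metis inj_onI)
  have "dissection \<Lambda> (s ` D')"
    unfolding dissection_def
  proof (intro conjI)
    show "finite (s ` D')" using D' by (simp add: basic_decomposition_def)
    show "\<forall>T\<in>s ` D'. good T" using s(1) Zbasis_good by auto
    show "\<Lambda> = (\<Union>T\<in>s ` D'. convex_cone hull T)" using D' s(2) unfolding basic_decomposition_def by auto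
    show "\<forall>T\<in>s ` D'. \<forall>T'\<in>s ` D'. \<forall>x. pos_at T x \<and> pos_at T' x \<longrightarrow> T = T'"
    proof (intro ballI allI impI, elim imageE conjE)
      fix T T' x C C' assume *: "pos_at T x" "pos_at T' x" "T = s C" "C \<in> D'" "T' = s C'" "C' \<in> D'"
      have "interior C = {x. pos_at T x}" "interior C' = {x. pos_at T' x}"
        using interior_cone[of "s C"] interior_cone[of "s C'"] s[OF *(4)] s[OF *(6)] * goodD(2,3)[OF Zbasis_good] by auto
      then have "interior C \<inter> interior C' \<noteq> {}" using * by auto
      then have "C = C'" using D' * unfolding basic_decomposition_def pairwise_def by blast
      then show "T = T'" using * by simp
    qed
  qed
  then have "sum F (s ` D') - sum F D \<in> Q.N" using dissection_independent D(1) by blast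
  moreover have "m = Q.N #>\<^bsub>Q.FG\<^esub> sum F (s ` D')"
  proof -
    interpret M: comm_group "Q.FG Mod Q.N" by (rule Q.comm_group_quotient)
    have eq: "psi_basic A L \<xi> C = Q.N #>\<^bsub>Q.FG\<^esub> F (s C)" if "C \<in> D'" for C
      using psi_basic_eq[OF s(1)[OF that]] s(2)[OF that] by simp
    have "m = finprod (Q.FG Mod Q.N) (\<lambda>C. Q.N #>\<^bsub>Q.FG\<^esub> F (s C)) D'"
    proof -
      have "Q.N #>\<^bsub>Q.FG\<^esub> F (s C) \<in> carrier (Q.FG Mod Q.N)" if "C \<in> D'" for C
        using F_keys[OF s(1)[OF that]] by (auto simp: Q.quotient_carrier)
      then show ?thesis unfolding m M_group_eq using eq by (intro M.finprod_cong') auto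
    qed
    also have "\<dots> = Q.N #>\<^bsub>Q.FG\<^esub> (\<Sum>C\<in>D'. F (s C))" using F_keys[OF s(1)] by (intro Q.finprod_coset)
    finally show ?thesis by (simp add: sum.reindex[OF inj])
  qed
  ultimately show "m = Q.N #>\<^bsub>Q.FG\<^esub> sum F D" by (simp add: Q.coset_eq_iff)
qed

end

section \<open>Stacked bases and elementary superlattices\<close>

text \<open>Base changes are integral operations on generators, for which integral combinations are
  handier than the coordinate condition in \<open>Zbasis\<close>.\<close>

definition Zspan :: "'v::real_vector set \<Rightarrow> 'v set" where
  "Zspan S = {\<Sum>v\<in>S. of_int (c v) *\<^sub>R v |c :: 'v \<Rightarrow> int. True}"

lemma ZspanI: "(\<Sum>v\<in>S. of_int (c v) *\<^sub>R v) \<in> Zspan S"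
  unfolding Zspan_def by blast

lemma ZspanE:
  assumes "x \<in> Zspan S"
  obtains c :: "'v::real_vector \<Rightarrow> int" where "x = (\<Sum>v\<in>S. of_int (c v) *\<^sub>R v)"
  using assms unfolding Zspan_def by blast

lemma Zspan_zero: "0 \<in> Zspan S"
  using ZspanI[of "\<lambda>_. 0" S] by simp

lemma Zspan_add: "x \<in> Zspan S \<Longrightarrow> y \<in> Zspan S \<Longrightarrow> x + y \<in> Zspan S"
proof (elim ZspanE)
  fix c d assume "x = (\<Sum>v\<in>S. of_int (c v) *\<^sub>R v)" "y = (\<Sum>v\<in>S. of_int (d v) *\<^sub>R v)"
  then show ?thesis using ZspanI[of "\<lambda>v. c v + d v" S] by (simp add: scaleR_add_left sum.distrib)
qed

lemma Zspan_scale: "x \<in> Zspan S \<Longrightarrow> of_int k *\<^sub>R x \<in> Zspan S"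
proof (elim ZspanE)
  fix c assume "x = (\<Sum>v\<in>S. of_int (c v) *\<^sub>R v)"
  then show ?thesis using ZspanI[of "\<lambda>v. k * c v" S] by (simp add: scaleR_sum_right)
qed

lemma Zspan_diff: "x \<in> Zspan S \<Longrightarrow> y \<in> Zspan S \<Longrightarrow> x - y \<in> Zspan S"
  using Zspan_add[of x S "of_int (- 1) *\<^sub>R y"] Zspan_scale[of y S "- 1"] by simp

lemma Zspan_base: "finite S \<Longrightarrow> v \<in> S \<Longrightarrow> v \<in> Zspan S"
  using ZspanI[of "\<lambda>u. of_bool (u = v)" S] sum_of_bool_scaleR[of S v] by simp

lemma Zspan_subset_span: "Zspan S \<subseteq> span S"
  by (auto elim!: ZspanE intro!: span_sum intro: span_scale span_base)

lemma span_Zspan: "finite S \<Longrightarrow> span (Zspan S) = span S"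
  by (metis Zspan_base Zspan_subset_span span_mono span_span subsetI subset_antisym)

lemma Zspan_insert:
  assumes "finite T" "v \<notin> T"
  shows "x \<in> Zspan (insert v T) \<longleftrightarrow> (\<exists>k t. t \<in> Zspan T \<and> x = of_int k *\<^sub>R v + t)"
proof
  assume "x \<in> Zspan (insert v T)"
  then obtain c :: "'a \<Rightarrow> int" where "x = (\<Sum>v\<in>insert v T. of_int (c v) *\<^sub>R v)" by (rule ZspanE)
  then have "x = of_int (c v) *\<^sub>R v + (\<Sum>v\<in>T. of_int (c v) *\<^sub>R v)" using assms by simp
  then show "\<exists>k t. t \<in> Zspan T \<and> x = of_int k *\<^sub>R v + t" using ZspanI by blast
next
  assume "\<exists>k t. t \<in> Zspan T \<and> x = of_int k *\<^sub>R v + t"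
  then obtain k t where t: "t \<in> Zspan T" "x = of_int k *\<^sub>R v + t" by blast
  then obtain c :: "'a \<Rightarrow> int" where c: "t = (\<Sum>v\<in>T. of_int (c v) *\<^sub>R v)" by (elim ZspanE)
  have "(\<Sum>u\<in>T. of_int ((c(v := k)) u) *\<^sub>R u) = (\<Sum>v\<in>T. of_int (c v) *\<^sub>R v)"
    using assms by (intro sum.cong) auto
  then have "x = (\<Sum>u\<in>insert v T. of_int ((c(v := k)) u) *\<^sub>R u)" using assms t c by simp
  then show "x \<in> Zspan (insert v T)" using ZspanI by metis
qed

text \<open>An elementary base change; subtracting \<open>t\<close> again inverts it.\<close>

lemma Zspan_transvection:
  assumes S: "finite S" "independent S" "v \<in> S" and t: "t \<in> Zspan (S - {v})"
  shows "independent (insert (v + t) (S - {v}))" "v + t \<notin> S - {v}" "Zspan (insert (v + t) (S - {v})) = Zspan S"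
proof -
  let ?T = "S - {v}"
  have vT: "v \<notin> span ?T" using S by (auto simp: dependent_def)
  have "t \<in> span ?T" using t Zspan_subset_span by blast
  then have "v + t \<notin> span ?T" using vT span_add_eq2 by blast
  then show "v + t \<notin> ?T" by (meson span_base)
  have indT: "independent ?T" using S(2) independent_mono[of S ?T] by auto
  show "independent (insert (v + t) ?T)" using \<open>v + t \<notin> span ?T\<close> indT by (rule independent_insertI)
  have S_eq: "S = insert v ?T" using S by auto
  show "Zspan (insert (v + t) ?T) = Zspan S"
  proof (intro equalityI subsetI)
    fix x assume "x \<in> Zspan (insert (v + t) ?T)"
    then obtain k s where "s \<in> Zspan ?T" "x = of_int k *\<^sub>R (v + t) + s"
      using Zspan_insert[of ?T "v + t" x] S \<open>v + t \<notin> ?T\<close> by auto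
    then have "of_int k *\<^sub>R t + s \<in> Zspan ?T" using t by (intro Zspan_add Zspan_scale)
    moreover have "x = of_int k *\<^sub>R v + (of_int k *\<^sub>R t + s)"
      using \<open>x = _\<close> by (simp add: scaleR_add_right)
    ultimately have "x \<in> Zspan (insert v ?T)" using Zspan_insert[of ?T v x] S(1) by blast
    then show "x \<in> Zspan S" using S_eq by simp
  next
    fix x assume "x \<in> Zspan S"
    then have "x \<in> Zspan (insert v ?T)" using S_eq by simp
    then obtain k s where "s \<in> Zspan ?T" "x = of_int k *\<^sub>R v + s" using Zspan_insert[of ?T v x] S(1) by blast
    then have "s - of_int k *\<^sub>R t \<in> Zspan ?T" using t by (intro Zspan_diff Zspan_scale)
    moreover have "x = of_int k *\<^sub>R (v + t) + (s - of_int k *\<^sub>R t)"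
      using \<open>x = _\<close> by (simp add: scaleR_add_right)
    ultimately show "x \<in> Zspan (insert (v + t) ?T)"
      using Zspan_insert[of ?T "v + t" x] S(1) \<open>v + t \<notin> ?T\<close> by blast
  qed
qed

text \<open>The divisor split off first is the least positive coefficient that occurs in \<open>N\<close> over all bases;
  minimality makes it divide the remaining coefficients.\<close>

lemma stacked_Zspan:
  fixes S :: "'v::euclidean_space set"
  assumes "independent S" "0 \<in> N" "\<And>x y. x \<in> N \<Longrightarrow> y \<in> N \<Longrightarrow> x - y \<in> N"
    "N \<subseteq> Zspan S" "m > (0::int)" "\<And>v. v \<in> S \<Longrightarrow> of_int m *\<^sub>R v \<in> N"
  shows "\<exists>S' d. independent S' \<and> card S' = card S \<and> Zspan S' = Zspan S \<and> (\<forall>v\<in>S'. d v > (0::int)) \<and>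
    N = {\<Sum>v\<in>S'. of_int (c v * d v) *\<^sub>R v |c :: 'v \<Rightarrow> int. True}"
  using assms
proof (induction "card S" arbitrary: S N)
  case 0
  have "S = {}" using 0(1) finiteI_independent[OF 0(2)] by simp
  then have "N = {0}" using 0 by (auto simp: Zspan_def)
  then show ?case using \<open>S = {}\<close> by (intro exI[of _ "{}"] exI[of _ "\<lambda>_. 1"]) (auto simp: independent_empty)
next
  case (Suc k)
  note N0 = Suc.prems(2) and Nd = Suc.prems(3)
  have Nadd: "x + y \<in> N" if "x \<in> N" "y \<in> N" for x y using Nd[OF that(1) Nd[OF N0 that(2)]] by simp
  have Nsc_nat: "of_nat j *\<^sub>R x \<in> N" if "x \<in> N" for j x
    using N0 Nadd[OF that] by (induction j) (auto simp: scaleR_add_left)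
  have Nsc: "of_int j *\<^sub>R x \<in> N" if "x \<in> N" for j x
  proof (cases "j \<ge> 0")
    case True
    then show ?thesis using Nsc_nat[OF that, of "nat j"] by simp
  next
    case False
    then show ?thesis using Nd[OF N0 Nsc_nat[OF that, of "nat (- j)"]] by simp
  qed
  have finS: "finite S" using Suc.prems(1) finiteI_independent by auto
  define P where "P d \<longleftrightarrow> d > 0 \<and> (\<exists>S' v x t. independent S' \<and> finite S' \<and> card S' = Suc k \<and> Zspan S' = Zspan S \<and>
    v \<in> S' \<and> x \<in> N \<and> t \<in> Zspan (S' - {v}) \<and> x = of_nat d *\<^sub>R v + t)" for d
  obtain v where v: "v \<in> S" using Suc.hyps(2) by fastforce
  have "P (nat m)"
    unfolding P_def using Suc.prems finS Suc.hyps(2) v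
    by (intro conjI exI[of _ S] exI[of _ v] exI[of _ "of_int m *\<^sub>R v"] exI[of _ 0]) (auto simp: Zspan_zero)
  then obtain d where d: "P d" and dmin: "\<And>e. P e \<Longrightarrow> d \<le> e"
    by (metis LeastI Least_le)
  then obtain S1 v1 x t where S1: "independent S1" "finite S1" "card S1 = Suc k" "Zspan S1 = Zspan S" "v1 \<in> S1"
    and x: "x \<in> N" "t \<in> Zspan (S1 - {v1})" "x = of_nat d *\<^sub>R v1 + t" and d0: "d > 0"
    unfolding P_def by blast
  define T where "T = S1 - {v1}"
  have finT: "finite T" and S1_eq: "S1 = insert v1 T" "v1 \<notin> T" using S1 by (auto simp: T_def)
  obtain c :: "'v \<Rightarrow> int" where c: "t = (\<Sum>u\<in>T. of_int (c u) *\<^sub>R u)" using x(2) by (auto simp: T_def elim: ZspanE)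
  have c_dvd: "int d dvd c u" if u: "u \<in> T" for u
  proof (rule ccontr)
    assume "\<not> int d dvd c u"
    define q where "q = c u div int d"
    define r where "r = c u mod int d"
    have r: "0 < r" "r < int d" "c u = q * int d + r"
    proof -
      have "r \<noteq> 0" using \<open>\<not> int d dvd c u\<close> by (simp add: r_def dvd_eq_mod_eq_0)
      moreover have "0 \<le> r" "r < int d" using d0 by (simp_all add: r_def)
      ultimately show "0 < r" "r < int d" "c u = q * int d + r" by (simp_all add: r_def q_def)
    qed
    \<comment> \<open>Adding \<open>q\<close> times \<open>u\<close> to \<open>v1\<close> lowers the
      coefficient of \<open>u\<close> in \<open>x\<close> from \<open>c u\<close> to its remainder
      \<open>r\<close>. This is a smaller positive coefficient in another basis.\<close>
    have quZ: "of_int q *\<^sub>R u \<in> Zspan (S1 - {v1})" using u finT by (auto simp: T_def intro: Zspan_scale Zspan_base)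
    note S2 = Zspan_transvection[OF S1(2,1,5) quZ, folded T_def]
    let ?S2 = "insert (v1 + of_int q *\<^sub>R u) T"
    let ?s = "of_nat d *\<^sub>R (v1 + of_int q *\<^sub>R u) + (t - of_int (c u) *\<^sub>R u)"
    have "t - of_int (c u) *\<^sub>R u = (\<Sum>u\<in>T - {u}. of_int (c u) *\<^sub>R u)"
      unfolding c using finT u by (simp add: sum.remove[of T u])
    then have "t - of_int (c u) *\<^sub>R u \<in> Zspan (T - {u})" using ZspanI by metis
    moreover have "?S2 - {u} = insert (v1 + of_int q *\<^sub>R u) (T - {u})" using S2(2) u by auto
    ultimately have "?s \<in> Zspan (?S2 - {u})"
      using Zspan_insert[of "T - {u}" "v1 + of_int q *\<^sub>R u" ?s] finT S2(2) of_int_of_nat_eq[of d, where 'a = real]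
      by (metis DiffD1 finite_Diff)
    moreover have "x = of_nat (nat r) *\<^sub>R u + ?s"
      unfolding x(3) using r by (simp add: algebra_simps)
    ultimately have "P (nat r)"
      unfolding P_def using r S2 S1(3,4) S1_eq finT u x(1)
      by (intro conjI exI[of _ ?S2] exI[of _ u] exI[of _ x] exI[of _ ?s]) auto
    then show False using dmin[of "nat r"] r by linarith
  qed
  \<comment> \<open>All coefficients of \<open>x\<close> are multiples of \<open>d\<close>, so
    \<open>v1\<close> can absorb the rest and \<open>x\<close> becomes \<open>d\<close> times a
    basis vector.\<close>
  define t' where "t' = (\<Sum>u\<in>T. of_int (c u div int d) *\<^sub>R u)"
  have t'Z: "t' \<in> Zspan (S1 - {v1})" unfolding t'_def T_def by (rule ZspanI)
  define v' where "v' = v1 + t'"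
  have "of_nat d *\<^sub>R t' = t"
    unfolding t'_def c scaleR_sum_right
  proof (rule sum.cong[OF refl])
    fix u assume "u \<in> T"
    then have "c u = int d * (c u div int d)" using c_dvd by simp
    then have "real_of_int (c u) = of_nat d * of_int (c u div int d)" by (metis of_int_mult of_int_of_nat_eq)
    then show "of_nat d *\<^sub>R of_int (c u div int d) *\<^sub>R u = of_int (c u) *\<^sub>R u" by simp
  qed
  then have xv': "x = of_nat d *\<^sub>R v'" using x(3) by (simp add: v'_def scaleR_add_right)
  note S3 = Zspan_transvection[OF S1(2,1,5) t'Z, folded T_def v'_def]
  have ZS: "Zspan S = Zspan (insert v' T)" using S3(3) S1(4) by simp
  have indT: "independent T" using S3(1) independent_mono by blast
  define N' where "N' = N \<inter> Zspan T"
  have split: "\<exists>q y'. y = of_int (q * int d) *\<^sub>R v' + y' \<and> y' \<in> N'" if y: "y \<in> N" for y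
  proof -
    obtain j s where js: "s \<in> Zspan T" "y = of_int j *\<^sub>R v' + s"
      using y Suc.prems(4) ZS Zspan_insert[OF finT S3(2)] by blast
    define q where "q = j div int d"
    define r where "r = j mod int d"
    have r: "0 \<le> r" "r < int d" "j = q * int d + r" using d0 by (auto simp: q_def r_def)
    \<comment> \<open>Subtracting a multiple of \<open>x\<close> leaves the remainder
      \<open>r\<close> as coefficient of \<open>v'\<close>, and minimality of \<open>d\<close>
      forces it to vanish. Hence \<open>N\<close> splits off the multiples of
      \<open>x\<close>.\<close>
    let ?y = "y - of_int q *\<^sub>R x"
    have yN: "?y \<in> N" using Nd y Nsc x by blast
    have yeq: "?y = of_int r *\<^sub>R v' + s" unfolding js(2) xv' r(3) by (simp add: algebra_simps)
    have "r = 0"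
    proof (rule ccontr)
      assume "r \<noteq> 0"
      then have "P (nat r)"
        unfolding P_def using r S3 S1(3,4) finT S1_eq yN js(1) yeq
        by (intro conjI exI[of _ "insert v' T"] exI[of _ v'] exI[of _ ?y] exI[of _ s]) auto
      then show False using dmin[of "nat r"] r \<open>r \<noteq> 0\<close> by linarith
    qed
    then have "y = of_int (q * int d) *\<^sub>R v' + s" "s \<in> N'"
      using js r yN yeq by (auto simp: N'_def)
    then show ?thesis by blast
  qed
  have "\<exists>T' d'. independent T' \<and> card T' = card T \<and> Zspan T' = Zspan T \<and> (\<forall>v\<in>T'. d' v > (0::int)) \<and>
    N' = {\<Sum>v\<in>T'. of_int (c v * d' v) *\<^sub>R v |c :: 'v \<Rightarrow> int. True}"
  proof (rule Suc.hyps(1))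
    show "k = card T" using S1 finT S1_eq by simp
    show "independent T" by fact
    show "0 \<in> N'" using N0 by (simp add: N'_def Zspan_zero)
    show "x - y \<in> N'" if "x \<in> N'" "y \<in> N'" for x y using that Nd by (auto simp: N'_def Zspan_diff)
    show "N' \<subseteq> Zspan T" by (simp add: N'_def)
    show "m > 0" by fact
    show "of_int m *\<^sub>R u \<in> N'" if u: "u \<in> T" for u
    proof -
      have "u \<in> Zspan S" using S1(4) Zspan_base[OF S1(2), of u] u by (auto simp: T_def)
      then obtain a :: "'v \<Rightarrow> int" where a: "u = (\<Sum>v\<in>S. of_int (a v) *\<^sub>R v)" by (rule ZspanE)
      have "of_int m *\<^sub>R u = (\<Sum>v\<in>S. of_int (a v) *\<^sub>R (of_int m *\<^sub>R v))"
        by (subst a) (simp add: scaleR_sum_right mult.commute)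
      also have "\<dots> \<in> N"
      proof -
        have "(\<Sum>v\<in>S'. of_int (a v) *\<^sub>R (of_int m *\<^sub>R v)) \<in> N" if "S' \<subseteq> S" for S'
          using finite_subset[OF that finS] that
          by (induction S' rule: finite_induct) (auto intro!: N0 Nadd Nsc Suc.prems(6) simp del: scaleR_scaleR)
        then show ?thesis by blast
      qed
      finally show ?thesis using u finT by (auto simp: N'_def intro: Zspan_scale Zspan_base)
    qed
  qed
  then obtain T' d' where T': "independent T'" "card T' = card T" "Zspan T' = Zspan T" "\<forall>v\<in>T'. d' v > (0::int)"
    "N' = {\<Sum>v\<in>T'. of_int (c v * d' v) *\<^sub>R v |c :: 'v \<Rightarrow> int. True}" by blast
  have finT': "finite T'" using T' finiteI_independent by auto
  have "v' \<notin> span T" using S3(1,2) by (simp add: independent_insert)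
  moreover have "span T' = span T" using span_Zspan[OF finT'] span_Zspan[OF finT] T' by simp
  ultimately have v'T': "v' \<notin> span T'" by simp
  then have v'n: "v' \<notin> T'" using span_base by blast
  define D where "D = d'(v' := int d)"
  have DT: "(\<Sum>u\<in>T'. of_int (a u * D u) *\<^sub>R u) = (\<Sum>u\<in>T'. of_int (a u * d' u) *\<^sub>R u)" for a
    using v'n by (intro sum.cong) (auto simp: D_def)
  show ?case
  proof (intro exI[of _ "insert v' T'"] exI[of _ D] conjI)
    show "independent (insert v' T')" using v'T' T' by (intro independent_insertI)
    show "card (insert v' T') = card S" using v'n finT' T' S1 finT S1_eq Suc.hyps(2) by simp
    show "Zspan (insert v' T') = Zspan S"
      unfolding ZS using Zspan_insert[OF finT S3(2)] Zspan_insert[OF finT' v'n] T'(3) by blast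
    show "\<forall>v\<in>insert v' T'. D v > 0" using T' d0 by (auto simp: D_def)
    show "N = {\<Sum>v\<in>insert v' T'. of_int (c v * D v) *\<^sub>R v |c :: 'v \<Rightarrow> int. True}"
    proof (intro equalityI subsetI)
      fix y assume "y \<in> N"
      then obtain q y' where y: "y = of_int (q * int d) *\<^sub>R v' + y'" "y' \<in> N'" using split by blast
      then obtain a :: "'v \<Rightarrow> int" where a: "y' = (\<Sum>v\<in>T'. of_int (a v * d' v) *\<^sub>R v)" unfolding T'(5) by blast
      have "(\<Sum>u\<in>T'. of_int ((a(v' := q)) u * D u) *\<^sub>R u) = y'"
        unfolding a DT using v'n by (intro sum.cong) auto
      then have "y = (\<Sum>u\<in>insert v' T'. of_int ((a(v' := q)) u * D u) *\<^sub>R u)"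
        using finT' v'n y by (simp add: D_def)
      then show "y \<in> {\<Sum>v\<in>insert v' T'. of_int (c v * D v) *\<^sub>R v |c :: 'v \<Rightarrow> int. True}" by blast
    next
      fix y assume "y \<in> {\<Sum>v\<in>insert v' T'. of_int (c v * D v) *\<^sub>R v |c :: 'v \<Rightarrow> int. True}"
      then obtain a :: "'v \<Rightarrow> int" where a: "y = (\<Sum>v\<in>insert v' T'. of_int (a v * D v) *\<^sub>R v)" by blast
      then have "y = of_int (a v') *\<^sub>R x + (\<Sum>u\<in>T'. of_int (a u * d' u) *\<^sub>R u)"
        using finT' v'n unfolding DT[symmetric] xv' by (simp add: D_def)
      moreover have "(\<Sum>u\<in>T'. of_int (a u * d' u) *\<^sub>R u) \<in> N'" unfolding T'(5) by blast
      ultimately show "y \<in> N" using Nadd Nsc x(1) by (auto simp: N'_def)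
    qed
  qed
qed

lemma Zbasis_iff_Zspan: "Zbasis L S \<longleftrightarrow> independent S \<and> span S = UNIV \<and> L = Zspan S"
proof -
  have "{x. \<forall>v\<in>S. representation S x v \<in> \<int>} = Zspan S" if S: "independent S" "span S = UNIV"
  proof (intro equalityI subsetI)
    have fin: "finite S" using card_basis[OF S] by simp
    fix x assume "x \<in> Zspan S"
    then obtain c :: "real^'a \<Rightarrow> int" where "x = (\<Sum>v\<in>S. of_int (c v) *\<^sub>R v)" by (rule ZspanE)
    then show "x \<in> {x. \<forall>v\<in>S. representation S x v \<in> \<int>}"
      using representation_unique[OF S(1) fin, of x "\<lambda>v. of_int (c v)"] by auto
  next
    fix x assume "x \<in> {x. \<forall>v\<in>S. representation S x v \<in> \<int>}"
    then have int: "of_int \<lfloor>representation S x v\<rfloor> = representation S x v" if "v \<in> S" for v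
      using that by (auto elim!: Ints_cases)
    have "x = (\<Sum>v\<in>S. representation S x v *\<^sub>R v)" using S by (simp add: representation_sum_eq)
    also have "\<dots> = (\<Sum>v\<in>S. of_int \<lfloor>representation S x v\<rfloor> *\<^sub>R v)"
      by (intro sum.cong refl arg_cong2[where f = scaleR] int[symmetric])
    finally show "x \<in> Zspan S" using ZspanI by metis
  qed
  then show ?thesis unfolding Zbasis_def by auto
qed

lemma scaled_basis:
  fixes S :: "(real^'n) set"
  assumes S: "independent S" "span S = UNIV" and c: "\<And>v. v \<in> S \<Longrightarrow> c v \<noteq> 0"
  defines "T \<equiv> (\<lambda>v. c v *\<^sub>R v) ` S"
  shows "independent T" "span T = UNIV" "inj_on (\<lambda>v. c v *\<^sub>R v) S"
    and "v \<in> S \<Longrightarrow> representation T x (c v *\<^sub>R v) = representation S x v / c v"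
proof -
  have fin: "finite S" using card_basis[OF S] by simp
  show inj: "inj_on (\<lambda>v. c v *\<^sub>R v) S"
  proof (rule inj_onI)
    fix u v assume *: "u \<in> S" "v \<in> S" "c u *\<^sub>R u = c v *\<^sub>R v"
    have rep: "representation S (c w *\<^sub>R w) z = (if z = w then c w else 0)" if "w \<in> S" for w z
      using that S by (simp add: representation_scale representation_basis)
    show "u = v" using rep[OF *(1), of u] rep[OF *(2), of u] *(3) c[OF *(1)] by (metis (full_types))
  qed
  have "v \<in> span T" if "v \<in> S" for v
  proof -
    have "(1 / c v) *\<^sub>R (c v *\<^sub>R v) \<in> span T" unfolding T_def using that by (intro span_scale span_base) auto
    then show ?thesis using c[OF that] by simp
  qed
  then have "span S \<subseteq> span T" by (intro span_minimal) auto
  then show sp: "span T = UNIV" using S by auto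
  have "card T = CARD('n)" unfolding T_def using card_image[OF inj] card_basis[OF S] by simp
  then show ind: "independent T"
    using sp fin by (intro card_le_dim_spanning[where V = UNIV]) (auto simp: T_def dim_UNIV)
  show "representation T x (c v *\<^sub>R v) = representation S x v / c v" if "v \<in> S"
  proof -
    define d where "d u = representation S x (the_inv_into S (\<lambda>v. c v *\<^sub>R v) u) / c (the_inv_into S (\<lambda>v. c v *\<^sub>R v) u)" for u
    have d: "d (c v *\<^sub>R v) = representation S x v / c v" if "v \<in> S" for v
      unfolding d_def using the_inv_into_f_f[OF inj that] by simp
    have "x = (\<Sum>v\<in>S. representation S x v *\<^sub>R v)" using S by (simp add: representation_sum_eq)
    also have "\<dots> = (\<Sum>v\<in>S. d (c v *\<^sub>R v) *\<^sub>R (c v *\<^sub>R v))" using d c by (intro sum.cong) auto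
    also have "\<dots> = (\<Sum>u\<in>T. d u *\<^sub>R u)" unfolding T_def by (simp add: sum.reindex[OF inj])
    finally have xd: "x = (\<Sum>u\<in>T. d u *\<^sub>R u)" .
    have "finite T" "c v *\<^sub>R v \<in> T" using fin that by (auto simp: T_def)
    then show ?thesis using representation_unique[OF ind _ xd] d[OF that] by metis
  qed
qed

lemma stacked_bases:
  fixes L L' :: "(real^'n) set"
  assumes "is_lattice L" "is_lattice L'" "L \<subseteq> L'"
  obtains S d where "Zbasis L' S" "\<And>v. v \<in> S \<Longrightarrow> d v > (0::int)" "Zbasis L ((\<lambda>v. of_int (d v) *\<^sub>R v) ` S)"
proof -
  obtain S0 S1 where S0: "Zbasis L' S0" and S1: "Zbasis L S1" using assms by (auto simp: is_lattice_iff)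
  interpret L': lattice_context L' S0 by unfold_locales fact
  interpret L: lattice_context L S1 by unfold_locales fact
  have g: "L'.good S1" using L.Zbasis_good[OF S1] assms(3) unfolding L.good_def L'.good_def by auto
  note S1' = L'.goodD[OF g]
  define m where "m = int (L'.idx S1)"
  \<comment> \<open>The coordinates of a point of \<open>L'\<close> in a basis of \<open>L\<close>
    are, up to sign, quotients of indices in \<open>L'\<close> with the fixed denominator
    \<open>m\<close>. This bounds the quotient, as \<open>stacked_Zspan\<close> demands.\<close>
  have mL: "of_int m *\<^sub>R v \<in> L" if v: "v \<in> L'" for v
  proof -
    have "representation S1 (of_int m *\<^sub>R v) u \<in> \<int>" if u: "u \<in> S1" for u
    proof (cases "representation S1 v u = 0")
      case False
      have "real (L'.idx (insert v (S1 - {u}))) = \<bar>representation S1 v u\<bar> * of_int m"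
        using L'.good_replace(2)[OF g u v False] by (simp add: m_def)
      then have "\<bar>of_int m * representation S1 v u\<bar> \<in> \<int>"
        by (metis Ints_of_nat abs_mult abs_of_nat m_def mult.commute of_int_of_nat_eq)
      then show ?thesis using S1' by (simp add: representation_scale abs_if split: if_splits)
    qed (use S1' in \<open>simp add: representation_scale\<close>)
    then show ?thesis unfolding L.mem_L by blast
  qed
  have "\<exists>S' d. independent S' \<and> card S' = card S0 \<and> Zspan S' = Zspan S0 \<and> (\<forall>v\<in>S'. d v > (0::int)) \<and>
    L = {\<Sum>v\<in>S'. of_int (c v * d v) *\<^sub>R v |c :: real^'n \<Rightarrow> int. True}"
  proof (rule stacked_Zspan)
    show "independent S0" using S0 by (simp add: Zbasis_def)
    show "L \<subseteq> Zspan S0" using S0 assms(3) by (simp add: Zbasis_iff_Zspan)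
    show "m > 0" using L'.idx(2)[OF g] by (simp add: m_def)
    show "of_int m *\<^sub>R v \<in> L" if "v \<in> S0" for v using that mL L'.goodD(1)[OF L'.Zbasis_good[OF S0]] by auto
  qed (use L.zero_L L.diff_L in auto)
  then obtain S d where S: "independent S" "card S = card S0" "Zspan S = Zspan S0" "\<forall>v\<in>S. d v > (0::int)"
    "L = {\<Sum>v\<in>S. of_int (c v * d v) *\<^sub>R v |c :: real^'n \<Rightarrow> int. True}" by blast
  have finS: "finite S" using S finiteI_independent by auto
  have "span S = UNIV"
    using span_Zspan[OF finS] span_Zspan[of S0] S(3) L'.goodD[OF L'.Zbasis_good[OF S0]] by simp
  then have Z: "Zbasis L' S" using S S0 by (simp add: Zbasis_iff_Zspan)
  have c: "of_int (d v) \<noteq> (0::real)" if "v \<in> S" for v using S(4) that by force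
  note sc = scaled_basis[where c = "\<lambda>v. of_int (d v)", OF S(1) \<open>span S = UNIV\<close> c]
  have "L = Zspan ((\<lambda>v. of_int (d v) *\<^sub>R v) ` S)"
  proof (intro equalityI subsetI)
    fix x assume "x \<in> L"
    then obtain a :: "real^'n \<Rightarrow> int" where "x = (\<Sum>v\<in>S. of_int (a v * d v) *\<^sub>R v)" unfolding S(5) by blast
    moreover define b where "b u = a (the_inv_into S (\<lambda>v. of_int (d v) *\<^sub>R v) u)" for u
    have "b (of_int (d v) *\<^sub>R v) = a v" if "v \<in> S" for v
      unfolding b_def using the_inv_into_f_f[OF sc(3) that] by simp
    then have "(\<Sum>u\<in>(\<lambda>v. of_int (d v) *\<^sub>R v) ` S. of_int (b u) *\<^sub>R u) = (\<Sum>v\<in>S. of_int (a v * d v) *\<^sub>R v)"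
      by (subst sum.reindex[OF sc(3)]) (auto intro: sum.cong)
    ultimately show "x \<in> Zspan ((\<lambda>v. of_int (d v) *\<^sub>R v) ` S)"
      using ZspanI[of b "(\<lambda>v. of_int (d v) *\<^sub>R v) ` S"] by simp
  next
    fix x assume "x \<in> Zspan ((\<lambda>v. of_int (d v) *\<^sub>R v) ` S)"
    then obtain a :: "real^'n \<Rightarrow> int" where "x = (\<Sum>u\<in>(\<lambda>v. of_int (d v) *\<^sub>R v) ` S. of_int (a u) *\<^sub>R u)" by (rule ZspanE)
    then have "x = (\<Sum>v\<in>S. of_int (a (of_int (d v) *\<^sub>R v) * d v) *\<^sub>R v)" by (simp add: sum.reindex[OF sc(3)])
    then show "x \<in> L" unfolding S(5) by (intro CollectI exI[of _ "\<lambda>v. a (of_int (d v) *\<^sub>R v)"] conjI TrueI)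
  qed
  then have "Zbasis L ((\<lambda>v. of_int (d v) *\<^sub>R v) ` S)" using sc(1,2) by (simp add: Zbasis_iff_Zspan)
  then show ?thesis using that[OF Z] S(4) by blast
qed

text \<open>The quotient condition in stacked form. Unlike the isomorphism type of the quotient, it
  passes directly through linear isomorphisms and duals.\<close>

definition elementary_step :: "nat \<Rightarrow> nat \<Rightarrow> (real^'n) set \<Rightarrow> (real^'n) set \<Rightarrow> bool" where
  "elementary_step l r L L' \<longleftrightarrow> (\<exists>S K. Zbasis L' S \<and> K \<subseteq> S \<and> card K = r \<and>
     Zbasis L ((\<lambda>v. (if v \<in> K then of_nat l else 1) *\<^sub>R v) ` S))"

text \<open>Reducing the coordinates along \<open>K\<close> modulo \<open>l\<close> is a surjection
  of \<open>L'\<close> with kernel \<open>L\<close>.\<close>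

lemma elementary_step_quotient:
  assumes "elementary_step l r L L'" and l: "l > 0"
  shows "additive_group L' Mod L \<cong> product_group {..<r} (\<lambda>_. integer_mod_group l)"
proof -
  obtain S K where S: "Zbasis L' S" and K: "K \<subseteq> S" "card K = r"
    and L: "Zbasis L ((\<lambda>v. (if v \<in> K then of_nat l else 1) *\<^sub>R v) ` S)"
    using assms(1) unfolding elementary_step_def by blast
  interpret L': lattice_context L' S by unfold_locales fact
  note S' = L'.goodD[OF L'.Zbasis_good[OF S]]
  have finK: "finite K" using K S' by (auto intro: finite_subset)
  obtain k where k: "bij_betw k {..<r} K"
    using ex_bij_betw_nat_finite[OF finK] K(2) by (auto simp: atLeast0LessThan)
  have kS: "k i \<in> S" if "i < r" for i using k K that by (auto simp: bij_betw_def)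
  let ?P = "product_group {..<r} (\<lambda>_. integer_mod_group l)"
  define h where "h x = (\<lambda>i\<in>{..<r}. \<lfloor>representation S x (k i)\<rfloor> mod int l)" for x
  have int: "of_int \<lfloor>representation S x v\<rfloor> = representation S x v" if "x \<in> L'" "v \<in> S" for x v
    using S that by (auto simp: Zbasis_def elim!: Ints_cases)
  have G: "group (additive_group L')"
  proof (rule groupI)
    show "\<exists>y\<in>carrier (additive_group L'). y \<otimes>\<^bsub>additive_group L'\<^esub> x = \<one>\<^bsub>additive_group L'\<^esub>"
      if "x \<in> carrier (additive_group L')" for x
      using that L'.minus_L by (intro bexI[of _ "- x"]) auto
  qed (auto simp: L'.add_L L'.zero_L add.assoc)
  have hom: "h \<in> hom (additive_group L') ?P"
  proof (rule homI)
    fix x y assume xy: "x \<in> carrier (additive_group L')" "y \<in> carrier (additive_group L')"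
    show "h x \<in> carrier ?P" unfolding h_def using l by (auto simp: carrier_integer_mod_group)
    have "\<lfloor>representation S (x + y) (k i)\<rfloor> = \<lfloor>representation S x (k i)\<rfloor> + \<lfloor>representation S y (k i)\<rfloor>" if "i < r" for i
    proof -
      have "representation S (x + y) (k i) = of_int (\<lfloor>representation S x (k i)\<rfloor> + \<lfloor>representation S y (k i)\<rfloor>)"
      proof -
        have "representation S (x + y) (k i) = representation S x (k i) + representation S y (k i)"
          using S' by (simp add: representation_add)
        also have "\<dots> = of_int \<lfloor>representation S x (k i)\<rfloor> + of_int \<lfloor>representation S y (k i)\<rfloor>"
          using xy kS[OF that] by (simp only: int additive_group_simps)
        finally show ?thesis by (simp only: of_int_add)
      qed
      then show ?thesis by (simp only: floor_of_int)
    qed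
    then show "h (x \<otimes>\<^bsub>additive_group L'\<^esub> y) = h x \<otimes>\<^bsub>?P\<^esub> h y"
      unfolding h_def by (auto simp: mod_add_eq)
  qed
  interpret h: group_hom "additive_group L'" ?P h
    using G hom by (simp add: group_hom_def group_hom_axioms_def)
  have c: "(if v \<in> K then of_nat l else 1) \<noteq> (0::real)" if "v \<in> S" for v using l by simp
  note sc = scaled_basis[where c = "\<lambda>v. if v \<in> K then of_nat l else 1", OF S'(2,3) c]
  have "kernel (additive_group L') ?P h = L"
  proof (intro equalityI subsetI)
    fix x assume "x \<in> kernel (additive_group L') ?P h"
    then have x: "x \<in> L'" and hx: "h x = (\<lambda>i\<in>{..<r}. 0)" by (auto simp: kernel_def)
    have "representation S x v / (if v \<in> K then of_nat l else 1) \<in> \<int>" if v: "v \<in> S" for v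
    proof (cases "v \<in> K")
      case True
      then obtain i where i: "i < r" "k i = v" using k by (auto simp: bij_betw_def)
      have "h x i = 0" using hx i by simp
      then have "int l dvd \<lfloor>representation S x v\<rfloor>" using i by (auto simp: h_def)
      then obtain q where "\<lfloor>representation S x v\<rfloor> = int l * q" by auto
      then have "representation S x v = of_nat l * of_int q" using int[OF x v] by (metis of_int_mult of_int_of_nat_eq)
      then show ?thesis using True l by simp
    qed (use int[OF x v] in \<open>metis Ints_of_int div_by_1\<close>)
    then show "x \<in> L" using L sc(4) by (auto simp: Zbasis_def)
  next
    fix x assume x: "x \<in> L"
    have q: "representation S x v / (if v \<in> K then of_nat l else 1) \<in> \<int>" if "v \<in> S" for v
      using x L sc(4)[OF _ that, of x] that by (auto simp: Zbasis_def)
    have xL': "x \<in> L'"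
    proof -
      have "representation S x v \<in> \<int>" if v: "v \<in> S" for v
      proof -
        have "representation S x v = (if v \<in> K then of_nat l else 1) * (representation S x v / (if v \<in> K then of_nat l else 1))"
          using c[OF v] by simp
        also have "\<dots> \<in> \<int>" using q[OF v] by (intro Ints_mult) auto
        finally show ?thesis .
      qed
      then show ?thesis using S by (auto simp: Zbasis_def)
    qed
    have "\<lfloor>representation S x (k i)\<rfloor> mod int l = 0" if i: "i < r" for i
    proof -
      have "k i \<in> K" using k i by (auto simp: bij_betw_def)
      then obtain z :: int where "representation S x (k i) / of_nat l = of_int z"
        using q[OF kS[OF i]] by (auto elim: Ints_cases)
      then have "representation S x (k i) = of_int (int l * z)" using l by (simp add: field_simps)
      then have "\<lfloor>representation S x (k i)\<rfloor> = int l * z" by (simp only: floor_of_int)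
      then show ?thesis by simp
    qed
    then show "x \<in> kernel (additive_group L') ?P h"
      using xL' by (auto simp: kernel_def h_def)
  qed
  moreover have "h ` carrier (additive_group L') = carrier ?P"
  proof (intro equalityI subsetI)
    fix y assume y: "y \<in> carrier ?P"
    define x where "x = (\<Sum>i<r. of_int (y i) *\<^sub>R k i)"
    have "x \<in> L'" unfolding x_def using kS S' by (intro L'.sum_L L'.scale_L) auto
    moreover have "h x = y"
    proof
      fix j
      show "h x j = y j"
      proof (cases "j < r")
        case True
        have "representation S x (k j) = (\<Sum>i<r. of_int (y i) * representation S (k i) (k j))"
          unfolding x_def using S' by (simp add: representation_sum representation_scale)
        also have "\<dots> = (\<Sum>i<r. if i = j then of_int (y i) else 0)"
        proof (rule sum.cong[OF refl])
          fix i assume "i \<in> {..<r}"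
          then have "k j = k i \<longleftrightarrow> i = j" using k True by (auto simp: bij_betw_def inj_on_def)
          then show "of_int (y i) * representation S (k i) (k j) = (if i = j then of_int (y i) else (0::real))"
            using kS \<open>i \<in> {..<r}\<close> S' by (simp add: representation_basis)
        qed
        also have "\<dots> = of_int (y j)" using True by simp
        finally have "h x j = y j mod int l" using True by (simp add: h_def)
        moreover have "y j \<in> {0..<int l}" using y True l by (auto simp: carrier_integer_mod_group PiE_iff)
        ultimately show ?thesis by simp
      next
        case False
        then show ?thesis using y by (auto simp: h_def PiE_iff extensional_def)
      qed
    qed
    ultimately show "y \<in> h ` carrier (additive_group L')" by auto
  qed (use h.hom_closed in auto)
  then have "additive_group L' Mod kernel (additive_group L') ?P h \<cong> ?P" by (rule h.FactGroup_iso)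
  ultimately show ?thesis by simp
qed

text \<open>The quotient is annihilated by \<open>l\<close>, so every stacked divisor divides the
  prime \<open>l\<close>. The number of divisors equal to \<open>l\<close> is found by comparing
  orders of quotients, which are powers of \<open>l\<close>.\<close>

lemma superlattices_iff:
  fixes L L' :: "(real^'n) set"
  assumes L: "is_lattice L" and l: "prime l"
  shows "L' \<in> superlattices l r L \<longleftrightarrow> is_lattice L' \<and> L \<subseteq> L' \<and> elementary_step l r L L'"
proof
  assume "is_lattice L' \<and> L \<subseteq> L' \<and> elementary_step l r L L'"
  then show "L' \<in> superlattices l r L"
    using elementary_step_quotient prime_gt_0_nat[OF l] by (auto simp: superlattices_def)
next
  assume "L' \<in> superlattices l r L"
  then have L': "is_lattice L'" "L \<subseteq> L'"
    and iso: "additive_group L' Mod L \<cong> product_group {..<r} (\<lambda>_. integer_mod_group l)"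
    by (auto simp: superlattices_def)
  obtain S d where S: "Zbasis L' S" and d: "\<And>v. v \<in> S \<Longrightarrow> d v > (0::int)" and dS: "Zbasis L ((\<lambda>v. of_int (d v) *\<^sub>R v) ` S)"
    using stacked_bases[OF L L'] by blast
  interpret L': lattice_context L' S by unfold_locales fact
  note S' = L'.goodD[OF L'.Zbasis_good[OF S]]
  have l0: "l > 0" using prime_gt_0_nat[OF l] .
  let ?P = "product_group {..<r} (\<lambda>_. integer_mod_group l)"
  have G: "comm_group (additive_group L')"
  proof (rule comm_groupI)
    show "\<exists>y\<in>carrier (additive_group L'). y \<otimes>\<^bsub>additive_group L'\<^esub> x = \<one>\<^bsub>additive_group L'\<^esub>"
      if "x \<in> carrier (additive_group L')" for x
      using that L'.minus_L by (intro bexI[of _ "- x"]) auto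
  qed (auto simp: L'.add_L L'.zero_L add.assoc add.commute)
  interpret G: comm_group "additive_group L'" by (rule G)
  interpret Lc: lattice_context L "(\<lambda>v. of_int (d v) *\<^sub>R v) ` S" by unfold_locales fact
  have inv: "inv\<^bsub>additive_group L'\<^esub> x = - x" if "x \<in> L'" for x
    using that L'.minus_L by (intro G.inv_equality) auto
  have "subgroup L (additive_group L')"
    using L'(2) Lc.zero_L Lc.add_L Lc.minus_L by (intro G.subgroupI) (auto simp: inv)
  then have N: "L \<lhd> additive_group L'" using G.normal_iff_subgroup by blast
  then interpret N: normal L "additive_group L'" .
  interpret Qt: group "additive_group L' Mod L" by (rule N.factorgroup_is_group)
  have P: "group ?P" by simp
  obtain \<theta> where \<theta>: "\<theta> \<in> iso (additive_group L' Mod L) ?P" using iso by (auto simp: is_iso_def)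
  have pow: "x [^]\<^bsub>additive_group L'\<^esub> j = of_nat j *\<^sub>R x" for x and j :: nat
    by (induction j) (auto simp: scaleR_add_left add.commute)
  \<comment> \<open>Annihilation by \<open>l\<close> is carried over from the product of cyclic
    groups along \<theta>.\<close>
  have lL: "of_nat l *\<^sub>R x \<in> L" if x: "x \<in> L'" for x
  proof -
    let ?X = "L #>\<^bsub>additive_group L'\<^esub> x"
    have X: "?X \<in> carrier (additive_group L' Mod L)" using x by (auto simp: carrier_FactGroup)
    have hom: "group_hom (additive_group L' Mod L) ?P \<theta>"
      using \<theta> P Qt.is_group by (auto simp: group_hom_def group_hom_axioms_def iso_def)
    have "\<theta> ?X \<in> carrier ?P" using \<theta> X by (auto simp: iso_def hom_def)
    then have "\<theta> ?X [^]\<^bsub>?P\<^esub> j = (\<lambda>i\<in>{..<r}. (int j * \<theta> ?X i) mod int l)" for j :: nat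
      using l0 by (induction j) (auto simp: fun_eq_iff PiE_iff algebra_simps mod_add_right_eq)
    then have "\<theta> ?X [^]\<^bsub>?P\<^esub> l = \<one>\<^bsub>?P\<^esub>" by (auto simp: fun_eq_iff)
    then have "\<theta> (?X [^]\<^bsub>additive_group L' Mod L\<^esub> l) = \<theta> \<one>\<^bsub>additive_group L' Mod L\<^esub>"
      using group_hom.hom_nat_pow[OF hom X] group_hom.hom_one[OF hom] by simp
    then have "?X [^]\<^bsub>additive_group L' Mod L\<^esub> l = \<one>\<^bsub>additive_group L' Mod L\<^esub>"
      using \<theta> X Qt.nat_pow_closed[OF X, of l] Qt.one_closed
      unfolding iso_def bij_betw_def by (blast dest: inj_onD)
    then have "L #>\<^bsub>additive_group L'\<^esub> (of_nat l *\<^sub>R x) = L"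
      using N.FactGroup_pow[of x l] x by (simp add: pow)
    moreover have "of_nat l *\<^sub>R x \<in> L #>\<^bsub>additive_group L'\<^esub> (of_nat l *\<^sub>R x)"
      using Lc.zero_L by (auto simp: r_coset_def)
    ultimately show ?thesis by simp
  qed
  have c: "of_int (d v) \<noteq> (0::real)" if "v \<in> S" for v using d[OF that] by simp
  note sc = scaled_basis[where c = "\<lambda>v. of_int (d v)", OF S'(2,3) c]
  \<comment> \<open>The point \<open>l\<close> times \<open>v\<close> lies in \<open>L\<close>,
    where its only nonzero coordinate is \<open>l\<close> divided by \<open>d v\<close>; so
    \<open>d v\<close> divides \<open>l\<close>.\<close>
  have d_cases: "d v = 1 \<or> d v = int l" if v: "v \<in> S" for v
  proof -
    have "of_nat l *\<^sub>R v \<in> L" using lL S'(1) v by auto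
    then have "representation S (of_nat l *\<^sub>R v) v / of_int (d v) \<in> \<int>"
      using dS sc(4)[OF _ v, of "of_nat l *\<^sub>R v"] v by (auto simp: Zbasis_def)
    moreover have "representation S (of_nat l *\<^sub>R v) v = of_nat l"
      using S' v by (simp add: representation_scale representation_basis)
    ultimately obtain z :: int where "of_nat l / of_int (d v) = (of_int z :: real)" by (auto elim: Ints_cases)
    then have "real_of_int (int l) = of_int (d v * z)" using c[OF v] by (simp add: field_simps)
    then have "int l = d v * z" by (simp only: of_int_eq_iff)
    then have "d v dvd int l" by simp
    then show ?thesis using l d[OF v]
      by (metis abs_of_pos int_dvd_int_iff prime_int_altdef prime_nat_int_transfer zdvd_not_zless zero_less_abs_iff order_less_imp_le prime_nat_iff nat_0_le)
  qed
  define K where "K = {v\<in>S. d v = int l}"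
  have "(\<lambda>v. of_int (d v) *\<^sub>R v) ` S = (\<lambda>v. (if v \<in> K then of_nat l else 1) *\<^sub>R v) ` S"
    using d_cases by (intro image_cong) (auto simp: K_def)
  then have step: "elementary_step l (card K) L L'"
    unfolding elementary_step_def using S dS by (intro exI[of _ S] exI[of _ K]) (auto simp: K_def)
  have iso2: "additive_group L' Mod L \<cong> product_group {..<card K} (\<lambda>_. integer_mod_group l)"
    using elementary_step_quotient[OF step l0] .
  have card: "card (carrier (product_group {..<m} (\<lambda>_. integer_mod_group l))) = l ^ m" for m
    using l0 by (simp add: card_PiE carrier_integer_mod_group)
  have "card (carrier (additive_group L' Mod L)) = l ^ r" "card (carrier (additive_group L' Mod L)) = l ^ card K"
    using iso iso2 card by (auto simp: is_iso_def iso_def dest!: bij_betw_same_card)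
  then have "card K = r" using prime_gt_1_nat[OF l] by simp
  then show "is_lattice L' \<and> L \<subseteq> L' \<and> elementary_step l r L L'" using step L' by simp
qed

section \<open>Linear images, and finiteness of the set of superlattices\<close>

lemma Zspan_image:
  assumes "linear g" "inj g"
  shows "Zspan (g ` S) = g ` Zspan S"
proof -
  have g: "g (\<Sum>v\<in>S. of_int (c v) *\<^sub>R v) = (\<Sum>v\<in>S. of_int (c v) *\<^sub>R g v)" for c :: "_ \<Rightarrow> int"
    using assms(1) by (simp add: linear_sum linear_scale)
  have inj: "inj_on g S" using assms(2) inj_on_subset by blast
  show ?thesis
  proof (intro equalityI subsetI)
    fix x assume "x \<in> Zspan (g ` S)"
    then obtain c :: "_ \<Rightarrow> int" where "x = (\<Sum>v\<in>g ` S. of_int (c v) *\<^sub>R v)" by (rule ZspanE)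
    then have "x = g (\<Sum>v\<in>S. of_int (c (g v)) *\<^sub>R v)" by (simp add: sum.reindex[OF inj] g)
    then show "x \<in> g ` Zspan S" by (rule image_eqI[OF _ ZspanI])
  next
    fix x assume "x \<in> g ` Zspan S"
    then obtain c :: "_ \<Rightarrow> int" where c: "x = g (\<Sum>v\<in>S. of_int (c v) *\<^sub>R v)" by (auto elim: ZspanE)
    have "x = (\<Sum>v\<in>g ` S. of_int (c (inv_into UNIV g v)) *\<^sub>R v)"
      using assms(2) by (simp add: c g sum.reindex[OF inj])
    then show "x \<in> Zspan (g ` S)" using ZspanI[of "\<lambda>v. c (inv_into UNIV g v)" "g ` S"] by simp
  qed
qed

lemma Zbasis_image:
  fixes g :: "real^'n \<Rightarrow> real^'n"
  assumes g: "linear g" "inj g" and "Zbasis L S"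
  shows "Zbasis (g ` L) (g ` S)"
proof -
  have S: "independent S" "span S = UNIV" "L = Zspan S" using assms(3) by (auto simp: Zbasis_iff_Zspan)
  have "independent (g ` S)" using g S by (intro linear_independent_injective_image) (auto intro: inj_on_subset)
  moreover have "span (g ` S) = UNIV"
    using linear_span_image[OF g(1), of S] S(2) linear_inj_imp_surj[OF g] by simp
  ultimately show ?thesis using S(3) Zspan_image[OF g] by (simp add: Zbasis_iff_Zspan)
qed

lemma elementary_step_image:
  fixes g :: "real^'n \<Rightarrow> real^'n"
  assumes g: "linear g" "inj g" and step: "elementary_step l r L L'"
  shows "elementary_step l r (g ` L) (g ` L')"
proof -
  obtain S K where S: "Zbasis L' S" "K \<subseteq> S" "card K = r"
    and L: "Zbasis L ((\<lambda>v. (if v \<in> K then of_nat l else 1) *\<^sub>R v) ` S)"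
    using step unfolding elementary_step_def by blast
  have "g ` (\<lambda>v. (if v \<in> K then of_nat l else 1) *\<^sub>R v) ` S =
      (\<lambda>v. (if v \<in> g ` K then of_nat l else 1) *\<^sub>R v) ` g ` S"
    unfolding image_image using inj_image_mem_iff[OF g(2), of _ K]
    by (intro image_cong) (auto simp: linear_scale[OF g(1)])
  moreover have "card (g ` K) = r" using S(3) card_image[of g K] g(2) inj_on_subset[of g UNIV K] by simp
  ultimately show ?thesis
    unfolding elementary_step_def using Zbasis_image[OF g S(1)] Zbasis_image[OF g L] S(2)
    by (intro exI[of _ "g ` S"] exI[of _ "g ` K"]) auto
qed

lemma is_lattice_image: "linear g \<Longrightarrow> inj g \<Longrightarrow> is_lattice L \<Longrightarrow> is_lattice (g ` L)"
  for g :: "real^'n \<Rightarrow> real^'n"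
  using Zbasis_image by (auto simp: is_lattice_iff)

lemma superlattices_image:
  fixes g :: "real^'n \<Rightarrow> real^'n"
  assumes g: "linear g" "inj g" and L: "is_lattice L" and l: "prime l"
  shows "superlattices l r (g ` L) = (`) g ` superlattices l r L"
proof -
  have sub: "(`) h ` superlattices l r M \<subseteq> superlattices l r (h ` M)"
    if "linear h" "inj h" "is_lattice M" for h :: "real^'n \<Rightarrow> real^'n" and M
  proof (rule image_subsetI)
    fix N assume "N \<in> superlattices l r M"
    then have "is_lattice N" "M \<subseteq> N" "elementary_step l r M N"
      using superlattices_iff[OF that(3) l] by auto
    then show "h ` N \<in> superlattices l r (h ` M)"
      unfolding superlattices_iff[OF is_lattice_image[OF that] l]
      by (intro conjI is_lattice_image[OF that(1,2)] elementary_step_image[OF that(1,2)] image_mono)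
  qed
  obtain h where h: "linear h" "\<And>x. h (g x) = x" "\<And>x. g (h x) = x"
    using linear_injective_isomorphism[OF g] by blast
  have hi: "inj h" using h(3) by (metis injI)
  show ?thesis
  proof
    have "h ` g ` L = L" using h(2) by (simp add: image_image)
    then have *: "(`) h ` superlattices l r (g ` L) \<subseteq> superlattices l r L"
      using sub[OF h(1) hi is_lattice_image[OF g L]] by simp
    show "superlattices l r (g ` L) \<subseteq> (`) g ` superlattices l r L"
    proof
      fix M assume "M \<in> superlattices l r (g ` L)"
      then have "h ` M \<in> superlattices l r L" using * by blast
      moreover have "M = g ` h ` M" using h(3) by (simp add: image_image)
      ultimately show "M \<in> (`) g ` superlattices l r L" by blast
    qed
  qed (rule sub[OF g L])
qed

lemma superlattices_scale:
  assumes L: "is_lattice L" and l: "prime l" and L': "L' \<in> superlattices l r L" and x: "x \<in> L'"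
  shows "of_nat l *\<^sub>R x \<in> L"
proof -
  obtain S K where S: "Zbasis L' S" "K \<subseteq> S"
    and LS: "Zbasis L ((\<lambda>v. (if v \<in> K then of_nat l else 1) *\<^sub>R v) ` S)" (is "Zbasis L ?T")
    using L' superlattices_iff[OF L l] unfolding elementary_step_def by blast
  interpret lattice_context L ?T by unfold_locales fact
  obtain c :: "_ \<Rightarrow> int" where c: "x = (\<Sum>v\<in>S. of_int (c v) *\<^sub>R v)"
    using x S by (auto simp: Zbasis_iff_Zspan elim: ZspanE)
  have lv: "of_nat l *\<^sub>R v \<in> L" if "v \<in> S" for v
  proof -
    have "(if v \<in> K then of_nat l else 1) *\<^sub>R v \<in> L"
      using goodD(1)[OF Zbasis_good[OF LS]] that by blast
    then show ?thesis using scale_L[of v "of_nat l"] by (auto split: if_splits)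
  qed
  have "of_nat l *\<^sub>R x = (\<Sum>v\<in>S. of_int (c v) *\<^sub>R (of_nat l *\<^sub>R v))"
    by (simp add: c scaleR_sum_right mult.commute)
  also have "\<dots> \<in> L"
  proof (rule sum_L)
    show "of_int (c v) *\<^sub>R (of_nat l *\<^sub>R v) \<in> L" if "v \<in> S" for v
      by (rule scale_L[OF lv[OF that]]) simp
  qed
  finally show ?thesis .
qed

text \<open>All superlattices lie between \<open>L\<close> and \<open>L\<close> divided by
  \<open>l\<close>. Such a lattice is a union of cosets of \<open>L\<close>, so it is determined by
  the representatives in the finite set \<open>D\<close> that it contains.\<close>

lemma finite_superlattices:
  assumes L: "is_lattice L" and l: "prime l"
  shows "finite (superlattices l r L)"
proof -
  obtain S where S: "Zbasis L S" using L by (auto simp: is_lattice_iff)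
  interpret lattice_context L S by unfold_locales fact
  note S' = goodD[OF Zbasis_good[OF S]]
  have l0: "l > 0" using prime_gt_0_nat[OF l] .
  define D where "D = (\<lambda>c. \<Sum>v\<in>S. (of_int (c v) / of_nat l) *\<^sub>R v) ` (PiE S (\<lambda>_. {0..<int l}))"
  have finD: "finite D" unfolding D_def using S' by (intro finite_imageI finite_PiE) auto
  have mem: "\<exists>d\<in>D. x - d \<in> L" if "of_nat l *\<^sub>R x \<in> L" for x
  proof -
    have "representation S (of_nat l *\<^sub>R x) v \<in> \<int>" if "v \<in> S" for v
      using \<open>of_nat l *\<^sub>R x \<in> L\<close> that by (simp add: mem_L)
    then have "of_nat l * representation S x v \<in> \<int>" if "v \<in> S" for v
      using S' that by (simp add: representation_scale)
    then have "\<forall>v. \<exists>z::int. v \<in> S \<longrightarrow> of_nat l * representation S x v = of_int z"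
      by (metis Ints_cases)
    then obtain z :: "_ \<Rightarrow> int" where z: "\<And>v. v \<in> S \<Longrightarrow> of_nat l * representation S x v = of_int (z v)"
      by metis
    define d where "d = (\<Sum>v\<in>S. (of_int (z v mod int l) / of_nat l) *\<^sub>R v)"
    have "d \<in> D" unfolding D_def d_def
      using l0 by (intro image_eqI[of _ _ "\<lambda>v\<in>S. z v mod int l"]) auto
    moreover have "x - d = (\<Sum>v\<in>S. of_int (z v div int l) *\<^sub>R v)"
    proof -
      have "x - d = (\<Sum>v\<in>S. (representation S x v - of_int (z v mod int l) / of_nat l) *\<^sub>R v)"
        using representation_sum_eq[of S x] S' by (simp add: d_def sum_subtractf scaleR_diff_left)
      also have "\<dots> = (\<Sum>v\<in>S. of_int (z v div int l) *\<^sub>R v)"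
      proof (rule sum.cong[OF refl])
        fix v assume v: "v \<in> S"
        have "real_of_int (z v) = of_nat l * of_int (z v div int l) + of_int (z v mod int l)"
          by (metis mult_div_mod_eq of_int_add of_int_mult of_int_of_nat_eq)
        then have "of_nat l * representation S x v = of_nat l * of_int (z v div int l) + of_int (z v mod int l)"
          using z[OF v] by simp
        then have "representation S x v - of_int (z v mod int l) / of_nat l = of_int (z v div int l)"
          using l0 by (simp add: field_simps)
        then show "(representation S x v - of_int (z v mod int l) / of_nat l) *\<^sub>R v = of_int (z v div int l) *\<^sub>R v" by simp
      qed
      finally show ?thesis .
    qed
    then have "x - d \<in> L" using S' by (auto intro!: sum_L scale_L)
    ultimately show ?thesis by blast
  qed
  have "inj_on (\<lambda>L'. L' \<inter> D) (superlattices l r L)"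
  proof (rule inj_onI)
    have sub: "M \<subseteq> M'" if M: "M \<in> superlattices l r L" and M': "M' \<in> superlattices l r L" and eq: "M \<inter> D = M' \<inter> D" for M M'
    proof
      fix x assume x: "x \<in> M"
      obtain SM where SM: "Zbasis M SM" using M by (auto simp: superlattices_def is_lattice_iff)
      obtain SM' where SM': "Zbasis M' SM'" using M' by (auto simp: superlattices_def is_lattice_iff)
      interpret M: lattice_context M SM by unfold_locales fact
      interpret M': lattice_context M' SM' by unfold_locales fact
      obtain d where d: "d \<in> D" "x - d \<in> L" using mem[OF superlattices_scale[OF L l M x]] by blast
      then have "d \<in> M" using M.diff_L[OF x, of "x - d"] M by (auto simp: superlattices_def)
      then have "d \<in> M'" using d eq by blast
      then show "x \<in> M'" using M'.add_L[of d "x - d"] d M' by (auto simp: superlattices_def)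
    qed
    fix M M' assume "M \<in> superlattices l r L" "M' \<in> superlattices l r L" "M \<inter> D = M' \<inter> D"
    then show "M = M'" using sub[of M M'] sub[of M' M] by auto
  qed
  moreover have "(\<lambda>L'. L' \<inter> D) ` superlattices l r L \<subseteq> Pow D" by auto
  ultimately show ?thesis using finD by (meson finite_Pow_iff inj_on_finite)
qed

section \<open>Duality and chains of superlattices\<close>

definition dual_lattice :: "(real^'n) set \<Rightarrow> (real^'n) set" where
  "dual_lattice M = {y. \<forall>x\<in>M. x \<bullet> y \<in> \<int>}"

text \<open>Represents the coordinate functional of \<open>v\<close> by the inner product; these
  vectors form the dual basis.\<close>

definition dual_vector :: "(real^'n) set \<Rightarrow> real^'n \<Rightarrow> real^'n" where
  "dual_vector S v = (SOME y. \<forall>x. representation S x v = y \<bullet> x)"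

lemma dual_vector:
  assumes "independent S" "span S = (UNIV :: (real^'n) set)"
  shows "dual_vector S v \<bullet> x = representation S x v"
proof -
  obtain y where "\<And>x. representation S x v = y \<bullet> x"
    using linear_as_inner[OF linear_representation_basis[OF assms]] by blast
  then have "\<exists>y. \<forall>x. representation S x v = y \<bullet> x" by blast
  then have "\<forall>x. representation S x v = dual_vector S v \<bullet> x"
    unfolding dual_vector_def by (rule someI_ex)
  then show ?thesis by metis
qed

lemma dual_basis:
  fixes S :: "(real^'n) set"
  assumes S: "Zbasis M S"
  shows "Zbasis (dual_lattice M) (dual_vector S ` S)" "inj_on (dual_vector S) S"
proof -
  have ind: "independent S" and sp: "span S = UNIV" and M: "M = Zspan S" using S by (auto simp: Zbasis_iff_Zspan)
  have fin: "finite S" and card: "card S = CARD('n)" using card_basis[OF ind sp] by auto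
  note dv = dual_vector[OF ind sp]
  let ?U = "dual_vector S ` S"
  have exp: "y = (\<Sum>v\<in>S. (v \<bullet> y) *\<^sub>R dual_vector S v)" for y
  proof -
    have "x \<bullet> y = x \<bullet> (\<Sum>v\<in>S. (v \<bullet> y) *\<^sub>R dual_vector S v)" for x
    proof -
      have "x \<bullet> y = (\<Sum>v\<in>S. representation S x v *\<^sub>R v) \<bullet> y" using ind sp by (simp add: representation_sum_eq)
      also have "\<dots> = (\<Sum>v\<in>S. (v \<bullet> y) * (dual_vector S v \<bullet> x))"
        by (simp add: inner_sum_left dv mult.commute)
      finally show ?thesis by (simp add: inner_sum_right inner_commute)
    qed
    then show ?thesis by (metis vector_eq_ldot)
  qed
  have "y \<in> span ?U" for y by (subst exp) (intro span_sum span_scale span_base imageI)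
  then have spU: "span ?U = UNIV" by blast
  have "card ?U \<le> CARD('n)" using card_image_le[OF fin, of "dual_vector S"] card by simp
  then have indU: "independent ?U"
    using spU fin by (intro card_le_dim_spanning[where V = UNIV]) (auto simp: dim_UNIV)
  have "card ?U = card S" using card_basis[OF indU spU] card by simp
  then show inj: "inj_on (dual_vector S) S" using fin by (intro eq_card_imp_inj_on)
  have rep: "representation ?U y (dual_vector S v) = v \<bullet> y" if v: "v \<in> S" for y v
  proof -
    define h where "h u = (the_inv_into S (dual_vector S) u) \<bullet> y" for u
    have h: "h (dual_vector S v) = v \<bullet> y" if "v \<in> S" for v
      unfolding h_def using the_inv_into_f_f[OF inj that] by simp
    have y_eq: "y = (\<Sum>u\<in>?U. h u *\<^sub>R u)"
      unfolding sum.reindex[OF inj] o_def using exp[of y] h by (simp cong: sum.cong)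
    then show ?thesis using representation_unique[OF indU _ y_eq, of "dual_vector S v"] fin v h by simp
  qed
  have "y \<in> dual_lattice M \<longleftrightarrow> (\<forall>v\<in>S. v \<bullet> y \<in> \<int>)" for y
  proof
    assume "y \<in> dual_lattice M"
    then show "\<forall>v\<in>S. v \<bullet> y \<in> \<int>" using Zspan_base[OF fin] unfolding dual_lattice_def M by auto
  next
    assume *: "\<forall>v\<in>S. v \<bullet> y \<in> \<int>"
    have "x \<bullet> y \<in> \<int>" if x: "x \<in> M" for x
    proof -
      obtain c :: "_ \<Rightarrow> int" where "x = (\<Sum>v\<in>S. of_int (c v) *\<^sub>R v)" using x unfolding M by (rule ZspanE)
      then show ?thesis using * by (auto simp: inner_sum_left intro!: Ints_sum Ints_mult)
    qed
    then show "y \<in> dual_lattice M" by (simp add: dual_lattice_def)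
  qed
  then have "dual_lattice M = {y. \<forall>u\<in>?U. representation ?U y u \<in> \<int>}" using rep by auto
  then show "Zbasis (dual_lattice M) ?U" using indU spU by (simp add: Zbasis_def)
qed

lemma is_lattice_dual: "is_lattice M \<Longrightarrow> is_lattice (dual_lattice M)"
  using dual_basis(1) by (auto simp: is_lattice_iff)

lemma dual_dual:
  assumes "is_lattice M"
  shows "dual_lattice (dual_lattice M) = M"
proof (intro equalityI subsetI)
  obtain S where S: "Zbasis M S" using assms by (auto simp: is_lattice_iff)
  fix x assume x: "x \<in> dual_lattice (dual_lattice M)"
  have "representation S x v \<in> \<int>" if v: "v \<in> S" for v
  proof -
    have "dual_vector S v \<bullet> y \<in> \<int>" if "y \<in> M" for y
      using dual_vector[of S v y] S v that by (auto simp: Zbasis_def)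
    then have "dual_vector S v \<in> dual_lattice M" by (simp add: dual_lattice_def inner_commute)
    then have "dual_vector S v \<bullet> x \<in> \<int>" using x by (auto simp: dual_lattice_def[of "dual_lattice M"])
    then show ?thesis using dual_vector[of S v x] S by (simp add: Zbasis_def)
  qed
  then show "x \<in> M" using S by (auto simp: Zbasis_def)
qed (auto simp: dual_lattice_def inner_commute)

lemma dual_antimono: "M \<subseteq> M' \<Longrightarrow> dual_lattice M' \<subseteq> dual_lattice M"
  by (auto simp: dual_lattice_def)

text \<open>Dual bases scale inversely: the dual basis for \<open>N1\<close> is that for
  \<open>N2\<close> divided by \<open>c\<close>, so multiplication by \<open>l\<close> on the image
  of \<open>K\<close> leads back to the latter.\<close>

lemma elementary_step_dual:
  fixes N1 N2 :: "(real^'n) set"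
  assumes step: "elementary_step l r N1 N2" and l: "l > 0"
  shows "elementary_step l r (dual_lattice N2) (dual_lattice N1)"
proof -
  obtain S K where S: "Zbasis N2 S" and K: "K \<subseteq> S" "card K = r"
    and T: "Zbasis N1 ((\<lambda>v. (if v \<in> K then of_nat l else 1) *\<^sub>R v) ` S)" (is "Zbasis N1 ?T")
    using step unfolding elementary_step_def by blast
  define c where "c v = (if v \<in> K then of_nat l else (1::real))" for v
  have T_eq: "?T = (\<lambda>v. c v *\<^sub>R v) ` S" by (simp add: c_def)
  have c0: "c v \<noteq> 0" for v using l by (simp add: c_def)
  have ind: "independent S" "span S = UNIV" using S by (auto simp: Zbasis_def)
  have indT: "independent ?T" "span ?T = UNIV" using T by (auto simp: Zbasis_def)
  note sc = scaled_basis[where c = c, OF ind c0, folded T_eq]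
  define u where "u v = dual_vector ?T (c v *\<^sub>R v)" for v
  have u: "u v = (1 / c v) *\<^sub>R dual_vector S v" if v: "v \<in> S" for v
  proof -
    have "u v \<bullet> x = ((1 / c v) *\<^sub>R dual_vector S v) \<bullet> x" for x
      unfolding u_def dual_vector[OF indT] using sc(4)[OF v, of x] by (simp add: dual_vector[OF ind])
    then show ?thesis by (metis vector_eq_rdot)
  qed
  have U: "Zbasis (dual_lattice N1) (u ` S)"
    using dual_basis(1)[OF T] unfolding T_eq image_image u_def[unfolded T_eq, symmetric] by simp
  have inju: "inj_on u S"
  proof (rule inj_onI)
    fix v w assume *: "v \<in> S" "w \<in> S" "u v = u w"
    have "c v *\<^sub>R v \<in> ?T" "c w *\<^sub>R w \<in> ?T" using * by (auto simp: T_eq)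
    then have "c v *\<^sub>R v = c w *\<^sub>R w" using dual_basis(2)[OF T] *(3) unfolding u_def by (meson inj_onD)
    then show "v = w" using sc(3) * by (auto dest: inj_onD)
  qed
  have "(\<lambda>x. (if x \<in> u ` K then of_nat l else 1) *\<^sub>R x) ` u ` S = dual_vector S ` S"
    unfolding image_image
  proof (rule image_cong[OF refl])
    fix v assume v: "v \<in> S"
    have "u v \<in> u ` K \<longleftrightarrow> v \<in> K" using inj_on_image_mem_iff[OF inju v K(1)] .
    then show "(if u v \<in> u ` K then of_nat l else 1) *\<^sub>R u v = dual_vector S v"
      using u[OF v] l by (auto simp: c_def)
  qed
  then have "Zbasis (dual_lattice N2) ((\<lambda>x. (if x \<in> u ` K then of_nat l else 1) *\<^sub>R x) ` u ` S)"
    using dual_basis(1)[OF S] by simp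
  moreover have "card (u ` K) = r" using K card_image[OF inj_on_subset[OF inju K(1)]] by simp
  ultimately show ?thesis
    unfolding elementary_step_def using U K(1) by (intro exI[of _ "u ` S"] exI[of _ "u ` K"]) auto
qed

text \<open>If \<open>L''\<close> has basis \<open>v\<close> and \<open>L\<close> has basis \<open>d v\<close>, the map sends \<open>v\<close> to a standard unit vector divided
  by the square root of \<open>d\<close>.\<close>

lemma self_dual_position:
  fixes L L'' :: "(real^'n) set"
  assumes "is_lattice L" "is_lattice L''" "L \<subseteq> L''"
  obtains g :: "real^'n \<Rightarrow> real^'n" where "linear g" "inj g" "dual_lattice (g ` L'') = g ` L"
proof -
  obtain S d where S: "Zbasis L'' S" and d: "\<And>v. v \<in> S \<Longrightarrow> d v > (0::int)" and dS: "Zbasis L ((\<lambda>v. of_int (d v) *\<^sub>R v) ` S)"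
    using stacked_bases[OF assms] by blast
  have ind: "independent S" "span S = UNIV" using S by (auto simp: Zbasis_def)
  have fin: "finite S" using card_basis[OF ind] by simp
  have c: "of_int (d v) \<noteq> (0::real)" if "v \<in> S" for v using d[OF that] by simp
  note sc = scaled_basis[where c = "\<lambda>v. of_int (d v)", OF ind c]
  obtain e :: "'n \<Rightarrow> real^'n" where e: "bij_betw e UNIV S" using basis_enum[OF ind] .
  have eS: "e i \<in> S" for i using e by (auto simp: bij_betw_def)
  define g where "g x = (\<chi> i. representation S x (e i) / sqrt (of_int (d (e i))))" for x
  have lin: "linear g" unfolding g_def
    using ind by (intro linearI) (auto simp: vec_eq_iff representation_add representation_scale add_divide_distrib)
  \<comment> \<open>Pairing images divides the coordinate of \<open>z\<close> at \<open>v\<close> by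
    \<open>d v\<close>, and integrality of all these quotients is membership of \<open>z\<close> in
    \<open>L\<close>.\<close>
  have inner: "g x \<bullet> g z = (\<Sum>v\<in>S. representation S x v * (representation S z v / of_int (d v)))" for x z
  proof -
    have "g x \<bullet> g z = (\<Sum>i\<in>UNIV. representation S x (e i) * (representation S z (e i) / of_int (d (e i))))"
      unfolding inner_vec_def g_def
    proof (intro sum.cong refl)
      fix i
      have "d (e i) > 0" using d eS by blast
      then have "sqrt (of_int (d (e i))) * sqrt (of_int (d (e i))) = of_int (d (e i))" by simp
      then show "(\<chi> i. representation S x (e i) / sqrt (of_int (d (e i)))) $ i \<bullet> (\<chi> i. representation S z (e i) / sqrt (of_int (d (e i)))) $ i =
          representation S x (e i) * (representation S z (e i) / of_int (d (e i)))"
        by (simp add: times_divide_times_eq)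
    qed
    also have "\<dots> = (\<Sum>v\<in>S. representation S x v * (representation S z v / of_int (d v)))"
      by (rule sum.reindex_bij_betw[OF e])
    finally show ?thesis .
  qed
  have "inj g"
  proof (rule linear_injective_0[OF lin, THEN iffD2], intro allI impI)
    fix x assume "g x = 0"
    have "representation S x v = 0" if v: "v \<in> S" for v
    proof -
      obtain i where "e i = v" using e v by (auto simp: bij_betw_def)
      moreover have "g x $ i = 0" using \<open>g x = 0\<close> by simp
      ultimately show ?thesis using d[OF v] by (auto simp: g_def)
    qed
    then have "(\<Sum>v\<in>S. representation S x v *\<^sub>R v) = 0" by simp
    then show "x = 0" using ind by (simp add: representation_sum_eq)
  qed
  moreover have "dual_lattice (g ` L'') = g ` L"
  proof (intro equalityI subsetI)
    fix y assume y: "y \<in> dual_lattice (g ` L'')"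
    obtain z where z: "y = g z" using linear_inj_imp_surj[OF lin \<open>inj g\<close>] by (metis surjD)
    have "representation S z v / of_int (d v) \<in> \<int>" if v: "v \<in> S" for v
    proof -
      have "v \<in> L''" using S v representation_basis[OF ind(1)] by (auto simp: Zbasis_def)
      then have "g v \<bullet> g z \<in> \<int>" using y z by (auto simp: dual_lattice_def)
      also have "g v \<bullet> g z = (\<Sum>u\<in>S. if u = v then representation S z v / of_int (d v) else 0)"
        unfolding inner using v ind by (intro sum.cong) (auto simp: representation_basis)
      finally show ?thesis using v fin by simp
    qed
    then have "z \<in> L" using dS sc(4) by (auto simp: Zbasis_def)
    then show "y \<in> g ` L" using z by blast
  next
    fix y assume "y \<in> g ` L"
    then obtain z where z: "z \<in> L" "y = g z" by blast
    have q: "representation S z v / of_int (d v) \<in> \<int>" if "v \<in> S" for v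
      using dS z sc(4)[OF _ that, of z] that by (auto simp: Zbasis_def)
    have "g x \<bullet> g z \<in> \<int>" if "x \<in> L''" for x
      unfolding inner using S that q by (intro Ints_sum Ints_mult) (auto simp: Zbasis_def)
    then show "y \<in> dual_lattice (g ` L'')" using z by (auto simp: dual_lattice_def)
  qed
  ultimately show ?thesis using that lin by blast
qed

text \<open>Once \<open>L''\<close> is the dual of \<open>L\<close>, taking duals is an involution of the lattices between them that
  exchanges the two steps of a chain.\<close>

lemma intermediate_lattices_swap:
  fixes L L'' :: "(real^'n) set"
  assumes L: "is_lattice L" and l: "prime l" "prime l'"
  obtains \<sigma> where "bij_betw \<sigma> {N\<in>superlattices l r L. L'' \<in> superlattices l' r' N}
    {N\<in>superlattices l' r' L. L'' \<in> superlattices l r N}"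
proof -
  let ?C = "\<lambda>l r l' r'. {N\<in>superlattices l r L. L'' \<in> superlattices l' r' N}"
  show ?thesis
  proof (cases "is_lattice L'' \<and> L \<subseteq> L''")
    case False
    \<comment> \<open>A set that is not a lattice above \<open>L\<close> is the top of no chain, so
      any map will do.\<close>
    then have "?C l r l' r' = {}" "?C l' r' l r = {}" unfolding superlattices_def by auto
    then show ?thesis using that[of id] by (auto simp: bij_betw_def)
  next
    case True
    then obtain g :: "real^'n \<Rightarrow> real^'n" where g: "linear g" "inj g" "dual_lattice (g ` L'') = g ` L"
      using self_dual_position[OF L] by blast
    obtain h where h: "linear h" "\<And>x. h (g x) = x" "\<And>x. g (h x) = x"
      using linear_injective_isomorphism[OF g(1,2)] by blast
    have hi: "inj h" using h(3) by (metis injI)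
    define \<sigma> where "\<sigma> N = h ` dual_lattice (g ` N)" for N
    have gh: "g ` h ` X = X" "h ` g ` X = X" for X using h by (simp_all add: image_image)
    have dL: "dual_lattice (g ` L) = g ` L''"
      using dual_dual[OF is_lattice_image[OF g(1,2)], of L''] True g(3) by simp
    have \<sigma>\<sigma>: "\<sigma> (\<sigma> N) = N" if "is_lattice N" for N
      unfolding \<sigma>_def gh using dual_dual[OF is_lattice_image[OF g(1,2) that]] gh by simp
    have lat: "is_lattice N" if "N \<in> superlattices l r M" for N l r M
      using that by (simp add: superlattices_def)
    have map: "\<sigma> N \<in> ?C l' r' l r" if l: "prime l" "prime l'" and N: "N \<in> ?C l r l' r'" for l r l' r' N
    proof -
      have latN: "is_lattice N" using N by (simp add: superlattices_def)
      have N1: "L \<subseteq> N" "elementary_step l r L N" and N2: "N \<subseteq> L''" "elementary_step l' r' N L''"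
        using N superlattices_iff[OF L l(1)] superlattices_iff[OF latN l(2)] by auto
      have lat\<sigma>: "is_lattice (\<sigma> N)" unfolding \<sigma>_def
        by (intro is_lattice_image[OF h(1) hi] is_lattice_dual is_lattice_image[OF g(1,2)] latN)
      have "elementary_step l' r' (h ` dual_lattice (g ` L'')) (\<sigma> N)"
        unfolding \<sigma>_def using l prime_gt_0_nat
        by (intro elementary_step_image[OF h(1) hi] elementary_step_dual elementary_step_image[OF g(1,2)] N2)
      then have s1: "elementary_step l' r' L (\<sigma> N)" using g(3) gh by simp
      have "elementary_step l r (\<sigma> N) (h ` dual_lattice (g ` L))"
        unfolding \<sigma>_def using l prime_gt_0_nat
        by (intro elementary_step_image[OF h(1) hi] elementary_step_dual elementary_step_image[OF g(1,2)] N1)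
      then have s2: "elementary_step l r (\<sigma> N) L''" using dL gh by simp
      have "h ` dual_lattice (g ` L'') \<subseteq> \<sigma> N" unfolding \<sigma>_def by (intro image_mono dual_antimono N2)
      moreover have "\<sigma> N \<subseteq> h ` dual_lattice (g ` L)" unfolding \<sigma>_def by (intro image_mono dual_antimono N1)
      ultimately have "L \<subseteq> \<sigma> N" "\<sigma> N \<subseteq> L''" using g(3) dL gh by simp_all
      then show ?thesis using s1 s2 lat\<sigma> True superlattices_iff[OF L l(2)] superlattices_iff[OF lat\<sigma> l(1)] by simp
    qed
    have "bij_betw \<sigma> (?C l r l' r') (?C l' r' l r)"
    proof -
      have inv: "\<sigma> (\<sigma> N) = N" if "N \<in> superlattices a b M" for N a b M
        using \<sigma>\<sigma>[OF lat[OF that]] .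
      have m1: "\<sigma> N \<in> ?C l' r' l r" if "N \<in> ?C l r l' r'" for N by (rule map[OF l that])
      have m2: "\<sigma> N \<in> ?C l r l' r'" if "N \<in> ?C l' r' l r" for N by (rule map[OF l(2,1) that])
      have "inj_on \<sigma> (?C l r l' r')"
      proof (rule inj_onI)
        fix N N' assume N: "N \<in> ?C l r l' r'" "N' \<in> ?C l r l' r'" and eq: "\<sigma> N = \<sigma> N'"
        have "N = \<sigma> (\<sigma> N)" by (rule inv[OF conjunct1[OF CollectD[OF N(1)]], symmetric])
        also have "\<dots> = N'" unfolding eq by (rule inv[OF conjunct1[OF CollectD[OF N(2)]]])
        finally show "N = N'" .
      qed
      moreover have "\<sigma> ` ?C l r l' r' = ?C l' r' l r"
      proof
        show "\<sigma> ` ?C l r l' r' \<subseteq> ?C l' r' l r" by (rule image_subsetI) (rule m1)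
        show "?C l' r' l r \<subseteq> \<sigma> ` ?C l r l' r'"
        proof
          fix N assume N: "N \<in> ?C l' r' l r"
          have "\<sigma> (\<sigma> N) \<in> \<sigma> ` ?C l r l' r'" by (rule imageI) (rule m2[OF N])
          then show "N \<in> \<sigma> ` ?C l r l' r'" by (simp only: inv[OF conjunct1[OF CollectD[OF N]]])
        qed
      qed
      ultimately show ?thesis by (rule bij_betw_imageI)
    qed
    then show ?thesis by (rule that)
  qed
qed

text \<open>The bijections between intermediate lattices, one for each top, are glued along the
  second component.\<close>

lemma superlattice_chains_swap:
  fixes L :: "(real^'n) set"
  assumes L: "is_lattice L" and l: "prime l" "prime l'"
  obtains h where "bij_betw h (Sigma (superlattices l r L) (superlattices l' r')) (Sigma (superlattices l' r' L) (superlattices l r))"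
    "\<And>p. snd (h p) = snd p"
proof -
  let ?bij = "\<lambda>\<sigma> L''. bij_betw \<sigma> {N\<in>superlattices l r L. L'' \<in> superlattices l' r' N}
      {N\<in>superlattices l' r' L. L'' \<in> superlattices l r N}"
  define \<sigma> where "\<sigma> L'' = (SOME \<sigma>. ?bij \<sigma> L'')" for L''
  have \<sigma>: "?bij (\<sigma> L'') L''" for L''
  proof -
    have "\<exists>\<sigma>. ?bij \<sigma> L''" by (rule intermediate_lattices_swap[OF L l]) (rule exI)
    then show ?thesis unfolding \<sigma>_def by (rule someI_ex)
  qed
  define h where "h p = (\<sigma> (snd p) (fst p), snd p)" for p
  have "bij_betw h (Sigma (superlattices l r L) (superlattices l' r')) (Sigma (superlattices l' r' L) (superlattices l r))"
    unfolding bij_betw_def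
  proof
    show "inj_on h (Sigma (superlattices l r L) (superlattices l' r'))"
    proof (rule inj_onI)
      fix p q assume p: "p \<in> Sigma (superlattices l r L) (superlattices l' r')"
        and q: "q \<in> Sigma (superlattices l r L) (superlattices l' r')" and eq: "h p = h q"
      have s: "snd p = snd q" and f: "\<sigma> (snd p) (fst p) = \<sigma> (snd p) (fst q)" using eq by (auto simp: h_def)
      have "fst p \<in> {N\<in>superlattices l r L. snd p \<in> superlattices l' r' N}"
        "fst q \<in> {N\<in>superlattices l r L. snd p \<in> superlattices l' r' N}" using p q s by auto
      then have "fst p = fst q" using inj_onD[OF bij_betw_imp_inj_on[OF \<sigma>] f] by blast
      then show "p = q" using s by (simp add: prod_eq_iff)
    qed
    show "h ` Sigma (superlattices l r L) (superlattices l' r') = Sigma (superlattices l' r' L) (superlattices l r)"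
    proof (intro equalityI subsetI)
      fix p assume "p \<in> h ` Sigma (superlattices l r L) (superlattices l' r')"
      then obtain N L'' where N: "N \<in> {N\<in>superlattices l r L. L'' \<in> superlattices l' r' N}" "p = (\<sigma> L'' N, L'')"
        by (auto simp: h_def)
      have "\<sigma> L'' N \<in> {N\<in>superlattices l' r' L. L'' \<in> superlattices l r N}" using bij_betw_apply[OF \<sigma> N(1)] .
      then show "p \<in> Sigma (superlattices l' r' L) (superlattices l r)" using N(2) by blast
    next
      fix p assume p: "p \<in> Sigma (superlattices l' r' L) (superlattices l r)"
      then have "fst p \<in> \<sigma> (snd p) ` {N\<in>superlattices l r L. snd p \<in> superlattices l' r' N}"
        using \<sigma>[of "snd p"] by (auto simp: bij_betw_def)
      then obtain N where "N \<in> superlattices l r L" "snd p \<in> superlattices l' r' N" "fst p = \<sigma> (snd p) N" by blast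
      then show "p \<in> h ` Sigma (superlattices l r L) (superlattices l' r')"
        by (intro image_eqI[of _ _ "(N, snd p)"]) (auto simp: h_def prod_eq_iff)
    qed
  qed
  then show ?thesis using that[of h] by (simp add: h_def)
qed

section \<open>Hecke sums\<close>

lemma (in comm_group) finprod_pow:
  assumes "\<And>i. i \<in> I \<Longrightarrow> f i \<in> carrier G"
  shows "finprod G (\<lambda>i. f i [^] (k::int)) I = finprod G f I [^] k"
  using assms
proof (induction I rule: infinite_finite_induct)
  case (insert i I)
  then have "f \<in> I \<rightarrow> carrier G" by auto
  with insert show ?case by (simp add: int_pow_distrib Pi_def)
qed auto

lemma (in comm_monoid) finprod_swap:
  assumes "\<And>i j. i \<in> I \<Longrightarrow> j \<in> J \<Longrightarrow> f i j \<in> carrier G"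
  shows "finprod G (\<lambda>i. finprod G (f i) J) I = finprod G (\<lambda>j. finprod G (\<lambda>i. f i j) I) J"
  using assms
proof (induction I rule: infinite_finite_induct)
  case (insert i I)
  have "finprod G (\<lambda>i. finprod G (f i) J) (insert i I) = finprod G (f i) J \<otimes> finprod G (\<lambda>i. finprod G (f i) J) I"
    using insert by (intro finprod_insert) (auto intro!: finprod_closed)
  also have "\<dots> = finprod G (f i) J \<otimes> finprod G (\<lambda>j. finprod G (\<lambda>i. f i j) I) J" using insert by simp
  also have "\<dots> = finprod G (\<lambda>j. f i j \<otimes> finprod G (\<lambda>i. f i j) I) J"
    using insert.prems by (intro finprod_multf[symmetric]) (auto intro!: finprod_closed)
  also have "\<dots> = finprod G (\<lambda>j. finprod G (\<lambda>i. f i j) (insert i I)) J"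
    using insert by (intro finprod_cong') (auto simp: finprod_insert Pi_def intro!: finprod_closed)
  finally show ?case .
qed (simp_all add: finprod_one_eqI)

lemma (in comm_monoid) finprod_Sigma:
  assumes "finite I" "\<And>i. i \<in> I \<Longrightarrow> finite (J i)" "\<And>i j. i \<in> I \<Longrightarrow> j \<in> J i \<Longrightarrow> f i j \<in> carrier G"
  shows "finprod G (\<lambda>i. finprod G (f i) (J i)) I = finprod G (\<lambda>(i, j). f i j) (Sigma I J)"
  using assms
proof (induction I rule: finite_induct)
  case (insert i I)
  have "Sigma (insert i I) J = Pair i ` J i \<union> Sigma I J" by auto
  then have "finprod G (\<lambda>(i, j). f i j) (Sigma (insert i I) J) =
      finprod G (\<lambda>(i, j). f i j) (Pair i ` J i) \<otimes> finprod G (\<lambda>(i, j). f i j) (Sigma I J)"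
    using insert by (simp only:) (intro finprod_Un_disjoint; auto)
  also have "finprod G (\<lambda>(i, j). f i j) (Pair i ` J i) = finprod G (f i) (J i)"
    using insert.prems by (subst finprod_reindex) (auto simp: inj_on_def)
  also have "finprod G (\<lambda>(i, j). f i j) (Sigma I J) = finprod G (\<lambda>i. finprod G (f i) (J i)) I"
    using insert by simp
  also have "finprod G (f i) (J i) \<otimes> finprod G (\<lambda>i. finprod G (f i) (J i)) I =
      finprod G (\<lambda>i. finprod G (f i) (J i)) (insert i I)"
    using insert by (intro finprod_insert[symmetric]) (auto intro!: finprod_closed)
  finally show ?case by simp
qed simp

lemma hom_finprod:
  assumes "comm_group G" "comm_group H" and h: "h \<in> hom G H" and f: "\<And>i. i \<in> I \<Longrightarrow> f i \<in> carrier G"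
  shows "h (finprod G f I) = finprod H (\<lambda>i. h (f i)) I"
proof -
  interpret G: comm_group G by fact
  interpret H: comm_group H by fact
  interpret group_hom G H h using h by unfold_locales
  show ?thesis using f
  proof (induction I rule: infinite_finite_induct)
    case (insert i I)
    then have "f \<in> I \<rightarrow> carrier G" "(\<lambda>i. h (f i)) \<in> I \<rightarrow> carrier H" by auto
    with insert show ?case by (simp add: Pi_def)
  qed simp_all
qed

section \<open>Universal property of the group of symbols\<close>

context comm_group
begin

text \<open>Uniqueness holds because the symbols generate the free group. For existence, the
  homomorphism extending \<open>f\<close> to the free group is trivial on the relations (S) and (M)
  by assumption and factors through the quotient.\<close>

lemma M_group_properties:
  shows comm_group_M: "comm_group (M_group G m)"
    and M_hom_eqI: "group H \<Longrightarrow> h \<in> hom (M_group G m) H \<Longrightarrow> h' \<in> hom (M_group G m) H \<Longrightarrow>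
      (\<And>as. as \<in> symbols G m \<Longrightarrow> h (symbol_class G m as) = h' (symbol_class G m as)) \<Longrightarrow>
      x \<in> carrier (M_group G m) \<Longrightarrow> h x = h' x"
    and M_hom_exists: "comm_group H \<Longrightarrow> f ` symbols G m \<subseteq> carrier H \<Longrightarrow>
      (\<And>as \<sigma>. as \<in> symbols G m \<Longrightarrow> \<sigma> permutes {..<m} \<Longrightarrow> f (permute_list \<sigma> as) = f as) \<Longrightarrow>
      (\<And>as bs. as @ bs \<in> symbols G m \<Longrightarrow> 2 \<le> length as \<Longrightarrow>
        f (as @ bs) = finprod H (\<lambda>i. f (blowup_entries G as i @ bs)) {..<length as}) \<Longrightarrow>
      \<exists>g\<in>hom (M_group G m) H. \<forall>as\<in>symbols G m. g (symbol_class G m as) = f as"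
proof -
  interpret Q: free_quotient "symbols G m" "rels_S G m \<union> rels_M G m"
    by unfold_locales (rule relations_carrier)
  have M: "M_group G m = Q.FG Mod Q.N" and sc: "\<And>as. symbol_class G m as = Q.N #>\<^bsub>Q.FG\<^esub> frag_of as"
    by (simp_all add: M_group_def M_relations_def symbol_class_def Q.N_def)
  show cM: "comm_group (M_group G m)" unfolding M by (rule Q.comm_group_quotient)
  show "h x = h' x" if H: "group H" and h: "h \<in> hom (M_group G m) H" and h': "h' \<in> hom (M_group G m) H"
    and eq: "\<And>as. as \<in> symbols G m \<Longrightarrow> h (symbol_class G m as) = h' (symbol_class G m as)"
    and x: "x \<in> carrier (M_group G m)" for H :: "('x, 'y) monoid_scheme" and h h' x
  proof -
    interpret Mg: comm_group "M_group G m" by (rule cM)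
    interpret H: group H by (rule H)
    interpret h: group_hom "M_group G m" H h using h by unfold_locales
    interpret h': group_hom "M_group G m" H h' using h' by unfold_locales
    obtain c where c: "Poly_Mapping.keys c \<subseteq> symbols G m" "x = Q.N #>\<^bsub>Q.FG\<^esub> c"
      using x unfolding M Q.quotient_carrier by blast
    have "h (Q.N #>\<^bsub>Q.FG\<^esub> c) = h' (Q.N #>\<^bsub>Q.FG\<^esub> c)"
    proof (rule free_Abelian_group_induct[OF c(1)])
      show "h (Q.N #>\<^bsub>Q.FG\<^esub> 0) = h' (Q.N #>\<^bsub>Q.FG\<^esub> 0)"
        using h.hom_one h'.hom_one by (simp add: Q.coset_zero M)
    next
      fix c d assume *: "Poly_Mapping.keys c \<subseteq> symbols G m" "Poly_Mapping.keys d \<subseteq> symbols G m"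
        "h (Q.N #>\<^bsub>Q.FG\<^esub> c) = h' (Q.N #>\<^bsub>Q.FG\<^esub> c)" "h (Q.N #>\<^bsub>Q.FG\<^esub> d) = h' (Q.N #>\<^bsub>Q.FG\<^esub> d)"
      have k: "Poly_Mapping.keys (c - d) \<subseteq> symbols G m" using * keys_diff[of c d] by auto
      have mem: "Q.N #>\<^bsub>Q.FG\<^esub> e \<in> carrier (M_group G m)" if "Poly_Mapping.keys e \<subseteq> symbols G m" for e
        unfolding M Q.quotient_carrier using that by blast
      have e: "Q.N #>\<^bsub>Q.FG\<^esub> c = (Q.N #>\<^bsub>Q.FG\<^esub> (c - d)) \<otimes>\<^bsub>M_group G m\<^esub> (Q.N #>\<^bsub>Q.FG\<^esub> d)"
        unfolding M using Q.coset_mult[OF k *(2)] by simp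
      have "h (Q.N #>\<^bsub>Q.FG\<^esub> (c - d)) \<otimes>\<^bsub>H\<^esub> h (Q.N #>\<^bsub>Q.FG\<^esub> d) = h' (Q.N #>\<^bsub>Q.FG\<^esub> (c - d)) \<otimes>\<^bsub>H\<^esub> h (Q.N #>\<^bsub>Q.FG\<^esub> d)"
        using *(3) unfolding e using mem[OF k] mem[OF *(2)] *(4) by simp
      then show "h (Q.N #>\<^bsub>Q.FG\<^esub> (c - d)) = h' (Q.N #>\<^bsub>Q.FG\<^esub> (c - d))"
        using mem[OF k] mem[OF *(2)] H.right_cancel by simp
    next
      fix as assume "as \<in> symbols G m"
      then show "h (Q.N #>\<^bsub>Q.FG\<^esub> frag_of as) = h' (Q.N #>\<^bsub>Q.FG\<^esub> frag_of as)" using eq sc by simp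
    qed
    then show ?thesis using c by simp
  qed
  show "\<exists>g\<in>hom (M_group G m) H. \<forall>as\<in>symbols G m. g (symbol_class G m as) = f as"
    if H: "comm_group H" and f: "f ` symbols G m \<subseteq> carrier H"
      and perm: "\<And>as \<sigma>. as \<in> symbols G m \<Longrightarrow> \<sigma> permutes {..<m} \<Longrightarrow> f (permute_list \<sigma> as) = f as"
      and blow: "\<And>as bs. as @ bs \<in> symbols G m \<Longrightarrow> 2 \<le> length as \<Longrightarrow>
        f (as @ bs) = finprod H (\<lambda>i. f (blowup_entries G as i @ bs)) {..<length as}"
    for H :: "('x, 'y) monoid_scheme" and f
  proof -
    interpret H: comm_group H by (rule H)
    obtain h where h: "h \<in> hom Q.FG H" "\<And>as. as \<in> symbols G m \<Longrightarrow> h (frag_of as) = f as"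
      using H.free_Abelian_group_universal[OF f] by blast
    interpret h: group_hom Q.FG H h using h(1) by (intro group_hom.intro group_hom_axioms.intro group_free_Abelian_group H.group_axioms)
    have hd: "h (c - d) = h c \<otimes>\<^bsub>H\<^esub> inv\<^bsub>H\<^esub> h d" if "Poly_Mapping.keys c \<subseteq> symbols G m" "Poly_Mapping.keys d \<subseteq> symbols G m" for c d
      using h.hom_mult[of c "- d"] h.hom_inv[of d] that by simp
    have rel: "h x = \<one>\<^bsub>H\<^esub>" if "x \<in> rels_S G m \<union> rels_M G m" for x
      using that
    proof
      assume "x \<in> rels_S G m"
      then obtain \<sigma> as where x: "x = frag_of (permute_list \<sigma> as) - frag_of as" "as \<in> symbols G m" "\<sigma> permutes {..<m}"
        unfolding rels_S_def by blast
      then show ?thesis using symbols_permute[OF x(2,3)] perm[OF x(2,3)] f by (auto simp: hd h(2) keys_frag_of)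
    next
      assume "x \<in> rels_M G m"
      then obtain as bs where x: "x = frag_of (as @ bs) - (\<Sum>i<length as. frag_of (blowup_entries G as i @ bs))"
        "2 \<le> length as" "as @ bs \<in> symbols G m"
        unfolding rels_M_def by blast
      have mem: "blowup_entries G as i @ bs \<in> symbols G m" if "i \<in> {..<length as}" for i
        using symbols_blowup[OF x(3)] that by simp
      have k: "Poly_Mapping.keys (\<Sum>i<length as. frag_of (blowup_entries G as i @ bs)) \<subseteq> symbols G m"
        using mem by (intro Q.sum_keys) (simp add: keys_frag_of)
      have "h (\<Sum>i<length as. frag_of (blowup_entries G as i @ bs)) = finprod H (\<lambda>i. h (frag_of (blowup_entries G as i @ bs))) {..<length as}"
      proof -
        have "h (sum c I) = finprod H (\<lambda>i. h (c i)) I" if "finite I" "\<And>i. i \<in> I \<Longrightarrow> Poly_Mapping.keys (c i) \<subseteq> symbols G m"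
          for c and I :: "nat set"
          using that
        proof (induction I rule: finite_induct)
          case empty
          then show ?case using h.hom_one by simp
        next
          case (insert i I)
          have "h (c i + sum c I) = h (c i) \<otimes>\<^bsub>H\<^esub> h (sum c I)"
            using h.hom_mult[of "c i" "sum c I"] insert.prems Q.sum_keys[of I c] by simp
          moreover have "(\<lambda>i. h (c i)) \<in> I \<rightarrow> carrier H" "h (c i) \<in> carrier H" using insert.prems by (auto intro!: h.hom_closed)
          ultimately show ?case using insert by simp
        qed
        from this[of "{..<length as}" "\<lambda>i. frag_of (blowup_entries G as i @ bs)"] show ?thesis
          using mem by (simp add: keys_frag_of)
      qed
      also have "\<dots> = finprod H (\<lambda>i. f (blowup_entries G as i @ bs)) {..<length as}"
        using mem h(2) f by (intro H.finprod_cong') auto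
      also have "\<dots> = h (frag_of (as @ bs))" using blow[OF x(3,2)] h(2) x(3) by simp
      finally show ?thesis unfolding x(1) using x(3) k f h(2) by (subst hd) (auto simp: keys_frag_of)
    qed
    have N1: "h c = \<one>\<^bsub>H\<^esub>" if "c \<in> Q.N" for c
    proof -
      have "generate Q.FG (rels_S G m \<union> rels_M G m) \<subseteq> kernel Q.FG H h"
        using rel Q.X_sub by (intro h.G.generate_subgroup_incl h.subgroup_kernel) (unfold kernel_def, blast)
      then show ?thesis using that unfolding Q.N_def kernel_def by blast
    qed
    have "h x = h y" if "x \<in> carrier Q.FG" "y \<in> carrier Q.FG" "Q.N #>\<^bsub>Q.FG\<^esub> x = Q.N #>\<^bsub>Q.FG\<^esub> y" for x y
    proof -
      have "h (x - y) = \<one>\<^bsub>H\<^esub>" using that N1 Q.coset_eq_iff by blast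
      moreover have "Poly_Mapping.keys (x - y) \<subseteq> symbols G m" using that keys_diff[of x y] by auto
      moreover have "x = (x - y) + y" by simp
      ultimately show ?thesis using h.hom_mult[of "x - y" y] that by simp
    qed
    then obtain g where "g \<in> hom (Q.FG Mod Q.N) H" "\<And>x. x \<in> carrier Q.FG \<Longrightarrow> g (Q.N #>\<^bsub>Q.FG\<^esub> x) = h x"
      using FactGroup_universal[OF h(1) Q.normal_N] by blast
    then show ?thesis unfolding M sc using h(2) by (intro bexI[of _ g]) (auto simp: keys_frag_of)
  qed
qed

end

section \<open>Additivity, realization and invariance of psi\<close>

context admissible_lattice
begin

lemma psi_closed:
  assumes "dissection \<Lambda> D" "\<And>S. S \<in> D \<Longrightarrow> Zbasis L S"
  shows "psi A L \<xi> \<Lambda> \<in> carrier (M_group A CARD('n))"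
proof -
  have "Poly_Mapping.keys (sum F D) \<subseteq> symbols A CARD('n)" using F_keys[OF assms(2)] by (intro Q.sum_keys)
  moreover have "psi A L \<xi> \<Lambda> = Q.N #>\<^bsub>Q.FG\<^esub> sum F D" by (rule psi_eq[OF assms])
  ultimately show ?thesis unfolding M_group_eq Q.quotient_carrier by blast
qed

lemma psi_cone_closed: "good S \<Longrightarrow> psi A L \<xi> (convex_cone hull S) \<in> carrier (M_group A CARD('n))"
  using resolution[of S] psi_closed by blast

lemma psi_symbol:
  assumes "Zbasis L (set es)" "distinct es"
  shows "psi A L \<xi> (convex_cone hull (set es)) = symbol_class A CARD('n) (symbol_of es)"
  using psi_eq[OF dissection_self[OF Zbasis_good[OF assms(1)]]] F_basis[OF assms] assms(1)
  by (simp add: symbol_class_eq Q.coset_eq_iff)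

text \<open>Pieces of arbitrary index are resolved into basic ones, and these resolutions together
  form a basic dissection of the whole cone.\<close>

lemma psi_dissection:
  assumes D: "dissection \<Lambda> D"
  shows "psi A L \<xi> \<Lambda> = finprod (M_group A CARD('n)) (\<lambda>S. psi A L \<xi> (convex_cone hull S)) D"
proof -
  have "\<exists>E. dissection (convex_cone hull S) E \<and> (\<forall>T\<in>E. Zbasis L T)" if "S \<in> D" for S
    using resolution dissectionD(2)[OF D that] by blast
  then obtain E where E: "\<And>S. S \<in> D \<Longrightarrow> dissection (convex_cone hull S) (E S) \<and> (\<forall>T\<in>E S. Zbasis L T)"
    by metis
  then have E1: "\<And>S. S \<in> D \<Longrightarrow> dissection (convex_cone hull S) (E S)" and E2: "\<And>S T. S \<in> D \<Longrightarrow> T \<in> E S \<Longrightarrow> Zbasis L T"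
    by blast+
  have k: "Poly_Mapping.keys (sum F (E S)) \<subseteq> symbols A CARD('n)" if "S \<in> D" for S
    using F_keys[OF E2[OF that]] by (intro Q.sum_keys) auto
  have "psi A L \<xi> \<Lambda> = Q.N #>\<^bsub>Q.FG\<^esub> sum F (\<Union>S\<in>D. E S)"
    using E2 by (intro psi_eq dissection_trans[OF D E1]) auto
  also have "\<dots> = Q.N #>\<^bsub>Q.FG\<^esub> (\<Sum>S\<in>D. sum F (E S))"
    by (simp only: sum_dissection_Union[OF D E1])
  also have "\<dots> = finprod (M_group A CARD('n)) (\<lambda>S. Q.N #>\<^bsub>Q.FG\<^esub> sum F (E S)) D"
    unfolding M_group_eq using k by (intro Q.finprod_coset[symmetric])
  also have "\<dots> = finprod (M_group A CARD('n)) (\<lambda>S. psi A L \<xi> (convex_cone hull S)) D"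
  proof -
    interpret M: comm_group "M_group A CARD('n)" by (rule comm_group_M)
    have "psi A L \<xi> (convex_cone hull S) = Q.N #>\<^bsub>Q.FG\<^esub> sum F (E S)" if "S \<in> D" for S
      using psi_eq[OF E1[OF that] E2[OF that]] .
    then show ?thesis using psi_cone_closed dissectionD(2)[OF D] by (intro M.finprod_cong') auto
  qed
  finally show ?thesis .
qed

lemma symbol_of_expansion:
  assumes "Zbasis L (set es)" "distinct es"
  shows "\<xi> = tensor_sum ((!) es) ((!) (symbol_of es))"
proof -
  note g = goodD[OF Zbasis_good[OF assms(1)]]
  have len: "length es = CARD('n)" using g(5) distinct_card[OF assms(2)] by simp
  have sm: "symbol_of es \<in> symbols A CARD('n)" using symbol_of_mem[OF assms] .
  let ?c = "\<lambda>i. contract A \<xi> (\<lambda>x. \<lfloor>representation (set es) x (es ! i)\<rfloor>)"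
  have nth: "?c i = symbol_of es ! i" if "i < CARD('n)" for i
    using that len by (simp add: symbol_of_def dual_coefficient_def)
  have esL: "es ! i \<in> L" if "i < CARD('n)" for i using that len g(1) by auto
  have smA: "symbol_of es ! i \<in> carrier A" if "i < CARD('n)" for i using that sm by (auto simp: symbols_def)
  have "\<xi> = tensor_sum ((!) es) ?c" using tensor_basis_expansion[OF \<xi> assms(2,1)] .
  also have "\<dots> = tensor_sum ((!) es) ((!) (symbol_of es))"
    using esL smA nth by (simp add: tensor_sum_coset)
  finally show ?thesis .
qed

end

text \<open>The contractions form a subgroup that contains all entries of \<open>as\<close>, and the
  entries generate the group. So every symbol comes from an admissible tensor.\<close>

lemma (in tensor_lattice) symbol_realization:
  assumes es: "Zbasis L (set es)" "distinct es" and as: "as \<in> symbols A CARD('n)"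
  defines "\<xi> \<equiv> tensor_sum ((!) es) ((!) as)"
  shows "admissible_lattice A L B \<xi>" and "symbol_lattice.symbol_of (\<lambda>\<phi>. contract A \<xi> (\<lambda>x. \<lfloor>\<phi> x\<rfloor>)) es = as"
proof -
  note g = goodD[OF Zbasis_good[OF es(1)]]
  have len: "length es = CARD('n)" using g(5) distinct_card[OF es(2)] by simp
  have as': "length as = CARD('n)" "set as \<subseteq> carrier A" "generate A (set as) = carrier A"
    using as by (auto simp: symbols_def)
  have esL: "es ! i \<in> L" if "i < CARD('n)" for i using that len g(1) by auto
  have asA: "as ! i \<in> carrier A" if "i < CARD('n)" for i using that as' by auto
  have car: "\<xi> \<in> carrier (tensor (additive_group L) A)"
    unfolding \<xi>_def using esL asA by (rule tensor_sum_carrier)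
  let ?H = "hom (additive_group L) integer_group"
  have con: "contract A \<xi> \<phi> = finprod A (\<lambda>i. as ! i [^] \<phi> (es ! i)) {..<CARD('n)}" if "\<phi> \<in> ?H" for \<phi>
    unfolding \<xi>_def using that esL asA by (rule contract_tensor_sum)
  have coord: "contract A \<xi> (\<lambda>x. \<lfloor>representation (set es) x (es ! i)\<rfloor>) = as ! i" if "i < CARD('n)" for i
    unfolding \<xi>_def using contract_basis_coefficient[OF es(2,1) asA that] .
  have homI: "\<phi> \<in> ?H" if "\<And>x y. x \<in> L \<Longrightarrow> y \<in> L \<Longrightarrow> \<phi> (x + y) = \<phi> x + \<phi> y" for \<phi>
    using that by (auto simp: hom_def)
  have homD: "\<phi> (x + y) = \<phi> x + \<phi> y" if "\<phi> \<in> ?H" "x \<in> L" "y \<in> L" for \<phi> x y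
    using hom_mult[OF that(1), of x y] that by simp
  have sub: "subgroup (contract A \<xi> ` ?H) A"
  proof
    show "contract A \<xi> ` ?H \<subseteq> carrier A" using contract_closed[OF car] by auto
    show "\<one> \<in> contract A \<xi> ` ?H"
    proof
      show "(\<lambda>_. 0) \<in> ?H" by (intro homI) auto
      then show "\<one> = contract A \<xi> (\<lambda>_. 0)" by (simp add: con finprod_one_eqI)
    qed
    show "x \<otimes> y \<in> contract A \<xi> ` ?H" if xy: "x \<in> contract A \<xi> ` ?H" "y \<in> contract A \<xi> ` ?H" for x y
    proof -
      obtain \<phi> \<psi> where *: "\<phi> \<in> ?H" "\<psi> \<in> ?H" "x = contract A \<xi> \<phi>" "y = contract A \<xi> \<psi>" using xy by blast
      have h: "(\<lambda>x. \<phi> x + \<psi> x) \<in> ?H" by (intro homI) (simp add: homD[OF *(1)] homD[OF *(2)])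
      have "x \<otimes> y = finprod A (\<lambda>i. as ! i [^] \<phi> (es ! i) \<otimes> as ! i [^] \<psi> (es ! i)) {..<CARD('n)}"
        unfolding *(3,4) con[OF *(1)] con[OF *(2)] using asA by (intro finprod_multf[symmetric]) auto
      also have "\<dots> = contract A \<xi> (\<lambda>x. \<phi> x + \<psi> x)"
        unfolding con[OF h] using asA by (intro finprod_cong') (auto simp: int_pow_mult)
      finally show ?thesis using h by blast
    qed
    show "inv x \<in> contract A \<xi> ` ?H" if x: "x \<in> contract A \<xi> ` ?H" for x
    proof -
      obtain \<phi> where *: "\<phi> \<in> ?H" "x = contract A \<xi> \<phi>" using x by blast
      have h: "(\<lambda>x. - \<phi> x) \<in> ?H" by (intro homI) (simp add: homD[OF *(1)])
      have "contract A \<xi> (\<lambda>x. - \<phi> x) = finprod A (\<lambda>i. (as ! i [^] \<phi> (es ! i)) [^] (-1::int)) {..<CARD('n)}"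
        unfolding con[OF h] using asA by (intro finprod_cong') (auto simp: int_pow_pow)
      also have "\<dots> = x [^] (-1::int)" unfolding *(2) con[OF *(1)] using asA by (intro finprod_pow) auto
      also have "\<dots> = inv x" using contract_closed[OF car *(1)] *(2) by (simp add: int_pow_neg)
      finally show ?thesis using h by force
    qed
  qed
  have "set as \<subseteq> contract A \<xi> ` ?H"
  proof
    fix a assume "a \<in> set as"
    then obtain i where i: "i < CARD('n)" "a = as ! i" using as' by (metis in_set_conv_nth)
    then have "es ! i \<in> set es" using len by simp
    then show "a \<in> contract A \<xi> ` ?H"
      using coord[OF i(1)] i(2) floor_hom[OF integral_on_representation[OF es(1)]] by (metis imageI)
  qed
  then have "carrier A \<subseteq> contract A \<xi> ` ?H" using generate_subgroup_incl[OF _ sub] as' by metis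
  then have "contract A \<xi> ` ?H = carrier A" using subgroup.subset[OF sub] by blast
  then show adm: "admissible_lattice A L B \<xi>" using car by unfold_locales
  then interpret admissible_lattice A L B \<xi> .
  show "symbol_of es = as"
    using coord len as'(1) by (intro nth_equalityI) (simp_all add: symbol_of_def dual_coefficient_def)
qed

lemma representation_image:
  fixes g :: "real^'n \<Rightarrow> real^'n"
  assumes g: "linear g" "inj g" and S: "independent S" "span S = UNIV" and e: "e \<in> S"
  shows "representation (g ` S) (g x) (g e) = representation S x e"
proof -
  have fin: "finite S" using card_basis[OF S] by simp
  have "inj_on g S" using g(2) by (rule inj_on_subset) simp
  define c where "c u = representation S x (inv_into UNIV g u)" for u
  have "g x = g (\<Sum>v\<in>S. representation S x v *\<^sub>R v)" using S by (simp add: representation_sum_eq)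
  also have "\<dots> = (\<Sum>v\<in>S. c (g v) *\<^sub>R g v)" using g by (simp add: linear_sum linear_scale c_def)
  also have "\<dots> = (\<Sum>u\<in>g ` S. c u *\<^sub>R u)" using \<open>inj_on g S\<close> by (simp add: sum.reindex)
  finally have "representation (g ` S) (g x) (g e) = c (g e)"
    using fin e linear_independent_injective_image[OF g(1) S(1)] inj_on_subset[OF g(2), of "span S"]
    by (intro representation_unique) auto
  then show ?thesis using g by (simp add: c_def)
qed

text \<open>A linear isomorphism carries bases to bases and dissections to dissections, and
  \<open>con\<close> makes the entries agree. This is the invariance of \<open>psi\<close> under
  isomorphisms of triples.\<close>

lemma psi_image:
  fixes g :: "real^'n \<Rightarrow> real^'n"
  assumes g: "linear g" "inj g"
    and "admissible_lattice A L B \<xi>" "admissible_lattice A (g ` L) B' \<xi>'"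
    and con: "\<And>\<phi>. \<phi> \<in> hom (additive_group (g ` L)) integer_group \<Longrightarrow> contract A \<xi>' \<phi> = contract A \<xi> (\<lambda>x. \<phi> (g x))"
    and D: "lattice_context.dissection L \<Lambda> D" "\<And>S. S \<in> D \<Longrightarrow> Zbasis L S"
  shows "psi A (g ` L) \<xi>' (g ` \<Lambda>) = psi A L \<xi> \<Lambda>"
proof -
  interpret S: admissible_lattice A L B \<xi> by fact
  interpret T: admissible_lattice A "g ` L" B' \<xi>' by fact
  interpret M: comm_group "M_group A CARD('n)" by (rule S.comm_group_M)
  note good = S.Zbasis_good[OF D(2)]
  have rep: "representation (g ` S) (g x) (g e) = representation S x e" if "Zbasis L S" "e \<in> S" for S x e
    using that S.goodD(2,3)[OF S.Zbasis_good] by (intro representation_image[OF g]) auto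
  have pos: "pos_at (g ` S) (g x) \<longleftrightarrow> pos_at S x" if "Zbasis L S" for S x
    using rep[OF that] by (auto simp: pos_at_def)
  have surj: "\<exists>x. y = g x" for y using linear_injective_imp_surjective[OF g] by (auto simp: surj_def)
  have "T.dissection (g ` \<Lambda>) ((`) g ` D)"
    unfolding T.dissection_def
  proof (intro conjI)
    show "finite ((`) g ` D)" using S.dissectionD(1)[OF D(1)] by simp
    show "\<forall>T\<in>(`) g ` D. T.good T" using D(2) Zbasis_image[OF g] T.Zbasis_good by auto
    show "g ` \<Lambda> = (\<Union>T\<in>(`) g ` D. convex_cone hull T)"
      using S.dissectionD(3)[OF D(1)] by (auto simp: convex_cone_hull_linear_image[OF g(1)])
    show "\<forall>T\<in>(`) g ` D. \<forall>T'\<in>(`) g ` D. \<forall>x. pos_at T x \<and> pos_at T' x \<longrightarrow> T = T'"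
    proof (intro ballI allI impI, elim imageE conjE)
      fix T T' y S S' assume *: "pos_at T y" "pos_at T' y" "T = g ` S" "S \<in> D" "T' = g ` S'" "S' \<in> D"
      obtain x where "y = g x" using surj by blast
      then have "S = S'" using * pos D(2) S.dissectionD(4)[OF D(1)] by metis
      then show "T = T'" using * by simp
    qed
  qed
  then have "psi A (g ` L) \<xi>' (g ` \<Lambda>) =
      finprod (M_group A CARD('n)) (\<lambda>T. psi A (g ` L) \<xi>' (convex_cone hull T)) ((`) g ` D)"
    by (rule T.psi_dissection)
  also have "\<dots> = finprod (M_group A CARD('n)) (\<lambda>S. psi A (g ` L) \<xi>' (convex_cone hull (g ` S))) D"
  proof (rule M.finprod_reindex)
    show "inj_on ((`) g) D" using g(2) by (auto simp: inj_on_def inj_image_eq_iff)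
    show "(\<lambda>T. psi A (g ` L) \<xi>' (convex_cone hull T)) \<in> (`) g ` D \<rightarrow> carrier (M_group A CARD('n))"
      using D(2) Zbasis_image[OF g] by (auto intro!: T.psi_cone_closed T.Zbasis_good)
  qed
  also have "\<dots> = finprod (M_group A CARD('n)) (\<lambda>S. psi A L \<xi> (convex_cone hull S)) D"
  proof (rule M.finprod_cong')
    fix S assume S: "S \<in> D"
    have Z: "Zbasis L S" using D(2) S .
    obtain es where es: "distinct es" "set es = S" using finite_distinct_list S.goodD(4)[OF good[OF S]] by blast
    have es': "distinct (map g es)" "set (map g es) = g ` S"
      using es g(2) by (auto simp: distinct_map inj_on_def)
    have "T.symbol_of (map g es) = S.symbol_of es"
      unfolding T.symbol_of_def S.symbol_of_def es' es(2) map_map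
    proof (rule map_cong)
      fix e assume e: "e \<in> set es"
      then have "(\<lambda>x. \<lfloor>representation (g ` S) x (g e)\<rfloor>) \<in> hom (additive_group (g ` L)) integer_group"
        using es by (intro T.floor_hom integral_on_representation Zbasis_image[OF g Z]) auto
      from con[OF this] show "(dual_coefficient (\<lambda>\<phi>. contract A \<xi>' (\<lambda>x. \<lfloor>\<phi> x\<rfloor>)) (g ` S) \<circ> g) e =
          dual_coefficient (\<lambda>\<phi>. contract A \<xi> (\<lambda>x. \<lfloor>\<phi> x\<rfloor>)) S e"
        using rep[OF Z] e es by (simp add: dual_coefficient_def)
    qed simp
    then show "psi A (g ` L) \<xi>' (convex_cone hull (g ` S)) = psi A L \<xi> (convex_cone hull S)"
      using T.psi_symbol[of "map g es"] S.psi_symbol[of es] es es' Z Zbasis_image[OF g Z] by simp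
  qed (use S.psi_cone_closed good in auto)
  also have "\<dots> = psi A L \<xi> \<Lambda>" by (rule S.psi_dissection[OF D(1), symmetric])
  finally show ?thesis .
qed

text \<open>Surjectivity survives because \<open>l\<close> maps \<open>L'\<close> into \<open>L\<close>: pulling a functional on \<open>L\<close> back along \<open>l\<close>
  raises its contraction to the \<open>l\<close>-th power.\<close>

lemma (in admissible_lattice) admissible_extension:
  assumes l: "prime l" and div: "\<And>a. a \<in> carrier A \<Longrightarrow> \<exists>b\<in>carrier A. a = b [^] int l"
    and L': "L' \<in> superlattices l r L" and B': "Zbasis L' B'"
  shows "admissible_lattice A L' B' (tensor_map (additive_group L') A (\<lambda>v. v) \<xi>)"
proof -
  interpret L': tensor_lattice A L' B' using B' by unfold_locales
  have tl: "tensor_lattice A L' B'" by unfold_locales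
  have sub: "L \<subseteq> L'" using L' by (simp add: superlattices_def)
  note tm = tensor_map_properties[OF tl sub \<xi>]
  let ?\<xi> = "tensor_map (additive_group L') A (\<lambda>v. v) \<xi>"
  have isL: "is_lattice L" using ZbasisB by (auto simp: is_lattice_iff)
  have "carrier A \<subseteq> contract A ?\<xi> ` hom (additive_group L') integer_group"
  proof
    fix a assume "a \<in> carrier A"
    then obtain b where b: "b \<in> carrier A" "a = b [^] int l" using div by blast
    then obtain \<phi> where \<phi>: "\<phi> \<in> hom (additive_group L) integer_group" "b = contract A \<xi> \<phi>" using adm by blast
    have add\<phi>: "\<phi> (x + y) = \<phi> x + \<phi> y" if "x \<in> L" "y \<in> L" for x y
      using hom_mult[OF \<phi>(1), of x y] that by simp
    have mult: "\<phi> (of_nat k *\<^sub>R x) = int k * \<phi> x" if x: "x \<in> L" for k x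
    proof (induction k)
      case 0
      then show ?case using add\<phi>[of 0 0] zero_L by simp
    next
      case (Suc k)
      have "of_nat k *\<^sub>R x \<in> L" using x by (intro scale_L) auto
      then show ?case using Suc add\<phi>[of "of_nat k *\<^sub>R x" x] x by (simp add: algebra_simps)
    qed
    let ?\<psi> = "\<lambda>x. \<phi> (of_nat l *\<^sub>R x)"
    have \<psi>: "?\<psi> \<in> hom (additive_group L') integer_group"
      using superlattices_scale[OF isL l L'] by (auto simp: hom_def scaleR_add_right add\<phi>)
    have \<psi>L: "?\<psi> \<in> hom (additive_group L) integer_group" using \<psi> sub by (auto simp: hom_def)
    obtain c where c: "Poly_Mapping.keys c \<subseteq> L \<times> carrier A" "\<xi> = T.N #>\<^bsub>T.FG\<^esub> c"
      using carrier_tensorE[OF \<xi>] .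
    have cl: "snd p [^] (Poly_Mapping.lookup c p * \<phi> (fst p)) \<in> carrier A" if "p \<in> Poly_Mapping.keys c" for p
      using that c by auto
    have "contract A ?\<xi> ?\<psi> = eval ?\<psi> c" unfolding tm(2)[OF \<psi>] unfolding c(2) by (rule contract_coset[OF \<psi>L c(1)])
    also have "\<dots> = finprod A (\<lambda>p. (snd p [^] (Poly_Mapping.lookup c p * \<phi> (fst p))) [^] int l) (Poly_Mapping.keys c)"
      unfolding eval_def
    proof (rule finprod_cong')
      fix p assume p: "p \<in> Poly_Mapping.keys c"
      then have "fst p \<in> L" "snd p \<in> carrier A" using c by auto
      then show "snd p [^] (Poly_Mapping.lookup c p * ?\<psi> (fst p)) = (snd p [^] (Poly_Mapping.lookup c p * \<phi> (fst p))) [^] int l"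
        by (simp add: mult int_pow_pow algebra_simps)
    qed (use cl in auto)
    also have "\<dots> = eval \<phi> c [^] int l" unfolding eval_def by (rule finprod_pow[OF cl])
    also have "eval \<phi> c = b" unfolding \<phi>(2) unfolding c(2) by (rule contract_coset[OF \<phi>(1) c(1), symmetric])
    finally have "a = contract A ?\<xi> ?\<psi>" using b(2) by simp
    then show "a \<in> contract A ?\<xi> ` hom (additive_group L') integer_group" using \<psi> by (rule image_eqI)
  qed
  moreover have "contract A ?\<xi> ` hom (additive_group L') integer_group \<subseteq> carrier A"
    using L'.contract_closed[OF tm(1)] by auto
  ultimately show ?thesis using tm(1) by unfold_locales auto
qed

section \<open>Hecke sums on dissections and under isomorphisms\<close>

context lattice_context
begin

lemma is_lattice_L: "is_lattice L"
  using ZbasisB by (auto simp: is_lattice_iff)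

lemma dissection_resolution:
  assumes D: "dissection \<Lambda> D"
  shows "\<exists>E. dissection \<Lambda> E \<and> (\<forall>T\<in>E. Zbasis L T)"
proof -
  have "\<exists>E. dissection (convex_cone hull S) E \<and> (\<forall>T\<in>E. Zbasis L T)" if "S \<in> D" for S
    using resolution dissectionD(2)[OF D that] by blast
  then obtain E where E: "\<And>S. S \<in> D \<Longrightarrow> dissection (convex_cone hull S) (E S) \<and> (\<forall>T\<in>E S. Zbasis L T)"
    by metis
  then have "dissection \<Lambda> (\<Union>S\<in>D. E S)" by (intro dissection_trans[OF D]) blast
  then show ?thesis using E by blast
qed

lemma full_rational_cone_good:
  assumes "good S"
  shows "full_rational_cone L (convex_cone hull S)"
proof -
  have "S \<subseteq> convex_cone hull S" by (rule hull_subset)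
  then have "span (convex_cone hull S) = UNIV" using span_mono[of S "convex_cone hull S"] goodD(3)[OF assms] by auto
  then have "dim (convex_cone hull S) = CARD('n)" using dim_eq_full[of "convex_cone hull S"] by simp
  then show ?thesis unfolding full_rational_cone_def using goodD[OF assms] by blast
qed

end

lemma full_rational_cone_mono: "full_rational_cone L \<Lambda> \<Longrightarrow> L \<subseteq> L' \<Longrightarrow> full_rational_cone L' \<Lambda>"
  unfolding full_rational_cone_def by blast

text \<open>Generators in \<open>L\<close> remain in \<open>L'\<close>, although a basic piece need
  not stay basic. Hence one dissection serves all superlattices at once.\<close>

lemma dissection_mono:
  assumes "lattice_context L B" "lattice_context L' B'" "L \<subseteq> L'" "lattice_context.dissection L \<Lambda> D"
  shows "lattice_context.dissection L' \<Lambda> D"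
proof -
  interpret L: lattice_context L B by fact
  interpret L': lattice_context L' B' by fact
  have "L'.good T" if "L.good T" for T using that assms(3) unfolding L.good_def L'.good_def by blast
  then show ?thesis using assms(4) unfolding L.dissection_def L'.dissection_def by (elim conjE) (intro conjI ballI; simp)
qed

lemma admissible_triple_iff:
  assumes "comm_group A"
  shows "admissible_triple A L \<xi> \<Lambda> \<longleftrightarrow> (\<exists>B. admissible_lattice A L B \<xi>) \<and> full_rational_cone L \<Lambda>"
  using assms
  unfolding admissible_triple_def is_lattice_iff admissible_lattice_def tensor_lattice_def lattice_context_def
    admissible_lattice_axioms_def by blast

text \<open>\<open>divisible\<close> is the form in which coprimality of \<open>l\<close> to the
  order of the finite group enters; it makes the extended tensor admissible over each
  superlattice.\<close>

locale hecke_lattice = admissible_lattice A L B \<xi>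
  for A :: "('a, 'm) monoid_scheme" (structure) and L B :: "(real^'n) set" and \<xi> +
  fixes l :: nat
  assumes l: "prime l" and divisible: "\<And>a. a \<in> carrier A \<Longrightarrow> \<exists>b\<in>carrier A. a = b [^] int l"
begin

abbreviation extension :: "(real^'n) set \<Rightarrow> ((real^'n) \<times> 'a \<Rightarrow>\<^sub>0 int) set" where
  "extension L' \<equiv> tensor_map (additive_group L') A (\<lambda>v. v) \<xi>"

lemma extensionE:
  assumes "L' \<in> superlattices l r L"
  obtains B' where "admissible_lattice A L' B' (extension L')" "L \<subseteq> L'"
proof -
  have "is_lattice L'" "L \<subseteq> L'" using assms by (auto simp: superlattices_def)
  then obtain B' where B': "Zbasis L' B'" by (auto simp: is_lattice_iff)
  show ?thesis using that[OF admissible_extension[OF l divisible assms B']] \<open>L \<subseteq> L'\<close> by blast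
qed

lemma psi_extension:
  assumes L': "L' \<in> superlattices l r L" and D: "dissection \<Lambda> D"
  shows "psi A L' (extension L') \<Lambda> = finprod (M_group A CARD('n)) (\<lambda>S. psi A L' (extension L') (convex_cone hull S)) D"
    and "psi A L' (extension L') \<Lambda> \<in> carrier (M_group A CARD('n))"
proof -
  obtain B' where B': "admissible_lattice A L' B' (extension L')" "L \<subseteq> L'" using extensionE[OF L'] .
  interpret L': admissible_lattice A L' B' "extension L'" by (rule B')
  have D': "L'.dissection \<Lambda> D"
    using D B'(2) by (intro dissection_mono[of L B L' B']) unfold_locales
  show "psi A L' (extension L') \<Lambda> = finprod (M_group A CARD('n)) (\<lambda>S. psi A L' (extension L') (convex_cone hull S)) D"
    by (rule L'.psi_dissection[OF D'])
  show "psi A L' (extension L') \<Lambda> \<in> carrier (M_group A CARD('n))"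
    using L'.dissection_resolution[OF D'] L'.psi_closed by blast
qed

lemma hecke_sum_closed:
  assumes D: "dissection \<Lambda> D"
  shows "hecke_sum A l r L \<xi> \<Lambda> \<in> carrier (M_group A CARD('n))"
proof -
  interpret M: comm_group "M_group A CARD('n)" by (rule comm_group_M)
  show ?thesis unfolding hecke_sum_def using psi_extension(2)[OF _ D] by (intro M.finprod_closed) auto
qed

text \<open>Every summand is additive on the common dissection, and the two finite sums are
  interchanged.\<close>

lemma hecke_sum_dissection:
  assumes D: "dissection \<Lambda> D"
  shows "hecke_sum A l r L \<xi> \<Lambda> = finprod (M_group A CARD('n)) (\<lambda>S. hecke_sum A l r L \<xi> (convex_cone hull S)) D"
proof -
  interpret M: comm_group "M_group A CARD('n)" by (rule comm_group_M)
  have cl: "psi A L' (extension L') (convex_cone hull S) \<in> carrier (M_group A CARD('n))"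
    if "L' \<in> superlattices l r L" "S \<in> D" for L' S
    using psi_extension(2)[OF that(1) dissection_self[OF dissectionD(2)[OF D that(2)]]] .
  have "hecke_sum A l r L \<xi> \<Lambda> = finprod (M_group A CARD('n))
      (\<lambda>L'. finprod (M_group A CARD('n)) (\<lambda>S. psi A L' (extension L') (convex_cone hull S)) D) (superlattices l r L)"
    unfolding hecke_sum_def using psi_extension(1)[OF _ D] cl by (intro M.finprod_cong') auto
  also have "\<dots> = finprod (M_group A CARD('n)) (\<lambda>S. hecke_sum A l r L \<xi> (convex_cone hull S)) D"
    unfolding hecke_sum_def using cl by (intro M.finprod_swap)
  finally show ?thesis .
qed

end

text \<open>Superlattices of the image are images of superlattices, and the summands match by
  \<open>psi_image\<close>.\<close>

lemma hecke_sum_image: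
  fixes g :: "real^'n \<Rightarrow> real^'n"
  assumes g: "linear g" "inj g" and "hecke_lattice A L B \<xi> l" "hecke_lattice A (g ` L) B' \<xi>' l"
    and con: "\<And>\<phi>. \<phi> \<in> hom (additive_group (g ` L)) integer_group \<Longrightarrow> contract A \<xi>' \<phi> = contract A \<xi> (\<lambda>x. \<phi> (g x))"
    and D: "lattice_context.dissection L \<Lambda> D"
  shows "hecke_sum A l r (g ` L) \<xi>' (g ` \<Lambda>) = hecke_sum A l r L \<xi> \<Lambda>"
proof -
  interpret S: hecke_lattice A L B \<xi> l by fact
  interpret T: hecke_lattice A "g ` L" B' \<xi>' l by fact
  interpret M: comm_group "M_group A CARD('n)" by (rule S.comm_group_M)
  have eq: "psi A (g ` L') (T.extension (g ` L')) (g ` \<Lambda>) = psi A L' (S.extension L') \<Lambda>"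
    if L': "L' \<in> superlattices l r L" for L'
  proof -
    obtain B1 where B1: "admissible_lattice A L' B1 (S.extension L')" "L \<subseteq> L'" using S.extensionE[OF L'] .
    interpret S': admissible_lattice A L' B1 "S.extension L'" by (rule B1)
    have gL': "g ` L' \<in> superlattices l r (g ` L)"
      using L' superlattices_image[OF g S.is_lattice_L S.l] by blast
    obtain B2 where B2: "admissible_lattice A (g ` L') B2 (T.extension (g ` L'))" "g ` L \<subseteq> g ` L'"
      using T.extensionE[OF gL'] .
    interpret T': admissible_lattice A "g ` L'" B2 "T.extension (g ` L')" by (rule B2)
    have "S'.dissection \<Lambda> D" using D B1(2) by (intro dissection_mono[of L B L' B1]) unfold_locales
    then obtain E where E: "S'.dissection \<Lambda> E" "\<And>T. T \<in> E \<Longrightarrow> Zbasis L' T" using S'.dissection_resolution by blast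
    show ?thesis
    proof (rule psi_image[OF g B1(1) B2(1) _ E])
      fix \<phi> assume \<phi>: "\<phi> \<in> hom (additive_group (g ` L')) integer_group"
      have \<phi>1: "\<phi> \<in> hom (additive_group (g ` L)) integer_group" using \<phi> B1(2) by (auto simp: hom_def)
      have \<phi>2: "(\<lambda>x. \<phi> (g x)) \<in> hom (additive_group L') integer_group"
        using \<phi> g(1) by (auto simp: hom_def linear_add)
      show "contract A (T.extension (g ` L')) \<phi> = contract A (S.extension L') (\<lambda>x. \<phi> (g x))"
        using T.tensor_map_properties(2)[OF T'.tensor_lattice_axioms B2(2) T.\<xi> \<phi>]
          S.tensor_map_properties(2)[OF S'.tensor_lattice_axioms B1(2) S.\<xi> \<phi>2] con[OF \<phi>1] by simp
    qed
  qed
  have cl: "psi A L' (S.extension L') \<Lambda> \<in> carrier (M_group A CARD('n))" if "L' \<in> superlattices l r L" for L'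
    using S.psi_extension(2)[OF that D] .
  have "hecke_sum A l r (g ` L) \<xi>' (g ` \<Lambda>) = finprod (M_group A CARD('n))
      (\<lambda>L'. psi A (g ` L') (T.extension (g ` L')) (g ` \<Lambda>)) (superlattices l r L)"
    unfolding hecke_sum_def superlattices_image[OF g S.is_lattice_L S.l] using eq cl g(2)
    by (intro M.finprod_reindex) (auto simp: inj_on_def inj_image_eq_iff)
  also have "\<dots> = hecke_sum A l r L \<xi> \<Lambda>"
    unfolding hecke_sum_def using eq cl by (intro M.finprod_cong') auto
  finally show ?thesis .
qed

lemma basis_change:
  fixes es es' :: "(real^'n) list"
  assumes es: "Zbasis L (set es)" "distinct es" and es': "Zbasis L' (set es')" "distinct es'"
  obtains g :: "real^'n \<Rightarrow> real^'n" where "linear g" "inj g" "map g es = es'" "g ` L = L'"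
proof -
  have Z: "independent (set es)" "span (set es) = UNIV" "L = Zspan (set es)"
    "independent (set es')" "span (set es') = UNIV" "L' = Zspan (set es')"
    using es(1) es'(1) by (auto simp: Zbasis_iff_Zspan)
  have len: "length es = length es'"
    using card_basis[OF Z(1,2)] card_basis[OF Z(4,5)] distinct_card[OF es(2)] distinct_card[OF es'(2)] by simp
  obtain g :: "real^'n \<Rightarrow> real^'n" where g: "linear g" "\<forall>x\<in>set es. g x = es' ! the_inv_into {..<length es} ((!) es) x"
    using linear_independent_extend[OF Z(1), of "\<lambda>x. es' ! the_inv_into {..<length es} ((!) es) x"] by blast
  have nth: "g (es ! i) = es' ! i" if "i < length es" for i
    using g(2) that inj_on_nth[OF es(2), of "{..<length es}"] by (simp add: the_inv_into_f_f)
  have m: "map g es = es'" using nth len by (intro nth_equalityI) auto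
  then have im: "g ` set es = set es'" by (metis set_map)
  have "range g = UNIV" using linear_span_image[OF g(1), of "set es"] Z im by simp
  then have "inj g" using linear_surjective_imp_injective[OF g(1)] by blast
  then show ?thesis using that[OF g(1) _ m] Zspan_image[OF g(1), of "set es"] im Z by simp
qed

text \<open>The linear map that takes one basis to the other also matches the tensors, since a
  contraction depends only on the entries and on the values of the functional on the basis. Hence
  the Hecke sum of a basic cone is a function of its symbol.\<close>

lemma hecke_sum_symbol:
  fixes es es' :: "(real^'n) list"
  assumes "hecke_lattice A L B \<xi> l" "hecke_lattice A L' B' \<xi>' l"
    and es: "Zbasis L (set es)" "distinct es" and es': "Zbasis L' (set es')" "distinct es'"
    and sym: "symbol_lattice.symbol_of (\<lambda>\<phi>. contract A \<xi> (\<lambda>x. \<lfloor>\<phi> x\<rfloor>)) es =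
      symbol_lattice.symbol_of (\<lambda>\<phi>. contract A \<xi>' (\<lambda>x. \<lfloor>\<phi> x\<rfloor>)) es'"
  shows "hecke_sum A l r L' \<xi>' (convex_cone hull (set es')) = hecke_sum A l r L \<xi> (convex_cone hull (set es))"
proof -
  interpret S: hecke_lattice A L B \<xi> l by fact
  interpret T: hecke_lattice A L' B' \<xi>' l by fact
  obtain g :: "real^'n \<Rightarrow> real^'n" where g: "linear g" "inj g" "map g es = es'" "g ` L = L'"
    using basis_change[OF es es'] .
  have len: "length es = CARD('n)" "length es' = CARD('n)"
    using S.goodD(5)[OF S.Zbasis_good[OF es(1)]] T.goodD(5)[OF T.Zbasis_good[OF es'(1)]] es(2) es'(2)
    by (simp_all add: distinct_card)
  have L: "es ! i \<in> L" "es' ! i \<in> L'" if "i < CARD('n)" for i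
    using that len S.goodD(1)[OF S.Zbasis_good[OF es(1)]] T.goodD(1)[OF T.Zbasis_good[OF es'(1)]] by auto
  have smA: "S.symbol_of es ! i \<in> carrier A" "T.symbol_of es' ! i \<in> carrier A" if "i < CARD('n)" for i
    using S.symbol_of_mem[OF es] T.symbol_of_mem[OF es'] that by (auto simp: symbols_def)
  have "contract A \<xi>' \<phi> = contract A \<xi> (\<lambda>x. \<phi> (g x))"
    if \<phi>: "\<phi> \<in> hom (additive_group L') integer_group" for \<phi>
  proof -
    have \<phi>2: "(\<lambda>x. \<phi> (g x)) \<in> hom (additive_group L) integer_group"
      using \<phi> g(1,4) by (auto simp: hom_def linear_add)
    have "contract A \<xi>' \<phi> = contract A (T.tensor_sum ((!) es') ((!) (T.symbol_of es'))) \<phi>"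
      by (rule arg_cong[OF T.symbol_of_expansion[OF es']])
    also have "\<dots> = finprod A (\<lambda>i. T.symbol_of es' ! i [^]\<^bsub>A\<^esub> \<phi> (es' ! i)) {..<CARD('n)}"
      by (rule T.contract_tensor_sum[OF \<phi> L(2) smA(2)])
    also have "\<dots> = finprod A (\<lambda>i. S.symbol_of es ! i [^]\<^bsub>A\<^esub> \<phi> (g (es ! i))) {..<CARD('n)}"
      using smA(1) sym g(3) len by (intro S.finprod_cong') auto
    also have "\<dots> = contract A (S.tensor_sum ((!) es) ((!) (S.symbol_of es))) (\<lambda>x. \<phi> (g x))"
      by (rule S.contract_tensor_sum[OF \<phi>2 L(1) smA(1), symmetric])
    also have "\<dots> = contract A \<xi> (\<lambda>x. \<phi> (g x))"
      by (rule arg_cong[OF S.symbol_of_expansion[OF es, symmetric]])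
    finally show ?thesis .
  qed
  moreover have "convex_cone hull (set es') = g ` (convex_cone hull (set es))"
    using convex_cone_hull_linear_image[OF g(1), of "set es"] g(3) by (metis set_map)
  ultimately show ?thesis
    using hecke_sum_image[OF g(1,2) assms(1), of B' \<xi>' "convex_cone hull (set es)" "{set es}" r]
      S.dissection_self[OF S.Zbasis_good[OF es(1)]] assms(2) unfolding g(4) by simp
qed

section \<open>Existence, uniqueness and commutation of the operators\<close>

lemma hecke_operator_exists:
  fixes A :: "('a, 'm) monoid_scheme" (structure)
  assumes "comm_group A" and l: "prime l" and div: "\<And>a. a \<in> carrier A \<Longrightarrow> \<exists>b\<in>carrier A. a = b [^] int l"
  shows "\<exists>T. is_hecke_operator TYPE('n::finite) A l r T"
proof -
  interpret comm_group A by fact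
  let ?M = "M_group A CARD('n)"
  interpret M: comm_group ?M by (rule comm_group_M)
  obtain es :: "(real^'n) list" where es: "distinct es" "set es = Basis" using finite_distinct_list[OF finite_Basis] by blast
  define L where "L = Zspan (set es)"
  have Z: "Zbasis L (set es)" unfolding L_def Zbasis_iff_Zspan es(2) by (simp add: independent_Basis)
  interpret L: tensor_lattice A L "set es" using Z by unfold_locales
  define \<xi> where "\<xi> as = L.tensor_sum ((!) es) ((!) as)" for as
  \<comment> \<open>A fixed model: every symbol is placed on the standard lattice with the standard
    cone, and the operator is prescribed by the Hecke sum there.\<close>
  define f where "f as = hecke_sum A l r L (\<xi> as) (convex_cone hull (set es))" for as
  have real: "hecke_lattice A L (set es) (\<xi> as) l"
    "symbol_lattice.symbol_of (\<lambda>\<phi>. contract A (\<xi> as) (\<lambda>x. \<lfloor>\<phi> x\<rfloor>)) es = as"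
    if "as \<in> symbols A CARD('n)" for as
    unfolding \<xi>_def using L.symbol_realization[OF Z es(1) that] l div
    by (auto intro!: hecke_lattice.intro hecke_lattice_axioms.intro)
  \<comment> \<open>Reduces any basic cone to the model. This is needed for the relations too, since
    reordering the basis or starring the model cone leads away from the model.\<close>
  have normal_form: "hecke_sum A l r L' \<xi>' (convex_cone hull (set es')) =
      f (symbol_lattice.symbol_of (\<lambda>\<phi>. contract A \<xi>' (\<lambda>x. \<lfloor>\<phi> x\<rfloor>)) es')"
    if h: "hecke_lattice A L' B' \<xi>' l" and es': "Zbasis L' (set es')" "distinct es'" for L' B' :: "(real^'n) set" and \<xi>' es'
  proof -
    interpret L': hecke_lattice A L' B' \<xi>' l by (rule h)
    have "L'.symbol_of es' \<in> symbols A CARD('n)" by (rule L'.symbol_of_mem[OF es'])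
    from real[OF this] show ?thesis
      unfolding f_def by (intro hecke_sum_symbol[OF _ h Z es(1) es']) auto
  qed
  have f_closed: "f as \<in> carrier ?M" if as: "as \<in> symbols A CARD('n)" for as
  proof -
    interpret H: hecke_lattice A L "set es" "\<xi> as" l using real(1)[OF as] .
    show ?thesis unfolding f_def by (rule H.hecke_sum_closed[OF L.dissection_self[OF L.Zbasis_good[OF Z]]])
  qed
  have "\<exists>g\<in>hom ?M ?M. \<forall>as\<in>symbols A CARD('n). g (symbol_class A CARD('n) as) = f as"
  proof (rule M_hom_exists[OF comm_group_M])
    show "f ` symbols A CARD('n) \<subseteq> carrier ?M" using f_closed by blast
    have len: "length es = CARD('n)" using L.goodD(5)[OF L.Zbasis_good[OF Z]] es(1) by (simp add: distinct_card)
    show "f (permute_list \<sigma> as) = f as" if as: "as \<in> symbols A CARD('n)" and \<sigma>: "\<sigma> permutes {..<CARD('n)}" for as \<sigma>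
    proof -
      interpret H: hecke_lattice A L "set es" "\<xi> as" l using real(1)[OF as] .
      have \<sigma>': "\<sigma> permutes {..<length es}" using \<sigma> len by simp
      have s: "set (permute_list \<sigma> es) = set es" using \<sigma>' by simp
      \<comment> \<open>Permuting the basis permutes the symbol but not the cone, which gives
        (S).\<close>
      have "H.symbol_of (permute_list \<sigma> es) = permute_list \<sigma> (H.symbol_of es)"
        unfolding H.symbol_of_def s using \<sigma>' by (simp add: permute_list_map)
      then have "H.symbol_of (permute_list \<sigma> es) = permute_list \<sigma> as" using real(2)[OF as] by simp
      then show ?thesis
        using normal_form[OF real(1)[OF as], of "permute_list \<sigma> es"] s Z es(1) \<sigma>' by (simp add: f_def)
    qed
    show "f (as @ bs) = finprod ?M (\<lambda>i. f (blowup_entries A as i @ bs)) {..<length as}"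
      if as: "as @ bs \<in> symbols A CARD('n)" and two: "2 \<le> length as" for as bs
    proof -
      interpret H: hecke_lattice A L "set es" "\<xi> (as @ bs)" l using real(1)[OF as] .
      let ?\<kappa> = "\<lambda>\<phi>. contract A (\<xi> (as @ bs)) (\<lambda>x. \<lfloor>\<phi> x\<rfloor>)"
      define ks where "ks = take (length as) es"
      define rs where "rs = drop (length as) es"
      have ab: "length as + length bs = CARD('n)" using as by (simp add: symbols_def)
      have kr: "es = ks @ rs" "length ks = length as" using len ab by (simp_all add: ks_def rs_def)
      have sym: "map (dual_coefficient ?\<kappa> (set es)) ks = as" "map (dual_coefficient ?\<kappa> (set es)) rs = bs"
      proof -
        have "map (dual_coefficient ?\<kappa> (set es)) ks @ map (dual_coefficient ?\<kappa> (set es)) rs = as @ bs"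
          using real(2)[OF as] kr(1) unfolding H.symbol_of_def by (metis map_append)
        then show "map (dual_coefficient ?\<kappa> (set es)) ks = as" "map (dual_coefficient ?\<kappa> (set es)) rs = bs"
          using kr(2) by (simp_all add: append_eq_append_conv)
      qed
      \<comment> \<open>The model cone is starred at the sum of the generators that carry
        \<open>as\<close>. The pieces have the symbols on the right of (M), so additivity of the
        Hecke sum over this star is the required identity.\<close>
      define z where "z = \<Sum>(set ks)"
      have ks: "set ks \<subseteq> set es" "distinct ks" "card (set ks) = length as"
        using kr es(1) distinct_card[of ks] by (auto simp: kr(1))
      have g: "L.good (set es)" by (rule L.Zbasis_good[OF Z])
      have zS: "z \<notin> set es" unfolding z_def using ks two by (intro H.star_not_mem[OF Z]) auto
      have rz: "representation (set es) z v = of_bool (v \<in> set ks)" if "v \<in> set es" for v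
      proof (rule representation_unique)
        have "(\<Sum>v\<in>set es. of_bool (v \<in> set ks) *\<^sub>R v) = (\<Sum>v\<in>set ks. of_bool (v \<in> set ks) *\<^sub>R v)"
          using ks(1) by (intro sum.mono_neutral_right) auto
        then show "z = (\<Sum>v\<in>set es. of_bool (v \<in> set ks) *\<^sub>R v)" by (simp add: z_def)
      qed (use L.goodD[OF g] that in auto)
      have zL: "z \<in> L" unfolding z_def using ks(1) L.goodD(1)[OF g] by (intro L.sum_L) auto
      have "ks ! 0 \<in> set ks" using two kr(2) by (intro nth_mem) auto
      then have z0: "z \<noteq> 0" using rz[of "ks ! 0"] ks(1) by (auto simp: representation_zero)
      have "nonneg_at (set es) z" using rz by (simp add: nonneg_at_def)
      from L.dissection_star[OF g zL z0 this]
      have "L.dissection (convex_cone hull (set es)) ((\<lambda>v. insert z (set es - {v})) ` {v\<in>set es. representation (set es) z v > 0})" .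
      moreover have "{v\<in>set es. representation (set es) z v > 0} = set ks" using rz ks(1) by auto
      moreover have "set ks = (!) ks ` {..<length as}" using kr(2) by (auto simp: set_conv_nth)
      ultimately have D: "L.dissection (convex_cone hull (set es)) ((\<lambda>i. insert z (set es - {ks ! i})) ` {..<length as})"
        by (simp add: image_image)
      have inj: "inj_on (\<lambda>i. insert z (set es - {ks ! i})) {..<length as}"
      proof (rule inj_onI)
        fix i j assume ij: "i \<in> {..<length as}" "j \<in> {..<length as}" "insert z (set es - {ks ! i}) = insert z (set es - {ks ! j})"
        have "ks ! i \<in> set es" "ks ! j \<in> set es" using ij ks(1) kr(2) by auto
        moreover from this have "ks ! i \<notin> insert z (set es - {ks ! i})" using zS by auto
        ultimately have "ks ! i = ks ! j" using ij(3) by simp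
        then show "i = j" using ij ks(2) kr(2) by (simp add: nth_eq_iff_index_eq)
      qed
      have each: "hecke_sum A l r L (\<xi> (as @ bs)) (convex_cone hull (insert z (set es - {ks ! i}))) = f (blowup_entries A as i @ bs)"
        if i: "i < length as" for i
      proof -
        have "Zbasis L (set (ks @ rs))" "distinct (ks @ rs)" using Z es(1) kr(1) by auto
        note star = H.symbol_of_star[OF this, of i, folded z_def kr(1)]
        have i': "2 \<le> length ks" "i < length ks" using i two kr(2) by auto
        from normal_form[OF real(1)[OF as] star(3)[OF i'] star(2)[OF i']] show ?thesis
          unfolding star(1)[OF i'] star(4)[OF i'] sym .
      qed
      have "f (as @ bs) = finprod ?M (\<lambda>S. hecke_sum A l r L (\<xi> (as @ bs)) (convex_cone hull S))
          ((\<lambda>i. insert z (set es - {ks ! i})) ` {..<length as})"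
        unfolding f_def by (rule H.hecke_sum_dissection[OF D])
      also have "\<dots> = finprod ?M (\<lambda>i. hecke_sum A l r L (\<xi> (as @ bs)) (convex_cone hull (insert z (set es - {ks ! i})))) {..<length as}"
        using H.hecke_sum_closed[OF L.dissection_self[OF L.dissectionD(2)[OF D]]] inj by (intro M.finprod_reindex) auto
      also have "\<dots> = finprod ?M (\<lambda>i. f (blowup_entries A as i @ bs)) {..<length as}"
        using each f_closed symbols_blowup[OF as] by (intro M.finprod_cong') auto
      finally show ?thesis .
    qed
  qed
  then obtain g where g: "g \<in> hom ?M ?M" "\<And>as. as \<in> symbols A CARD('n) \<Longrightarrow> g (symbol_class A CARD('n) as) = f as"
    by blast
  \<comment> \<open>The values outside the carrier are made undefined, as \<open>extensional\<close>
    prescribes.\<close>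
  define T where "T = restrict g (carrier ?M)"
  have Tg: "T x = g x" if "x \<in> carrier ?M" for x using that by (simp add: T_def)
  have T: "T \<in> hom ?M ?M" using g(1) by (auto simp: hom_def T_def)
  have "T (psi A L' \<xi>' \<Lambda>) = hecke_sum A l r L' \<xi>' \<Lambda>" if adm: "admissible_triple A L' \<xi>' \<Lambda>"
    for L' :: "(real^'n) set" and \<xi>' \<Lambda>
  proof -
    obtain B' where B': "admissible_lattice A L' B' \<xi>'" and \<Lambda>: "full_rational_cone L' \<Lambda>"
      using adm admissible_triple_iff[OF comm_group_axioms] by blast
    have h: "hecke_lattice A L' B' \<xi>' l" using B' l div by (auto intro!: hecke_lattice.intro hecke_lattice_axioms.intro)
    interpret H: hecke_lattice A L' B' \<xi>' l by (rule h)
    obtain D where D: "H.dissection \<Lambda> D" "\<And>S. S \<in> D \<Longrightarrow> Zbasis L' S" using H.basic_dissection_exists[OF \<Lambda>] by blast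
    have cl: "psi A L' \<xi>' (convex_cone hull S) \<in> carrier ?M" if "S \<in> D" for S
      using H.psi_cone_closed[OF H.Zbasis_good[OF D(2)[OF that]]] .
    have each: "T (psi A L' \<xi>' (convex_cone hull S)) = hecke_sum A l r L' \<xi>' (convex_cone hull S)" if S: "S \<in> D" for S
    proof -
      have "finite S" using H.goodD(4)[OF H.Zbasis_good[OF D(2)[OF S]]] .
      then obtain es' where es': "distinct es'" "set es' = S" using finite_distinct_list by blast
      have Z': "Zbasis L' (set es')" using D(2)[OF S] es'(2) by simp
      show ?thesis
        using Tg[OF cl[OF S]] H.psi_symbol[OF Z' es'(1)] g(2)[OF H.symbol_of_mem[OF Z' es'(1)]]
          normal_form[OF h Z' es'(1)] es'(2) by simp
    qed
    have "T (psi A L' \<xi>' \<Lambda>) = finprod ?M (\<lambda>S. T (psi A L' \<xi>' (convex_cone hull S))) D"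
      unfolding H.psi_dissection[OF D(1)] using cl by (intro hom_finprod[OF comm_group_M comm_group_M T]) auto
    also have "\<dots> = finprod ?M (\<lambda>S. hecke_sum A l r L' \<xi>' (convex_cone hull S)) D"
      using each H.hecke_sum_closed[OF H.dissection_self[OF H.Zbasis_good[OF D(2)]]] by (intro M.finprod_cong') auto
    also have "\<dots> = hecke_sum A l r L' \<xi>' \<Lambda>" by (rule H.hecke_sum_dissection[OF D(1), symmetric])
    finally show ?thesis .
  qed
  then show ?thesis using T unfolding is_hecke_operator_def by (intro exI[of _ T]) (auto simp: T_def)
qed

lemma symbol_triple:
  assumes "comm_group A" and as: "as \<in> symbols A CARD('n::finite)"
  obtains L :: "(real^'n) set" and B \<xi> S where "admissible_lattice A L B \<xi>" "Zbasis L S"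
    "symbol_class A CARD('n) as = psi A L \<xi> (convex_cone hull S)"
proof -
  interpret comm_group A by fact
  obtain es :: "(real^'n) list" where es: "distinct es" "set es = Basis" using finite_distinct_list[OF finite_Basis] by blast
  have Z: "Zbasis (Zspan (set es)) (set es)" unfolding Zbasis_iff_Zspan es(2) by (simp add: independent_Basis)
  interpret L: tensor_lattice A "Zspan (set es)" "set es" using Z by unfold_locales
  note real = L.symbol_realization[OF Z es(1) as]
  show ?thesis
    using that[OF real(1) Z] admissible_lattice.psi_symbol[OF real(1) Z es(1)] real(2) by simp
qed

text \<open>The symbols generate the group, and each is the value of \<open>psi\<close> on a basic
  cone, where both operators are prescribed.\<close>

lemma hecke_operator_unique:
  fixes A :: "('a, 'm) monoid_scheme"
  assumes "comm_group A" and T: "is_hecke_operator TYPE('n::finite) A l r T" "is_hecke_operator TYPE('n) A l r T'"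
  shows "T = T'"
proof
  fix x
  interpret comm_group A by fact
  let ?M = "M_group A CARD('n)"
  show "T x = T' x"
  proof (cases "x \<in> carrier ?M")
    case True
    show ?thesis
    proof (rule M_hom_eqI[OF comm_group.axioms(2)[OF comm_group_M] _ _ _ True])
      show "T \<in> hom ?M ?M" "T' \<in> hom ?M ?M" using T by (auto simp: is_hecke_operator_def)
      fix as assume "as \<in> symbols A CARD('n)"
      then obtain L :: "(real^'n) set" and B \<xi> S where adm: "admissible_lattice A L B \<xi>" and Z: "Zbasis L S"
        and sc: "symbol_class A CARD('n) as = psi A L \<xi> (convex_cone hull S)"
        using symbol_triple[OF assms(1)] by blast
      interpret L: admissible_lattice A L B \<xi> by (rule adm)
      have "admissible_triple A L \<xi> (convex_cone hull S)"
        using adm L.full_rational_cone_good[OF L.Zbasis_good[OF Z]] admissible_triple_iff[OF assms(1)] by blast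
      then show "T (symbol_class A CARD('n) as) = T' (symbol_class A CARD('n) as)"
        using T unfolding sc is_hecke_operator_def by simp
    qed
  next
    case False
    then show ?thesis using T unfolding is_hecke_operator_def by (simp add: extensional_def)
  qed
qed

text \<open>Extending a tensor in two steps agrees with extending it at once, so the intermediate
  lattice leaves no trace in the summand. The second claim is what later allows the product to be
  reindexed.\<close>

lemma hecke_operator_psi:
  fixes L :: "(real^'n) set"
  assumes T: "is_hecke_operator TYPE('n) A l r T" "is_hecke_operator TYPE('n) A l' r' T'"
    and h: "hecke_lattice A L B \<xi> l" "hecke_lattice A L B \<xi> l'" and Z: "Zbasis L S"
  defines "\<Lambda> \<equiv> convex_cone hull S"
  shows "T (T' (psi A L \<xi> \<Lambda>)) = finprod (M_group A CARD('n))
    (\<lambda>(L', L''). psi A L'' (tensor_map (additive_group L'') A (\<lambda>v. v) \<xi>) \<Lambda>)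
    (Sigma (superlattices l' r' L) (superlattices l r))"
    and "L' \<in> superlattices l' r' L \<Longrightarrow> L'' \<in> superlattices l r L' \<Longrightarrow>
      psi A L'' (tensor_map (additive_group L'') A (\<lambda>v. v) \<xi>) \<Lambda> \<in> carrier (M_group A CARD('n))"
proof -
  interpret H: hecke_lattice A L B \<xi> l' by (rule h(2))
  let ?M = "M_group A CARD('n)"
  interpret M: comm_group ?M by (rule H.comm_group_M)
  have l: "prime l" using h(1) by (simp add: hecke_lattice_def hecke_lattice_axioms_def)
  have g: "H.good S" by (rule H.Zbasis_good[OF Z])
  have D: "H.dissection \<Lambda> {S}" unfolding \<Lambda>_def by (rule H.dissection_self[OF g])
  have full: "full_rational_cone L \<Lambda>" unfolding \<Lambda>_def by (rule H.full_rational_cone_good[OF g])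
  have Tpsi: "T (psi A L' \<xi>' \<Lambda>) = hecke_sum A l r L' \<xi>' \<Lambda>" "T' (psi A L' \<xi>' \<Lambda>) = hecke_sum A l' r' L' \<xi>' \<Lambda>"
    if "admissible_lattice A L' B' \<xi>'" "L \<subseteq> L'" for L' B' \<xi>'
    using T that full_rational_cone_mono[OF full] admissible_triple_iff[OF H.comm_group_axioms]
    unfolding is_hecke_operator_def by blast+
  have step: "T (psi A L' (H.extension L') \<Lambda>) =
      finprod ?M (\<lambda>L''. psi A L'' (tensor_map (additive_group L'') A (\<lambda>v. v) \<xi>) \<Lambda>) (superlattices l r L')"
    and closed: "\<And>L''. L'' \<in> superlattices l r L' \<Longrightarrow>
      psi A L'' (tensor_map (additive_group L'') A (\<lambda>v. v) \<xi>) \<Lambda> \<in> carrier ?M"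
    if L': "L' \<in> superlattices l' r' L" for L'
  proof -
    obtain B' where B': "admissible_lattice A L' B' (H.extension L')" "L \<subseteq> L'" using H.extensionE[OF L'] .
    have h': "hecke_lattice A L' B' (H.extension L') l"
      using B'(1) h(1) by (simp add: hecke_lattice_def)
    interpret H': hecke_lattice A L' B' "H.extension L'" l by (rule h')
    have D': "H'.dissection \<Lambda> {S}" using D B'(2) by (intro dissection_mono[of L B L' B']) unfold_locales
    have ext: "H'.extension L'' = tensor_map (additive_group L'') A (\<lambda>v. v) \<xi>" if L'': "L'' \<in> superlattices l r L'" for L''
    proof -
      obtain B'' where B'': "admissible_lattice A L'' B'' (H'.extension L'')" "L' \<subseteq> L''" using H'.extensionE[OF L''] .
      interpret H'': admissible_lattice A L'' B'' "H'.extension L''" by (rule B''(1))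
      show ?thesis
        using H.tensor_map_properties(3)[OF H'.tensor_lattice_axioms B'(2) H.\<xi> H''.tensor_lattice_axioms B''(2)] .
    qed
    show cl: "psi A L'' (tensor_map (additive_group L'') A (\<lambda>v. v) \<xi>) \<Lambda> \<in> carrier ?M"
      if L'': "L'' \<in> superlattices l r L'" for L''
      using H'.psi_extension(2)[OF L'' D'] ext[OF L''] by simp
    show "T (psi A L' (H.extension L') \<Lambda>) =
      finprod ?M (\<lambda>L''. psi A L'' (tensor_map (additive_group L'') A (\<lambda>v. v) \<xi>) \<Lambda>) (superlattices l r L')"
      unfolding Tpsi(1)[OF B'] hecke_sum_def using cl ext by (intro M.finprod_cong') auto
  qed
  have "T' (psi A L \<xi> \<Lambda>) = finprod ?M (\<lambda>L'. psi A L' (H.extension L') \<Lambda>) (superlattices l' r' L)"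
    using Tpsi(2)[OF H.admissible_lattice_axioms] by (simp add: hecke_sum_def)
  then have "T (T' (psi A L \<xi> \<Lambda>)) = finprod ?M (\<lambda>L'. T (psi A L' (H.extension L') \<Lambda>)) (superlattices l' r' L)"
    using T(1) H.psi_extension(2)[OF _ D]
    by (simp only:) (intro hom_finprod[OF H.comm_group_M H.comm_group_M]; simp add: is_hecke_operator_def)
  also have "\<dots> = finprod ?M (\<lambda>L'. finprod ?M (\<lambda>L''. psi A L'' (tensor_map (additive_group L'') A (\<lambda>v. v) \<xi>) \<Lambda>)
      (superlattices l r L')) (superlattices l' r' L)"
    using step closed by (intro M.finprod_cong') (auto intro!: M.finprod_closed)
  also have "\<dots> = finprod ?M (\<lambda>(L', L''). psi A L'' (tensor_map (additive_group L'') A (\<lambda>v. v) \<xi>) \<Lambda>)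
    (Sigma (superlattices l' r' L) (superlattices l r))"
  proof (rule M.finprod_Sigma)
    show "finite (superlattices l' r' L)" by (rule finite_superlattices[OF H.is_lattice_L H.l])
    show "finite (superlattices l r L')" if "L' \<in> superlattices l' r' L" for L'
      using that by (intro finite_superlattices l) (simp add: superlattices_def)
  qed (use closed in blast)
  finally show "T (T' (psi A L \<xi> \<Lambda>)) = finprod ?M
    (\<lambda>(L', L''). psi A L'' (tensor_map (additive_group L'') A (\<lambda>v. v) \<xi>) \<Lambda>)
    (Sigma (superlattices l' r' L) (superlattices l r))" .
  show "L' \<in> superlattices l' r' L \<Longrightarrow> L'' \<in> superlattices l r L' \<Longrightarrow>
      psi A L'' (tensor_map (additive_group L'') A (\<lambda>v. v) \<xi>) \<Lambda> \<in> carrier ?M"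
    by (rule closed)
qed

text \<open>Equality of the two homomorphisms is checked on symbols, where both composites are
  products over chains and \<open>superlattice_chains_swap\<close> reindexes one into the
  other.\<close>

lemma hecke_operators_commute:
  fixes A :: "('a, 'm) monoid_scheme"
  assumes "comm_group A"
    and l: "prime l" "\<And>a. a \<in> carrier A \<Longrightarrow> \<exists>b\<in>carrier A. a = b [^]\<^bsub>A\<^esub> int l"
    and l': "prime l'" "\<And>a. a \<in> carrier A \<Longrightarrow> \<exists>b\<in>carrier A. a = b [^]\<^bsub>A\<^esub> int l'"
    and T: "is_hecke_operator TYPE('n::finite) A l r T" "is_hecke_operator TYPE('n) A l' r' T'"
    and x: "x \<in> carrier (M_group A CARD('n))"
  shows "T (T' x) = T' (T x)"
proof -
  interpret comm_group A by fact
  let ?M = "M_group A CARD('n)"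
  interpret M: comm_group ?M by (rule comm_group_M)
  have hom: "T \<in> hom ?M ?M" "T' \<in> hom ?M ?M" using T by (auto simp: is_hecke_operator_def)
  have "(T \<circ> T') x = (T' \<circ> T) x"
  proof (rule M_hom_eqI[OF M.is_group _ _ _ x])
    show "T \<circ> T' \<in> hom ?M ?M" "T' \<circ> T \<in> hom ?M ?M" using hom Group.hom_compose by blast+
    fix as assume "as \<in> symbols A CARD('n)"
    then obtain L :: "(real^'n) set" and B \<xi> S where adm: "admissible_lattice A L B \<xi>" and Z: "Zbasis L S"
      and sc: "symbol_class A CARD('n) as = psi A L \<xi> (convex_cone hull S)"
      using symbol_triple[OF assms(1)] by blast
    let ?\<Lambda> = "convex_cone hull S"
    define p where "p = (\<lambda>(L' :: (real^'n) set, L''). psi A L'' (tensor_map (additive_group L'') A (\<lambda>v. v) \<xi>) ?\<Lambda>)"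
    define C where "C l r l' r' = Sigma (superlattices l r L) (superlattices l' r')" for l r l' r'
    have h: "hecke_lattice A L B \<xi> l" "hecke_lattice A L B \<xi> l'"
      using adm l l' by (auto intro!: hecke_lattice.intro hecke_lattice_axioms.intro)
    interpret H: hecke_lattice A L B \<xi> l by (rule h(1))
    have "\<exists>\<tau>. bij_betw \<tau> (C l r l' r') (C l' r' l r) \<and> (\<forall>c. snd (\<tau> c) = snd c)"
      unfolding C_def by (rule superlattice_chains_swap[OF H.is_lattice_L l(1) l'(1), of r r']) (intro exI conjI allI)
    then obtain \<tau> where \<tau>: "bij_betw \<tau> (C l r l' r') (C l' r' l r)" "\<And>c. snd (\<tau> c) = snd c"
      by blast
    have closed: "p c \<in> carrier ?M" if "c \<in> C l' r' l r" for c
      using that hecke_operator_psi(2)[OF T h Z] by (auto simp: p_def C_def)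
    have p\<tau>: "p (\<tau> c) = p c" if "c \<in> C l r l' r'" for c
      using \<tau>(2)[of c] by (simp add: p_def case_prod_unfold)
    have closed': "p c \<in> carrier ?M" if "c \<in> C l r l' r'" for c
      using closed[of "\<tau> c"] p\<tau>[OF that] bij_betwE[OF \<tau>(1)] that by simp
    have "T (T' (psi A L \<xi> ?\<Lambda>)) = finprod ?M p (C l' r' l r)"
      unfolding p_def C_def by (rule hecke_operator_psi(1)[OF T h Z])
    also have "\<dots> = finprod ?M p (\<tau> ` C l r l' r')" using \<tau>(1) by (simp add: bij_betw_def)
    also have "\<dots> = finprod ?M (\<lambda>c. p (\<tau> c)) (C l r l' r')"
      using \<tau>(1) closed by (intro M.finprod_reindex) (auto simp: bij_betw_def)
    also have "\<dots> = finprod ?M p (C l r l' r')" using closed' p\<tau> by (intro M.finprod_cong') auto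
    also have "\<dots> = T' (T (psi A L \<xi> ?\<Lambda>))"
      unfolding p_def C_def by (rule hecke_operator_psi(1)[OF T(2,1) h(2,1) Z, symmetric])
    finally show "(T \<circ> T') (symbol_class A CARD('n) as) = (T' \<circ> T) (symbol_class A CARD('n) as)" by (simp add: sc)
  qed
  then show ?thesis by simp
qed

section \<open>Characters of a finite abelian group\<close>

lemma comm_group_character_group:
  assumes "comm_group G"
  shows "comm_group (character_group G)"
proof -
  interpret comm_group G by fact
  show ?thesis
  proof (rule comm_groupI)
    fix \<alpha> assume a: "\<alpha> \<in> carrier (character_group G)"
    show "\<exists>\<beta>\<in>carrier (character_group G). \<beta> \<otimes>\<^bsub>character_group G\<^esub> \<alpha> = \<one>\<^bsub>character_group G\<^esub>"
      using a by (intro bexI[of _ "\<lambda>x\<in>carrier G. inverse (\<alpha> x)"])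
        (auto simp: character_group_def complex_units_def hom_def Pi_def fun_eq_iff restrict_def extensional_def)
  qed (auto simp: character_group_def complex_units_def hom_def Pi_def fun_eq_iff restrict_def extensional_def)
qed

text \<open>By Lagrange's theorem, the values of a character are roots of unity whose order divides
  that of \<open>G\<close>.\<close>

lemma character_power:
  assumes "comm_group G" "finite (carrier G)" and \<alpha>: "\<alpha> \<in> carrier (character_group G)"
  shows "\<alpha> [^]\<^bsub>character_group G\<^esub> card (carrier G) = \<one>\<^bsub>character_group G\<^esub>"
proof -
  interpret comm_group G by fact
  interpret C: comm_group "character_group G" by (rule comm_group_character_group[OF assms(1)])
  have mult: "\<alpha> (x \<otimes>\<^bsub>G\<^esub> y) = \<alpha> x * \<alpha> y" "\<alpha> x \<noteq> 0" if "x \<in> carrier G" "y \<in> carrier G" for x y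
    using \<alpha> that by (auto simp: character_group_def complex_units_def hom_def)
  have one: "\<alpha> \<one>\<^bsub>G\<^esub> = 1" using mult[of "\<one>\<^bsub>G\<^esub>" "\<one>\<^bsub>G\<^esub>"] by simp
  have pow: "\<alpha> (x [^]\<^bsub>G\<^esub> k) = \<alpha> x ^ k" if "x \<in> carrier G" for x and k :: nat
    using that by (induction k) (simp_all add: one mult(1))
  have "(\<alpha> [^]\<^bsub>character_group G\<^esub> k) = (\<lambda>x\<in>carrier G. \<alpha> x ^ k)" for k :: nat
    by (induction k) (auto simp: character_group_def fun_eq_iff restrict_def)
  moreover have "\<alpha> x ^ card (carrier G) = 1" if "x \<in> carrier G" for x
    using pow[OF that, of "card (carrier G)"] power_order_eq_one[OF assms(2) that] one by simp
  ultimately show ?thesis by (auto simp: character_group_def fun_eq_iff restrict_def)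
qed

text \<open>The order of \<open>G\<close> annihilates the character group, so a Bezout coefficient
  \<open>u\<close> of \<open>l\<close> exhibits \<alpha> as the \<open>l\<close>-th power of its
  \<open>u\<close>-th power.\<close>

lemma character_group_divisible:
  assumes "comm_group G" "finite (carrier G)" and l: "prime l" "\<not> l dvd card (carrier G)"
    and \<alpha>: "\<alpha> \<in> carrier (character_group G)"
  shows "\<exists>\<beta>\<in>carrier (character_group G). \<alpha> = \<beta> [^]\<^bsub>character_group G\<^esub> int l"
proof -
  interpret C: comm_group "character_group G" by (rule comm_group_character_group[OF assms(1)])
  have "coprime l (card (carrier G))" using l by (rule prime_imp_coprime)
  then have "gcd (int l) (int (card (carrier G))) = 1" by (simp add: coprime_iff_gcd_eq_1[symmetric])
  then obtain u v where uv: "u * int l + v * int (card (carrier G)) = 1"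
    using bezout_int[of "int l" "int (card (carrier G))"] by auto
  have "\<alpha> = \<alpha> [^]\<^bsub>character_group G\<^esub> (u * int l + int (card (carrier G)) * v)"
    using \<alpha> uv by (simp add: mult.commute)
  also have "\<dots> = (\<alpha> [^]\<^bsub>character_group G\<^esub> u) [^]\<^bsub>character_group G\<^esub> int l \<otimes>\<^bsub>character_group G\<^esub>
      (\<alpha> [^]\<^bsub>character_group G\<^esub> int (card (carrier G))) [^]\<^bsub>character_group G\<^esub> v"
    using \<alpha> by (simp only: C.int_pow_mult C.int_pow_pow)
  also have "\<dots> = (\<alpha> [^]\<^bsub>character_group G\<^esub> u) [^]\<^bsub>character_group G\<^esub> int l"
    using \<alpha> character_power[OF assms(1,2) \<alpha>] by (simp add: int_pow_int)
  finally show ?thesis using \<alpha> by blast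
qed

theorem proposition15:
  fixes G :: "('g, 'm) monoid_scheme"
  assumes "comm_group G" and "finite (carrier G)" and "CARD('n::finite) \<ge> 2"
  shows "(\<forall>l r. prime l \<and> \<not> l dvd card (carrier G) \<and> 1 \<le> r \<and> r \<le> CARD('n) - 1 \<longrightarrow>
            (\<exists>!T. is_hecke_operator TYPE('n) (character_group G) l r T)) \<and>
         (\<forall>l r l' r' T T'.
            prime l \<and> \<not> l dvd card (carrier G) \<and> 1 \<le> r \<and> r \<le> CARD('n) - 1 \<and>
            prime l' \<and> \<not> l' dvd card (carrier G) \<and> 1 \<le> r' \<and> r' \<le> CARD('n) - 1 \<and>
            is_hecke_operator TYPE('n) (character_group G) l r T \<and>
            is_hecke_operator TYPE('n) (character_group G) l' r' T' \<longrightarrow>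
            (\<forall>x\<in>carrier (M_group (character_group G) CARD('n)). T (T' x) = T' (T x)))"
proof -
  note cg = comm_group_character_group[OF assms(1)] and div = character_group_divisible[OF assms(1,2)]
  show ?thesis
  proof (intro conjI allI impI ballI, goal_cases)
    case (1 l r)
    then show ?case
      using hecke_operator_exists[OF cg, of l r, where 'n='n] div[of l] hecke_operator_unique[OF cg] by blast
  next
    case (2 l r l' r' T T' x)
    then show ?case
      using hecke_operators_commute[OF cg, of l l' r T r' T' x, where 'n='n] div[of l] div[of l'] by blast
  qed
qed

end
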